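(* Let $\nu\ge1$ and let $X$ be the random grain model on $\mathbb{R}^\nu$ with generic grain $\Xi$ satisfying $0<\mathrm{E}\,\mathrm{Leb}_\nu(\Xi)^2<\infty$. Then for any $\phi\in\Phi:=L^1(\mathbb{R}^\nu)\cap L^\infty(\mathbb{R}^\nu)$, as $\lambda\to\infty$, $$\lambda^{-\nu/2}\big(X_\lambda(\phi)-\mathrm{E}X_\lambda(\phi)\big)\ \stackrel{d}{\longrightarrow}\ W(\phi),$$ where $W(\phi)$ is a centered Gaussian random variable with variance $$\mathrm{Var}(W(\phi))=\|\phi\|_2^2\int_{\mathbb{R}^\nu}r_X(\boldsymbol{t})\,\mathrm{d}\boldsymbol{t}=\|\phi\|_2^2\;\mathrm{E}\,\mathrm{Leb}_\nu(\Xi)^2,$$ and this variance lies in $(0,+\infty)$ whenever $\phi$ is not almost everywhere zero. Moreover, as $\lambda\to\infty$, $$\Big\{\lambda^{-\nu/2}\big(\widehat X_{\lambda,k}(\phi)-\mathrm{E}\widehat X_{\lambda,k}(\phi)\big);\ k\ge1\Big\}\ \stackrel{fdd}{\longrightarrow}\ \{W_k(\phi);\ k\ge1\},$$ where $\{W_k(\phi);k\ge1\}$ is a centered (jointly) Gaussian sequence with covariances $$\mathrm{Cov}\big(W_k(\phi),W_l(\phi)\big)=\|\phi\|_2^2\int_{\mathbb{R}^\nu}\mathrm{Cov}\big(\widehat X_k(\boldsymbol{t}),\widehat X_l(\boldsymbol{0})\big)\,\mathrm{d}\boldsymbol{t},\qquad k,l\ge1.$$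
   Context: $\mathrm{Leb}_\nu$ is Lebesgue measure on $\mathbb{R}^\nu$, $\mathbb{I}$ an indicator, and $\|\phi\|_2^2=\int_{\mathbb{R}^\nu}|\phi(\boldsymbol{u})|^2\mathrm{d}\boldsymbol{u}$. A random closed set is a measurable map from a complete probability space into the space of closed subsets of $\mathbb{R}^\nu$ with the Borel $\sigma$-algebra of the Fell topology. A random grain is a random closed set $\Xi\subset\mathbb{R}^\nu$ with $\mu:=\mathrm{E}\,\mathrm{Leb}_\nu(\Xi)<\infty$. Random grain model: let $\{\boldsymbol{u}_j;j\ge1\}$ be a stationary Poisson point process on $\mathbb{R}^\nu$ with unit intensity and let $\{\Xi,\Xi_j;j\ge1\}$ be i.i.d. random grains, independent of $\{\boldsymbol{u}_j\}$. The random grain model with generic grain $\Xi$ is $$X(\boldsymbol{t})=\sum_{j=1}^\infty\mathbb{I}\big(\boldsymbol{t}\in(\boldsymbol{u}_j+\Xi_j)\big),\qquad\boldsymbol{t}\in\mathbb{R}^\nu ,$$ with covariance function $r_X(\boldsymbol{t})=\mathrm{Cov}(X(\boldsymbol{0}),X(\boldsymbol{t}))=\mathrm{E}\,\mathrm{Leb}_\nu(\Xi\cap(\Xi-\boldsymbol{t}))$. For $k\ge1$ set $\widehat X_k(\boldsymbol{t})=\mathbb{I}(X(\boldsymbol{t})\ge k)$. For $\lambda>0$ and real-valued $\phi\in L^1(\mathbb{R}^\nu)\cap L^\infty(\mathbb{R}^\nu)$, $$X_\lambda(\phi)=\int_{\mathbb{R}^\nu}\phi(\boldsymbol{t}/\lambda)X(\boldsymbol{t})\,\mathrm{d}\boldsymbol{t},\qquad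 \widehat X_{\lambda,k}(\phi)=\int_{\mathbb{R}^\nu}\phi(\boldsymbol{t}/\lambda)\widehat X_k(\boldsymbol{t})\,\mathrm{d}\boldsymbol{t}.$$ $\stackrel{d}{\to}$ denotes convergence in distribution and $\stackrel{fdd}{\to}$ convergence of finite-dimensional distributions. A centered Gaussian variable may have zero variance (then it is $0$). *)

theory Defs
  imports "HOL-Probability.Probability"
begin

section \<open>Random closed sets\<close>

text \<open>Hit-or-miss subbase of the Fell topology; the miss set of the empty compact set is the
  whole carrier, so the carrier is the space of all closed sets.\<close>

definition fell_topology :: "'a::topological_space set topology" where
  "fell_topology = topology_generated_by
     ({{F. closed F \<and> F \<inter> K = {}} | K. compact K} \<union>
      {{F. closed F \<and> F \<inter> G \<noteq> {}} | G. open G})"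

lemma topspace_fell_topology: "topspace fell_topology = Collect closed"
proof -
  have "{F. closed F \<and> F \<inter> {} = {}} \<in> {{F. closed F \<and> F \<inter> K = {}} | K. compact K}"
    by (rule CollectI, rule exI[of _ "{}"]) simp
  then show ?thesis
    unfolding fell_topology_def topology_generated_by_topspace by auto
qed

definition fell_borel :: "'a::topological_space set measure" where
  "fell_borel = sigma (topspace fell_topology) {U. openin fell_topology U}"

definition random_closed_set :: "'w measure \<Rightarrow> ('w \<Rightarrow> 'a::euclidean_space set) \<Rightarrow> bool" where
  "random_closed_set M \<Xi> \<longleftrightarrow> prob_space M \<and> complete_measure M \<and> \<Xi> \<in> M \<rightarrow>\<^sub>M fell_borel"

definition random_grain :: "'w measure \<Rightarrow> ('w \<Rightarrow> 'a::euclidean_space set) \<Rightarrow> bool" where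
  "random_grain M \<Xi> \<longleftrightarrow>
     random_closed_set M \<Xi> \<and> (\<integral>\<^sup>+\<omega>. emeasure lebesgue (\<Xi> \<omega>) \<partial>M) < \<infinity>"

definition grain_second_moment :: "'w measure \<Rightarrow> ('w \<Rightarrow> 'a::euclidean_space set) \<Rightarrow> ennreal" where
  "grain_second_moment M \<Xi> = (\<integral>\<^sup>+\<omega>. (emeasure lebesgue (\<Xi> \<omega>))\<^sup>2 \<partial>M)"


section \<open>The random grain model\<close>

text \<open>A point process is given by an enumeration of its points by measurable maps; the number of
  points in a set is counted with multiplicity.\<close>

definition point_count :: "(nat \<Rightarrow> 'w \<Rightarrow> 'a) \<Rightarrow> 'a set \<Rightarrow> 'w \<Rightarrow> ennreal" where
  "point_count u B \<omega> = (\<Sum>j. indicator B (u j \<omega>))"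

text \<open>Unit intensity: the intensity measure is Lebesgue measure.  The Poisson weights are written
  out because \<^const>\<open>poisson_pmf\<close> excludes rate 0, which occurs for null sets.\<close>

definition unit_poisson_process ::
  "'w measure \<Rightarrow> (nat \<Rightarrow> 'w \<Rightarrow> 'a::euclidean_space) \<Rightarrow> bool" where
  "unit_poisson_process M u \<longleftrightarrow>
     (\<forall>j. u j \<in> borel_measurable M) \<and>
     (\<forall>B\<in>sets borel. emeasure lborel B < \<infinity> \<longrightarrow>
        (\<forall>n. measure M {\<omega> \<in> space M. point_count u B \<omega> = of_nat n} =
             exp (- measure lborel B) * measure lborel B ^ n / fact n)) \<and>
     (\<forall>B::nat \<Rightarrow> 'a set. range B \<subseteq> sets borel \<and> disjoint_family B \<longrightarrow>
        prob_space.indep_vars M (\<lambda>_. borel) (\<lambda>i. point_count u (B i)) UNIV)"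

text \<open>The generic grain \<open>\<Xi>\<close> and the grains \<open>G j\<close> are treated as one i.i.d. family, in
  which \<open>None\<close> indexes \<open>\<Xi>\<close>.  The last clause makes this family independent of the sequence of
  points; it uses the generated \<open>\<sigma>\<close>-algebras because \<^const>\<open>prob_space.indep_var\<close>
  needs both variables to have the same type.\<close>

definition random_grain_model ::
  "'w measure \<Rightarrow> (nat \<Rightarrow> 'w \<Rightarrow> 'a::euclidean_space) \<Rightarrow> ('w \<Rightarrow> 'a set) \<Rightarrow>
   (nat \<Rightarrow> 'w \<Rightarrow> 'a set) \<Rightarrow> bool" where
  "random_grain_model M u \<Xi> G \<longleftrightarrow>
     prob_space M \<and> complete_measure M \<and>
     unit_poisson_process M u \<and>
     random_grain M \<Xi> \<and> (\<forall>j. random_grain M (G j)) \<and>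
     prob_space.indep_vars M (\<lambda>_. fell_borel) (case_option \<Xi> G) UNIV \<and>
     (\<forall>j. distr M fell_borel (G j) = distr M fell_borel \<Xi>) \<and>
     prob_space.indep_set M
       (sets (vimage_algebra (space M) (\<lambda>\<omega> j. u j \<omega>) (Pi\<^sub>M UNIV (\<lambda>_. borel))))
       (sets (vimage_algebra (space M) (\<lambda>\<omega> i. case_option \<Xi> G i \<omega>) (Pi\<^sub>M UNIV (\<lambda>_. fell_borel))))"

text \<open>The series defining the field is evaluated in \<open>[0,\<infinity>]\<close>.  It is finite almost everywhere, so
  setting the field to 0 where the series is infinite does not affect any integral.\<close>

definition grain_count ::
  "(nat \<Rightarrow> 'w \<Rightarrow> 'a::euclidean_space) \<Rightarrow> (nat \<Rightarrow> 'w \<Rightarrow> 'a set) \<Rightarrow> 'a \<Rightarrow> 'w \<Rightarrow> ennreal" where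
  "grain_count u G t \<omega> = (\<Sum>j. indicator ((+) (u j \<omega>) ` G j \<omega>) t)"

definition grain_field ::
  "(nat \<Rightarrow> 'w \<Rightarrow> 'a::euclidean_space) \<Rightarrow> (nat \<Rightarrow> 'w \<Rightarrow> 'a set) \<Rightarrow> 'a \<Rightarrow> 'w \<Rightarrow> real" where
  "grain_field u G t \<omega> = enn2real (grain_count u G t \<omega>)"

definition excursion_field ::
  "(nat \<Rightarrow> 'w \<Rightarrow> 'a::euclidean_space) \<Rightarrow> (nat \<Rightarrow> 'w \<Rightarrow> 'a set) \<Rightarrow> nat \<Rightarrow> 'a \<Rightarrow> 'w \<Rightarrow> real" where
  "excursion_field u G k t \<omega> = of_bool (of_nat k \<le> grain_count u G t \<omega>)"

definition covariance :: "'w measure \<Rightarrow> ('w \<Rightarrow> real) \<Rightarrow> ('w \<Rightarrow> real) \<Rightarrow> real" where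
  "covariance M X Y =
     (\<integral>\<omega>. (X \<omega> - (\<integral>\<omega>'. X \<omega>' \<partial>M)) * (Y \<omega> - (\<integral>\<omega>'. Y \<omega>' \<partial>M)) \<partial>M)"

definition grain_covariance ::
  "'w measure \<Rightarrow> (nat \<Rightarrow> 'w \<Rightarrow> 'a::euclidean_space) \<Rightarrow> (nat \<Rightarrow> 'w \<Rightarrow> 'a set) \<Rightarrow> 'a \<Rightarrow> real" where
  "grain_covariance M u G t = covariance M (grain_field u G 0) (grain_field u G t)"


section \<open>Test functions and rescaled integrals\<close>

definition L1_Linf :: "('a::euclidean_space \<Rightarrow> real) set" where
  "L1_Linf = {\<phi>. integrable lebesgue \<phi> \<and> (\<exists>C. AE t in lebesgue. \<bar>\<phi> t\<bar> \<le> C)}"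

definition L2_norm_sq :: "('a::euclidean_space \<Rightarrow> real) \<Rightarrow> real" where
  "L2_norm_sq \<phi> = (\<integral>t. \<bar>\<phi> t\<bar>\<^sup>2 \<partial>lebesgue)"

definition scaled_integral ::
  "('a::euclidean_space \<Rightarrow> 'w \<Rightarrow> real) \<Rightarrow> ('a \<Rightarrow> real) \<Rightarrow> real \<Rightarrow> 'w \<Rightarrow> real" where
  "scaled_integral Y \<phi> s \<omega> = (\<integral>t. \<phi> (t /\<^sub>R s) * Y t \<omega> \<partial>lebesgue)"

definition normalized_integral ::
  "'w measure \<Rightarrow> ('a::euclidean_space \<Rightarrow> 'w \<Rightarrow> real) \<Rightarrow> ('a \<Rightarrow> real) \<Rightarrow> real \<Rightarrow> 'w \<Rightarrow> real" where
  "normalized_integral M Y \<phi> s \<omega> =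
     s powr (- (real DIM('a) / 2)) *
       (scaled_integral Y \<phi> s \<omega> - (\<integral>\<omega>'. scaled_integral Y \<phi> s \<omega>' \<partial>M))"


section \<open>Convergence in distribution and Gaussian variables\<close>

text \<open>The library's \<^const>\<open>weak_conv_m\<close> covers only sequences of laws on the real line.\<close>

definition conv_in_distribution ::
  "'w measure \<Rightarrow> ('i \<Rightarrow> 'w \<Rightarrow> 'b::topological_space) \<Rightarrow> 'v measure \<Rightarrow> ('v \<Rightarrow> 'b) \<Rightarrow> 'i filter \<Rightarrow> bool"
  where
  "conv_in_distribution M X N W F \<longleftrightarrow>
     (\<forall>\<^sub>F i in F. X i \<in> borel_measurable M) \<and> W \<in> borel_measurable N \<and>
     (\<forall>f::'b \<Rightarrow> real. continuous_on UNIV f \<and> bounded (range f) \<longrightarrow>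
        ((\<lambda>i. \<integral>\<omega>. f (X i \<omega>) \<partial>M) \<longlongrightarrow> (\<integral>\<omega>. f (W \<omega>) \<partial>N)) F)"

text \<open>A finite subfamily indexed by \<open>J\<close> is a random element of the product space \<open>'k \<Rightarrow> real\<close>
  whose coordinates outside \<open>J\<close> are constant.\<close>

definition conv_fdd ::
  "'w measure \<Rightarrow> ('i \<Rightarrow> 'k \<Rightarrow> 'w \<Rightarrow> real) \<Rightarrow> 'v measure \<Rightarrow> ('k \<Rightarrow> 'v \<Rightarrow> real) \<Rightarrow> 'k set \<Rightarrow> 'i filter \<Rightarrow> bool"
  where
  "conv_fdd M X N W K F \<longleftrightarrow>
     (\<forall>J. finite J \<and> J \<subseteq> K \<longrightarrow>
        conv_in_distribution M (\<lambda>i \<omega>. \<lambda>k\<in>J. X i k \<omega>) N (\<lambda>\<omega>. \<lambda>k\<in>J. W k \<omega>) F)"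

definition gaussian_rv :: "'w measure \<Rightarrow> ('w \<Rightarrow> real) \<Rightarrow> bool" where
  "gaussian_rv M X \<longleftrightarrow> X \<in> borel_measurable M \<and>
     ((\<exists>m \<sigma>. 0 < \<sigma> \<and> distributed M lborel X (normal_density m \<sigma>)) \<or>
      (\<exists>m. AE \<omega> in M. X \<omega> = m))"

definition gaussian_family :: "'w measure \<Rightarrow> 'k set \<Rightarrow> ('k \<Rightarrow> 'w \<Rightarrow> real) \<Rightarrow> bool" where
  "gaussian_family M K X \<longleftrightarrow>
     (\<forall>J c. finite J \<and> J \<subseteq> K \<longrightarrow> gaussian_rv M (\<lambda>\<omega>. \<Sum>k\<in>J. c k * X k \<omega>))"

end

theory Submission imports Defs begin

text \<open>By the marking theorem the pairs \<open>(u\<^sub>j, \<Xi>\<^sub>j)\<close> form a Poisson process, and its Laplace functional gives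
  the joint probability generating function of the counts of marked points in finitely many sets.
  Counts of two sets share only the points of the intersection, so Lipschitz functions \<open>f\<close>, \<open>g\<close> of them
  have covariance at most \<open>L L'\<close> times the measure of the intersection, which for the counts at \<open>s\<close>
  and \<open>t\<close> is \<open>r(s - t)\<close> with integral \<open>E Leb(\<Xi>)\<^sup>2\<close>.  Since \<open>x \<mapsto> 1[x \<ge> k]\<close> is Lipschitz on the
  integers, the field and its excursion sets are treated alike.

  A Lipschitz function of the field is approximated in this covariance sense by a polynomial in
  \<open>2\<close> to the power minus the count, with the grains cut off by a ball.  The approximating field is bounded
  and finite-range dependent, and its integrals have characteristic functions that satisfy
  \<open>\<psi>'(\<theta>) = - \<theta> v \<psi>(\<theta>) + error\<close>.  Convergence of the characteristic functions of all linear combinations,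
  together with bounded second moments, yields joint convergence in distribution; the limit is built
  from independent normal variables by a Cholesky factorisation of the covariance.\<close>

section \<open>The Laplace functional\<close>

text \<open>Only a second moment of the grain volume is given and grains may be unbounded, so the
  field itself is neither bounded nor finite-range dependent. The approximation works because the
  mean square error of an integral is at most the squared L2 norm of the test function times the
  integral of an absolute covariance, and the factor s^(-nu/2) keeps the L2 norm of the rescaled
  test function independent of the scale s; the error is therefore uniform in s. The covariance
  bound also supplies a dominating multiple of r, provided that the approximants share one Lipschitz
  constant. Powers v^N with 0 \<le> v \<le> 1 are the building blocks: their joint expectations are
  explicit and factor for disjoint sets of marked points, and the values 2^(-N) lie in the compact
  interval [0, 1], where Weierstrass approximation applies. The characteristic function is treated
  by a differential equation because its derivation uses only such factorisations of moments, with
  no blocking of space.\<close>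

lemma suminf_indicator_eq_card:
  "(\<Sum>j. indicator B (x j) :: ennreal) =
     (if finite {j. x j \<in> B} then of_nat (card {j. x j \<in> B}) else \<infinity>)"
proof -
  have "(\<Sum>j. indicator B (x j) :: ennreal) = (\<integral>\<^sup>+j. indicator {j. x j \<in> B} j \<partial>count_space UNIV)"
    by (subst nn_integral_count_space_nat) (auto intro!: suminf_cong simp: indicator_def)
  also have "\<dots> = emeasure (count_space UNIV) {j. x j \<in> B}"
    by simp
  finally show ?thesis
    by (simp add: emeasure_count_space)
qed

text \<open>Infinite counts agree as well, since \<open>card\<close> of an infinite set and
  \<open>enn2real\<close> of infinity are both 0. The floor form yields measurability of the
  count.\<close>

lemma card_eq_floor_point_count:
  "card {j. u j \<omega> \<in> B} = nat \<lfloor>enn2real (point_count u B \<omega>)\<rfloor>"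
  unfolding point_count_def suminf_indicator_eq_card by simp

lemma borel_measurable_point_count:
  assumes [measurable]: "\<And>j. u j \<in> borel_measurable M" "B \<in> sets borel"
  shows "point_count u B \<in> borel_measurable M"
  unfolding point_count_def[abs_def] by measurable

context prob_space begin

text \<open>The Poisson weights of the events "exactly n points" add up to 1, so these events
  exhaust the space up to a null set and infinite counts are excluded. The generating function is
  then the exponential series.\<close>

lemma poisson_count:
  assumes P: "unit_poisson_process M u" and B[measurable]: "B \<in> sets borel"
    and fin: "emeasure lborel B < \<infinity>"
  shows AE_finite_poisson_count: "AE \<omega> in M. finite {j. u j \<omega> \<in> B}"
    and expectation_power_poisson_count: "0 \<le> v \<Longrightarrow> v \<le> 1 \<Longrightarrow>
      (\<integral>\<omega>. v ^ card {j. u j \<omega> \<in> B} \<partial>M) = exp (- ((1 - v) * measure lborel B))"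
proof -
  define b where "b = measure lborel B"
  define N where "N = point_count u B"
  have u[measurable]: "u j \<in> borel_measurable M" for j
    using P by (auto simp: unit_poisson_process_def)
  have N[measurable]: "N \<in> borel_measurable M"
    unfolding N_def by (rule borel_measurable_point_count) auto
  define A where "A n = {\<omega> \<in> space M. N \<omega> = of_nat n}" for n :: nat
  have A[measurable]: "A n \<in> events" for n unfolding A_def by measurable
  have dA: "disjoint_family A" by (auto simp: disjoint_family_on_def A_def)
  define p where "p n = exp (- b) * b ^ n / fact n" for n
  have pA: "prob (A n) = p n" for n
    using P fin B unfolding unit_poisson_process_def A_def N_def p_def b_def by blast
  have b0: "b \<ge> 0" by (simp add: b_def)
  \<comment> \<open>The case \<open>v = 1\<close> says that the weights add up to 1; other values of
    \<open>v\<close> give the generating function.\<close>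
  have sums_v: "(\<lambda>n. v ^ n * p n) sums exp (- ((1 - v) * b))" for v
  proof -
    have "(\<lambda>n. exp (- b) * ((v * b) ^ n /\<^sub>R fact n)) sums (exp (- b) * exp (v * b))"
      by (intro sums_mult exp_converges)
    also have "exp (- b) * exp (v * b) = exp (- ((1 - v) * b))"
      by (simp add: exp_add[symmetric] algebra_simps)
    finally show ?thesis
      by (simp add: p_def power_mult_distrib divide_inverse mult_ac)
  qed
  have "(\<lambda>n. prob (A n)) sums prob (\<Union>n. A n)"
    using finite_measure_UNION[of A] A dA by (auto simp: image_subset_iff)
  moreover have "(\<lambda>n. prob (A n)) sums 1"
    using sums_v[of 1] by (simp add: pA)
  ultimately have "prob (\<Union>n. A n) = 1"
    using sums_unique2 by blast
  then have AEA: "AE \<omega> in M. \<omega> \<in> (\<Union>n. A n)"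
    by (subst (asm) prob_eq_1) auto
  have finA: "finite {j. u j \<omega> \<in> B} \<and> card {j. u j \<omega> \<in> B} = n" if "\<omega> \<in> A n" for \<omega> n
    using that unfolding A_def N_def point_count_def suminf_indicator_eq_card
    by (auto split: if_splits)
  show "AE \<omega> in M. finite {j. u j \<omega> \<in> B}"
    using AEA by eventually_elim (use finA in blast)
  assume v: "0 \<le> v" "v \<le> 1"
  have "(\<integral>\<^sup>+\<omega>. ennreal (v ^ card {j. u j \<omega> \<in> B}) \<partial>M)
      = (\<integral>\<^sup>+\<omega>. (\<Sum>n. ennreal (v ^ n) * indicator (A n) \<omega>) \<partial>M)"
  proof (rule nn_integral_cong_AE)
    show "AE \<omega> in M. ennreal (v ^ card {j. u j \<omega> \<in> B}) = (\<Sum>n. ennreal (v ^ n) * indicator (A n) \<omega>)"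
      using AEA
    proof eventually_elim
      case (elim \<omega>)
      then obtain n where n: "\<omega> \<in> A n" by auto
      then have "\<omega> \<in> A m \<longleftrightarrow> m = n" for m by (auto simp: A_def)
      then have "(\<lambda>m. ennreal (v ^ m) * indicator (A m) \<omega>) = (\<lambda>m. if m = n then ennreal (v ^ n) else 0)"
        by (auto simp: indicator_def)
      then have "(\<Sum>m. ennreal (v ^ m) * indicator (A m) \<omega>) = ennreal (v ^ n)"
        using sums_single[of n "\<lambda>_. ennreal (v ^ n)"] by (simp add: sums_iff)
      then show ?case using finA[OF n] by simp
    qed
  qed
  also have "\<dots> = (\<Sum>n. ennreal (v ^ n) * emeasure M (A n))"
    by (subst nn_integral_suminf) (auto simp: nn_integral_cmult)
  also have "\<dots> = (\<Sum>n. ennreal (v ^ n * p n))"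
  proof (rule suminf_cong)
    fix n
    show "ennreal (v ^ n) * emeasure M (A n) = ennreal (v ^ n * p n)"
      unfolding emeasure_eq_measure pA using v b0 by (intro ennreal_mult[symmetric]) (auto simp: p_def)
  qed
  also have "\<dots> = ennreal (exp (- ((1 - v) * b)))"
    using sums_v[of v] v b0 by (intro suminf_ennreal_eq) (auto simp: p_def)
  finally have nn: "(\<integral>\<^sup>+\<omega>. ennreal (v ^ card {j. u j \<omega> \<in> B}) \<partial>M) = ennreal (exp (- ((1 - v) * b)))" .
  have [measurable]: "(\<lambda>\<omega>. v ^ card {j. u j \<omega> \<in> B}) \<in> borel_measurable M"
    unfolding card_eq_floor_point_count N_def[symmetric] by measurable
  show "(\<integral>\<omega>. v ^ card {j. u j \<omega> \<in> B} \<partial>M) = exp (- ((1 - v) * measure lborel B))"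
    using nn v by (intro integral_eq_nn_integral[THEN trans]) (auto simp: b_def)
qed

lemma expectation_prod_power_poisson_count:
  assumes P: "unit_poisson_process M u" and B: "\<And>i. B i \<in> sets borel" "disjoint_family (B :: nat \<Rightarrow> _)"
    and I: "finite I" "\<And>i. i \<in> I \<Longrightarrow> emeasure lborel (B i) < \<infinity>"
    and v: "\<And>i. i \<in> I \<Longrightarrow> 0 \<le> v i \<and> v i \<le> 1"
  shows "(\<integral>\<omega>. (\<Prod>i\<in>I. v i ^ card {j. u j \<omega> \<in> B i}) \<partial>M) =
    (\<Prod>i\<in>I. exp (- ((1 - v i) * measure lborel (B i))))"
proof -
  have u[measurable]: "u j \<in> borel_measurable M" for j
    using P by (auto simp: unit_poisson_process_def)
  have "indep_vars (\<lambda>_. borel) (\<lambda>i. point_count u (B i)) UNIV"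
    using P B unfolding unit_poisson_process_def by (auto simp: image_subset_iff)
  then have "indep_vars (\<lambda>_. borel) (\<lambda>i. point_count u (B i)) I"
    by (rule indep_vars_subset) auto
  then have "indep_vars (\<lambda>_. borel) (\<lambda>i \<omega>. v i ^ nat \<lfloor>enn2real (point_count u (B i) \<omega>)\<rfloor>) I"
    by (rule indep_vars_compose2[where Y = "\<lambda>i x. v i ^ nat \<lfloor>enn2real x\<rfloor>"]) measurable
  then have ind: "indep_vars (\<lambda>_. borel) (\<lambda>i \<omega>. v i ^ card {j. u j \<omega> \<in> B i}) I"
    by (simp add: card_eq_floor_point_count)
  have int: "integrable M (\<lambda>\<omega>. v i ^ card {j. u j \<omega> \<in> B i})" if "i \<in> I" for i
  proof (rule integrable_const_bound[where B=1])
    show "AE \<omega> in M. norm (v i ^ card {j. u j \<omega> \<in> B i}) \<le> 1"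
      using v[OF that] by (auto simp: power_le_one)
    show "(\<lambda>\<omega>. v i ^ card {j. u j \<omega> \<in> B i}) \<in> borel_measurable M"
      using ind that by (auto simp: indep_vars_def)
  qed
  show ?thesis
    using indep_vars_lebesgue_integral[OF I(1) ind int] v I
    by (simp add: expectation_power_poisson_count[OF P B(1)])
qed

text \<open>Points where \<open>g\<close> equals 1 contribute nothing to the product. Each of the
  finitely many other level sets has finite measure, so almost surely the product has finitely many
  factors different from 1 and is a product of powers of independent Poisson counts.\<close>

lemma laplace_functional_points_simple:
  assumes P: "unit_poisson_process M (u :: nat \<Rightarrow> _ \<Rightarrow> 'b::euclidean_space)"
    and g[measurable]: "g \<in> borel_measurable borel" and fr: "finite (range g)"
    and g01: "\<And>x. 0 \<le> g x \<and> g x \<le> (1::real)"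
    and int: "integrable lborel (\<lambda>x. 1 - g x)"
  shows "(\<lambda>n. \<integral>\<omega>. (\<Prod>j<n. g (u j \<omega>)) \<partial>M) \<longlonglongrightarrow> exp (- (\<integral>x. 1 - g x \<partial>lborel))"
proof -
  have u[measurable]: "u j \<in> borel_measurable M" for j
    using P by (auto simp: unit_poisson_process_def)
  obtain f n where f: "bij_betw f {..<n::nat} (range g - {1})"
    using ex_bij_betw_nat_finite[of "range g - {1}"] fr by (auto simp: atLeast0LessThan)
  \<comment> \<open>Empty sets pad the finite partition to a sequence, the form in which complete
    independence is available.\<close>
  define B where "B i = (if i < n then {x. g x = f i} else {})" for i
  have B[measurable]: "B i \<in> sets borel" for i
  proof -
    have "g -` {f i} \<inter> space borel \<in> sets borel" by (rule measurable_sets[OF g]) simp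
    then show ?thesis by (simp add: B_def vimage_def)
  qed
  have finj: "f i = f k \<Longrightarrow> i < n \<Longrightarrow> k < n \<Longrightarrow> i = k" for i k
    using f by (auto simp: bij_betw_def inj_on_def)
  have dB: "disjoint_family B"
    using finj by (auto simp: disjoint_family_on_def B_def)
  have f01: "0 \<le> f i \<and> f i < 1" if "i < n" for i
  proof -
    have "f i \<in> range g - {1}" using f that by (auto simp: bij_betw_def)
    then show ?thesis using g01 by (auto simp: less_le)
  qed
  \<comment> \<open>Markov's inequality: on the level set, \<open>1 - g\<close> is the positive
    constant \<open>1 - f i\<close>, and its integral is finite.\<close>
  have finB: "emeasure lborel (B i) < \<infinity>" if i: "i < n" for i
  proof -
    have "ennreal (1 - f i) * emeasure lborel (B i) = (\<integral>\<^sup>+x. ennreal (1 - f i) * indicator (B i) x \<partial>lborel)"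
      by (subst nn_integral_cmult_indicator) auto
    also have "\<dots> \<le> (\<integral>\<^sup>+x. ennreal (1 - g x) \<partial>lborel)"
      by (intro nn_integral_mono) (auto simp: B_def indicator_def i)
    also have "\<dots> < \<infinity>"
      using int g01 by (subst nn_integral_eq_integral) auto
    finally show ?thesis
      using f01[OF i] by (auto simp: ennreal_mult_less_top less_top[symmetric] ennreal_eq_0_iff ennreal_mult_eq_top_iff top_unique)
  qed
  have cover: "\<exists>!i. i < n \<and> x \<in> B i" if "g x \<noteq> 1" for x
  proof -
    have "g x \<in> f ` {..<n}" using f that by (auto simp: bij_betw_def)
    then show ?thesis using finj by (auto simp: B_def)
  qed
  have B1: "x \<in> B i \<Longrightarrow> g x \<noteq> 1" for x i
    using f01 by (auto simp: B_def split: if_splits dest: less_imp_neq)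
  have fin: "AE \<omega> in M. \<forall>i<n. finite {j. u j \<omega> \<in> B i}"
    by (intro AE_all_countable[THEN iffD2] allI AE_impI)
       (rule AE_finite_poisson_count[OF P B finB])
  have "(\<lambda>m. \<integral>\<omega>. (\<Prod>j<m. g (u j \<omega>)) \<partial>M) \<longlonglongrightarrow>
        (\<integral>\<omega>. (\<Prod>i<n. f i ^ card {j. u j \<omega> \<in> B i}) \<partial>M)"
  proof (rule integral_dominated_convergence[where w = "\<lambda>_. 1"])
    show "(\<lambda>\<omega>. \<Prod>i<n. f i ^ card {j. u j \<omega> \<in> B i}) \<in> borel_measurable M"
      unfolding card_eq_floor_point_count
      using borel_measurable_point_count[OF u B] by measurable
    show "AE \<omega> in M. norm (\<Prod>j<m. g (u j \<omega>)) \<le> 1" for m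
      using g01 by (auto intro!: AE_I2 prod_le_1 simp: abs_prod)
    show "AE \<omega> in M. (\<lambda>m. \<Prod>j<m. g (u j \<omega>)) \<longlonglongrightarrow> (\<Prod>i<n. f i ^ card {j. u j \<omega> \<in> B i})"
      using fin
    proof eventually_elim
      case (elim \<omega>)
      define S where "S = (\<Union>i<n. {j. u j \<omega> \<in> B i})"
      have finS: "finite S" using elim by (auto simp: S_def)
      have SI: "j \<in> S \<longleftrightarrow> g (u j \<omega>) \<noteq> 1" for j
      proof
        assume "j \<in> S"
        then obtain i where "u j \<omega> \<in> B i" unfolding S_def by blast
        then show "g (u j \<omega>) \<noteq> 1" by (rule B1)
      next
        assume "g (u j \<omega>) \<noteq> 1"
        from cover[OF this] obtain i where "i < n \<and> u j \<omega> \<in> B i" by (rule ex1E)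
        then show "j \<in> S" unfolding S_def by blast
      qed
      have "(\<Prod>j\<in>S. g (u j \<omega>)) = (\<Prod>i<n. \<Prod>j\<in>{j. u j \<omega> \<in> B i}. g (u j \<omega>))"
        unfolding S_def using elim dB
        by (intro prod.UNION_disjoint) (auto simp: disjoint_family_on_def)
      also have "\<dots> = (\<Prod>i<n. f i ^ card {j. u j \<omega> \<in> B i})"
        by (intro prod.cong refl) (simp add: B_def)
      finally have PS: "(\<Prod>j\<in>S. g (u j \<omega>)) = (\<Prod>i<n. f i ^ card {j. u j \<omega> \<in> B i})" .
      obtain k where k: "S \<subseteq> {..<k}"
        using finS finite_nat_iff_bounded by auto
      have "(\<Prod>j<m. g (u j \<omega>)) = (\<Prod>j\<in>S. g (u j \<omega>))" if "m \<ge> k" for m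
        using k that by (intro prod.mono_neutral_right) (auto simp: SI subset_iff)
      then show ?case unfolding PS[symmetric]
        by (intro tendsto_eventually eventually_sequentiallyI[of k]) auto
    qed
  qed auto
  also have "(\<integral>\<omega>. (\<Prod>i<n. f i ^ card {j. u j \<omega> \<in> B i}) \<partial>M) =
      (\<Prod>i<n. exp (- ((1 - f i) * measure lborel (B i))))"
    using f01 finB by (intro expectation_prod_power_poisson_count[OF P B dB]) (auto intro: less_imp_le)
  also have "\<dots> = exp (- (\<Sum>i<n. (1 - f i) * measure lborel (B i)))"
    by (simp add: exp_sum sum_negf[symmetric])
  also have "(\<Sum>i<n. (1 - f i) * measure lborel (B i)) = (\<integral>x. (\<Sum>i<n. (1 - f i) * indicator (B i) x) \<partial>lborel)"
    using finB by (subst Bochner_Integration.integral_sum) auto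
  also have "\<dots> = (\<integral>x. 1 - g x \<partial>lborel)"
  proof (rule Bochner_Integration.integral_cong[OF refl])
    fix x
    show "(\<Sum>i<n. (1 - f i) * indicator (B i) x) = 1 - g x"
    proof (cases "g x = 1")
      case True
      then have "x \<notin> B i" for i using B1 by auto
      then show ?thesis using True by simp
    next
      case False
      then obtain k where k: "k < n" "x \<in> B k" "\<And>i. i < n \<Longrightarrow> x \<in> B i \<Longrightarrow> i = k"
        using cover by metis
      have "(\<Sum>i<n. (1 - f i) * indicator (B i) x) = (\<Sum>i<n. if i = k then 1 - f k else 0)"
      proof (rule sum.cong[OF refl])
        fix i assume "i \<in> {..<n}"
        then have "x \<in> B i \<longleftrightarrow> i = k" using k(2) k(3)[of i] by auto
        then show "(1 - f i) * indicator (B i) x = (if i = k then 1 - f k else 0)"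
          by (simp add: indicator_def)
      qed
      also have "\<dots> = 1 - f k" using k(1) by simp
      also have "f k = g x" using k(1,2) by (simp add: B_def)
      finally show ?thesis .
    qed
  qed
  finally show ?thesis .
qed

text \<open>Simple functions \<open>h m\<close> decrease to \<open>g\<close>, which leaves an
  interchange of the limits in \<open>n\<close> and \<open>m\<close>. Monotonicity in both variables
  replaces uniformity: the expectation for \<open>g\<close> is squeezed between its limit value and
  the expectation for one fixed \<open>h m\<close>.\<close>

lemma laplace_functional_points:
  assumes P: "unit_poisson_process M (u :: nat \<Rightarrow> _ \<Rightarrow> 'b::euclidean_space)"
    and g[measurable]: "g \<in> borel_measurable borel"
    and g01: "\<And>x. 0 \<le> g x \<and> g x \<le> (1::real)"
    and int: "integrable lborel (\<lambda>x. 1 - g x)"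
  shows "(\<lambda>n. \<integral>\<omega>. (\<Prod>j<n. g (u j \<omega>)) \<partial>M) \<longlonglongrightarrow> exp (- (\<integral>x. 1 - g x \<partial>lborel))"
proof -
  have u[measurable]: "u j \<in> borel_measurable M" for j
    using P by (auto simp: unit_poisson_process_def)
  obtain f :: "nat \<Rightarrow> 'b \<Rightarrow> real" where f: "incseq f" "\<And>i. simple_function borel (f i)"
    "\<And>x. bdd_above (range (\<lambda>i. f i x))" "\<And>i x. 0 \<le> f i x" "(\<lambda>x. 1 - g x) = (SUP i. f i)"
    using borel_measurable_implies_simple_function_sequence_real[of "\<lambda>x. 1 - g x" borel] g01
    by auto
  have fm[measurable]: "f i \<in> borel_measurable borel" for i
    using f(2) by (rule borel_measurable_simple_function)
  have inc: "incseq (\<lambda>i. f i x)" for x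
    using f(1) by (auto simp: incseq_def le_fun_def)
  have eq: "1 - g x = (SUP i. f i x)" for x
    using fun_cong[OF f(5), of x] unfolding Sup_fun_def image_image .
  have lim: "(\<lambda>i. f i x) \<longlonglongrightarrow> 1 - g x" for x
    unfolding eq using f(3) inc by (intro LIMSEQ_incseq_SUP) auto
  have le: "f i x \<le> 1 - g x" for i x
    using incseq_le[OF inc lim] by blast
  define h where "h m x = 1 - f m x" for m x
  have hm[measurable]: "h m \<in> borel_measurable borel" for m unfolding h_def by measurable
  have h01: "0 \<le> h m x \<and> h m x \<le> 1" for m x
    using f(4)[of m x] le[of m x] g01[of x] by (auto simp: h_def)
  have gh: "g x \<le> h m x" for x m using le[of m x] by (auto simp: h_def)
  have inth: "integrable lborel (\<lambda>x. 1 - h m x)" for m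
    by (rule Bochner_Integration.integrable_bound[OF int]) (use f(4) le g01 in \<open>auto simp: h_def\<close>)
  define e where "e n m = (\<integral>\<omega>. (\<Prod>j<n. h m (u j \<omega>)) \<partial>M)" for n m
  define a where "a n = (\<integral>\<omega>. (\<Prod>j<n. g (u j \<omega>)) \<partial>M)" for n
  define L where "L m = exp (- (\<integral>x. 1 - h m x \<partial>lborel))" for m
  define L0 where "L0 = exp (- (\<integral>x. 1 - g x \<partial>lborel))"
  have eL: "(\<lambda>n. e n m) \<longlonglongrightarrow> L m" for m
    unfolding e_def L_def
  proof (rule laplace_functional_points_simple[OF P hm _ h01 inth])
    have "finite (range (f m))"
      using f(2)[of m] by (simp add: simple_function_def)
    then have "finite ((\<lambda>y. 1 - y) ` range (f m))"
      by (rule finite_imageI)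
    moreover have "range (h m) = (\<lambda>y. 1 - y) ` range (f m)"
      unfolding h_def image_image ..
    ultimately show "finite (range (h m))" by (simp only:)
  qed
  have bnd: "integrable M (\<lambda>\<omega>. \<Prod>j<n. h m (u j \<omega>))" for n m
    by (rule integrable_const_bound[where B=1]) (use h01 in \<open>auto intro!: AE_I2 prod_le_1 simp: abs_prod\<close>)
  have bndg: "integrable M (\<lambda>\<omega>. \<Prod>j<n. g (u j \<omega>))" for n
    by (rule integrable_const_bound[where B=1]) (use g01 in \<open>auto intro!: AE_I2 prod_le_1 simp: abs_prod\<close>)
  have ea: "(\<lambda>m. e n m) \<longlonglongrightarrow> a n" for n
    unfolding e_def a_def
  proof (rule integral_dominated_convergence[where w="\<lambda>_. 1"])
    show "AE \<omega> in M. norm (\<Prod>j<n. h m (u j \<omega>)) \<le> 1" for m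
      using h01 by (auto intro!: AE_I2 prod_le_1 simp: abs_prod)
    have "(\<lambda>m. h m x) \<longlonglongrightarrow> g x" for x
      unfolding h_def using tendsto_diff[OF tendsto_const lim[of x], of 1] by simp
    then show "AE \<omega> in M. (\<lambda>m. \<Prod>j<n. h m (u j \<omega>)) \<longlonglongrightarrow> (\<Prod>j<n. g (u j \<omega>))"
      by (intro AE_I2 tendsto_prod)
  qed auto
  have LL: "L \<longlonglongrightarrow> L0"
    unfolding L_def[abs_def] L0_def
  proof (intro tendsto_exp tendsto_minus integral_dominated_convergence[where w="\<lambda>x. 1 - g x"])
    show "AE x in lborel. (\<lambda>m. 1 - h m x) \<longlonglongrightarrow> 1 - g x" using lim by (simp add: h_def)
    show "AE x in lborel. norm (1 - h m x) \<le> 1 - g x" for m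
      using f(4) le g01 by (auto simp: h_def)
  qed (use int in auto)
  have ale: "a n \<le> e n m" for n m
    unfolding a_def e_def using gh g01 h01
    by (intro integral_mono bnd bndg prod_mono) auto
  have edec: "decseq (\<lambda>n. e n m)" for m
    unfolding e_def
  proof (intro decseq_SucI integral_mono bnd)
    fix n \<omega>
    show "(\<Prod>j<Suc n. h m (u j \<omega>)) \<le> (\<Prod>j<n. h m (u j \<omega>))"
      using h01 by (simp add: mult_left_le prod_nonneg)
  qed
  \<comment> \<open>The partial products decrease in \<open>n\<close>, so \<open>L m\<close> bounds
    them from below; letting \<open>m\<close> tend to infinity at fixed \<open>n\<close> gives the
    lower half of the squeeze.\<close>
  have eL0: "L m \<le> e n m" for n m
    using decseq_ge[OF edec eL] .
  have aL0: "L0 \<le> a n" for n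
    using LIMSEQ_le[OF LL ea[of n]] eL0 by blast
  show ?thesis
    unfolding a_def[symmetric] L0_def[symmetric]
  proof (rule LIMSEQ_I)
    fix r :: real assume r: "0 < r"
    then obtain m where m: "L m < L0 + r/2"
      using order_tendstoD(2)[OF LL, of "L0 + r/2"] by (auto dest: eventually_happens)
    have "\<forall>\<^sub>F n in sequentially. e n m < L m + r/2"
      using order_tendstoD(2)[OF eL[of m], of "L m + r/2"] r by simp
    then obtain no where "\<And>n. n \<ge> no \<Longrightarrow> e n m < L m + r/2"
      by (auto simp: eventually_sequentially)
    then have "norm (a n - L0) < r" if "n \<ge> no" for n
      using ale[of n m] aL0[of n] m that by (force simp: abs_if)
    then show "\<exists>no. \<forall>n\<ge>no. norm (a n - L0) < r" by blast
  qed
qed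

end

section \<open>Marks\<close>

lemma sets_fell_borel: "sets fell_borel = sigma_sets (Collect closed) {U. openin fell_topology U}"
  and space_fell_borel: "space fell_borel = Collect closed"
proof -
  have sub: "{U. openin fell_topology U} \<subseteq> Pow (Collect closed)"
    using openin_subset[of fell_topology] unfolding topspace_fell_topology by blast
  show "sets fell_borel = sigma_sets (Collect closed) {U. openin fell_topology U}"
    "space fell_borel = Collect closed"
    unfolding fell_borel_def topspace_fell_topology
    by (rule sets_measure_of[OF sub], rule space_measure_of[OF sub])
qed

lemma sets_fell_miss: "compact K \<Longrightarrow> {F. closed F \<and> F \<inter> K = {}} \<in> sets fell_borel"
  unfolding sets_fell_borel
  by (intro sigma_sets.Basic) (auto simp: fell_topology_def intro!: topology_generated_by_Basis)

text \<open>A point lies outside a closed set exactly when some ball with centre in a countable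
  dense set and radius 1/(n+1) contains the point and misses the set. This is a countable union of
  rectangles built from miss sets, and it makes the indicator of a random closed set jointly
  measurable.\<close>

lemma sets_fell_not_mem:
  "{z \<in> space (borel \<Otimes>\<^sub>M fell_borel). fst z \<notin> snd z} \<in> sets (borel \<Otimes>\<^sub>M (fell_borel :: 'a::euclidean_space set measure))"
proof -
  obtain D :: "'a set" where D: "countable D" "\<And>X. open X \<Longrightarrow> X \<noteq> {} \<Longrightarrow> \<exists>d\<in>D. d \<in> X"
    using countable_dense_setE by blast
  have "{z \<in> space (borel \<Otimes>\<^sub>M fell_borel). fst z \<notin> snd z} =
    (\<Union>d\<in>D. \<Union>n. cball d (inverse (Suc n)) \<times> {F. closed F \<and> F \<inter> cball d (inverse (Suc n)) = {}})"
    (is "?L = ?R")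
  proof (intro set_eqI iffI)
    fix z assume "z \<in> ?L"
    then have z: "closed (snd z)" "fst z \<notin> snd z" by (auto simp: space_pair_measure space_fell_borel)
    then obtain e where e: "e > 0" "ball (fst z) e \<inter> snd z = {}"
      by (metis open_Compl open_contains_ball ComplI disjoint_eq_subset_Compl)
    obtain n where n: "inverse (real (Suc n)) < e / 2"
      using reals_Archimedean[of "e/2"] e by auto
    obtain d where d: "d \<in> D" "d \<in> ball (fst z) (inverse (Suc n))"
      using D(2)[of "ball (fst z) (inverse (Suc n))"] by auto
    have sub: "cball d (inverse (Suc n)) \<subseteq> ball (fst z) e"
    proof
      fix y assume "y \<in> cball d (inverse (Suc n))"
      then have "dist (fst z) y < inverse (Suc n) + inverse (Suc n)"
        using d(2) dist_triangle[of "fst z" y d] by auto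
      then show "y \<in> ball (fst z) e" using n by auto
    qed
    have "fst z \<in> cball d (inverse (Suc n))" using d(2) by (simp add: dist_commute)
    moreover have "snd z \<inter> cball d (inverse (Suc n)) = {}" using sub e(2) by blast
    ultimately have "(fst z, snd z) \<in> cball d (inverse (Suc n)) \<times> {F. closed F \<and> F \<inter> cball d (inverse (Suc n)) = {}}"
      using z(1) by blast
    then show "z \<in> ?R" unfolding prod.collapse using d(1) by blast
  qed (auto simp: space_pair_measure space_fell_borel)
  also have "\<dots> \<in> sets (borel \<Otimes>\<^sub>M fell_borel)"
    by (intro sets.countable_UN'' D(1) sets.countable_UN pair_measureI sets_fell_miss) (auto intro!: pair_measureI sets_fell_miss)
  finally show ?thesis .
qed

lemma pred_fell_mem[measurable (raw)]:
  assumes f: "f \<in> borel_measurable N" and g: "g \<in> N \<rightarrow>\<^sub>M (fell_borel :: 'a::euclidean_space set measure)"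
  shows "Measurable.pred N (\<lambda>x. f x \<in> g x)"
proof -
  have "Measurable.pred (borel \<Otimes>\<^sub>M fell_borel) (\<lambda>z. fst z \<notin> (snd z :: 'a set))"
    using sets_fell_not_mem by (simp add: pred_def)
  from measurable_compose[OF measurable_Pair[OF f g] this]
  have "Measurable.pred N (\<lambda>x. f x \<notin> g x)" by simp
  from pred_intros_logic(2)[OF this] show ?thesis unfolding not_not .
qed

locale grain_model = prob_space M for M :: "'w measure" +
  fixes u :: "nat \<Rightarrow> 'w \<Rightarrow> 'a::euclidean_space" and \<Xi> :: "'w \<Rightarrow> 'a set" and G :: "nat \<Rightarrow> 'w \<Rightarrow> 'a set"
  assumes model: "random_grain_model M u \<Xi> G"
begin

definition Q :: "'a set measure" where "Q = distr M fell_borel \<Xi>"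

text \<open>The intensity measure of the marked point process of pairs (point, grain).\<close>

definition Lam :: "('a \<times> 'a set) measure" where "Lam = lborel \<Otimes>\<^sub>M Q"

lemma P: "unit_poisson_process M u"
  using model by (simp add: random_grain_model_def)

lemma measurable_u[measurable]: "u j \<in> borel_measurable M"
  using P by (simp add: unit_poisson_process_def)

lemma measurable_G[measurable]: "G j \<in> M \<rightarrow>\<^sub>M fell_borel"
  and measurable_\<Xi>[measurable]: "\<Xi> \<in> M \<rightarrow>\<^sub>M fell_borel"
  using model by (simp_all add: random_grain_model_def random_grain_def random_closed_set_def)

lemma distr_G: "distr M fell_borel (G j) = Q"
  using model by (simp add: random_grain_model_def Q_def)

lemma sets_Q[simp, measurable_cong]: "sets Q = sets fell_borel"
  by (simp add: Q_def)

lemma sets_Lam[measurable_cong]: "sets Lam = sets (borel \<Otimes>\<^sub>M fell_borel)"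
  unfolding Lam_def by (intro sets_pair_measure_cong) auto

sublocale Q: prob_space Q
  unfolding Q_def by (rule prob_space_distr) simp

lemma indep_G: "indep_vars (\<lambda>_. fell_borel) (case_option \<Xi> G) UNIV"
  using model unfolding random_grain_model_def by (elim conjE)

abbreviation (input) "GG \<equiv> \<lambda>\<omega> i. case_option \<Xi> G i \<omega>"

text \<open>Independence is given for the generated \<sigma>-algebras. As a product form of the
  joint law it permits integrating over the grains for fixed points by Fubini.\<close>

lemma points_grains_distr:
  "distr M (Pi\<^sub>M UNIV (\<lambda>_. borel)) (\<lambda>\<omega> j. u j \<omega>) \<Otimes>\<^sub>M distr M (Pi\<^sub>M UNIV (\<lambda>_. fell_borel)) GG =
   distr M (Pi\<^sub>M UNIV (\<lambda>_. borel) \<Otimes>\<^sub>M Pi\<^sub>M UNIV (\<lambda>_. fell_borel)) (\<lambda>\<omega>. (\<lambda>j. u j \<omega>, GG \<omega>))"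
proof (rule pair_measure_eqI)
  have U[measurable]: "(\<lambda>\<omega> j. u j \<omega>) \<in> M \<rightarrow>\<^sub>M Pi\<^sub>M UNIV (\<lambda>_. borel)"
    by (intro measurable_PiM_single') auto
  have m: "case_option \<Xi> G i \<in> M \<rightarrow>\<^sub>M fell_borel" for i by (cases i) auto
  have cl: "\<omega> \<in> space M \<Longrightarrow> closed (case_option \<Xi> G i \<omega>)" for i \<omega>
    using measurable_space[OF m] unfolding space_fell_borel by blast
  have GGm[measurable]: "GG \<in> M \<rightarrow>\<^sub>M Pi\<^sub>M UNIV (\<lambda>_. fell_borel)"
    using m by (intro measurable_PiM_single') (auto simp: PiE_def space_fell_borel cl)
  have ind: "indep_set (sets (vimage_algebra (space M) (\<lambda>\<omega> j. u j \<omega>) (Pi\<^sub>M UNIV (\<lambda>_. borel))))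
     (sets (vimage_algebra (space M) GG (Pi\<^sub>M UNIV (\<lambda>_. fell_borel))))"
    using model unfolding random_grain_model_def by (elim conjE)
  show "sigma_finite_measure (distr M (Pi\<^sub>M UNIV (\<lambda>_. borel)) (\<lambda>\<omega> j. u j \<omega>))"
    "sigma_finite_measure (distr M (Pi\<^sub>M UNIV (\<lambda>_. fell_borel)) GG)"
    by (auto intro!: prob_space_imp_sigma_finite prob_space_distr)
  show "sets (distr M (Pi\<^sub>M UNIV (\<lambda>_. borel)) (\<lambda>\<omega> j. u j \<omega>) \<Otimes>\<^sub>M distr M (Pi\<^sub>M UNIV (\<lambda>_. fell_borel)) GG) =
    sets (distr M (Pi\<^sub>M UNIV (\<lambda>_. borel) \<Otimes>\<^sub>M Pi\<^sub>M UNIV (\<lambda>_. fell_borel)) (\<lambda>\<omega>. (\<lambda>j. u j \<omega>, GG \<omega>)))"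
    by (simp cong: sets_pair_measure_cong)
  fix A B assume A: "A \<in> sets (distr M (Pi\<^sub>M UNIV (\<lambda>_. borel)) (\<lambda>\<omega> j. u j \<omega>))"
    and B: "B \<in> sets (distr M (Pi\<^sub>M UNIV (\<lambda>_. fell_borel)) GG)"
  then have AB[measurable]: "A \<in> sets (Pi\<^sub>M UNIV (\<lambda>_. borel))" "B \<in> sets (Pi\<^sub>M UNIV (\<lambda>_. fell_borel))" by auto
  have "(\<lambda>\<omega> j. u j \<omega>) -` A \<inter> space M \<in> sets (vimage_algebra (space M) (\<lambda>\<omega> j. u j \<omega>) (Pi\<^sub>M UNIV (\<lambda>_. borel)))"
    "GG -` B \<inter> space M \<in> sets (vimage_algebra (space M) GG (Pi\<^sub>M UNIV (\<lambda>_. fell_borel)))"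
    by (rule in_vimage_algebra, fact)+
  from indep_setD[OF ind this]
  have "prob (((\<lambda>\<omega> j. u j \<omega>) -` A \<inter> space M) \<inter> (GG -` B \<inter> space M)) =
    prob ((\<lambda>\<omega> j. u j \<omega>) -` A \<inter> space M) * prob (GG -` B \<inter> space M)" .
  moreover have "((\<lambda>\<omega> j. u j \<omega>) -` A \<inter> space M) \<inter> (GG -` B \<inter> space M) =
     (\<lambda>\<omega>. (\<lambda>j. u j \<omega>, GG \<omega>)) -` (A \<times> B) \<inter> space M" by auto
  ultimately show "emeasure (distr M (Pi\<^sub>M UNIV (\<lambda>_. borel)) (\<lambda>\<omega> j. u j \<omega>)) A * emeasure (distr M (Pi\<^sub>M UNIV (\<lambda>_. fell_borel)) GG) B
    = emeasure (distr M (Pi\<^sub>M UNIV (\<lambda>_. borel) \<Otimes>\<^sub>M Pi\<^sub>M UNIV (\<lambda>_. fell_borel)) (\<lambda>\<omega>. (\<lambda>j. u j \<omega>, GG \<omega>))) (A \<times> B)"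
    by (simp add: emeasure_distr emeasure_eq_measure ennreal_mult[symmetric])
qed

text \<open>For fixed points the grains are still independent with law \<open>Q\<close>, so the
  inner integral factors over the marks. This is the marking theorem at the level of finite
  products.\<close>

lemma expectation_prod_marks:
  assumes g[measurable]: "g \<in> borel_measurable (borel \<Otimes>\<^sub>M fell_borel)" and g01: "\<And>z. 0 \<le> g z \<and> g z \<le> (1::real)"
  shows "(\<integral>\<omega>. (\<Prod>j<n. g (u j \<omega>, G j \<omega>)) \<partial>M) = (\<integral>\<omega>. (\<Prod>j<n. \<integral>F. g (u j \<omega>, F) \<partial>Q) \<partial>M)"
proof -
  let ?N1 = "Pi\<^sub>M UNIV (\<lambda>_::nat. borel :: 'a measure)"
  let ?N2 = "Pi\<^sub>M UNIV (\<lambda>_::nat option. fell_borel :: 'a set measure)"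
  have U[measurable]: "(\<lambda>\<omega> j. u j \<omega>) \<in> M \<rightarrow>\<^sub>M ?N1"
    by (intro measurable_PiM_single') auto
  have m: "case_option \<Xi> G i \<in> M \<rightarrow>\<^sub>M fell_borel" for i by (cases i) auto
  have cl: "\<omega> \<in> space M \<Longrightarrow> closed (case_option \<Xi> G i \<omega>)" for i \<omega>
    using measurable_space[OF m] unfolding space_fell_borel by blast
  have GGm[measurable]: "GG \<in> M \<rightarrow>\<^sub>M ?N2"
    using m by (intro measurable_PiM_single') (auto simp: PiE_def space_fell_borel cl)
  define h where "h z = (\<Prod>j<n. g (fst z j, snd z (Some j)))" for z :: "(nat \<Rightarrow> 'a) \<times> (nat option \<Rightarrow> 'a set)"
  have h[measurable]: "h \<in> borel_measurable (?N1 \<Otimes>\<^sub>M ?N2)"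
    unfolding h_def[abs_def] by measurable
  have hb: "norm (h z) \<le> 1" for z
    unfolding h_def using g01 by (auto intro!: prod_le_1 simp: abs_prod)
  interpret D1: prob_space "distr M ?N1 (\<lambda>\<omega> j. u j \<omega>)" by (rule prob_space_distr) simp
  interpret D2: prob_space "distr M ?N2 GG" by (rule prob_space_distr) simp
  interpret DD: pair_prob_space "distr M ?N1 (\<lambda>\<omega> j. u j \<omega>)" "distr M ?N2 GG" ..
  have "(\<integral>\<omega>. (\<Prod>j<n. g (u j \<omega>, G j \<omega>)) \<partial>M) = (\<integral>\<omega>. h (\<lambda>j. u j \<omega>, GG \<omega>) \<partial>M)"
    by (simp add: h_def)
  also have "\<dots> = (\<integral>z. h z \<partial>(distr M ?N1 (\<lambda>\<omega> j. u j \<omega>) \<Otimes>\<^sub>M distr M ?N2 GG))"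
    unfolding points_grains_distr by (subst integral_distr) auto
  also have "\<dots> = (\<integral>x. \<integral>y. h (x, y) \<partial>distr M ?N2 GG \<partial>distr M ?N1 (\<lambda>\<omega> j. u j \<omega>))"
    by (rule DD.integral_fst'[symmetric], rule DD.P.integrable_const_bound[where B=1]) (use hb in auto)
  also have "\<dots> = (\<integral>\<omega>. \<integral>y. h (\<lambda>j. u j \<omega>, y) \<partial>distr M ?N2 GG \<partial>M)"
    by (subst integral_distr) auto
  also have "\<dots> = (\<integral>\<omega>. (\<Prod>j<n. \<integral>F. g (u j \<omega>, F) \<partial>Q) \<partial>M)"
  proof (rule Bochner_Integration.integral_cong[OF refl])
    fix \<omega> assume "\<omega> \<in> space M"
    have [measurable]: "(\<lambda>y. h (\<lambda>j. u j \<omega>, y)) \<in> borel_measurable ?N2"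
      by (rule measurable_compose[OF measurable_Pair1' h]) (simp add: space_PiM)
    have gm[measurable]: "(\<lambda>F. g (u j \<omega>, F)) \<in> borel_measurable fell_borel" for j
      by (rule measurable_compose[OF measurable_Pair1' g]) simp
    \<comment> \<open>The image under \<open>Some\<close> selects the grains of the model; the index
      \<open>None\<close> belongs to the generic grain.\<close>
    have ind: "indep_vars (\<lambda>_. borel) (\<lambda>i \<omega>'. g (u (the i) \<omega>, case_option \<Xi> G i \<omega>')) (Some ` {..<n})"
      by (rule indep_vars_subset[OF indep_vars_compose2[OF indep_G, of "\<lambda>i F. g (u (the i) \<omega>, F)" "\<lambda>_. borel"]]) auto
    have "(\<integral>y. h (\<lambda>j. u j \<omega>, y) \<partial>distr M ?N2 GG) = (\<integral>\<omega>'. (\<Prod>i\<in>Some ` {..<n}. g (u (the i) \<omega>, case_option \<Xi> G i \<omega>')) \<partial>M)"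
      by (subst integral_distr) (auto simp: h_def prod.reindex)
    also have "\<dots> = (\<Prod>i\<in>Some ` {..<n}. \<integral>\<omega>'. g (u (the i) \<omega>, case_option \<Xi> G i \<omega>') \<partial>M)"
      by (rule indep_vars_lebesgue_integral[OF _ ind])
         (use g01 in \<open>auto intro!: integrable_const_bound[where B=1]\<close>)
    also have "\<dots> = (\<Prod>j<n. \<integral>\<omega>'. g (u j \<omega>, G j \<omega>') \<partial>M)"
      by (simp add: prod.reindex)
    also have "\<dots> = (\<Prod>j<n. \<integral>F. g (u j \<omega>, F) \<partial>Q)"
      by (intro prod.cong refl) (subst distr_G[symmetric], subst integral_distr, auto)
    finally show "(\<integral>y. h (\<lambda>j. u j \<omega>, y) \<partial>distr M ?N2 GG) = (\<Prod>j<n. \<integral>F. g (u j \<omega>, F) \<partial>Q)" .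
  qed
  finally show ?thesis .
qed

text \<open>Averaging \<open>g\<close> over the mark leaves a function \<open>h\<close> of the
  position alone with values in [0, 1], to which the Laplace functional of the points applies;
  Fubini identifies the two integrals.\<close>

lemma laplace_functional:
  assumes g[measurable]: "g \<in> borel_measurable (borel \<Otimes>\<^sub>M fell_borel)" and g01: "\<And>z. 0 \<le> g z \<and> g z \<le> (1::real)"
    and int: "integrable Lam (\<lambda>z. 1 - g z)"
  shows "(\<lambda>n. \<integral>\<omega>. (\<Prod>j<n. g (u j \<omega>, G j \<omega>)) \<partial>M) \<longlonglongrightarrow> exp (- (\<integral>z. 1 - g z \<partial>Lam))"
proof -
  interpret pair_sigma_finite lborel Q ..
  define h where "h x = (\<integral>F. g (x, F) \<partial>Q)" for x
  have [measurable]: "h \<in> borel_measurable borel"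
    unfolding h_def by measurable
  have gx[measurable]: "(\<lambda>F. g (x, F)) \<in> borel_measurable Q" for x by measurable
  have ig: "integrable Q (\<lambda>F. g (x, F))" for x
    using g01 by (intro Q.integrable_const_bound[where B=1]) auto
  have h01: "0 \<le> h x \<and> h x \<le> 1" for x
    unfolding h_def using g01 ig
    by (auto intro!: Q.integral_le_const integral_nonneg_AE)
  have eq: "1 - h x = (\<integral>F. 1 - g (x, F) \<partial>Q)" for x
    unfolding h_def using ig by (simp add: Q.prob_space)
  have "integrable lborel (\<lambda>x. \<integral>F. 1 - g (x, F) \<partial>Q)"
    using int unfolding Lam_def by (rule integrable_fst')
  then have ih: "integrable lborel (\<lambda>x. 1 - h x)" by (simp add: eq)
  have "(\<integral>x. 1 - h x \<partial>lborel) = (\<integral>z. 1 - g z \<partial>Lam)"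
    unfolding eq Lam_def using int unfolding Lam_def by (rule integral_fst')
  then show ?thesis
    using laplace_functional_points[OF P _ h01 ih]
    unfolding expectation_prod_marks[OF g g01] h_def[symmetric] by simp
qed

end

section \<open>Counting marked points\<close>

text \<open>The two limits are told apart as long as \<open>v < 1\<close>: an infinite index set
  sends the product to 0. This is how infinite counts of marked points are detected.\<close>

lemma
  fixes v :: real
  shows LIMSEQ_prod_if_finite: "finite S \<Longrightarrow> (\<lambda>n. \<Prod>j<n. if j \<in> S then v else 1) \<longlonglongrightarrow> v ^ card S"
    and LIMSEQ_prod_if_infinite: "infinite S \<Longrightarrow> 0 \<le> v \<Longrightarrow> v < 1 \<Longrightarrow>
      (\<lambda>n. \<Prod>j<n. if j \<in> S then v else 1) \<longlonglongrightarrow> 0"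
proof -
  have eq: "(\<Prod>j<n. if j \<in> S then v else 1) = v ^ card (S \<inter> {..<n})" for n
    by (simp add: prod.If_cases Int_commute)
  show "(\<lambda>n. \<Prod>j<n. if j \<in> S then v else 1) \<longlonglongrightarrow> v ^ card S" if "finite S"
  proof -
    obtain k where k: "S \<subseteq> {..<k}" using \<open>finite S\<close> finite_nat_iff_bounded by auto
    have "S \<inter> {..<n} = S" if "n \<ge> k" for n using k that by auto
    then show ?thesis unfolding eq
      by (intro tendsto_eventually eventually_sequentiallyI[of k]) simp
  qed
  show "(\<lambda>n. \<Prod>j<n. if j \<in> S then v else 1) \<longlonglongrightarrow> 0" if S: "infinite S" and v: "0 \<le> v" "v < 1"
  proof (rule LIMSEQ_I)
    fix r :: real assume "0 < r"
    then obtain k where k: "v ^ k < r" using real_arch_pow_inv[of r v] v by auto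
    obtain T where T: "finite T" "card T = k" "T \<subseteq> S"
      using infinite_arbitrarily_large[OF S] by metis
    obtain m where m: "T \<subseteq> {..<m}" using T(1) finite_nat_iff_bounded by auto
    have "norm (v ^ card (S \<inter> {..<n}) - 0) < r" if "n \<ge> m" for n
    proof -
      have "T \<subseteq> S \<inter> {..<n}" using T(3) m that by auto
      then have "k \<le> card (S \<inter> {..<n})" using card_mono[of "S \<inter> {..<n}" T] T(2) by auto
      then have "v ^ card (S \<inter> {..<n}) \<le> v ^ k" using v by (intro power_decreasing) auto
      then show ?thesis using k v by simp
    qed
    then show "\<exists>m. \<forall>n\<ge>m. norm ((\<Prod>j<n. if j \<in> S then v else 1) - 0) < r" unfolding eq by blast
  qed
qed

context grain_model begin

text \<open>An infinite count is recorded as 0; for sets of finite \<open>Lam\<close> measure this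
  is a null event by \<open>AE_finite_num\<close>.\<close>

definition num :: "('a \<times> 'a set) set \<Rightarrow> 'w \<Rightarrow> nat" where
  "num C \<omega> = card {j. (u j \<omega>, G j \<omega>) \<in> C}"

lemma num_eq_floor:
  "num C \<omega> = nat \<lfloor>enn2real (\<Sum>j. indicator C (u j \<omega>, G j \<omega>))\<rfloor>"
  unfolding num_def suminf_indicator_eq_card by simp

lemma measurable_num[measurable]:
  assumes C[measurable]: "C \<in> sets Lam"
  shows "num C \<in> M \<rightarrow>\<^sub>M count_space UNIV"
proof -
  have [measurable]: "C \<in> sets (borel \<Otimes>\<^sub>M fell_borel)" using C by (simp add: sets_Lam)
  have "(\<lambda>\<omega>. (\<Sum>j. indicator C (u j \<omega>, G j \<omega>)) :: ennreal) \<in> borel_measurable M" by measurable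
  then show ?thesis unfolding num_eq_floor[abs_def] by measurable
qed

text \<open>With \<open>g = v\<close> on \<open>C\<close> and 1 elsewhere the Laplace functional is
  the expectation of \<open>v ^ num C\<close> restricted to finite counts, as the products vanish in
  the limit on infinite ones. Hence the probability of a finite count is at least exp (- (1 - v)
  Lam(C)), and this tends to 1 as \<open>v\<close> increases to 1.\<close>

lemma AE_finite_num:
  assumes C[measurable]: "C \<in> sets Lam" and fin: "emeasure Lam C < \<infinity>"
  shows "AE \<omega> in M. finite {j. (u j \<omega>, G j \<omega>) \<in> C}"
proof -
  have [measurable]: "C \<in> sets (borel \<Otimes>\<^sub>M fell_borel)" using C by (simp add: sets_Lam)
  define F where "F = {\<omega> \<in> space M. (\<Sum>j. indicator C (u j \<omega>, G j \<omega>) :: ennreal) < \<infinity>}"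
  have F[measurable]: "F \<in> events" unfolding F_def by measurable
  have memF: "\<omega> \<in> F \<longleftrightarrow> \<omega> \<in> space M \<and> finite {j. (u j \<omega>, G j \<omega>) \<in> C}" for \<omega>
    unfolding F_def suminf_indicator_eq_card by (auto simp: less_top[symmetric])
  have le: "exp (- ((1 - v) * measure Lam C)) \<le> prob F" if v: "0 < v" "v < 1" for v
  proof -
    define g where "g z = (if z \<in> C then v else 1)" for z
    define L where "L \<omega> = (if \<omega> \<in> F then v ^ num C \<omega> else 0)" for \<omega>
    have g1: "1 - g z = (1 - v) * indicator C z" for z by (auto simp: g_def)
    have "(\<lambda>n. \<integral>\<omega>. (\<Prod>j<n. g (u j \<omega>, G j \<omega>)) \<partial>M) \<longlonglongrightarrow> exp (- (\<integral>z. 1 - g z \<partial>Lam))"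
    proof (rule laplace_functional)
      show "g \<in> borel_measurable (borel \<Otimes>\<^sub>M fell_borel)" unfolding g_def[abs_def] by measurable
      show "0 \<le> g z \<and> g z \<le> 1" for z using v by (simp add: g_def)
      show "integrable Lam (\<lambda>z. 1 - g z)" unfolding g1 using fin by (intro integrable_mult_right integrable_real_indicator) auto
    qed
    moreover have "(\<lambda>n. \<integral>\<omega>. (\<Prod>j<n. g (u j \<omega>, G j \<omega>)) \<partial>M) \<longlonglongrightarrow> (\<integral>\<omega>. L \<omega> \<partial>M)"
    proof (rule integral_dominated_convergence[where w="\<lambda>_. 1"])
      show "L \<in> borel_measurable M" unfolding L_def[abs_def] by measurable
      show "(\<lambda>\<omega>. \<Prod>j<n. g (u j \<omega>, G j \<omega>)) \<in> borel_measurable M" for n unfolding g_def by measurable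
      show "AE \<omega> in M. norm (\<Prod>j<n. g (u j \<omega>, G j \<omega>)) \<le> 1" for n
        using v by (auto intro!: AE_I2 prod_le_1 simp: abs_prod g_def)
      show "AE \<omega> in M. (\<lambda>n. \<Prod>j<n. g (u j \<omega>, G j \<omega>)) \<longlonglongrightarrow> L \<omega>"
      proof (rule AE_I2)
        fix \<omega> assume w: "\<omega> \<in> space M"
        define S where "S = {j. (u j \<omega>, G j \<omega>) \<in> C}"
        have g_eq: "g (u j \<omega>, G j \<omega>) = (if j \<in> S then v else 1)" for j by (simp add: g_def S_def)
        show "(\<lambda>n. \<Prod>j<n. g (u j \<omega>, G j \<omega>)) \<longlonglongrightarrow> L \<omega>"
          unfolding g_eq
          using LIMSEQ_prod_if_finite[of S v] LIMSEQ_prod_if_infinite[of S v] v w memF[of \<omega>]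
          by (auto simp: L_def num_def S_def)
      qed
    qed simp
    ultimately have "exp (- (\<integral>z. 1 - g z \<partial>Lam)) = (\<integral>\<omega>. L \<omega> \<partial>M)" by (rule LIMSEQ_unique)
    also have "\<dots> \<le> (\<integral>\<omega>. indicator F \<omega> \<partial>M)"
    proof (rule integral_mono)
      show "integrable M L"
        by (rule integrable_const_bound[where B=1]) (use v in \<open>auto simp: L_def[abs_def] power_le_one\<close>)
      show "L \<omega> \<le> indicator F \<omega>" for \<omega> using v by (auto simp: L_def power_le_one)
    qed (auto simp: integrable_real_indicator emeasure_eq_measure)
    also have "\<dots> = prob F" by simp
    finally show ?thesis unfolding g1 by simp
  qed
  have "((\<lambda>v. exp (- ((1 - v) * measure Lam C))) \<longlongrightarrow> exp (- ((1 - 1) * measure Lam C))) (at_left 1)"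
    by (intro tendsto_intros)
  moreover have "\<forall>\<^sub>F v in at_left 1. exp (- ((1 - v) * measure Lam C)) \<le> prob F"
    unfolding eventually_at_left_field by (intro exI[of _ 0]) (auto intro: le)
  ultimately have "exp (- ((1 - 1) * measure Lam C)) \<le> prob F"
    by (rule tendsto_upperbound) simp
  then have "1 \<le> prob F" by simp
  then have "prob F = 1" using prob_le_1[of F] by simp
  then have "AE \<omega> in M. \<omega> \<in> F" by (subst (asm) prob_eq_1) auto
  then show ?thesis by eventually_elim (simp add: memF)
qed

text \<open>A marked point contributes the factor \<open>v i\<close> for every set
  \<open>C i\<close> that contains it, so overlapping sets need no decomposition into disjoint
  pieces. Off the union of the sets this factor is 1, which gives integrability.\<close>

lemma expectation_prod_power_num:
  assumes I: "finite I" and C: "\<And>i. i \<in> I \<Longrightarrow> C i \<in> sets Lam"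
    and fin: "\<And>i. i \<in> I \<Longrightarrow> emeasure Lam (C i) < \<infinity>" and v: "\<And>i. i \<in> I \<Longrightarrow> 0 \<le> v i \<and> v i \<le> (1::real)"
  shows "(\<integral>\<omega>. (\<Prod>i\<in>I. v i ^ num (C i) \<omega>) \<partial>M) =
    exp (- (\<integral>z. 1 - (\<Prod>i\<in>I. if z \<in> C i then v i else 1) \<partial>Lam))" (is "?E = _")
    and integrable_prod_if: "integrable Lam (\<lambda>z. 1 - (\<Prod>i\<in>I. if z \<in> C i then v i else 1))"
proof -
  define g where "g z = (\<Prod>i\<in>I. if z \<in> C i then v i else 1)" for z
  have CC[measurable]: "C i \<in> sets (borel \<Otimes>\<^sub>M fell_borel)" if "i \<in> I" for i using C[OF that] by (simp add: sets_Lam)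
  have gm[measurable]: "g \<in> borel_measurable (borel \<Otimes>\<^sub>M fell_borel)"
    unfolding g_def[abs_def] by (intro borel_measurable_prod measurable_If) auto
  have g01: "0 \<le> g z \<and> g z \<le> 1" for z
    unfolding g_def using v by (auto intro!: prod_nonneg prod_le_1)
  have U: "(\<Union>i\<in>I. C i) \<in> sets Lam" using I C by auto
  have "emeasure Lam (\<Union>i\<in>I. C i) \<le> (\<Sum>i\<in>I. emeasure Lam (C i))"
    using I C by (intro emeasure_subadditive_finite) auto
  also have "\<dots> < \<infinity>" using fin I by (auto simp: ennreal_sum_less_top less_top[symmetric])
  finally have finU: "emeasure Lam (\<Union>i\<in>I. C i) < \<infinity>" .
  show int: "integrable Lam (\<lambda>z. 1 - (\<Prod>i\<in>I. if z \<in> C i then v i else 1))"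
    unfolding g_def[symmetric]
  proof (rule Bochner_Integration.integrable_bound)
    show "integrable Lam (indicat_real (\<Union>i\<in>I. C i))" using U finU by (intro integrable_real_indicator) auto
    show "(\<lambda>z. 1 - g z) \<in> borel_measurable Lam" using gm by (simp cong: measurable_cong_sets add: sets_Lam)
    have "g z = 1" if "z \<notin> (\<Union>i\<in>I. C i)" for z
      unfolding g_def using that by (intro prod.neutral) auto
    then show "AE z in Lam. norm (1 - g z) \<le> norm (indicat_real (\<Union>i\<in>I. C i) z)"
      using g01 by (intro AE_I2) (auto simp: indicator_def abs_le_iff)
  qed
  have "(\<lambda>n. \<integral>\<omega>. (\<Prod>j<n. g (u j \<omega>, G j \<omega>)) \<partial>M) \<longlonglongrightarrow> ?E"
  proof (rule integral_dominated_convergence[where w="\<lambda>_. 1"])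
    show "(\<lambda>\<omega>. \<Prod>i\<in>I. v i ^ num (C i) \<omega>) \<in> borel_measurable M"
    proof (rule borel_measurable_prod)
      fix i assume "i \<in> I"
      from measurable_num[OF C[OF this]]
      show "(\<lambda>\<omega>. v i ^ num (C i) \<omega>) \<in> borel_measurable M" by measurable
    qed
    show "AE \<omega> in M. norm (\<Prod>j<n. g (u j \<omega>, G j \<omega>)) \<le> 1" for n
      using g01 by (auto intro!: AE_I2 prod_le_1 simp: abs_prod)
    have "AE \<omega> in M. \<forall>i\<in>I. finite {j. (u j \<omega>, G j \<omega>) \<in> C i}"
      using I C fin by (intro AE_finite_allI AE_finite_num) auto
    then show "AE \<omega> in M. (\<lambda>n. \<Prod>j<n. g (u j \<omega>, G j \<omega>)) \<longlonglongrightarrow> (\<Prod>i\<in>I. v i ^ num (C i) \<omega>)"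
    proof eventually_elim
      case (elim \<omega>)
      have "(\<Prod>j<n. g (u j \<omega>, G j \<omega>)) = (\<Prod>i\<in>I. \<Prod>j<n. if j \<in> {j. (u j \<omega>, G j \<omega>) \<in> C i} then v i else 1)" for n
        unfolding g_def by (subst prod.swap) simp
      then show ?case unfolding num_def using elim
        by (simp only:) (intro tendsto_prod LIMSEQ_prod_if_finite, blast)
    qed
  qed auto
  then show "?E = exp (- (\<integral>z. 1 - (\<Prod>i\<in>I. if z \<in> C i then v i else 1) \<partial>Lam))"
    using laplace_functional[OF gm g01] int unfolding g_def[symmetric] by (blast intro: LIMSEQ_unique)
qed

text \<open>Complete independence as a factorisation of moments, so that no \<open>\<sigma>\<close>-algebras are needed.\<close>

lemma expectation_prod_power_num_disjoint:
  assumes I: "finite I" "finite J" and C: "\<And>i. i \<in> I \<union> J \<Longrightarrow> C i \<in> sets Lam"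
    and fin: "\<And>i. i \<in> I \<union> J \<Longrightarrow> emeasure Lam (C i) < \<infinity>" and v: "\<And>i. i \<in> I \<union> J \<Longrightarrow> 0 \<le> v i \<and> v i \<le> (1::real)"
    and disj: "I \<inter> J = {}" "\<And>i j. i \<in> I \<Longrightarrow> j \<in> J \<Longrightarrow> C i \<inter> C j = {}"
  shows "(\<integral>\<omega>. (\<Prod>i\<in>I. v i ^ num (C i) \<omega>) * (\<Prod>i\<in>J. v i ^ num (C i) \<omega>) \<partial>M) =
    (\<integral>\<omega>. (\<Prod>i\<in>I. v i ^ num (C i) \<omega>) \<partial>M) * (\<integral>\<omega>. (\<Prod>i\<in>J. v i ^ num (C i) \<omega>) \<partial>M)"
proof -
  let ?g = "\<lambda>I z. \<Prod>i\<in>I. if z \<in> C i then v i else 1"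
  have split: "(\<lambda>z. 1 - ?g (I \<union> J) z) = (\<lambda>z. (1 - ?g I z) + (1 - ?g J z))"
  proof
    fix z
    \<comment> \<open>A marked point meets sets of at most one family, so one of the two products is
      1, and then 1 - x y = (1 - x) + (1 - y).\<close>
    have "?g I z = 1 \<or> ?g J z = 1"
    proof (cases "\<exists>i\<in>I. z \<in> C i")
      case True
      then have "\<And>j. j \<in> J \<Longrightarrow> z \<notin> C j" using disj(2) by blast
      then show ?thesis by (intro disjI2 prod.neutral) auto
    qed (auto intro!: disjI1 prod.neutral)
    moreover have "?g (I \<union> J) z = ?g I z * ?g J z"
      using I disj(1) by (rule prod.union_disjoint)
    ultimately show "1 - ?g (I \<union> J) z = (1 - ?g I z) + (1 - ?g J z)" by auto
  qed
  have "integrable Lam (\<lambda>z. 1 - ?g I z)" "integrable Lam (\<lambda>z. 1 - ?g J z)"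
    using I C fin v by (auto intro!: integrable_prod_if)
  then have eq: "(\<integral>z. 1 - ?g (I \<union> J) z \<partial>Lam) = (\<integral>z. 1 - ?g I z \<partial>Lam) + (\<integral>z. 1 - ?g J z \<partial>Lam)"
    unfolding split by (rule Bochner_Integration.integral_add)
  have "(\<integral>\<omega>. (\<Prod>i\<in>I. v i ^ num (C i) \<omega>) * (\<Prod>i\<in>J. v i ^ num (C i) \<omega>) \<partial>M) =
    (\<integral>\<omega>. (\<Prod>i\<in>I \<union> J. v i ^ num (C i) \<omega>) \<partial>M)"
    using I disj(1) by (simp add: prod.union_disjoint)
  also have "\<dots> = exp (- (\<integral>z. 1 - ?g (I \<union> J) z \<partial>Lam))"
    using I C fin v by (intro expectation_prod_power_num) auto
  also have "\<dots> = exp (- (\<integral>z. 1 - ?g I z \<partial>Lam)) * exp (- (\<integral>z. 1 - ?g J z \<partial>Lam))"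
    unfolding eq by (simp add: exp_add[symmetric])
  also have "\<dots> = (\<integral>\<omega>. (\<Prod>i\<in>I. v i ^ num (C i) \<omega>) \<partial>M) * (\<integral>\<omega>. (\<Prod>i\<in>J. v i ^ num (C i) \<omega>) \<partial>M)"
    using I C fin v by (subst (1 2) expectation_prod_power_num) auto
  finally show ?thesis .
qed

end

section \<open>Covariances of functions of two counts\<close>

lemma polynomial_approx_unit_interval:
  fixes h :: "real \<Rightarrow> real"
  assumes "continuous_on {0..1} h" "0 < e"
  obtains a d where "\<And>y. 0 \<le> y \<Longrightarrow> y \<le> 1 \<Longrightarrow> \<bar>h y - (\<Sum>k\<le>d::nat. a k * y ^ k)\<bar> < e"
proof -
  obtain g where g: "real_polynomial_function g" "\<And>x. x \<in> {0..1} \<Longrightarrow> \<bar>h x - g x\<bar> < e"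
    using Stone_Weierstrass_real_polynomial_function[OF _ assms] by auto
  obtain a d where "g = (\<lambda>x. \<Sum>k\<le>d. a k * x ^ k)"
    using g(1) unfolding real_polynomial_function_iff_sum by blast
  then show ?thesis using g(2) by (intro that[of a d]) auto
qed

text \<open>The point (1/2)^i has distance at least (1/2)^(i+1) from every other power of 1/2,
  attained at the next power. A hat of slope 2^(i+1) therefore isolates it, and the indicator of one
  value of a count becomes a continuous function of (1/2)^n.\<close>

lemma half_pow_hat:
  fixes i n :: nat
  shows "max 0 (1 - 2 ^ Suc i * \<bar>(1/2) ^ n - (1/2) ^ i\<bar>) = (if n = i then 1 else 0 :: real)"
proof -
  consider "n = i" | "n < i" | "i < n" by linarith
  then show ?thesis
  proof cases
    case 2
    then have "(1/2::real) ^ n \<ge> (1/2) ^ (i - 1)" by (intro power_decreasing) auto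
    also have "(1/2::real) ^ (i - 1) = 2 * (1/2) ^ i" using 2 by (cases i) auto
    finally have "\<bar>(1/2::real) ^ n - (1/2) ^ i\<bar> \<ge> (1/2) ^ i" by simp
    then have "2 ^ Suc i * \<bar>(1/2::real) ^ n - (1/2) ^ i\<bar> \<ge> 2 ^ Suc i * (1/2) ^ i" by simp
    then show ?thesis using 2 by (simp add: power_one_over max_def)
  next
    case 3
    then have "(1/2::real) ^ n \<le> (1/2) ^ Suc i" by (intro power_decreasing) auto
    then have "\<bar>(1/2::real) ^ n - (1/2) ^ i\<bar> \<ge> (1/2) ^ Suc i" unfolding power_Suc by linarith
    then have "2 ^ Suc i * \<bar>(1/2::real) ^ n - (1/2) ^ i\<bar> \<ge> 2 ^ Suc i * (1/2) ^ Suc i"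
      by (intro mult_left_mono) auto
    then show ?thesis using 3 by (simp add: power_one_over max_def del: power_Suc)
  qed simp
qed

lemma integral_pgf_polynomial:
  fixes X Y :: "'b \<Rightarrow> nat"
  assumes "prob_space M" and [measurable]: "X \<in> M \<rightarrow>\<^sub>M count_space UNIV" "Y \<in> M \<rightarrow>\<^sub>M count_space UNIV"
  shows "(\<integral>\<omega>. (\<Sum>k\<le>d. a k * ((1/2) ^ X \<omega>) ^ k) * (\<Sum>l\<le>e. b l * ((1/2) ^ Y \<omega>) ^ l) \<partial>M) =
    (\<Sum>k\<le>d::nat. \<Sum>l\<le>e::nat. a k * b l * (\<integral>\<omega>. ((1/2) ^ k) ^ X \<omega> * ((1/2::real) ^ l) ^ Y \<omega> \<partial>M))"
proof -
  interpret prob_space M by fact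
  have int: "integrable M (\<lambda>\<omega>. ((1/2) ^ k) ^ X \<omega> * ((1/2::real) ^ l) ^ Y \<omega>)" for k l
    by (rule integrable_const_bound[where B=1]) (auto intro!: AE_I2 mult_le_one power_le_one)
  have "(\<Sum>k\<le>d. a k * ((1/2) ^ X \<omega>) ^ k) * (\<Sum>l\<le>e. b l * ((1/2) ^ Y \<omega>) ^ l) =
     (\<Sum>k\<le>d. \<Sum>l\<le>e. a k * b l * (((1/2) ^ k) ^ X \<omega> * ((1/2::real) ^ l) ^ Y \<omega>))" for \<omega>
    by (simp add: sum_product power_mult[symmetric] mult.commute[of _ "X \<omega>"] mult.commute[of _ "Y \<omega>"] mult.assoc mult.left_commute)
  then show ?thesis using int by simp
qed

lemma measurable_Pair_count_space:
  fixes X Y :: "'b \<Rightarrow> nat"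
  assumes "X \<in> M \<rightarrow>\<^sub>M count_space UNIV" "Y \<in> M \<rightarrow>\<^sub>M count_space UNIV"
  shows "(\<lambda>\<omega>. (X \<omega>, Y \<omega>)) \<in> M \<rightarrow>\<^sub>M count_space UNIV"
  using measurable_Pair[OF assms]
  by (simp add: pair_measure_countable)

text \<open>Products of hats in (1/2)^X and (1/2)^Y have the point probabilities as expectations.
  The hats are uniform limits of polynomials, and polynomial expectations are combinations of the
  given generating functions.\<close>

lemma distr_eqI_pgf:
  fixes X Y :: "'b \<Rightarrow> nat" and X' Y' :: "'c \<Rightarrow> nat"
  assumes M: "prob_space M" and [measurable]: "X \<in> M \<rightarrow>\<^sub>M count_space UNIV" "Y \<in> M \<rightarrow>\<^sub>M count_space UNIV"
    and N: "prob_space N" and [measurable]: "X' \<in> N \<rightarrow>\<^sub>M count_space UNIV" "Y' \<in> N \<rightarrow>\<^sub>M count_space UNIV"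
    and pgf: "\<And>k l. (\<integral>\<omega>. ((1/2) ^ k) ^ X \<omega> * ((1/2::real) ^ l) ^ Y \<omega> \<partial>M) =
      (\<integral>\<omega>. ((1/2) ^ k) ^ X' \<omega> * ((1/2::real) ^ l) ^ Y' \<omega> \<partial>N)"
  shows "distr M (count_space UNIV) (\<lambda>\<omega>. (X \<omega>, Y \<omega>)) = distr N (count_space UNIV) (\<lambda>\<omega>. (X' \<omega>, Y' \<omega>))"
proof -
  interpret M: prob_space M by fact
  interpret N: prob_space N by fact
  note [measurable] = measurable_Pair_count_space
  define hat where "hat i y = max 0 (1 - 2 ^ Suc i * \<bar>y - (1/2) ^ i\<bar>)" for i :: nat and y :: real
  have hat: "hat i ((1/2) ^ n) = (if n = i then 1 else 0)" for i n
    unfolding hat_def by (rule half_pow_hat)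
  have "\<exists>a d. \<forall>y. 0 \<le> y \<longrightarrow> y \<le> 1 \<longrightarrow> \<bar>hat i y - (\<Sum>k\<le>d::nat. a k * y ^ k)\<bar> < 1 / Suc n" for i n
  proof -
    have "continuous_on {0..1} (hat i)" unfolding hat_def by (intro continuous_intros)
    then show ?thesis by (rule polynomial_approx_unit_interval[where e="1 / Suc n"]) auto
  qed
  then obtain a d where ad: "\<And>i n y. 0 \<le> y \<Longrightarrow> y \<le> 1 \<Longrightarrow> \<bar>hat i y - (\<Sum>k\<le>d i n. a i n k * y ^ k)\<bar> < 1 / Suc n"
    by metis
  define p where "p i n y = (\<Sum>k\<le>d i n. a i n k * y ^ k)" for i n and y :: real

  have p_lim: "(\<lambda>n. p i n y) \<longlonglongrightarrow> hat i y" if "0 \<le> y" "y \<le> 1" for i y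
  proof (rule LIM_zero_cancel, rule Lim_null_comparison)
    show "(\<lambda>n. 1 / real (Suc n)) \<longlonglongrightarrow> 0" by (rule LIMSEQ_Suc[OF lim_1_over_n])
    show "\<forall>\<^sub>F n in sequentially. norm (p i n y - hat i y) \<le> 1 / real (Suc n)"
      using ad[OF that, of i] by (auto simp: p_def abs_minus_commute intro!: always_eventually less_imp_le)
  qed
  have hat01: "0 \<le> hat i y \<and> hat i y \<le> 1" for i y by (auto simp: hat_def)
  have p_le: "\<bar>p i n y\<bar> \<le> 2" if "0 \<le> y" "y \<le> 1" for i n y
  proof -
    have "1 / real (Suc n) \<le> 1" by simp
    then show ?thesis using ad[OF that, of i n] hat01[of i y] unfolding p_def by linarith
  qed
  have pm[measurable]: "p i n \<in> borel_measurable borel" for i n unfolding p_def by measurable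
  have lim: "(\<lambda>n. \<integral>\<omega>. p i n ((1/2) ^ Z \<omega>) * p j n ((1/2) ^ Z' \<omega>) \<partial>K) \<longlonglongrightarrow> measure K {\<omega> \<in> space K. Z \<omega> = i \<and> Z' \<omega> = j}"
    if K: "prob_space K" and [measurable]: "Z \<in> K \<rightarrow>\<^sub>M count_space UNIV" "Z' \<in> K \<rightarrow>\<^sub>M count_space UNIV"
    for K and Z Z' :: "'d \<Rightarrow> nat" and i j
  proof -
    interpret K: prob_space K by fact
    have "(\<lambda>n. \<integral>\<omega>. p i n ((1/2) ^ Z \<omega>) * p j n ((1/2) ^ Z' \<omega>) \<partial>K) \<longlonglongrightarrow> (\<integral>\<omega>. hat i ((1/2) ^ Z \<omega>) * hat j ((1/2) ^ Z' \<omega>) \<partial>K)"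
    proof (rule integral_dominated_convergence[where w="\<lambda>_. 4"])
      show "AE \<omega> in K. (\<lambda>n. p i n ((1/2) ^ Z \<omega>) * p j n ((1/2) ^ Z' \<omega>)) \<longlonglongrightarrow> hat i ((1/2) ^ Z \<omega>) * hat j ((1/2) ^ Z' \<omega>)"
        by (intro AE_I2 tendsto_mult p_lim) (auto simp: power_le_one)
      show "AE \<omega> in K. norm (p i n ((1/2) ^ Z \<omega>) * p j n ((1/2) ^ Z' \<omega>)) \<le> 4" for n
      proof (rule AE_I2)
        fix \<omega>
        have "\<bar>p i n ((1/2) ^ Z \<omega>)\<bar> * \<bar>p j n ((1/2) ^ Z' \<omega>)\<bar> \<le> 2 * 2"
          by (intro mult_mono p_le) (auto simp: power_le_one)
        then show "norm (p i n ((1/2) ^ Z \<omega>) * p j n ((1/2) ^ Z' \<omega>)) \<le> 4" by (simp add: abs_mult)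
      qed
    qed (auto simp: hat)
    also have "(\<integral>\<omega>. hat i ((1/2) ^ Z \<omega>) * hat j ((1/2) ^ Z' \<omega>) \<partial>K) = (\<integral>\<omega>. indicator {\<omega> \<in> space K. Z \<omega> = i \<and> Z' \<omega> = j} \<omega> \<partial>K)"
      by (intro Bochner_Integration.integral_cong refl) (auto simp: hat indicator_def)
    also have "\<dots> = measure K {\<omega> \<in> space K. Z \<omega> = i \<and> Z' \<omega> = j}"
      by (auto intro!: arg_cong[where f="measure K"])
    finally show ?thesis .
  qed
  have eq: "measure M {\<omega> \<in> space M. X \<omega> = i \<and> Y \<omega> = j} = measure N {\<omega> \<in> space N. X' \<omega> = i \<and> Y' \<omega> = j}" for i j
  proof (rule LIMSEQ_unique[OF lim[OF M]])
    have "(\<integral>\<omega>. p i n ((1/2) ^ X \<omega>) * p j n ((1/2) ^ Y \<omega>) \<partial>M) = (\<integral>\<omega>. p i n ((1/2) ^ X' \<omega>) * p j n ((1/2) ^ Y' \<omega>) \<partial>N)" for n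
      unfolding p_def by (subst (1 2) integral_pgf_polynomial) (auto simp: M N pgf)
    then show "(\<lambda>n. \<integral>\<omega>. p i n ((1/2) ^ X \<omega>) * p j n ((1/2) ^ Y \<omega>) \<partial>M) \<longlonglongrightarrow> measure N {\<omega> \<in> space N. X' \<omega> = i \<and> Y' \<omega> = j}"
      using lim[OF N, of X' Y' i j] by simp
  qed auto
  show ?thesis
  proof (rule measure_eqI_countable[where A=UNIV])
    fix z :: "nat \<times> nat"
    obtain i j where z: "z = (i, j)" by fastforce
    have "(\<lambda>\<omega>. (X \<omega>, Y \<omega>)) -` {z} \<inter> space M = {\<omega> \<in> space M. X \<omega> = i \<and> Y \<omega> = j}"
      "(\<lambda>\<omega>. (X' \<omega>, Y' \<omega>)) -` {z} \<inter> space N = {\<omega> \<in> space N. X' \<omega> = i \<and> Y' \<omega> = j}" using z by auto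
    then show "emeasure (distr M (count_space UNIV) (\<lambda>\<omega>. (X \<omega>, Y \<omega>))) {z} = emeasure (distr N (count_space UNIV) (\<lambda>\<omega>. (X' \<omega>, Y' \<omega>))) {z}"
      by (subst (1 2) emeasure_distr) (auto simp: M.emeasure_eq_measure N.emeasure_eq_measure eq intro!: measurable_Pair_count_space)
  qed auto
qed

lemma
  fixes X Y :: "'b \<Rightarrow> nat" and X' Y' :: "'c \<Rightarrow> nat" and f g :: "nat \<Rightarrow> real"
  assumes M: "prob_space M" and X[measurable]: "X \<in> M \<rightarrow>\<^sub>M count_space UNIV" "Y \<in> M \<rightarrow>\<^sub>M count_space UNIV"
    and N: "prob_space N" and X'[measurable]: "X' \<in> N \<rightarrow>\<^sub>M count_space UNIV" "Y' \<in> N \<rightarrow>\<^sub>M count_space UNIV"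
    and pgf: "\<And>k l. (\<integral>\<omega>. ((1/2) ^ k) ^ X \<omega> * ((1/2::real) ^ l) ^ Y \<omega> \<partial>M) =
      (\<integral>\<omega>. ((1/2) ^ k) ^ X' \<omega> * ((1/2::real) ^ l) ^ Y' \<omega> \<partial>N)"
  shows integral_eqI_pgf: "(\<integral>\<omega>. f (X \<omega>) * g (Y \<omega>) \<partial>M) = (\<integral>\<omega>. f (X' \<omega>) * g (Y' \<omega>) \<partial>N)"
    and integrable_iff_pgf: "integrable M (\<lambda>\<omega>. f (X \<omega>) * g (Y \<omega>)) \<longleftrightarrow> integrable N (\<lambda>\<omega>. f (X' \<omega>) * g (Y' \<omega>))"
proof -
  note d = distr_eqI_pgf[OF M X N X' pgf]
  have "(\<integral>\<omega>. f (X \<omega>) * g (Y \<omega>) \<partial>M) = (\<integral>z. f (fst z) * g (snd z) \<partial>distr M (count_space UNIV) (\<lambda>\<omega>. (X \<omega>, Y \<omega>)))"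
    by (subst integral_distr) (auto intro!: measurable_Pair_count_space)
  also have "\<dots> = (\<integral>\<omega>. f (X' \<omega>) * g (Y' \<omega>) \<partial>N)"
    unfolding d by (subst integral_distr) (auto intro!: measurable_Pair_count_space)
  finally show "(\<integral>\<omega>. f (X \<omega>) * g (Y \<omega>) \<partial>M) = (\<integral>\<omega>. f (X' \<omega>) * g (Y' \<omega>) \<partial>N)" .
  have "integrable M (\<lambda>\<omega>. f (X \<omega>) * g (Y \<omega>)) \<longleftrightarrow> integrable (distr M (count_space UNIV) (\<lambda>\<omega>. (X \<omega>, Y \<omega>))) (\<lambda>z. f (fst z) * g (snd z))"
    by (subst integrable_distr_eq) (auto intro!: measurable_Pair_count_space)
  also have "\<dots> \<longleftrightarrow> integrable N (\<lambda>\<omega>. f (X' \<omega>) * g (Y' \<omega>))"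
    unfolding d by (subst integrable_distr_eq) (auto intro!: measurable_Pair_count_space)
  finally show "integrable M (\<lambda>\<omega>. f (X \<omega>) * g (Y \<omega>)) \<longleftrightarrow> integrable N (\<lambda>\<omega>. f (X' \<omega>) * g (Y' \<omega>))" .
qed

section \<open>An explicit Poisson representation of two counts\<close>

text \<open>The Poisson law with the degenerate rate 0 included.\<close>

definition pois :: "real \<Rightarrow> nat pmf" where
  "pois b = (if b = 0 then return_pmf 0 else poisson_pmf b)"

lemma pmf_pois: "0 \<le> b \<Longrightarrow> pmf (pois b) n = exp (- b) * b ^ n / fact n"
  by (cases "b = 0") (auto simp: pois_def mult.commute power_0_left indicator_def)

lemma has_bochner_integral_pois:
  assumes b: "0 \<le> b" and h: "\<And>n. 0 \<le> h n" and s: "(\<lambda>n. exp (- b) * b ^ n / fact n * h n) sums s"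
  shows "has_bochner_integral (pois b) h s"
proof (rule has_bochner_integral_nn_integral)
  have "(\<integral>\<^sup>+n. ennreal (h n) \<partial>pois b) = (\<Sum>n. ennreal (exp (- b) * b ^ n / fact n * h n))"
    unfolding nn_integral_measure_pmf nn_integral_count_space_nat pmf_pois[OF b]
    using b h by (intro suminf_cong ennreal_mult[symmetric]) auto
  also have "\<dots> = ennreal s"
    using s b h by (intro suminf_ennreal_eq) auto
  finally show "(\<integral>\<^sup>+n. ennreal (h n) \<partial>pois b) = ennreal s" .
  show "0 \<le> s" using s b h by (intro sums_le[OF _ sums_zero s]) auto
qed (use h in auto)

lemma exp_series_sums: "(\<lambda>n. exp (- b) * (c::real) ^ n / fact n) sums exp (c - b)"
proof -
  have "(\<lambda>n. exp (- b) * (c ^ n /\<^sub>R fact n)) sums (exp (- b) * exp c)"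
    by (intro sums_mult exp_converges)
  then show ?thesis by (simp add: exp_add[symmetric] divide_inverse mult_ac)
qed

lemma has_bochner_integral_pois_power:
  assumes "0 \<le> b" "0 \<le> v"
  shows "has_bochner_integral (pois b) (\<lambda>n. v ^ n) (exp (- ((1 - v) * b)))"
proof (rule has_bochner_integral_pois)
  show "(\<lambda>n. exp (- b) * b ^ n / fact n * v ^ n) sums exp (- ((1 - v) * b))"
    using exp_series_sums[of b "b * v"] by (simp add: power_mult_distrib algebra_simps)
qed (use assms in auto)

lemma
  assumes b: "0 \<le> b"
  shows has_bochner_integral_pois_id: "has_bochner_integral (pois b) (\<lambda>n. real n) b"
    and has_bochner_integral_pois_square: "has_bochner_integral (pois b) (\<lambda>n. (real n)\<^sup>2) (b\<^sup>2 + b)"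
proof -
  have 0: "(\<lambda>n. exp (- b) * b ^ n / fact n) sums 1"
    using exp_series_sums[of b b] by simp
  \<comment> \<open>The term at 0 vanishes; after the index shift the factor \<open>n\<close>
    cancels against the factorial and leaves a factor \<open>b\<close>.\<close>
  have "(\<lambda>n. exp (- b) * b ^ Suc n / fact (Suc n) * real (Suc n)) sums b"
  proof -
    have "exp (- b) * b ^ Suc n / fact (Suc n) * real (Suc n) = b * (exp (- b) * b ^ n / fact n)" for n
      by (simp add: fact_Suc del: of_nat_Suc)
    then show ?thesis using sums_mult[OF 0, of b] by (simp only: mult_1_right)
  qed
  from sums_Suc[OF this] have 1: "(\<lambda>n. exp (- b) * b ^ n / fact n * real n) sums b" by simp
  have "(\<lambda>n. exp (- b) * b ^ Suc n / fact (Suc n) * (real (Suc n))\<^sup>2) sums (b * (b + 1))"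
  proof -
    have "exp (- b) * b ^ Suc n / fact (Suc n) * (real (Suc n))\<^sup>2 =
      b * (exp (- b) * b ^ n / fact n * real n + exp (- b) * b ^ n / fact n)" for n
      by (simp add: fact_Suc power2_eq_square del: of_nat_Suc) (simp add: field_simps)
    then show ?thesis using sums_mult[OF sums_add[OF 1 0], of b] by simp
  qed
  from sums_Suc[OF this] have 2: "(\<lambda>n. exp (- b) * b ^ n / fact n * (real n)\<^sup>2) sums (b\<^sup>2 + b)"
    by (simp add: algebra_simps power2_eq_square)
  show "has_bochner_integral (pois b) (\<lambda>n. real n) b"
    by (rule has_bochner_integral_pois[OF b _ 1]) simp
  show "has_bochner_integral (pois b) (\<lambda>n. (real n)\<^sup>2) (b\<^sup>2 + b)"
    by (rule has_bochner_integral_pois[OF b _ 2]) simp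
qed

lemma (in pair_sigma_finite)
  fixes f g :: "_ \<Rightarrow> real"
  assumes f: "integrable M1 f" and g: "integrable M2 g"
  shows integrable_mult_pair: "integrable (M1 \<Otimes>\<^sub>M M2) (\<lambda>p. f (fst p) * g (snd p))"
    and integral_mult_pair: "(\<integral>p. f (fst p) * g (snd p) \<partial>(M1 \<Otimes>\<^sub>M M2)) = (\<integral>x. f x \<partial>M1) * (\<integral>y. g y \<partial>M2)"
proof -
  note [measurable] = borel_measurable_integrable[OF f] borel_measurable_integrable[OF g]
  show *: "integrable (M1 \<Otimes>\<^sub>M M2) (\<lambda>p. f (fst p) * g (snd p))"
  proof (rule Fubini_integrable)
    show "integrable M1 (\<lambda>x. \<integral>y. norm (f (fst (x, y)) * g (snd (x, y))) \<partial>M2)"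
      using f g by (simp add: abs_mult)
  qed (use g in auto)
  show "(\<integral>p. f (fst p) * g (snd p) \<partial>(M1 \<Otimes>\<^sub>M M2)) = (\<integral>x. f x \<partial>M1) * (\<integral>y. g y \<partial>M2)"
    using integral_fst'[OF *] by simp
qed

text \<open>\<open>((A, A'), B, B')\<close>: the counts of points in \<open>C - C'\<close>, \<open>C' - C\<close>, \<open>C \<inter> C'\<close>, and an independent
  copy of the last one.\<close>

definition pois4 :: "real \<Rightarrow> real \<Rightarrow> real \<Rightarrow> ((nat \<times> nat) \<times> nat \<times> nat) pmf" where
  "pois4 a a' b = pair_pmf (pair_pmf (pois a) (pois a')) (pair_pmf (pois b) (pois b))"

lemma expectation_pois4_power:
  assumes r: "0 \<le> a" "0 \<le> a'" "0 \<le> b" and v: "0 \<le> v1" "0 \<le> v2" "0 \<le> v3" "0 \<le> v4"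
  shows "(\<integral>z. v1 ^ fst (fst z) * v2 ^ snd (fst z) * (v3 ^ fst (snd z) * v4 ^ snd (snd z)) \<partial>pois4 a a' b) =
    exp (- ((1 - v1) * a + (1 - v2) * a' + (1 - v3) * b + (1 - v4) * b))"
proof (rule integral_eq_nn_integral[THEN trans])
  have 1: "(\<integral>\<^sup>+n. ennreal (v ^ n) \<partial>pois c) = ennreal (exp (- ((1 - v) * c)))" if "0 \<le> c" "0 \<le> v" for c v
    using has_bochner_integral_pois_power[OF that] that
    by (subst nn_integral_eq_integral) (auto simp: has_bochner_integral_iff)
  have "(\<integral>\<^sup>+z. ennreal (v1 ^ fst (fst z) * v2 ^ snd (fst z) * (v3 ^ fst (snd z) * v4 ^ snd (snd z))) \<partial>pois4 a a' b)
    = ennreal (exp (- ((1 - v1) * a))) * ennreal (exp (- ((1 - v2) * a'))) * (ennreal (exp (- ((1 - v3) * b))) * ennreal (exp (- ((1 - v4) * b))))"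
    unfolding pois4_def using v r
    by (simp add: nn_integral_pair_pmf' ennreal_mult nn_integral_cmult nn_integral_multc 1)
  also have "\<dots> = ennreal (exp (- ((1 - v1) * a + (1 - v2) * a' + (1 - v3) * b + (1 - v4) * b)))"
    by (simp add: ennreal_mult[symmetric] exp_add[symmetric] algebra_simps)
  finally show "enn2real (\<integral>\<^sup>+z. ennreal (v1 ^ fst (fst z) * v2 ^ snd (fst z) * (v3 ^ fst (snd z) * v4 ^ snd (snd z))) \<partial>pois4 a a' b) =
    exp (- ((1 - v1) * a + (1 - v2) * a' + (1 - v3) * b + (1 - v4) * b))" by simp
qed (use v in auto)

lemma
  assumes r: "0 \<le> a" "0 \<le> a'" "0 \<le> b"
  shows integrable_pois4_squares: "integrable (pois4 a a' b) (\<lambda>z. (real (fst (fst z)))\<^sup>2)"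
      "integrable (pois4 a a' b) (\<lambda>z. (real (snd (fst z)))\<^sup>2)"
      "integrable (pois4 a a' b) (\<lambda>z. (real (fst (snd z)))\<^sup>2)"
      "integrable (pois4 a a' b) (\<lambda>z. (real (snd (snd z)))\<^sup>2)"
    and has_bochner_integral_pois4_diff:
      "has_bochner_integral (pois4 a a' b) (\<lambda>z. (real (fst (snd z)) - real (snd (snd z)))\<^sup>2) (2 * b)"
proof -
  let ?T = "pois4 a a' b"
  have m: "map_pmf (\<lambda>z. fst (fst z)) ?T = pois a" "map_pmf (\<lambda>z. snd (fst z)) ?T = pois a'"
    "map_pmf (\<lambda>z. fst (snd z)) ?T = pois b" "map_pmf (\<lambda>z. snd (snd z)) ?T = pois b"
    unfolding pois4_def
    by (simp_all add: map_pmf_comp[symmetric, of fst fst] map_pmf_comp[symmetric, of snd fst]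
        map_pmf_comp[symmetric, of fst snd] map_pmf_comp[symmetric, of snd snd] map_fst_pair_pmf map_snd_pair_pmf)
  have int: "integrable (pois c) (\<lambda>n. (real n)\<^sup>2)" if "0 \<le> c" for c
    using has_bochner_integral_pois_square[OF that] by (rule integrable.intros)
  show sq: "integrable ?T (\<lambda>z. (real (fst (fst z)))\<^sup>2)" "integrable ?T (\<lambda>z. (real (snd (fst z)))\<^sup>2)"
    "integrable ?T (\<lambda>z. (real (fst (snd z)))\<^sup>2)" "integrable ?T (\<lambda>z. (real (snd (snd z)))\<^sup>2)"
    using int[OF r(1), folded m(1)] int[OF r(2), folded m(2)] int[OF r(3), folded m(3)] int[OF r(3), folded m(4)]
    by (simp_all add: integrable_map_pmf_eq)
  have E: "(\<integral>z. (real (fst (snd z)))\<^sup>2 \<partial>?T) = b\<^sup>2 + b" "(\<integral>z. (real (snd (snd z)))\<^sup>2 \<partial>?T) = b\<^sup>2 + b"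
    using has_bochner_integral_integral_eq[OF has_bochner_integral_pois_square[OF r(3)]]
      integral_map_pmf[of "\<lambda>z. fst (snd z)" ?T "\<lambda>n. (real n)\<^sup>2"]
      integral_map_pmf[of "\<lambda>z. snd (snd z)" ?T "\<lambda>n. (real n)\<^sup>2"]
    unfolding m by simp_all
  have BB: "has_bochner_integral ?T (\<lambda>z. real (fst (snd z)) * real (snd (snd z))) (b * b)"
  proof (rule has_bochner_integral_nn_integral)
    have 1: "(\<integral>\<^sup>+n. ennreal (real n) \<partial>pois b) = ennreal b"
      using has_bochner_integral_pois_id[OF r(3)]
      by (subst nn_integral_eq_integral) (auto simp: has_bochner_integral_iff)
    show "(\<integral>\<^sup>+z. ennreal (real (fst (snd z)) * real (snd (snd z))) \<partial>?T) = ennreal (b * b)"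
      unfolding pois4_def using r
      by (simp add: nn_integral_pair_pmf' ennreal_mult nn_integral_cmult nn_integral_multc 1 del: ennreal_of_nat_eq_real_of_nat)
  qed (use r in auto)
  have "has_bochner_integral ?T (\<lambda>z. (real (fst (snd z)))\<^sup>2 + (real (snd (snd z)))\<^sup>2 - 2 * (real (fst (snd z)) * real (snd (snd z))))
     ((b\<^sup>2 + b) + (b\<^sup>2 + b) - 2 * (b * b))"
    using sq(3,4) E BB by (intro has_bochner_integral_diff has_bochner_integral_add has_bochner_integral_mult_right)
       (simp_all add: has_bochner_integral_iff)
  then show "has_bochner_integral ?T (\<lambda>z. (real (fst (snd z)) - real (snd (snd z)))\<^sup>2) (2 * b)"
    by (simp add: power2_eq_square algebra_simps)
qed

section \<open>Lipschitz functions of counts and the covariance inequality\<close>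

definition lip :: "real \<Rightarrow> (nat \<Rightarrow> real) \<Rightarrow> bool" where
  "lip L f \<longleftrightarrow> 0 \<le> L \<and> (\<forall>m n. \<bar>f m - f n\<bar> \<le> L * \<bar>real m - real n\<bar>)"

lemma lipI:
  assumes L: "0 \<le> L" and f: "\<And>n. \<bar>f (Suc n) - f n\<bar> \<le> L"
  shows "lip L f"
proof -
  have le: "\<bar>f (m + d) - f m\<bar> \<le> L * real d" for m d
  proof (induction d)
    case (Suc d)
    have "\<bar>f (m + Suc d) - f m\<bar> \<le> \<bar>f (Suc (m + d)) - f (m + d)\<bar> + \<bar>f (m + d) - f m\<bar>" by simp
    also have "\<dots> \<le> L + L * real d" by (intro add_mono Suc f)
    finally show ?case by (simp add: algebra_simps)
  qed simp
  have "\<bar>f m - f n\<bar> \<le> L * \<bar>real m - real n\<bar>" for m n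
  proof (cases "m \<le> n")
    case True
    then show ?thesis using le[of m "n - m"] by (simp add: abs_minus_commute of_nat_diff)
  next
    case False
    then show ?thesis using le[of n "m - n"] by (simp add: of_nat_diff)
  qed
  then show ?thesis using L by (simp add: lip_def)
qed

lemma lip_square_bound:
  assumes "lip L f"
  shows "(f n)\<^sup>2 \<le> 2 * (f 0)\<^sup>2 + 2 * L\<^sup>2 * (real n)\<^sup>2"
proof -
  have "\<bar>f n - f 0\<bar> \<le> L * real n" using assms unfolding lip_def by (metis diff_zero of_nat_0 abs_of_nat)
  then have "(f n - f 0)\<^sup>2 \<le> (L * real n)\<^sup>2" by (rule abs_le_square_iff[THEN iffD1, OF order_trans]) simp
  moreover have "(f n)\<^sup>2 \<le> 2 * (f 0)\<^sup>2 + 2 * (f n - f 0)\<^sup>2"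
    using zero_le_power2[of "f n - 2 * f 0"] by (simp add: power2_eq_square algebra_simps)
  ultimately show ?thesis by (simp add: power_mult_distrib)
qed

text \<open>A Lipschitz function of a count grows at most linearly, so the product is bounded by a
  combination of squares of the four Poisson variables.\<close>

lemma integrable_pois4_lip:
  fixes f g :: "nat \<Rightarrow> real"
  assumes r: "0 \<le> a" "0 \<le> a'" "0 \<le> b" and fg: "lip L f" "lip L' g"
    and le: "\<And>z. p z \<le> fst (fst z) + snd (fst z) + fst (snd z) + snd (snd z)"
      "\<And>z. q z \<le> fst (fst z) + snd (fst z) + fst (snd z) + snd (snd z)"
  shows "integrable (pois4 a a' b) (\<lambda>z. f (p z) * g (q z))"
proof (rule Bochner_Integration.integrable_bound)
  define s where "s z = 4 * (real (fst (fst z)))\<^sup>2 + 4 * (real (snd (fst z)))\<^sup>2 + 4 * (real (fst (snd z)))\<^sup>2 + 4 * (real (snd (snd z)))\<^sup>2"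
    for z :: "(nat \<times> nat) \<times> nat \<times> nat"
  have s: "(real n)\<^sup>2 \<le> s z" if "n \<le> fst (fst z) + snd (fst z) + fst (snd z) + snd (snd z)" for n z
  proof -
    have sq: "(w + x + y + t)\<^sup>2 \<le> 4 * w\<^sup>2 + 4 * x\<^sup>2 + 4 * y\<^sup>2 + 4 * t\<^sup>2" for w x y t :: real
      using zero_le_power2[of "w - x"] zero_le_power2[of "w - y"] zero_le_power2[of "w - t"]
        zero_le_power2[of "x - y"] zero_le_power2[of "x - t"] zero_le_power2[of "y - t"]
      by (simp add: power2_eq_square algebra_simps)
    have "(real n)\<^sup>2 \<le> (real (fst (fst z)) + real (snd (fst z)) + real (fst (snd z)) + real (snd (snd z)))\<^sup>2"
      using that by (intro power_mono) linarith+
    also have "\<dots> \<le> s z" unfolding s_def by (rule sq)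
    finally show ?thesis .
  qed
  show "integrable (pois4 a a' b) (\<lambda>z. 2 * (f 0)\<^sup>2 + 2 * L\<^sup>2 * s z + (2 * (g 0)\<^sup>2 + 2 * L'\<^sup>2 * s z))"
    unfolding s_def using integrable_pois4_squares[OF r] by auto
  show "AE z in pois4 a a' b. norm (f (p z) * g (q z)) \<le> norm (2 * (f 0)\<^sup>2 + 2 * L\<^sup>2 * s z + (2 * (g 0)\<^sup>2 + 2 * L'\<^sup>2 * s z))"
  proof (rule AE_I2)
    fix z
    have "2 * (\<bar>f (p z)\<bar> * \<bar>g (q z)\<bar>) \<le> (f (p z))\<^sup>2 + (g (q z))\<^sup>2"
      using zero_le_power2[of "\<bar>f (p z)\<bar> - \<bar>g (q z)\<bar>"] by (simp add: power2_diff)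
    moreover have "0 \<le> \<bar>f (p z)\<bar> * \<bar>g (q z)\<bar>" by simp
    ultimately have "\<bar>f (p z) * g (q z)\<bar> \<le> (f (p z))\<^sup>2 + (g (q z))\<^sup>2"
      unfolding abs_mult by linarith
    also have "\<dots> \<le> (2 * (f 0)\<^sup>2 + 2 * L\<^sup>2 * (real (p z))\<^sup>2) + (2 * (g 0)\<^sup>2 + 2 * L'\<^sup>2 * (real (q z))\<^sup>2)"
      by (intro add_mono lip_square_bound fg)
    also have "\<dots> \<le> 2 * (f 0)\<^sup>2 + 2 * L\<^sup>2 * s z + (2 * (g 0)\<^sup>2 + 2 * L'\<^sup>2 * s z)"
      by (intro add_mono mult_left_mono s le order_refl) auto
    finally show "norm (f (p z) * g (q z)) \<le> norm (2 * (f 0)\<^sup>2 + 2 * L\<^sup>2 * s z + (2 * (g 0)\<^sup>2 + 2 * L'\<^sup>2 * s z))" by simp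
  qed
qed simp

context grain_model begin

lemma measure_Lam_split:
  assumes [measurable]: "C \<in> sets Lam" "C' \<in> sets Lam" and "emeasure Lam C < \<infinity>"
  shows "measure Lam C = measure Lam (C - C') + measure Lam (C \<inter> C')"
proof -
  have "C - C' \<in> fmeasurable Lam" "C \<inter> C' \<in> fmeasurable Lam"
    using fmeasurableI2[OF fmeasurableI[OF assms(1,3)], of "C - C'"]
      fmeasurableI2[OF fmeasurableI[OF assms(1,3)], of "C \<inter> C'"] assms by auto
  then have "measure Lam ((C - C') \<union> (C \<inter> C')) = measure Lam (C - C') + measure Lam (C \<inter> C')"
    by (intro measure_Un2[THEN trans]) (auto intro!: arg_cong[where f="measure Lam"])
  moreover have "(C - C') \<union> (C \<inter> C') = C" by blast
  ultimately show ?thesis by simp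
qed

lemma expectation_power_num2:
  assumes C[measurable]: "C \<in> sets Lam" "C' \<in> sets Lam" and fin: "emeasure Lam C < \<infinity>" "emeasure Lam C' < \<infinity>"
    and v: "0 \<le> v" "v \<le> (1::real)" "0 \<le> w" "w \<le> 1"
  shows "(\<integral>\<omega>. v ^ num C \<omega> * w ^ num C' \<omega> \<partial>M) =
    exp (- ((1 - v) * measure Lam (C - C') + (1 - w) * measure Lam (C' - C) + (1 - v * w) * measure Lam (C \<inter> C')))"
proof -
  have fm: "C - C' \<in> fmeasurable Lam" "C' - C \<in> fmeasurable Lam" "C \<inter> C' \<in> fmeasurable Lam"
    using fmeasurableI2[OF fmeasurableI[OF C(1) fin(1)], of "C - C'"] fmeasurableI2[OF fmeasurableI[OF C(2) fin(2)], of "C' - C"]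
      fmeasurableI2[OF fmeasurableI[OF C(1) fin(1)], of "C \<inter> C'"] C by auto
  define D where "D i = (if i then C else C')" for i
  define V where "V i = (if i then v else w)" for i
  have "(\<integral>\<omega>. (\<Prod>i\<in>UNIV. V i ^ num (D i) \<omega>) \<partial>M) = exp (- (\<integral>z. 1 - (\<Prod>i\<in>UNIV. if z \<in> D i then V i else 1) \<partial>Lam))"
    by (rule expectation_prod_power_num) (use C fin v in \<open>auto simp: D_def V_def\<close>)
  then have "(\<integral>\<omega>. v ^ num C \<omega> * w ^ num C' \<omega> \<partial>M) = exp (- (\<integral>z. 1 - (if z \<in> C then v else 1) * (if z \<in> C' then w else 1) \<partial>Lam))"
    by (simp add: UNIV_bool D_def V_def mult.commute cong: if_cong)
  also have "(\<lambda>z. 1 - (if z \<in> C then v else 1) * (if z \<in> C' then w else 1)) =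
     (\<lambda>z. (1 - v) * indicator (C - C') z + (1 - w) * indicator (C' - C) z + (1 - v * w) * indicator (C \<inter> C') z)"
    by (auto simp: indicator_def)
  also have "(\<integral>z. (1 - v) * indicator (C - C') z + (1 - w) * indicator (C' - C) z + (1 - v * w) * indicator (C \<inter> C') z \<partial>Lam) =
    (1 - v) * measure Lam (C - C') + (1 - w) * measure Lam (C' - C) + (1 - v * w) * measure Lam (C \<inter> C')"
    using fm by (simp add: fmeasurable_def)
  finally show ?thesis .
qed

text \<open>Write the counts as A + B and A' + B, where B counts the common points, and let B' be an
  independent copy of B. Twice the covariance is the expectation of (f(A + B) - f(A + B')) (g(A' +
  B) - g(A' + B')). The Lipschitz bound reduces this to the expectation of (B - B')^2, which is
  twice the measure of the intersection; for the identity functions there is equality.\<close>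

lemma
  fixes f g :: "nat \<Rightarrow> real"
  assumes C[measurable]: "C \<in> sets Lam" "C' \<in> sets Lam" and fin: "emeasure Lam C < \<infinity>" "emeasure Lam C' < \<infinity>"
    and f: "lip L f" and g: "lip L' g"
  shows integrable_num2: "integrable M (\<lambda>\<omega>. f (num C \<omega>) * g (num C' \<omega>))"
    and covariance_num_le: "\<bar>(\<integral>\<omega>. f (num C \<omega>) * g (num C' \<omega>) \<partial>M) - (\<integral>\<omega>. f (num C \<omega>) \<partial>M) * (\<integral>\<omega>. g (num C' \<omega>) \<partial>M)\<bar>
       \<le> L * L' * measure Lam (C \<inter> C')"
    and covariance_num: "(\<integral>\<omega>. real (num C \<omega>) * real (num C' \<omega>) \<partial>M) - (\<integral>\<omega>. real (num C \<omega>) \<partial>M) * (\<integral>\<omega>. real (num C' \<omega>) \<partial>M)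
       = measure Lam (C \<inter> C')"
proof -
  define a a' b where "a = measure Lam (C - C')" and "a' = measure Lam (C' - C)" and "b = measure Lam (C \<inter> C')"
  have r: "0 \<le> a" "0 \<le> a'" "0 \<le> b" by (auto simp: a_def a'_def b_def)
  have mC: "measure Lam C = a + b" using measure_Lam_split[OF C fin(1)] by (simp add: a_def b_def)
  have mC': "measure Lam C' = a' + b" using measure_Lam_split[OF C(2,1) fin(2)] by (simp add: a'_def b_def Int_commute)
  let ?T = "pois4 a a' b"
  define A where "A z = fst (fst z)" for z :: "(nat \<times> nat) \<times> nat \<times> nat"
  define A' where "A' z = snd (fst z)" for z :: "(nat \<times> nat) \<times> nat \<times> nat"
  define B where "B z = fst (snd z)" for z :: "(nat \<times> nat) \<times> nat \<times> nat"
  define B' where "B' z = snd (snd z)" for z :: "(nat \<times> nat) \<times> nat \<times> nat"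
  note defs = A_def A'_def B_def B'_def
  have pT: "prob_space ?T" by (rule prob_space_measure_pmf)
  interpret MM: pair_prob_space M M ..
  have half: "0 \<le> (1/2::real) ^ k" "(1/2::real) ^ k \<le> 1" for k :: nat by (auto simp: power_le_one)
  have E4: "(\<integral>z. v1 ^ A z * v2 ^ A' z * (v3 ^ B z * v4 ^ B' z) \<partial>?T) = exp (- ((1 - v1) * a + (1 - v2) * a' + (1 - v3) * b + (1 - v4) * b))"
    if "0 \<le> v1" "0 \<le> v2" "0 \<le> v3" "0 \<le> v4" for v1 v2 v3 v4
    unfolding defs using r that by (rule expectation_pois4_power)
  \<comment> \<open>The joint law of the two counts, represented in two ways: the shared part is B
    or its copy B'.\<close>
  have dep: "(\<integral>\<omega>. v ^ num C \<omega> * w ^ num C' \<omega> \<partial>M) = (\<integral>z. v ^ (A z + B z) * w ^ (A' z + B z) \<partial>?T)"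
    "(\<integral>\<omega>. v ^ num C \<omega> * w ^ num C' \<omega> \<partial>M) = (\<integral>z. v ^ (A z + B' z) * w ^ (A' z + B' z) \<partial>?T)"
    if v: "0 \<le> v" "v \<le> 1" "0 \<le> w" "w \<le> 1" for v w :: real
    using E4[of v w "v * w" 1] E4[of v w 1 "v * w"] v
    by (simp_all add: expectation_power_num2[OF C fin v] a_def[symmetric] a'_def[symmetric] b_def[symmetric] power_add power_mult_distrib mult_ac)
  have single: "(\<integral>\<omega>. v ^ num C \<omega> \<partial>M) = exp (- ((1 - v) * (a + b)))" "(\<integral>\<omega>. v ^ num C' \<omega> \<partial>M) = exp (- ((1 - v) * (a' + b)))"
    if v: "0 \<le> v" "v \<le> 1" for v :: real
    using expectation_power_num2[OF C(1) C(1) fin(1) fin(1) v, of 1] expectation_power_num2[OF C(2) C(2) fin(2) fin(2) v, of 1]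
    by (simp_all add: mC mC')
  have intp: "integrable M (\<lambda>\<omega>. v ^ num K \<omega>)" if "0 \<le> v" "v \<le> 1" "K \<in> sets Lam" for v :: real and K
    using that by (intro integrable_const_bound[where B=1]) (auto simp: power_le_one)
  \<comment> \<open>Independent copies of the two counts, realised on the product space, correspond
    to using B in one count and B' in the other, again in two ways.\<close>
  have ind: "(\<integral>p. v ^ num C (fst p) * w ^ num C' (snd p) \<partial>(M \<Otimes>\<^sub>M M)) = (\<integral>z. v ^ (A z + B z) * w ^ (A' z + B' z) \<partial>?T)"
    "(\<integral>p. v ^ num C (fst p) * w ^ num C' (snd p) \<partial>(M \<Otimes>\<^sub>M M)) = (\<integral>z. v ^ (A z + B' z) * w ^ (A' z + B z) \<partial>?T)"
    if v: "0 \<le> v" "v \<le> 1" "0 \<le> w" "w \<le> 1" for v w :: real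
  proof -
    have "(\<integral>p. v ^ num C (fst p) * w ^ num C' (snd p) \<partial>(M \<Otimes>\<^sub>M M)) = exp (- ((1 - v) * (a + b))) * exp (- ((1 - w) * (a' + b)))"
      using v by (subst MM.integral_mult_pair) (auto simp: intp single)
    also have "\<dots> = exp (- ((1 - v) * a + (1 - w) * a' + (1 - v) * b + (1 - w) * b))"
      by (simp add: exp_add[symmetric] algebra_simps)
    finally have eq: "(\<integral>p. v ^ num C (fst p) * w ^ num C' (snd p) \<partial>(M \<Otimes>\<^sub>M M)) =
      exp (- ((1 - v) * a + (1 - w) * a' + (1 - v) * b + (1 - w) * b))" .
    show "(\<integral>p. v ^ num C (fst p) * w ^ num C' (snd p) \<partial>(M \<Otimes>\<^sub>M M)) = (\<integral>z. v ^ (A z + B z) * w ^ (A' z + B' z) \<partial>?T)"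
      "(\<integral>p. v ^ num C (fst p) * w ^ num C' (snd p) \<partial>(M \<Otimes>\<^sub>M M)) = (\<integral>z. v ^ (A z + B' z) * w ^ (A' z + B z) \<partial>?T)"
      using E4[of v w v w] E4[of v w w v] v unfolding eq by (simp_all add: power_add mult_ac add_ac)
  qed
  have m[measurable]: "num C \<in> M \<rightarrow>\<^sub>M count_space UNIV" "num C' \<in> M \<rightarrow>\<^sub>M count_space UNIV" by auto
  have mT: "h \<in> ?T \<rightarrow>\<^sub>M count_space UNIV" for h :: "_ \<Rightarrow> nat" by simp
  have mMM: "(\<lambda>p. num C (fst p)) \<in> M \<Otimes>\<^sub>M M \<rightarrow>\<^sub>M count_space UNIV" "(\<lambda>p. num C' (snd p)) \<in> M \<Otimes>\<^sub>M M \<rightarrow>\<^sub>M count_space UNIV"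
    by measurable
  have iT: "integrable ?T (\<lambda>z. h (A z + B z) * k (A' z + B z))" "integrable ?T (\<lambda>z. h (A z + B' z) * k (A' z + B' z))"
      "integrable ?T (\<lambda>z. h (A z + B z) * k (A' z + B' z))" "integrable ?T (\<lambda>z. h (A z + B' z) * k (A' z + B z))"
    if "lip H h" "lip K k" for H K h k
    by (intro integrable_pois4_lip[OF r that]; simp add: defs)+
  have int2: "integrable M (\<lambda>\<omega>. h (num C \<omega>) * k (num C' \<omega>))" if "lip H h" "lip K k" for H K h k
    unfolding integrable_iff_pgf[OF prob_space_axioms m pT mT mT dep(1)[OF half half], of h k]
    using iT(1)[OF that] .
  show "integrable M (\<lambda>\<omega>. f (num C \<omega>) * g (num C' \<omega>))" by (rule int2[OF f g])
  have lip1: "lip 0 (\<lambda>_. 1)" by (simp add: lip_def)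
  \<comment> \<open>Averaging the two dependent and the two independent representations yields the
    four terms of the product of differences.\<close>
  have cov: "2 * ((\<integral>\<omega>. h (num C \<omega>) * k (num C' \<omega>) \<partial>M) - (\<integral>\<omega>. h (num C \<omega>) \<partial>M) * (\<integral>\<omega>. k (num C' \<omega>) \<partial>M)) =
    (\<integral>z. (h (A z + B z) - h (A z + B' z)) * (k (A' z + B z) - k (A' z + B' z)) \<partial>?T)"
    and covint: "integrable ?T (\<lambda>z. (h (A z + B z) - h (A z + B' z)) * (k (A' z + B z) - k (A' z + B' z)))"
    if hk: "lip H h" "lip K k" for H K h k
  proof -
    note i = iT[OF hk]
    have 1: "(\<integral>\<omega>. h (num C \<omega>) * k (num C' \<omega>) \<partial>M) = (\<integral>z. h (A z + B z) * k (A' z + B z) \<partial>?T)"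
      "(\<integral>\<omega>. h (num C \<omega>) * k (num C' \<omega>) \<partial>M) = (\<integral>z. h (A z + B' z) * k (A' z + B' z) \<partial>?T)"
      by (rule integral_eqI_pgf[OF prob_space_axioms m pT mT mT dep(1)[OF half half]],
          rule integral_eqI_pgf[OF prob_space_axioms m pT mT mT dep(2)[OF half half]])
    have 2: "(\<integral>\<omega>. h (num C \<omega>) \<partial>M) * (\<integral>\<omega>. k (num C' \<omega>) \<partial>M) = (\<integral>p. h (num C (fst p)) * k (num C' (snd p)) \<partial>(M \<Otimes>\<^sub>M M))"
      using int2[OF hk(1) lip1] int2[OF lip1 hk(2)] by (subst MM.integral_mult_pair) auto
    have 3: "(\<integral>\<omega>. h (num C \<omega>) \<partial>M) * (\<integral>\<omega>. k (num C' \<omega>) \<partial>M) = (\<integral>z. h (A z + B z) * k (A' z + B' z) \<partial>?T)"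
      "(\<integral>\<omega>. h (num C \<omega>) \<partial>M) * (\<integral>\<omega>. k (num C' \<omega>) \<partial>M) = (\<integral>z. h (A z + B' z) * k (A' z + B z) \<partial>?T)"
      unfolding 2
      by (rule integral_eqI_pgf[OF MM.P.prob_space_axioms mMM pT mT mT ind(1)[OF half half]],
          rule integral_eqI_pgf[OF MM.P.prob_space_axioms mMM pT mT mT ind(2)[OF half half]])
    have eq: "(\<lambda>z. (h (A z + B z) - h (A z + B' z)) * (k (A' z + B z) - k (A' z + B' z))) =
      (\<lambda>z. h (A z + B z) * k (A' z + B z) + h (A z + B' z) * k (A' z + B' z) - h (A z + B z) * k (A' z + B' z) - h (A z + B' z) * k (A' z + B z))"
      by (simp add: algebra_simps)
    show "integrable ?T (\<lambda>z. (h (A z + B z) - h (A z + B' z)) * (k (A' z + B z) - k (A' z + B' z)))"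
      unfolding eq by (intro Bochner_Integration.integrable_diff Bochner_Integration.integrable_add i)
    have "(\<integral>z. (h (A z + B z) - h (A z + B' z)) * (k (A' z + B z) - k (A' z + B' z)) \<partial>?T) =
      (\<integral>z. h (A z + B z) * k (A' z + B z) \<partial>?T) + (\<integral>z. h (A z + B' z) * k (A' z + B' z) \<partial>?T)
      - (\<integral>z. h (A z + B z) * k (A' z + B' z) \<partial>?T) - (\<integral>z. h (A z + B' z) * k (A' z + B z) \<partial>?T)"
      unfolding eq using i by simp
    then show "2 * ((\<integral>\<omega>. h (num C \<omega>) * k (num C' \<omega>) \<partial>M) - (\<integral>\<omega>. h (num C \<omega>) \<partial>M) * (\<integral>\<omega>. k (num C' \<omega>) \<partial>M)) =
      (\<integral>z. (h (A z + B z) - h (A z + B' z)) * (k (A' z + B z) - k (A' z + B' z)) \<partial>?T)"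
      unfolding 1(1)[symmetric] 1(2)[symmetric] 3(1)[symmetric] 3(2)[symmetric] by simp
  qed
  note diff = has_bochner_integral_pois4_diff[OF r, folded B_def B'_def]
  have lipid: "lip 1 real" by (simp add: lip_def)
  have "(\<integral>z. (real (A z + B z) - real (A z + B' z)) * (real (A' z + B z) - real (A' z + B' z)) \<partial>?T) = 2 * b"
    using has_bochner_integral_integral_eq[OF diff] by (simp add: power2_eq_square)
  with cov[OF lipid lipid]
  show "(\<integral>\<omega>. real (num C \<omega>) * real (num C' \<omega>) \<partial>M) - (\<integral>\<omega>. real (num C \<omega>) \<partial>M) * (\<integral>\<omega>. real (num C' \<omega>) \<partial>M)
       = measure Lam (C \<inter> C')"
    by (simp add: b_def)
  have L: "0 \<le> L" "0 \<le> L'" using f g by (auto simp: lip_def)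
  have "\<bar>\<integral>z. (f (A z + B z) - f (A z + B' z)) * (g (A' z + B z) - g (A' z + B' z)) \<partial>?T\<bar> \<le>
    (\<integral>z. \<bar>(f (A z + B z) - f (A z + B' z)) * (g (A' z + B z) - g (A' z + B' z))\<bar> \<partial>?T)"
    by (rule integral_abs_bound)
  also have "\<dots> \<le> (\<integral>z. L * L' * (real (B z) - real (B' z))\<^sup>2 \<partial>?T)"
  proof (rule integral_mono)
    show "integrable ?T (\<lambda>z. \<bar>(f (A z + B z) - f (A z + B' z)) * (g (A' z + B z) - g (A' z + B' z))\<bar>)"
      using covint[OF f g] by (rule integrable_abs)
    show "integrable ?T (\<lambda>z. L * L' * (real (B z) - real (B' z))\<^sup>2)"
      using diff by (auto simp: has_bochner_integral_iff)
    fix z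
    have "\<bar>f (A z + B z) - f (A z + B' z)\<bar> \<le> L * \<bar>real (A z + B z) - real (A z + B' z)\<bar>"
      "\<bar>g (A' z + B z) - g (A' z + B' z)\<bar> \<le> L' * \<bar>real (A' z + B z) - real (A' z + B' z)\<bar>"
      using f g unfolding lip_def by blast+
    then have 1: "\<bar>f (A z + B z) - f (A z + B' z)\<bar> \<le> L * \<bar>real (B z) - real (B' z)\<bar>"
      and 2: "\<bar>g (A' z + B z) - g (A' z + B' z)\<bar> \<le> L' * \<bar>real (B z) - real (B' z)\<bar>" by simp_all
    have "\<bar>(f (A z + B z) - f (A z + B' z)) * (g (A' z + B z) - g (A' z + B' z))\<bar> \<le>
      (L * \<bar>real (B z) - real (B' z)\<bar>) * (L' * \<bar>real (B z) - real (B' z)\<bar>)"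
      unfolding abs_mult using L by (intro mult_mono 1 2) auto
    also have "\<dots> = L * L' * (real (B z) - real (B' z))\<^sup>2"
      unfolding power2_abs[symmetric, of "real (B z) - real (B' z)"] power2_eq_square by (simp only: mult_ac)
    finally show "\<bar>(f (A z + B z) - f (A z + B' z)) * (g (A' z + B z) - g (A' z + B' z))\<bar> \<le> L * L' * (real (B z) - real (B' z))\<^sup>2" .
  qed
  also have "\<dots> = L * L' * (2 * b)" using has_bochner_integral_integral_eq[OF diff] by simp
  finally have le: "\<bar>\<integral>z. (f (A z + B z) - f (A z + B' z)) * (g (A' z + B z) - g (A' z + B' z)) \<partial>?T\<bar> \<le> L * L' * (2 * b)" .
  show "\<bar>(\<integral>\<omega>. f (num C \<omega>) * g (num C' \<omega>) \<partial>M) - (\<integral>\<omega>. f (num C \<omega>) \<partial>M) * (\<integral>\<omega>. g (num C' \<omega>) \<partial>M)\<bar>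
       \<le> L * L' * measure Lam (C \<inter> C')"
    using le unfolding cov[OF f g, symmetric] by (simp add: abs_mult b_def[symmetric])
qed

end

section \<open>The counting field\<close>

lemma nn_integral_lborel_reflect:
  fixes t :: "'a::euclidean_space"
  assumes [measurable]: "f \<in> borel_measurable borel"
  shows "(\<integral>\<^sup>+y. f (t - y) \<partial>lborel) = (\<integral>\<^sup>+y. f y \<partial>lborel)"
proof -
  have "(lborel :: 'a measure) = distr lborel borel (\<lambda>x. t - x)"
    using lborel_affine[of "-1" t] by (simp add: density_1)
  then have "(\<integral>\<^sup>+y. f y \<partial>lborel) = (\<integral>\<^sup>+y. f y \<partial>distr lborel borel (\<lambda>x. t - x))" by (rule arg_cong)
  then show ?thesis by (simp add: nn_integral_distr)
qed

lemma nn_integral_lborel_shift: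
  fixes t :: "'a::euclidean_space"
  assumes [measurable]: "f \<in> borel_measurable borel"
  shows "(\<integral>\<^sup>+y. f (t + y) \<partial>lborel) = (\<integral>\<^sup>+y. f y \<partial>lborel)"
proof -
  have "(\<integral>\<^sup>+y. f y \<partial>lborel) = (\<integral>\<^sup>+y. f y \<partial>distr lborel borel ((+) t))" by (simp add: lborel_distr_plus)
  then show ?thesis by (simp add: nn_integral_distr)
qed

context grain_model begin

text \<open>Marked points whose shifted grain covers \<open>t\<close>, with the grain cut off by the
  window \<open>D\<close>. The window \<open>UNIV\<close> gives the original field; a ball as window
  makes the field finite-range dependent.\<close>

definition cover :: "'a set \<Rightarrow> 'a \<Rightarrow> ('a \<times> 'a set) set" where
  "cover D t = {z \<in> space (borel \<Otimes>\<^sub>M fell_borel). t - fst z \<in> snd z \<and> t - fst z \<in> D}"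

definition X :: "'a set \<Rightarrow> 'a \<Rightarrow> 'w \<Rightarrow> nat" where
  "X D t \<omega> = card {j. t - u j \<omega> \<in> G j \<omega> \<and> t - u j \<omega> \<in> D}"

text \<open>This is E Leb(\<Xi> \<inter> (\<Xi> - h)), the covariance function of the field. It is
  kept in the extended reals so that Tonelli applies before finiteness is known.\<close>

definition overlap :: "'a \<Rightarrow> ennreal" where
  "overlap h = (\<integral>\<^sup>+F. \<integral>\<^sup>+y. indicator F y * indicator F (h + y) \<partial>lborel \<partial>Q)"

lemma sets_cover[measurable]:
  assumes [measurable]: "D \<in> sets borel"
  shows "cover D t \<in> sets Lam"
  unfolding sets_Lam cover_def by measurable

lemma X_eq_num: "\<omega> \<in> space M \<Longrightarrow> X D t \<omega> = num (cover D t) \<omega>"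
  unfolding X_def num_def cover_def using measurable_space[OF measurable_G]
  by (auto simp: space_pair_measure intro!: arg_cong[where f=card])

lemma measurable_X_pair:
  assumes [measurable]: "D \<in> sets borel"
  shows "(\<lambda>z. X D (fst z) (snd z)) \<in> borel \<Otimes>\<^sub>M M \<rightarrow>\<^sub>M count_space UNIV"
proof -
  have "X D t \<omega> = nat \<lfloor>enn2real (\<Sum>j. if t - u j \<omega> \<in> G j \<omega> \<and> t - u j \<omega> \<in> D then 1 else 0)\<rfloor>" for t \<omega>
  proof -
    have "(\<Sum>j. if t - u j \<omega> \<in> G j \<omega> \<and> t - u j \<omega> \<in> D then 1 else 0 :: ennreal) =
      (\<Sum>j. indicator {j. t - u j \<omega> \<in> G j \<omega> \<and> t - u j \<omega> \<in> D} j)"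
      by (intro suminf_cong) (auto simp: indicator_def)
    then show ?thesis
      unfolding suminf_indicator_eq_card[of "{j. t - u j \<omega> \<in> G j \<omega> \<and> t - u j \<omega> \<in> D}" "\<lambda>j. j"] by (simp add: X_def)
  qed
  moreover have "(\<lambda>z. nat \<lfloor>enn2real (\<Sum>j. if fst z - u j (snd z) \<in> G j (snd z) \<and> fst z - u j (snd z) \<in> D then 1 else 0)\<rfloor>)
     \<in> borel \<Otimes>\<^sub>M M \<rightarrow>\<^sub>M count_space UNIV" by measurable
  ultimately show ?thesis by simp
qed

lemma measurable_X[measurable (raw)]:
  assumes "D \<in> sets borel" and [measurable]: "f \<in> borel_measurable N" "g \<in> N \<rightarrow>\<^sub>M M"
  shows "(\<lambda>x. X D (f x) (g x)) \<in> N \<rightarrow>\<^sub>M count_space UNIV"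
  using measurable_compose[OF measurable_Pair[OF assms(2,3)] measurable_X_pair[OF assms(1)]] by simp

lemma closed_space_Q: "F \<in> space Q \<Longrightarrow> closed F"
  by (simp add: Q_def space_fell_borel)

text \<open>The reflection of the point through \<open>t\<close> preserves Lebesgue measure and
  turns positions into grain coordinates. Only the lag \<open>s - t\<close> survives, which is the
  source of stationarity.\<close>

lemma emeasure_cover_Int:
  assumes D[measurable]: "D \<in> sets borel" "D' \<in> sets borel"
  shows "emeasure Lam (cover D t \<inter> cover D' s) =
    (\<integral>\<^sup>+F. \<integral>\<^sup>+y. indicator (F \<inter> D) y * indicator (F \<inter> D') (s - t + y) \<partial>lborel \<partial>Q)"
proof -
  interpret pair_sigma_finite lborel Q ..
  have m[measurable]: "cover D t \<inter> cover D' s \<in> sets (lborel \<Otimes>\<^sub>M Q)"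
    using sets_cover[OF D(1), of t] sets_cover[OF D(2), of s] unfolding Lam_def by auto
  have "emeasure Lam (cover D t \<inter> cover D' s) = (\<integral>\<^sup>+z. indicator (cover D t \<inter> cover D' s) z \<partial>(lborel \<Otimes>\<^sub>M Q))"
    unfolding Lam_def using m by (rule nn_integral_indicator[symmetric])
  also have "\<dots> = (\<integral>\<^sup>+F. \<integral>\<^sup>+x. indicator (cover D t \<inter> cover D' s) (x, F) \<partial>lborel \<partial>Q)"
    by (rule nn_integral_snd[symmetric]) simp
  also have "\<dots> = (\<integral>\<^sup>+F. \<integral>\<^sup>+y. indicator (F \<inter> D) y * indicator (F \<inter> D') (s - t + y) \<partial>lborel \<partial>Q)"
  proof (rule nn_integral_cong)
    fix F assume "F \<in> space Q"
    then have F: "closed F" by (rule closed_space_Q)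
    then have [measurable]: "F \<in> sets borel" by simp
    have "(\<integral>\<^sup>+x. indicator (cover D t \<inter> cover D' s) (x, F) \<partial>lborel) =
      (\<integral>\<^sup>+x. indicator (F \<inter> D) (t - x) * indicator (F \<inter> D') (s - t + (t - x)) \<partial>lborel)"
      using F by (intro nn_integral_cong) (auto simp: cover_def indicator_def space_pair_measure space_fell_borel)
    also have "\<dots> = (\<integral>\<^sup>+y. indicator (F \<inter> D) y * indicator (F \<inter> D') (s - t + y) \<partial>lborel)"
      by (rule nn_integral_lborel_reflect[where f="\<lambda>y. indicator (F \<inter> D) y * indicator (F \<inter> D') (s - t + y)"]) measurable
    finally show "(\<integral>\<^sup>+x. indicator (cover D t \<inter> cover D' s) (x, F) \<partial>lborel) =
      (\<integral>\<^sup>+y. indicator (F \<inter> D) y * indicator (F \<inter> D') (s - t + y) \<partial>lborel)" .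
  qed
  finally show ?thesis .
qed

lemma nn_integral_Q:
  assumes [measurable]: "f \<in> borel_measurable fell_borel"
  shows "(\<integral>\<^sup>+F. f F \<partial>Q) = (\<integral>\<^sup>+\<omega>. f (\<Xi> \<omega>) \<partial>M)"
  unfolding Q_def by (subst nn_integral_distr) auto

lemma closed_\<Xi>: "\<omega> \<in> space M \<Longrightarrow> closed (\<Xi> \<omega>)"
  using measurable_space[OF measurable_\<Xi>] by (auto simp: space_fell_borel)

lemma emeasure_cover_finite:
  assumes [measurable]: "D \<in> sets borel"
  shows "emeasure Lam (cover D t) < \<infinity>"
proof -
  have "emeasure Lam (cover D t) = emeasure Lam (cover D t \<inter> cover D t)" by simp
  also have "\<dots> \<le> (\<integral>\<^sup>+F. \<integral>\<^sup>+y. indicator F y \<partial>lborel \<partial>Q)"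
    unfolding emeasure_cover_Int[OF assms assms]
    by (intro nn_integral_mono) (auto simp: indicator_def)
  also have "\<dots> = (\<integral>\<^sup>+\<omega>. \<integral>\<^sup>+y. indicator (\<Xi> \<omega>) y \<partial>lborel \<partial>M)"
    by (rule nn_integral_Q) measurable
  also have "\<dots> = (\<integral>\<^sup>+\<omega>. emeasure lebesgue (\<Xi> \<omega>) \<partial>M)"
    by (intro nn_integral_cong) (simp add: closed_\<Xi>)
  also have "\<dots> < \<infinity>"
    using model by (simp add: random_grain_model_def random_grain_def)
  finally show ?thesis .
qed

lemma overlap_eq: "overlap (s - t) = emeasure Lam (cover UNIV t \<inter> cover UNIV s)"
  by (subst emeasure_cover_Int) (auto simp: overlap_def)

lemma overlap_finite: "overlap h < \<infinity>"
proof -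
  have "overlap h = emeasure Lam (cover UNIV 0 \<inter> cover UNIV h)" using overlap_eq[of h 0] by simp
  also have "\<dots> \<le> emeasure Lam (cover UNIV 0)" by (intro emeasure_mono) auto
  also have "\<dots> < \<infinity>" by (rule emeasure_cover_finite) simp
  finally show ?thesis .
qed

definition \<rho> :: "'a \<Rightarrow> real" where "\<rho> h = enn2real (overlap h)"

lemma \<rho>_nonneg: "0 \<le> \<rho> h" by (simp add: \<rho>_def)

lemma borel_measurable_overlap[measurable]: "overlap \<in> borel_measurable borel"
  unfolding overlap_def by measurable

lemma borel_measurable_\<rho>[measurable]: "\<rho> \<in> borel_measurable borel"
  unfolding \<rho>_def by measurable

lemma measure_cover_Int_UNIV: "measure Lam (cover UNIV t \<inter> cover UNIV s) = \<rho> (s - t)"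
  by (simp add: \<rho>_def overlap_eq measure_def)

lemma measure_cover_Int_le:
  assumes [measurable]: "D \<in> sets borel" "D' \<in> sets borel"
  shows "measure Lam (cover D t \<inter> cover D' s) \<le> \<rho> (s - t)"
  unfolding measure_cover_Int_UNIV[symmetric]
  using overlap_finite[of "s - t"] unfolding overlap_eq
  by (intro measure_mono_fmeasurable) (auto simp: cover_def fmeasurable_def)

text \<open>For a fixed grain, Tonelli and translation invariance turn the double integral into the
  square of its volume. Here the second moment of the volume enters as the integral of the
  covariance.\<close>

lemma nn_integral_overlap: "(\<integral>\<^sup>+h. overlap h \<partial>lborel) = grain_second_moment M \<Xi>"
proof -
  interpret QL: pair_sigma_finite lborel Q ..
  have "(\<integral>\<^sup>+h. overlap h \<partial>lborel) = (\<integral>\<^sup>+F. \<integral>\<^sup>+h. \<integral>\<^sup>+y. indicator F y * indicator F (h + y) \<partial>lborel \<partial>lborel \<partial>Q)"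
    unfolding overlap_def by (rule QL.Fubini'[symmetric]) measurable
  also have "\<dots> = (\<integral>\<^sup>+F. (emeasure lborel F)\<^sup>2 \<partial>Q)"
  proof (rule nn_integral_cong)
    fix F assume "F \<in> space Q"
    then have F: "closed F" by (rule closed_space_Q)
    then have [measurable]: "F \<in> sets borel" by simp
    have "(\<integral>\<^sup>+h. \<integral>\<^sup>+y. indicator F y * indicator F (h + y) \<partial>lborel \<partial>lborel) =
      (\<integral>\<^sup>+y. \<integral>\<^sup>+h. indicator F y * indicator F (h + y) \<partial>lborel \<partial>lborel)"
      by (rule lborel_pair.Fubini'[symmetric]) measurable
    also have "\<dots> = (\<integral>\<^sup>+y. indicator F y * emeasure lborel F \<partial>lborel)"
    proof (rule nn_integral_cong)
      fix y
      have "(\<integral>\<^sup>+h. indicator F (h + y) \<partial>lborel) = (\<integral>\<^sup>+h. indicator F h \<partial>lborel)"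
        using nn_integral_lborel_shift[of "indicator F" y] by (simp add: add.commute)
      then show "(\<integral>\<^sup>+h. indicator F y * indicator F (h + y) \<partial>lborel) = indicator F y * emeasure lborel F"
        by (subst nn_integral_cmult) auto
    qed
    also have "\<dots> = (emeasure lborel F)\<^sup>2"
      by (subst nn_integral_multc) (auto simp: power2_eq_square)
    finally show "(\<integral>\<^sup>+h. \<integral>\<^sup>+y. indicator F y * indicator F (h + y) \<partial>lborel \<partial>lborel) = (emeasure lborel F)\<^sup>2" .
  qed
  also have "\<dots> = (\<integral>\<^sup>+F. (\<integral>\<^sup>+y. indicator F y \<partial>lborel)\<^sup>2 \<partial>Q)"
    by (intro nn_integral_cong) (simp add: closed_space_Q)
  also have "\<dots> = (\<integral>\<^sup>+\<omega>. (\<integral>\<^sup>+y. indicator (\<Xi> \<omega>) y \<partial>lborel)\<^sup>2 \<partial>M)"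
    by (rule nn_integral_Q) measurable
  also have "\<dots> = grain_second_moment M \<Xi>"
    unfolding grain_second_moment_def
    by (intro nn_integral_cong) (simp add: closed_\<Xi>)
  finally show ?thesis .
qed

lemma has_bochner_integral_\<rho>:
  assumes "grain_second_moment M \<Xi> < \<infinity>"
  shows "has_bochner_integral lborel \<rho> (enn2real (grain_second_moment M \<Xi>))"
proof (rule has_bochner_integral_nn_integral)
  have "ennreal (\<rho> h) = overlap h" for h using overlap_finite[of h] by (simp add: \<rho>_def)
  then show "(\<integral>\<^sup>+h. ennreal (\<rho> h) \<partial>lborel) = ennreal (enn2real (grain_second_moment M \<Xi>))"
    using assms by (simp add: nn_integral_overlap)
qed (auto simp: \<rho>_nonneg)

end

section \<open>Quadratic forms of translation-invariant kernels\<close>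

lemma integrable_lborel_reflect:
  fixes f :: "'a::euclidean_space \<Rightarrow> real"
  shows "integrable lborel f \<Longrightarrow> integrable lborel (\<lambda>y. f (t - y))"
    and "f \<in> borel_measurable borel \<Longrightarrow> (\<integral>y. f (t - y) \<partial>lborel) = (\<integral>y. f y \<partial>lborel)"
proof -
  have eq: "(lborel :: 'a measure) = distr lborel borel (\<lambda>x. t - x)"
    using lborel_affine[of "-1" t] by (simp add: density_1)
  show "integrable lborel (\<lambda>y. f (t - y))" if "integrable lborel f"
  proof -
    have "f \<in> borel_measurable borel" using that by auto
    moreover have "integrable (distr lborel borel (\<lambda>x. t - x)) f" using that arg_cong[OF eq, of "\<lambda>M. integrable M f"] by simp
    ultimately show ?thesis using integrable_distr_eq[of "\<lambda>x. t - x" lborel borel f] by simp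
  qed
  show "(\<integral>y. f (t - y) \<partial>lborel) = (\<integral>y. f y \<partial>lborel)" if [measurable]: "f \<in> borel_measurable borel"
  proof -
    have "(\<integral>y. f y \<partial>lborel) = (\<integral>y. f y \<partial>distr lborel borel (\<lambda>x. t - x))" using eq by (rule arg_cong)
    then show ?thesis by (simp add: integral_distr)
  qed
qed

lemma integrable_lborel_translate:
  fixes f :: "'a::euclidean_space \<Rightarrow> real"
  assumes f: "integrable lborel f"
  shows "integrable lborel (\<lambda>y. f (y - t))" "(\<integral>y. f (y - t) \<partial>lborel) = (\<integral>y. f y \<partial>lborel)"
proof -
  have [measurable]: "f \<in> borel_measurable borel" using f by auto
  have "integrable lborel (\<lambda>y. f (0 - (t - y)))"
    by (intro integrable_lborel_reflect(1)[of "\<lambda>y. f (0 - y)"] integrable_lborel_reflect(1)[OF f])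
  then show "integrable lborel (\<lambda>y. f (y - t))" by simp
  show "(\<integral>y. f (y - t) \<partial>lborel) = (\<integral>y. f y \<partial>lborel)"
    using integrable_lborel_reflect(2)[of "\<lambda>y. f (0 - y)" t] integrable_lborel_reflect(2)[of f 0] by simp
qed

lemma
  fixes f :: "'a::euclidean_space \<Rightarrow> real"
  assumes s: "0 < s" and f: "integrable lborel f"
  shows integrable_lborel_scale: "integrable lborel (\<lambda>t. f (t /\<^sub>R s))"
    and integral_lborel_scale: "(\<integral>t. f (t /\<^sub>R s) \<partial>lborel) = s ^ DIM('a) * (\<integral>x. f x \<partial>lborel)"
proof -
  have fm[measurable]: "f \<in> borel_measurable borel" using f by auto
  have eq: "(lborel :: 'a measure) = density (distr lborel borel (\<lambda>x. s *\<^sub>R x)) (\<lambda>_. ennreal (s ^ DIM('a)))"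
    using lborel_affine[of s 0] s by simp
  have "integrable (density (distr lborel borel (\<lambda>x. s *\<^sub>R x)) (\<lambda>_. ennreal (s ^ DIM('a)))) (\<lambda>t. f (t /\<^sub>R s))"
    using f s by (simp add: integrable_density integrable_distr_eq)
  then show "integrable lborel (\<lambda>t. f (t /\<^sub>R s))" unfolding eq[symmetric] .
  have "(\<integral>t. f (t /\<^sub>R s) \<partial>lborel) = (\<integral>t. f (t /\<^sub>R s) \<partial>density (distr lborel borel (\<lambda>x. s *\<^sub>R x)) (\<lambda>_. ennreal (s ^ DIM('a))))"
    using eq by (rule arg_cong)
  also have "\<dots> = s ^ DIM('a) * (\<integral>x. f x \<partial>lborel)"
    using s by (simp add: integral_density integral_distr)
  finally show "(\<integral>t. f (t /\<^sub>R s) \<partial>lborel) = s ^ DIM('a) * (\<integral>x. f x \<partial>lborel)" .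
qed

lemma integrable_bounded_mult:
  fixes f g :: "'b \<Rightarrow> real"
  assumes f: "integrable K f" and g[measurable]: "g \<in> borel_measurable K" and C: "\<And>x. \<bar>g x\<bar> \<le> C"
  shows "integrable K (\<lambda>x. f x * g x)"
proof (rule Bochner_Integration.integrable_bound)
  have [measurable]: "f \<in> borel_measurable K" using f by auto
  show "integrable K (\<lambda>x. C * f x)" using f by simp
  have "0 \<le> C" using C[of undefined] by linarith
  then show "AE x in K. norm (f x * g x) \<le> norm (C * f x)"
    using C by (intro AE_I2) (auto simp: abs_mult mult.commute[of C] intro!: mult_left_mono)
  show "(\<lambda>x. f x * g x) \<in> borel_measurable K" by measurable
qed

text \<open>A quadratic form with a translation-invariant kernel depends on the weight only through
  this function. Its value at lag 0 is the squared L2 norm.\<close>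

definition autocorr :: "('a::euclidean_space \<Rightarrow> real) \<Rightarrow> 'a \<Rightarrow> real" where
  "autocorr a h = (\<integral>t. a t * a (t - h) \<partial>lborel)"

lemma abs_autocorr_le:
  assumes a: "integrable lborel a" and \<alpha>: "\<And>t. \<bar>a t\<bar> \<le> \<alpha>"
  shows "\<bar>autocorr a h\<bar> \<le> (\<integral>t. (a t)\<^sup>2 \<partial>lborel)"
proof -
  have [measurable]: "a \<in> borel_measurable borel" using a by auto
  have i2: "integrable lborel (\<lambda>t. (a t)\<^sup>2)"
    unfolding power2_eq_square using \<alpha> by (intro integrable_bounded_mult[OF a]) auto
  have i3: "integrable lborel (\<lambda>t. (a (t - h))\<^sup>2)" and e3: "(\<integral>t. (a (t - h))\<^sup>2 \<partial>lborel) = (\<integral>t. (a t)\<^sup>2 \<partial>lborel)"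
    using integrable_lborel_translate[OF i2, of h] by auto
  have i4: "integrable lborel (\<lambda>t. a t * a (t - h))" using \<alpha> by (intro integrable_bounded_mult[OF a]) auto
  have "\<bar>autocorr a h\<bar> \<le> (\<integral>t. \<bar>a t * a (t - h)\<bar> \<partial>lborel)" unfolding autocorr_def by (rule integral_abs_bound)
  also have "\<dots> \<le> (\<integral>t. ((a t)\<^sup>2 + (a (t - h))\<^sup>2) / 2 \<partial>lborel)"
  proof (rule integral_mono)
    show "\<bar>a t * a (t - h)\<bar> \<le> ((a t)\<^sup>2 + (a (t - h))\<^sup>2) / 2" for t
      using zero_le_power2[of "\<bar>a t\<bar> - \<bar>a (t - h)\<bar>"] by (simp add: power2_diff abs_mult)
  qed (use i2 i3 i4 in auto)
  also have "\<dots> = (\<integral>t. (a t)\<^sup>2 \<partial>lborel)" using i2 i3 e3 by simp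
  finally show ?thesis .
qed

lemma quadratic_form_eq_autocorr:
  fixes a r :: "'a::euclidean_space \<Rightarrow> real"
  assumes a: "integrable lborel a" and \<alpha>: "\<And>t. \<bar>a t\<bar> \<le> \<alpha>" and r: "integrable lborel r"
  shows "(\<integral>t. \<integral>t'. a t * a t' * r (t - t') \<partial>lborel \<partial>lborel) = (\<integral>h. r h * autocorr a h \<partial>lborel)"
    and borel_measurable_autocorr: "autocorr a \<in> borel_measurable borel"
proof -
  have [measurable]: "a \<in> borel_measurable borel" "r \<in> borel_measurable borel" using a r by auto
  show "autocorr a \<in> borel_measurable borel" unfolding autocorr_def by measurable
  have "(\<integral>t. \<integral>t'. a t * a t' * r (t - t') \<partial>lborel \<partial>lborel) = (\<integral>t. \<integral>h. a t * a (t - h) * r h \<partial>lborel \<partial>lborel)"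
  proof (rule Bochner_Integration.integral_cong[OF refl])
    fix t
    show "(\<integral>t'. a t * a t' * r (t - t') \<partial>lborel) = (\<integral>h. a t * a (t - h) * r h \<partial>lborel)"
      using integrable_lborel_reflect(2)[of "\<lambda>t'. a t * a t' * r (t - t')" t] by simp
  qed
  also have "\<dots> = (\<integral>h. \<integral>t. a t * a (t - h) * r h \<partial>lborel \<partial>lborel)"
  proof (rule lborel_pair.Fubini_integral[of "\<lambda>t h. a t * a (t - h) * r h", symmetric])
    have "integrable (lborel \<Otimes>\<^sub>M lborel) (\<lambda>p. (a (fst p) * r (snd p)) * a (fst p - snd p))"
      using \<alpha> by (intro integrable_bounded_mult[OF lborel_pair.integrable_mult_pair[OF a r]]) auto
    then show "integrable (lborel \<Otimes>\<^sub>M lborel) (\<lambda>(t, h). a t * a (t - h) * r h)"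
      by (simp add: case_prod_beta' mult_ac)
  qed
  also have "\<dots> = (\<integral>h. r h * autocorr a h \<partial>lborel)"
    unfolding autocorr_def by (intro Bochner_Integration.integral_cong refl) (simp add: mult.commute)
  finally show "(\<integral>t. \<integral>t'. a t * a t' * r (t - t') \<partial>lborel \<partial>lborel) = (\<integral>h. r h * autocorr a h \<partial>lborel)" .
qed

text \<open>The autocorrelation is largest at lag 0. The weight thus enters only through its L2
  norm, which makes the bound uniform over rescaled test functions.\<close>

lemma abs_quadratic_form_le:
  fixes a r :: "'a::euclidean_space \<Rightarrow> real"
  assumes a: "integrable lborel a" and \<alpha>: "\<And>t. \<bar>a t\<bar> \<le> \<alpha>" and r: "integrable lborel r"
  shows "\<bar>\<integral>t. \<integral>t'. a t * a t' * r (t - t') \<partial>lborel \<partial>lborel\<bar> \<le> (\<integral>t. (a t)\<^sup>2 \<partial>lborel) * (\<integral>h. \<bar>r h\<bar> \<partial>lborel)"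
proof -
  note le = abs_autocorr_le[OF a \<alpha>]
  have "\<bar>\<integral>h. r h * autocorr a h \<partial>lborel\<bar> \<le> (\<integral>h. \<bar>r h * autocorr a h\<bar> \<partial>lborel)" by (rule integral_abs_bound)
  also have "\<dots> \<le> (\<integral>h. \<bar>r h\<bar> * (\<integral>t. (a t)\<^sup>2 \<partial>lborel) \<partial>lborel)"
  proof (rule integral_mono)
    show "integrable lborel (\<lambda>h. \<bar>r h * autocorr a h\<bar>)"
      using le borel_measurable_autocorr[OF a \<alpha> r] by (intro integrable_abs integrable_bounded_mult[OF r]) auto
    show "\<bar>r h * autocorr a h\<bar> \<le> \<bar>r h\<bar> * (\<integral>t. (a t)\<^sup>2 \<partial>lborel)" for h
      unfolding abs_mult by (intro mult_left_mono le) auto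
  qed (use r in auto)
  finally show ?thesis unfolding quadratic_form_eq_autocorr[OF a \<alpha> r] by (simp add: mult.commute)
qed

text \<open>Two stages, both by dominated convergence: a continuous cut-off to a ball, then
  continuous functions that converge almost everywhere, clipped at \<open>C\<close>. Clipping keeps
  the bound of \<open>f\<close>, and together with the cut-off it provides the dominating
  function.\<close>

lemma L1_approx_bounded_continuous:
  fixes f :: "'a::euclidean_space \<Rightarrow> real"
  assumes f: "integrable lborel f" and C: "\<And>x. \<bar>f x\<bar> \<le> C" and e: "0 < e"
  obtains g where "continuous_on UNIV g" "\<And>x. \<bar>g x\<bar> \<le> C" "integrable lborel g" "(\<integral>x. \<bar>f x - g x\<bar> \<partial>lborel) < e"
proof -
  have [measurable]: "f \<in> borel_measurable borel" using f by auto
  have C0: "0 \<le> C" using C[of undefined] by linarith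
  define cut where "cut m x = max 0 (min 1 (real m - norm x))" for m and x :: 'a
  have cut01: "0 \<le> cut m x \<and> cut m x \<le> 1" for m x by (auto simp: cut_def)
  have cut_cont: "continuous_on UNIV (cut m)" for m unfolding cut_def by (intro continuous_intros)
  have cut_meas[measurable]: "cut m \<in> borel_measurable borel" for m by (intro borel_measurable_continuous_onI cut_cont)
  have cut_int: "integrable lborel (cut m)" for m
  proof (rule Bochner_Integration.integrable_bound)
    show "integrable lborel (indicat_real (cball (0::'a) m))"
      using emeasure_bounded_finite[of "cball (0::'a) m"] by (intro integrable_real_indicator) auto
    show "AE x in lborel. norm (cut m x) \<le> norm (indicat_real (cball 0 m) x)"
      by (intro AE_I2) (auto simp: cut_def indicator_def)
  qed simp
  have "(\<lambda>m. \<integral>x. \<bar>f x - cut m x * f x\<bar> \<partial>lborel) \<longlonglongrightarrow> (\<integral>x. 0 \<partial>(lborel :: 'a measure))"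
  proof (rule integral_dominated_convergence[where w="\<lambda>x. \<bar>f x\<bar>"])
    show "AE x in lborel. (\<lambda>m. \<bar>f x - cut m x * f x\<bar>) \<longlonglongrightarrow> 0"
    proof (rule AE_I2)
      fix x :: 'a
      obtain k :: nat where k: "norm x + 1 \<le> real k" using real_arch_simple by blast
      have "cut m x = 1" if "m \<ge> k" for m
      proof -
        have "real k \<le> real m" using that by simp
        then show ?thesis using k by (simp add: cut_def)
      qed
      then show "(\<lambda>m. \<bar>f x - cut m x * f x\<bar>) \<longlonglongrightarrow> 0"
        by (intro tendsto_eventually eventually_sequentiallyI[of k]) simp
    qed
    show "AE x in lborel. norm \<bar>f x - cut m x * f x\<bar> \<le> \<bar>f x\<bar>" for m
    proof (rule AE_I2)
      fix x
      have "\<bar>f x - cut m x * f x\<bar> = \<bar>1 - cut m x\<bar> * \<bar>f x\<bar>" by (simp add: abs_mult[symmetric] algebra_simps)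
      also have "\<dots> \<le> 1 * \<bar>f x\<bar>" using cut01[of m x] by (intro mult_right_mono) auto
      finally show "norm \<bar>f x - cut m x * f x\<bar> \<le> \<bar>f x\<bar>" by simp
    qed
  qed (use f in auto)
  then have "\<forall>\<^sub>F m in sequentially. (\<integral>x. \<bar>f x - cut m x * f x\<bar> \<partial>lborel) < e / 2"
    using e by (intro order_tendstoD(2)) auto
  then obtain m where m: "(\<integral>x. \<bar>f x - cut m x * f x\<bar> \<partial>lborel) < e / 2"
    by (auto dest: eventually_happens)
  \<comment> \<open>Measurability in this sense means being the limit of continuous functions off a
    negligible set.\<close>
  have "f measurable_on UNIV"
    by (intro lebesgue_measurable_imp_measurable_on) (simp_all add: measurable_completion)
  then obtain Nn g where N: "negligible Nn" and gc: "\<And>n. continuous_on UNIV (g n)"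
    and gl: "\<And>x. x \<notin> Nn \<Longrightarrow> (\<lambda>n. g n x) \<longlonglongrightarrow> f x"
    unfolding measurable_on_def by auto
  define k where "k n x = cut m x * max (- C) (min C (g n x))" for n x
  have kc: "continuous_on UNIV (k n)" for n unfolding k_def by (intro continuous_intros cut_cont gc)
  have km[measurable]: "k n \<in> borel_measurable borel" for n by (intro borel_measurable_continuous_onI kc)
  have kC': "\<bar>k n x\<bar> \<le> C * cut m x" for n x
  proof -
    have "\<bar>k n x\<bar> = cut m x * \<bar>max (- C) (min C (g n x))\<bar>" using cut01[of m x] by (simp add: k_def abs_mult)
    also have "\<dots> \<le> cut m x * C" using cut01[of m x] C0 by (intro mult_left_mono) auto
    finally show ?thesis by (simp add: mult.commute)
  qed
  have kC: "\<bar>k n x\<bar> \<le> C" for n x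
    using order_trans[OF kC'[of n x] mult_left_mono[of "cut m x" 1 C]] cut01[of m x] C0 by simp
  have ki: "integrable lborel (k n)" for n
  proof (rule Bochner_Integration.integrable_bound)
    show "integrable lborel (\<lambda>x. C * cut m x)" using cut_int by simp
    show "AE x in lborel. norm (k n x) \<le> norm (C * cut m x)"
      using kC' cut01 C0 by (intro AE_I2) (simp add: abs_mult)
  qed simp
  have mf: "integrable lborel (\<lambda>x. cut m x * f x)"
    using integrable_bounded_mult[OF f, of "cut m" 1] cut01 by (simp add: mult.commute abs_le_iff)
  have "(\<lambda>n. \<integral>x. \<bar>cut m x * f x - k n x\<bar> \<partial>lborel) \<longlonglongrightarrow> (\<integral>x. 0 \<partial>(lborel :: 'a measure))"
  proof (rule integral_dominated_convergence[where w="\<lambda>x. 2 * C * cut m x"])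
    have "AE x in lebesgue. x \<notin> Nn" using N by (simp add: negligible_iff_null_sets AE_not_in)
    then have "AE x in lborel. x \<notin> Nn" by (simp add: AE_completion_iff)
    then show "AE x in lborel. (\<lambda>n. \<bar>cut m x * f x - k n x\<bar>) \<longlonglongrightarrow> 0"
    proof eventually_elim
      case (elim x)
      have "(\<lambda>n. \<bar>cut m x * f x - k n x\<bar>) \<longlonglongrightarrow> \<bar>cut m x * f x - cut m x * max (- C) (min C (f x))\<bar>"
        unfolding k_def by (intro tendsto_intros gl elim)
      moreover have "max (- C) (min C (f x)) = f x" using C[of x] by (auto simp: max_def min_def)
      ultimately show ?case by simp
    qed
    show "AE x in lborel. norm \<bar>cut m x * f x - k n x\<bar> \<le> 2 * C * cut m x" for n
    proof (rule AE_I2)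
      fix x
      have "\<bar>cut m x * f x\<bar> \<le> cut m x * C" unfolding abs_mult using cut01[of m x] C by (intro mult_mono) auto
      then have "\<bar>cut m x * f x\<bar> \<le> C * cut m x" by (simp only: mult.commute)
      then show "norm \<bar>cut m x * f x - k n x\<bar> \<le> 2 * C * cut m x" using kC'[of n x] unfolding mult.assoc[of 2] by simp
    qed
  qed (use cut_int in auto)
  then have "\<forall>\<^sub>F n in sequentially. (\<integral>x. \<bar>cut m x * f x - k n x\<bar> \<partial>lborel) < e / 2"
    using e by (intro order_tendstoD(2)) auto
  then obtain n where n: "(\<integral>x. \<bar>cut m x * f x - k n x\<bar> \<partial>lborel) < e / 2"
    by (auto dest: eventually_happens)
  have "(\<integral>x. \<bar>f x - k n x\<bar> \<partial>lborel) \<le> (\<integral>x. \<bar>f x - cut m x * f x\<bar> + \<bar>cut m x * f x - k n x\<bar> \<partial>lborel)"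
    using f mf ki[of n] by (intro integral_mono) auto
  also have "\<dots> = (\<integral>x. \<bar>f x - cut m x * f x\<bar> \<partial>lborel) + (\<integral>x. \<bar>cut m x * f x - k n x\<bar> \<partial>lborel)"
    using f mf ki[of n] by simp
  also have "\<dots> < e" using m n by simp
  finally show ?thesis by (rule that[OF kc kC ki])
qed

text \<open>This is continuity of translation in L1. The test function need not be continuous, so
  the shifted factor is first replaced by a continuous one, with an error uniform in the
  shift.\<close>

lemma autocorr_tendsto:
  fixes \<phi> :: "'a::euclidean_space \<Rightarrow> real"
  assumes \<phi>: "integrable lborel \<phi>" and C: "\<And>x. \<bar>\<phi> x\<bar> \<le> C"
  shows "((\<lambda>s. autocorr \<phi> (h /\<^sub>R s)) \<longlongrightarrow> (\<integral>x. (\<phi> x)\<^sup>2 \<partial>lborel)) at_top"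
proof (rule tendstoI)
  fix e :: real assume e: "0 < e"
  have [measurable]: "\<phi> \<in> borel_measurable borel" using \<phi> by auto
  have C0: "0 \<le> C" using C[of undefined] by linarith
  \<comment> \<open>The error in the autocorrelation is at most \<open>C * d\<close>; the
    denominator makes this less than \<open>e / 3\<close>, also when \<open>C\<close> is 0.\<close>
  define d where "d = e / (3 * (C + 1))"
  have d: "0 < d" using e C0 by (simp add: d_def)
  have Cd: "C * d < e / 3" using e C0 by (simp add: d_def field_simps)
  obtain g where g: "continuous_on UNIV g" "\<And>x. \<bar>g x\<bar> \<le> C" "integrable lborel g" "(\<integral>x. \<bar>\<phi> x - g x\<bar> \<partial>lborel) < d"
    using L1_approx_bounded_continuous[OF \<phi> C d] by blast
  have [measurable]: "g \<in> borel_measurable borel" by (intro borel_measurable_continuous_onI g)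
  define c where "c y = (\<integral>x. \<phi> x * g (x - y) \<partial>lborel)" for y
  have close: "\<bar>autocorr \<phi> y - c y\<bar> < e / 3" for y
  proof -
    have i1: "integrable lborel (\<lambda>x. \<phi> x * \<phi> (x - y))" using C by (intro integrable_bounded_mult[OF \<phi>]) auto
    have i2: "integrable lborel (\<lambda>x. \<phi> x * g (x - y))" using g(2) by (intro integrable_bounded_mult[OF \<phi>]) auto
    have i3: "integrable lborel (\<lambda>x. \<bar>\<phi> x - g x\<bar>)" using \<phi> g(3) by auto
    note t = integrable_lborel_translate[OF i3, of y]
    have "autocorr \<phi> y - c y = (\<integral>x. \<phi> x * (\<phi> (x - y) - g (x - y)) \<partial>lborel)"
      unfolding autocorr_def c_def using i1 i2 by (simp add: right_diff_distrib)
    also have "\<bar>\<dots>\<bar> \<le> (\<integral>x. \<bar>\<phi> x * (\<phi> (x - y) - g (x - y))\<bar> \<partial>lborel)" by (rule integral_abs_bound)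
    also have "\<dots> \<le> (\<integral>x. C * \<bar>\<phi> (x - y) - g (x - y)\<bar> \<partial>lborel)"
    proof (rule integral_mono)
      show "integrable lborel (\<lambda>x. \<bar>\<phi> x * (\<phi> (x - y) - g (x - y))\<bar>)"
        using i1 i2 by (auto simp: right_diff_distrib)
      show "integrable lborel (\<lambda>x. C * \<bar>\<phi> (x - y) - g (x - y)\<bar>)" using t(1) by simp
      show "\<bar>\<phi> x * (\<phi> (x - y) - g (x - y))\<bar> \<le> C * \<bar>\<phi> (x - y) - g (x - y)\<bar>" for x
        unfolding abs_mult using C by (intro mult_right_mono) auto
    qed
    also have "\<dots> = C * (\<integral>x. \<bar>\<phi> x - g x\<bar> \<partial>lborel)" using t(2) by simp
    also have "\<dots> \<le> C * d" using g(4) C0 by (intro mult_left_mono) auto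
    finally show ?thesis using Cd by simp
  qed
  have "((\<lambda>s. c (h /\<^sub>R s)) \<longlongrightarrow> c 0) at_top"
    unfolding c_def
  proof (rule integral_dominated_convergence_at_top[where w="\<lambda>x. C * \<bar>\<phi> x\<bar>"])
    have "((\<lambda>s. h /\<^sub>R s) \<longlongrightarrow> 0) at_top"
      using tendsto_scaleR[OF tendsto_inverse_0_at_top[OF filterlim_ident] tendsto_const[of h]] by simp
    then have "((\<lambda>s. g (x - h /\<^sub>R s)) \<longlongrightarrow> g (x - 0)) at_top" for x
      using g(1) by (intro isCont_tendsto_compose[of _ g] tendsto_intros) (auto simp: continuous_on_eq_continuous_at)
    then show "AE x in lborel. ((\<lambda>s. \<phi> x * g (x - h /\<^sub>R s)) \<longlongrightarrow> \<phi> x * g (x - 0)) at_top"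
      by (intro AE_I2 tendsto_mult tendsto_const)
    show "\<forall>\<^sub>F s in at_top. AE x in lborel. norm (\<phi> x * g (x - h /\<^sub>R s)) \<le> C * \<bar>\<phi> x\<bar>"
      using g(2) by (intro always_eventually allI AE_I2) (auto simp: abs_mult mult.commute[of C] intro!: mult_left_mono)
  qed (use \<phi> in auto)
  then have "\<forall>\<^sub>F s in at_top. dist (c (h /\<^sub>R s)) (c 0) < e / 3" by (rule tendstoD) (use e in simp)
  then show "\<forall>\<^sub>F s in at_top. dist (autocorr \<phi> (h /\<^sub>R s)) (\<integral>x. (\<phi> x)\<^sup>2 \<partial>lborel) < e"
  proof eventually_elim
    case (elim s)
    have "(\<integral>x. (\<phi> x)\<^sup>2 \<partial>lborel) = autocorr \<phi> 0" by (simp add: autocorr_def power2_eq_square)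
    then show ?case using elim close[of "h /\<^sub>R s"] close[of 0] unfolding dist_real_def by linarith
  qed
qed

text \<open>The normalising factor of the limit theorem is absorbed into the test function, which
  makes the L2 norm independent of \<open>s\<close>.\<close>

definition rescale :: "('a::euclidean_space \<Rightarrow> real) \<Rightarrow> real \<Rightarrow> 'a \<Rightarrow> real" where
  "rescale \<phi> s t = s powr (- (real DIM('a) / 2)) * \<phi> (t /\<^sub>R s)"

lemma
  fixes \<phi> :: "'a::euclidean_space \<Rightarrow> real"
  assumes \<phi>: "integrable lborel \<phi>" and C: "\<And>x. \<bar>\<phi> x\<bar> \<le> C" and s: "0 < s"
  shows integrable_rescale: "integrable lborel (rescale \<phi> s)"
    and rescale_le: "\<bar>rescale \<phi> s t\<bar> \<le> s powr (- (real DIM('a) / 2)) * C"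
    and rescale_L1: "(\<integral>t. \<bar>rescale \<phi> s t\<bar> \<partial>lborel) = s powr (real DIM('a) / 2) * (\<integral>x. \<bar>\<phi> x\<bar> \<partial>lborel)"
    and rescale_L2: "(\<integral>t. (rescale \<phi> s t)\<^sup>2 \<partial>lborel) = (\<integral>x. (\<phi> x)\<^sup>2 \<partial>lborel)"
    and autocorr_rescale: "autocorr (rescale \<phi> s) h = autocorr \<phi> (h /\<^sub>R s)"
proof -
  have [measurable]: "\<phi> \<in> borel_measurable borel" using \<phi> by auto
  let ?\<nu> = "real DIM('a)"
  have p: "s ^ DIM('a) = s powr ?\<nu>" using s by (simp add: powr_realpow)
  have p1: "s powr (- (?\<nu> / 2)) * s powr ?\<nu> = s powr (?\<nu> / 2)" by (simp add: powr_add[symmetric])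
  have p2: "s powr (- (?\<nu> / 2)) * s powr (- (?\<nu> / 2)) * s powr ?\<nu> = 1" using s by (simp add: powr_add[symmetric])
  show "integrable lborel (rescale \<phi> s)" unfolding rescale_def by (intro integrable_mult_right integrable_lborel_scale s \<phi>)
  show "\<bar>rescale \<phi> s t\<bar> \<le> s powr (- (?\<nu> / 2)) * C" unfolding rescale_def abs_mult using C by (intro mult_mono) auto
  have "(\<integral>t. \<bar>rescale \<phi> s t\<bar> \<partial>lborel) = s powr (- (?\<nu> / 2)) * (\<integral>t. \<bar>\<phi> (t /\<^sub>R s)\<bar> \<partial>lborel)"
    by (simp add: rescale_def abs_mult)
  also have "\<dots> = s powr (- (?\<nu> / 2)) * s powr ?\<nu> * (\<integral>x. \<bar>\<phi> x\<bar> \<partial>lborel)"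
    using integral_lborel_scale[OF s integrable_abs[OF \<phi>]] by (simp add: p)
  finally show "(\<integral>t. \<bar>rescale \<phi> s t\<bar> \<partial>lborel) = s powr (?\<nu> / 2) * (\<integral>x. \<bar>\<phi> x\<bar> \<partial>lborel)" unfolding p1 .
  have ac: "autocorr (rescale \<phi> s) h = autocorr \<phi> (h /\<^sub>R s)" for h
  proof -
    have i: "integrable lborel (\<lambda>x. \<phi> x * \<phi> (x - h /\<^sub>R s))" using C by (intro integrable_bounded_mult[OF \<phi>]) auto
    have "autocorr (rescale \<phi> s) h = (\<integral>t. s powr (- (?\<nu> / 2)) * s powr (- (?\<nu> / 2)) * (\<phi> (t /\<^sub>R s) * \<phi> (t /\<^sub>R s - h /\<^sub>R s)) \<partial>lborel)"
      unfolding autocorr_def rescale_def by (simp add: scaleR_diff_right mult_ac)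
    also have "\<dots> = s powr (- (?\<nu> / 2)) * s powr (- (?\<nu> / 2)) * (s powr ?\<nu> * autocorr \<phi> (h /\<^sub>R s))"
      using integral_lborel_scale[OF s i] by (simp add: autocorr_def p)
    also have "\<dots> = (s powr (- (?\<nu> / 2)) * s powr (- (?\<nu> / 2)) * s powr ?\<nu>) * autocorr \<phi> (h /\<^sub>R s)" by (simp only: mult.assoc)
    finally show ?thesis unfolding p2 by simp
  qed
  show "autocorr (rescale \<phi> s) h = autocorr \<phi> (h /\<^sub>R s)" by (rule ac)
  show "(\<integral>t. (rescale \<phi> s t)\<^sup>2 \<partial>lborel) = (\<integral>x. (\<phi> x)\<^sup>2 \<partial>lborel)"
    using ac[of 0] by (simp add: autocorr_def power2_eq_square)
qed

text \<open>In autocorrelation form the scale appears only in the argument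
  \<open>h /\<^sub>R s\<close>, and the integrand is dominated by the kernel times the squared L2
  norm.\<close>

lemma quadratic_form_rescale_tendsto:
  fixes \<phi> r :: "'a::euclidean_space \<Rightarrow> real"
  assumes \<phi>: "integrable lborel \<phi>" and C: "\<And>x. \<bar>\<phi> x\<bar> \<le> C" and r: "integrable lborel r"
  shows "((\<lambda>s. \<integral>t. \<integral>t'. rescale \<phi> s t * rescale \<phi> s t' * r (t - t') \<partial>lborel \<partial>lborel) \<longlongrightarrow>
    (\<integral>x. (\<phi> x)\<^sup>2 \<partial>lborel) * (\<integral>h. r h \<partial>lborel)) at_top"
proof -
  have [measurable]: "r \<in> borel_measurable borel" "autocorr \<phi> \<in> borel_measurable borel"
    using r borel_measurable_autocorr[OF \<phi> C r] by auto
  define A where "A = (\<integral>x. (\<phi> x)\<^sup>2 \<partial>lborel)"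
  have "((\<lambda>s. \<integral>h. r h * autocorr \<phi> (h /\<^sub>R s) \<partial>lborel) \<longlongrightarrow> (\<integral>h. r h * A \<partial>lborel)) at_top"
  proof (rule integral_dominated_convergence_at_top[where w="\<lambda>h. \<bar>r h\<bar> * A"])
    show "AE h in lborel. ((\<lambda>s. r h * autocorr \<phi> (h /\<^sub>R s)) \<longlongrightarrow> r h * A) at_top"
      unfolding A_def by (intro AE_I2 tendsto_mult tendsto_const autocorr_tendsto[OF \<phi> C])
    show "\<forall>\<^sub>F s in at_top. AE h in lborel. norm (r h * autocorr \<phi> (h /\<^sub>R s)) \<le> \<bar>r h\<bar> * A"
      unfolding A_def real_norm_def abs_mult
      by (intro always_eventually allI AE_I2 mult_left_mono abs_autocorr_le[OF \<phi> C]) auto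
  qed (use r in auto)
  moreover have "\<forall>\<^sub>F s in at_top. (\<integral>h. r h * autocorr \<phi> (h /\<^sub>R s) \<partial>lborel) =
     (\<integral>t. \<integral>t'. rescale \<phi> s t * rescale \<phi> s t' * r (t - t') \<partial>lborel \<partial>lborel)"
    using eventually_gt_at_top[of 0]
  proof eventually_elim
    case (elim s)
    show ?case
      unfolding quadratic_form_eq_autocorr[OF integrable_rescale[OF \<phi> C elim] rescale_le[OF \<phi> C elim] r]
        autocorr_rescale[OF \<phi> C elim] ..
  qed
  ultimately have "((\<lambda>s. \<integral>t. \<integral>t'. rescale \<phi> s t * rescale \<phi> s t' * r (t - t') \<partial>lborel \<partial>lborel) \<longlongrightarrow> (\<integral>h. r h * A \<partial>lborel)) at_top"
    by (rule Lim_transform_eventually)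
  then show ?thesis by (simp add: A_def mult.commute)
qed

section \<open>A central limit theorem for finite-range dependent fields\<close>

text \<open>Lists of points rather than sets allow repeated factors, so powers of the field at one
  point are covered. The bound \<open>B\<close> holds for every outcome, which makes all moments
  finite and lets exponential series be integrated term by term.\<close>

locale finite_range_field = prob_space M for M :: "'w measure" +
  fixes Z :: "'a::euclidean_space \<Rightarrow> 'w \<Rightarrow> real" and B r :: real
  assumes Z_pair: "(\<lambda>p. Z (fst p) (snd p)) \<in> borel_measurable (borel \<Otimes>\<^sub>M M)"
    and Z_le: "\<And>t \<omega>. \<bar>Z t \<omega>\<bar> \<le> B"
    and Z_centered: "\<And>t. (\<integral>\<omega>. Z t \<omega> \<partial>M) = 0"
    and Z_indep: "\<And>ts ss. (\<And>t s. t \<in> set ts \<Longrightarrow> s \<in> set ss \<Longrightarrow> r < dist t s) \<Longrightarrow>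
      (\<integral>\<omega>. (\<Prod>t\<leftarrow>ts. Z t \<omega>) * (\<Prod>s\<leftarrow>ss. Z s \<omega>) \<partial>M) = (\<integral>\<omega>. (\<Prod>t\<leftarrow>ts. Z t \<omega>) \<partial>M) * (\<integral>\<omega>. (\<Prod>s\<leftarrow>ss. Z s \<omega>) \<partial>M)"
    and r_nonneg: "0 \<le> r"
begin

sublocale lM: pair_sigma_finite lborel M ..

lemma Z_measurable[measurable (raw)]:
  assumes [measurable]: "f \<in> borel_measurable N" "g \<in> N \<rightarrow>\<^sub>M M"
  shows "(\<lambda>x. Z (f x) (g x)) \<in> borel_measurable N"
  using measurable_compose[OF measurable_Pair[OF assms] Z_pair] by simp

lemma B_nonneg: "0 \<le> B"
  using Z_le[of undefined undefined] by linarith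

lemma integrable_bounded_rv:
  fixes V :: "'w \<Rightarrow> 'b::{banach, second_countable_topology}"
  shows "V \<in> borel_measurable M \<Longrightarrow> (\<And>\<omega>. norm (V \<omega>) \<le> K) \<Longrightarrow> integrable M V"
  by (rule integrable_const_bound[where B=K]) auto

lemma
  fixes F :: "'a \<Rightarrow> 'w \<Rightarrow> 'b::{banach, second_countable_topology}" and b :: "'a \<Rightarrow> real"
  assumes b: "integrable lborel b" and F: "(\<lambda>p. F (fst p) (snd p)) \<in> borel_measurable (borel \<Otimes>\<^sub>M M)"
    and K: "\<And>s \<omega>. norm (F s \<omega>) \<le> K"
  shows expectation_integral_swap: "(\<integral>\<omega>. \<integral>s. b s *\<^sub>R F s \<omega> \<partial>lborel \<partial>M) = (\<integral>s. b s *\<^sub>R (\<integral>\<omega>. F s \<omega> \<partial>M) \<partial>lborel)"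
    and integrable_expectation: "integrable lborel (\<lambda>s. b s *\<^sub>R (\<integral>\<omega>. F s \<omega> \<partial>M))"
    and integrable_path: "\<omega> \<in> space M \<Longrightarrow> integrable lborel (\<lambda>s. b s *\<^sub>R F s \<omega>)"
    and norm_integral_path_le: "norm (\<integral>s. b s *\<^sub>R F s \<omega> \<partial>lborel) \<le> K * (\<integral>s. \<bar>b s\<bar> \<partial>lborel)"
    and measurable_path_integral: "(\<lambda>\<omega>. \<integral>s. b s *\<^sub>R F s \<omega> \<partial>lborel) \<in> borel_measurable M"
proof -
  have bm[measurable]: "b \<in> borel_measurable borel" using b by auto
  have K0: "0 \<le> K" using K[of undefined undefined] norm_ge_zero order_trans by blast
  have Fm[measurable]: "(\<lambda>(s, \<omega>). F s \<omega>) \<in> borel_measurable (borel \<Otimes>\<^sub>M M)"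
    using F by (simp add: case_prod_beta')
  have Fm'[measurable]: "(\<lambda>(\<omega>, s). F s \<omega>) \<in> borel_measurable (M \<Otimes>\<^sub>M borel)"
    using measurable_compose[OF measurable_pair_swap' Fm] by (simp add: case_prod_beta')
  have Fs[measurable]: "F s \<in> borel_measurable M" for s
    using measurable_compose[OF measurable_Pair1'[of s borel M] Fm] by simp
  have Fw[measurable]: "(\<lambda>s. F s \<omega>) \<in> borel_measurable borel" if "\<omega> \<in> space M" for \<omega>
    using measurable_compose[OF measurable_Pair2'[OF that, of borel] Fm] by simp
  have iF: "integrable M (\<lambda>\<omega>. F s \<omega>)" for s using K by (intro integrable_bounded_rv) auto
  show path: "integrable lborel (\<lambda>s. b s *\<^sub>R F s \<omega>)" if "\<omega> \<in> space M" for \<omega>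
  proof (rule Bochner_Integration.integrable_bound)
    show "integrable lborel (\<lambda>s. K * b s)" using b by simp
    show "AE s in lborel. norm (b s *\<^sub>R F s \<omega>) \<le> norm (K * b s)"
      using K K0 by (intro AE_I2) (auto simp: abs_mult mult.commute[of K] intro!: mult_left_mono)
  qed (use Fw[OF that] in measurable)
  have int: "integrable (lborel \<Otimes>\<^sub>M M) (\<lambda>(s, \<omega>). b s *\<^sub>R F s \<omega>)"
  proof (rule lM.Fubini_integrable)
    have "integrable lborel (\<lambda>s. \<bar>b s\<bar> * (\<integral>\<omega>. norm (F s \<omega>) \<partial>M))"
    proof (rule Bochner_Integration.integrable_bound)
      show "integrable lborel (\<lambda>s. K * b s)" using b by simp
      have "(\<integral>\<omega>. norm (F s \<omega>) \<partial>M) \<le> K" for s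
        using iF[of s] K by (intro integral_le_const) auto
      moreover have "0 \<le> (\<integral>\<omega>. norm (F s \<omega>) \<partial>M)" for s by simp
      ultimately show "AE s in lborel. norm (\<bar>b s\<bar> * (\<integral>\<omega>. norm (F s \<omega>) \<partial>M)) \<le> norm (K * b s)"
        using K0 by (intro AE_I2) (auto simp: abs_mult mult.commute[of K] intro!: mult_left_mono)
    qed measurable
    then show "integrable lborel (\<lambda>s. \<integral>\<omega>. norm (case (s, \<omega>) of (s, \<omega>) \<Rightarrow> b s *\<^sub>R F s \<omega>) \<partial>M)"
      by simp
    show "AE s in lborel. integrable M (\<lambda>\<omega>. case (s, \<omega>) of (s, \<omega>) \<Rightarrow> b s *\<^sub>R F s \<omega>)"
      using iF by simp
  qed measurable
  show "(\<integral>\<omega>. \<integral>s. b s *\<^sub>R F s \<omega> \<partial>lborel \<partial>M) = (\<integral>s. b s *\<^sub>R (\<integral>\<omega>. F s \<omega> \<partial>M) \<partial>lborel)"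
    using lM.Fubini_integral[OF int] by simp
  show "integrable lborel (\<lambda>s. b s *\<^sub>R (\<integral>\<omega>. F s \<omega> \<partial>M))"
    using lM.integrable_fst[OF int] by simp
  show "norm (\<integral>s. b s *\<^sub>R F s \<omega> \<partial>lborel) \<le> K * (\<integral>s. \<bar>b s\<bar> \<partial>lborel)"
  proof (cases "integrable lborel (\<lambda>s. b s *\<^sub>R F s \<omega>)")
    case True
    have "norm (\<integral>s. b s *\<^sub>R F s \<omega> \<partial>lborel) \<le> (\<integral>s. norm (b s *\<^sub>R F s \<omega>) \<partial>lborel)"
      by (rule integral_norm_bound)
    also have "\<dots> \<le> (\<integral>s. K * \<bar>b s\<bar> \<partial>lborel)"
      using integrable_norm[OF True] b K by (intro integral_mono) (auto simp: mult.commute[of K] intro!: mult_left_mono)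
    finally show ?thesis by simp
  next
    case False
    then show ?thesis using K0 by (simp add: not_integrable_integral_eq)
  qed
  show "(\<lambda>\<omega>. \<integral>s. b s *\<^sub>R F s \<omega> \<partial>lborel) \<in> borel_measurable M"
    by measurable
qed

section \<open>Path integrals and their mixed moments\<close>

definition S :: "('a \<Rightarrow> real) \<Rightarrow> 'w \<Rightarrow> real" where
  "S b \<omega> = (\<integral>s. b s * Z s \<omega> \<partial>lborel)"

lemma
  assumes b: "integrable lborel b"
  shows S_measurable[measurable]: "S b \<in> borel_measurable M"
    and S_le: "\<bar>S b \<omega>\<bar> \<le> B * (\<integral>s. \<bar>b s\<bar> \<partial>lborel)"
    and integrable_Z_path: "\<omega> \<in> space M \<Longrightarrow> integrable lborel (\<lambda>s. b s * Z s \<omega>)"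
  using measurable_path_integral[OF b Z_pair, of B] norm_integral_path_le[OF b Z_pair, of B \<omega>]
    integrable_path[OF b Z_pair, of B \<omega>] Z_le
  by (simp_all add: S_def[abs_def])

lemma expectation_mult_S:
  fixes V :: "'w \<Rightarrow> 'b::{banach, second_countable_topology}"
  assumes b: "integrable lborel b" and V[measurable]: "V \<in> borel_measurable M" and K: "\<And>\<omega>. norm (V \<omega>) \<le> K"
  shows "(\<integral>\<omega>. S b \<omega> *\<^sub>R V \<omega> \<partial>M) = (\<integral>s. b s *\<^sub>R (\<integral>\<omega>. Z s \<omega> *\<^sub>R V \<omega> \<partial>M) \<partial>lborel)"
proof -
  have K0: "0 \<le> K" using K[of undefined] norm_ge_zero order_trans by blast
  have "(\<integral>\<omega>. S b \<omega> *\<^sub>R V \<omega> \<partial>M) = (\<integral>\<omega>. \<integral>s. b s *\<^sub>R (Z s \<omega> *\<^sub>R V \<omega>) \<partial>lborel \<partial>M)"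
  proof (rule Bochner_Integration.integral_cong[OF refl])
    fix \<omega> assume "\<omega> \<in> space M"
    from integral_scaleR_left[OF integrable_Z_path[OF b this], of "V \<omega>"]
    show "S b \<omega> *\<^sub>R V \<omega> = (\<integral>s. b s *\<^sub>R (Z s \<omega> *\<^sub>R V \<omega>) \<partial>lborel)" by (simp add: S_def)
  qed
  also have "\<dots> = (\<integral>s. b s *\<^sub>R (\<integral>\<omega>. Z s \<omega> *\<^sub>R V \<omega> \<partial>M) \<partial>lborel)"
  proof (rule expectation_integral_swap[OF b])
    show "norm (Z s \<omega> *\<^sub>R V \<omega>) \<le> B * K" for s \<omega>
      using Z_le[of s \<omega>] K[of \<omega>] B_nonneg by (auto intro!: mult_mono)
  qed measurable
  finally show ?thesis .
qed

lemma prod_list_measurable[measurable]: "(\<lambda>\<omega>. \<Prod>s\<leftarrow>ss. Z s \<omega>) \<in> borel_measurable M"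
  by (induction ss) auto

lemma prod_list_le: "\<bar>\<Prod>s\<leftarrow>ss. Z s \<omega>\<bar> \<le> B ^ length ss"
  by (induction ss) (auto simp: abs_mult intro!: mult_mono Z_le B_nonneg)

text \<open>Factorisation of mixed moments takes the place of the independence of \<open>Z t\<close> from a \<open>\<sigma>\<close>-algebra.\<close>

lemma expectation_far_power:
  assumes b: "integrable lborel b" and far: "\<And>s. b s \<noteq> 0 \<Longrightarrow> r < dist t s"
    and ss: "\<And>s. s \<in> set ss \<Longrightarrow> r < dist t s"
  shows "(\<integral>\<omega>. Z t \<omega> * (\<Prod>s\<leftarrow>ss. Z s \<omega>) * S b \<omega> ^ k \<partial>M) = 0"
  \<comment> \<open>The list is generalised: writing one factor \<open>S b\<close> as an integral
    adds its integration variable to the list, and this point is again far from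
    \<open>t\<close>.\<close>
  using ss
proof (induction k arbitrary: ss)
  case 0
  then show ?case using Z_indep[of "[t]" ss] Z_centered by simp
next
  case (Suc k)
  let ?C = "B * (\<integral>s. \<bar>b s\<bar> \<partial>lborel)"
  have "(\<integral>\<omega>. Z t \<omega> * (\<Prod>s\<leftarrow>ss. Z s \<omega>) * S b \<omega> ^ Suc k \<partial>M) =
    (\<integral>\<omega>. S b \<omega> *\<^sub>R (Z t \<omega> * (\<Prod>s\<leftarrow>ss. Z s \<omega>) * S b \<omega> ^ k) \<partial>M)"
    by (simp add: mult_ac)
  also have "\<dots> = (\<integral>s. b s *\<^sub>R (\<integral>\<omega>. Z s \<omega> *\<^sub>R (Z t \<omega> * (\<Prod>s\<leftarrow>ss. Z s \<omega>) * S b \<omega> ^ k) \<partial>M) \<partial>lborel)"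
  proof (rule expectation_mult_S[OF b])
    show "norm (Z t \<omega> * (\<Prod>s\<leftarrow>ss. Z s \<omega>) * S b \<omega> ^ k) \<le> B * B ^ length ss * ?C ^ k" for \<omega>
      unfolding real_norm_def abs_mult power_abs using B_nonneg
      by (intro mult_mono Z_le prod_list_le power_mono S_le[OF b]) auto
  qed (use b in measurable)
  also have "\<dots> = (\<integral>s. 0 \<partial>(lborel :: 'a measure))"
  proof (rule Bochner_Integration.integral_cong[OF refl])
    fix s
    show "b s *\<^sub>R (\<integral>\<omega>. Z s \<omega> *\<^sub>R (Z t \<omega> * (\<Prod>s\<leftarrow>ss. Z s \<omega>) * S b \<omega> ^ k) \<partial>M) = 0"
    proof (cases "b s = 0")
      case False
      have "(\<integral>\<omega>. Z t \<omega> * (\<Prod>s\<leftarrow>s # ss. Z s \<omega>) * S b \<omega> ^ k \<partial>M) = 0"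
        by (rule Suc.IH) (use Suc.prems far[OF False] in auto)
      then show ?thesis by (simp add: mult_ac)
    qed simp
  qed
  finally show ?case by simp
qed

text \<open>Every Taylor polynomial of the exponential has vanishing mixed expectation with
  \<open>Z t\<close>, by the far power lemma. Since \<open>S b\<close> is bounded, the remainder is
  of order C^(n+1)/(n+1)! uniformly in the outcome and tends to 0.\<close>

lemma expectation_far_iexp:
  assumes b: "integrable lborel b" and far: "\<And>s. b s \<noteq> 0 \<Longrightarrow> r < dist t s"
  shows "(\<integral>\<omega>. Z t \<omega> *\<^sub>R iexp (\<theta> * S b \<omega>) \<partial>M) = 0"
proof -
  define C where "C = \<bar>\<theta>\<bar> * (B * (\<integral>s. \<bar>b s\<bar> \<partial>lborel))"
  have C0: "0 \<le> C" unfolding C_def using B_nonneg by simp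
  have C: "\<bar>\<theta> * S b \<omega>\<bar> \<le> C" for \<omega>
    unfolding C_def abs_mult by (intro mult_left_mono S_le[OF b]) auto
  note [measurable] = S_measurable[OF b]
  have le: "norm (\<integral>\<omega>. Z t \<omega> *\<^sub>R iexp (\<theta> * S b \<omega>) \<partial>M) \<le> B * (C ^ Suc n / fact (Suc n))" for n
  proof -
    define P where "P \<omega> = (\<Sum>k\<le>n. (\<i> * (\<theta> * S b \<omega>)) ^ k / fact k)" for \<omega>
    have Pk: "Z t \<omega> *\<^sub>R P \<omega> = (\<Sum>k\<le>n. (Z t \<omega> * S b \<omega> ^ k) *\<^sub>R ((\<i> * \<theta>) ^ k / fact k))" for \<omega>
      unfolding P_def scaleR_sum_right by (intro sum.cong refl) (simp add: scaleR_conv_of_real power_mult_distrib)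
    have ik: "integrable M (\<lambda>\<omega>. Z t \<omega> * S b \<omega> ^ k)" for k
    proof (rule integrable_bounded_rv[where K="B * (B * (\<integral>s. \<bar>b s\<bar> \<partial>lborel)) ^ k"])
      show "norm (Z t \<omega> * S b \<omega> ^ k) \<le> B * (B * (\<integral>s. \<bar>b s\<bar> \<partial>lborel)) ^ k" for \<omega>
        unfolding real_norm_def abs_mult power_abs using B_nonneg
        by (intro mult_mono Z_le power_mono S_le[OF b]) auto
    qed measurable
    have iP: "integrable M (\<lambda>\<omega>. Z t \<omega> *\<^sub>R P \<omega>)" unfolding Pk using ik by (intro Bochner_Integration.integrable_sum integrable_scaleR_left) auto
    have P0: "(\<integral>\<omega>. Z t \<omega> *\<^sub>R P \<omega> \<partial>M) = 0"
      unfolding Pk using ik expectation_far_power[where ss="[]" and t=t, OF b far] by simp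
    have ie: "integrable M (\<lambda>\<omega>. Z t \<omega> *\<^sub>R iexp (\<theta> * S b \<omega>))"
      by (rule integrable_bounded_rv[where K=B]) (auto simp: Z_le)
    have "(\<integral>\<omega>. Z t \<omega> *\<^sub>R iexp (\<theta> * S b \<omega>) \<partial>M) = (\<integral>\<omega>. Z t \<omega> *\<^sub>R (iexp (\<theta> * S b \<omega>) - P \<omega>) \<partial>M)"
      using iP ie P0 by (simp add: scaleR_diff_right)
    also have "norm \<dots> \<le> B * (C ^ Suc n / fact (Suc n))"
    proof (rule order_trans[OF integral_norm_bound integral_le_const])
      show "integrable M (\<lambda>\<omega>. norm (Z t \<omega> *\<^sub>R (iexp (\<theta> * S b \<omega>) - P \<omega>)))"
        using iP ie by (simp add: scaleR_diff_right)
      show "AE \<omega> in M. norm (Z t \<omega> *\<^sub>R (iexp (\<theta> * S b \<omega>) - P \<omega>)) \<le> B * (C ^ Suc n / fact (Suc n))"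
      proof (rule AE_I2)
        fix \<omega>
        have "cmod (iexp (\<theta> * S b \<omega>) - P \<omega>) \<le> \<bar>\<theta> * S b \<omega>\<bar> ^ Suc n / fact (Suc n)"
          unfolding P_def using iexp_approx1[of "\<theta> * S b \<omega>" n] by simp
        also have "\<dots> \<le> C ^ Suc n / fact (Suc n)" by (intro divide_right_mono power_mono C) auto
        finally show "norm (Z t \<omega> *\<^sub>R (iexp (\<theta> * S b \<omega>) - P \<omega>)) \<le> B * (C ^ Suc n / fact (Suc n))"
          unfolding norm_scaleR real_norm_def using Z_le B_nonneg by (intro mult_mono) auto
      qed
    qed
    finally show ?thesis .
  qed
  have "(\<lambda>n. C ^ n / fact n) \<longlonglongrightarrow> 0"
    using summable_LIMSEQ_zero[OF summable_exp[of C]] by (simp add: divide_inverse mult.commute)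
  from tendsto_mult_left[OF LIMSEQ_Suc[OF this], of B]
  have "norm (\<integral>\<omega>. Z t \<omega> *\<^sub>R iexp (\<theta> * S b \<omega>) \<partial>M) \<le> B * 0"
    by (rule LIMSEQ_le_const) (use le in auto)
  then show ?thesis by simp
qed

lemma integral_diff_mult_add_null:
  fixes f g h :: "'b \<Rightarrow> complex"
  assumes "integrable K f" "integrable K g" "integrable K h" "(\<integral>x. h x \<partial>K) = 0"
  shows "(\<integral>x. f x \<partial>K) - c * (\<integral>x. g x \<partial>K) = (\<integral>x. f x - c * g x - h x \<partial>K)"
  using assms by simp

lemma norm_integral_le_integral:
  fixes f :: "'b \<Rightarrow> 'c::{banach, second_countable_topology}"
  assumes h: "integrable K h" and le: "\<And>x. norm (f x) \<le> h x"
  shows "norm (\<integral>x. f x \<partial>K) \<le> (\<integral>x. h x \<partial>K)"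
proof (cases "integrable K f")
  case True
  have "norm (\<integral>x. f x \<partial>K) \<le> (\<integral>x. norm (f x) \<partial>K)" by (rule integral_norm_bound)
  also have "\<dots> \<le> (\<integral>x. h x \<partial>K)" using True h le by (intro integral_mono) auto
  finally show ?thesis .
next
  \<comment> \<open>The Bochner integral of a non-integrable function is 0, and \<open>h\<close> is
    nonnegative.\<close>
  case False
  have "0 \<le> h x" for x using norm_ge_zero[of "f x"] le[of x] by linarith
  then show ?thesis using False by (simp add: not_integrable_integral_eq)
qed

lemma expectation_abs_le_sqrt:
  fixes R :: "'w \<Rightarrow> real"
  assumes R[measurable]: "R \<in> borel_measurable M" and K: "\<And>\<omega>. \<bar>R \<omega>\<bar> \<le> K"
  shows "(\<integral>\<omega>. \<bar>R \<omega>\<bar> \<partial>M) \<le> sqrt (\<integral>\<omega>. (R \<omega>)\<^sup>2 \<partial>M)"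
proof -
  have i: "integrable M (\<lambda>\<omega>. \<bar>R \<omega>\<bar>)" by (rule integrable_bounded_rv[where K=K]) (auto simp: K)
  have "norm (\<bar>R \<omega>\<bar>\<^sup>2) \<le> K\<^sup>2" for \<omega> using power_mono[OF K[of \<omega>], of 2] by simp
  then have i2: "integrable M (\<lambda>\<omega>. \<bar>R \<omega>\<bar>\<^sup>2)" by (intro integrable_bounded_rv[where K="K\<^sup>2"]) auto
  have "0 \<le> variance (\<lambda>\<omega>. \<bar>R \<omega>\<bar>)" by simp
  then have "(\<integral>\<omega>. \<bar>R \<omega>\<bar> \<partial>M)\<^sup>2 \<le> (\<integral>\<omega>. (R \<omega>)\<^sup>2 \<partial>M)"
    unfolding variance_eq[OF i i2] by simp
  then show ?thesis by (rule real_le_rsqrt)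
qed

text \<open>For a bounded variable the second-order Taylor remainder of the exponential is at most
  K^2/2 times the square of the increment, uniformly in the outcome.\<close>

lemma vector_derivative_expectation_iexp:
  assumes Y[measurable]: "Y \<in> borel_measurable M" and K: "\<And>\<omega>. \<bar>Y \<omega>\<bar> \<le> K"
  shows "((\<lambda>\<theta>. \<integral>\<omega>. iexp (\<theta> * Y \<omega>) \<partial>M) has_vector_derivative \<i> * (\<integral>\<omega>. Y \<omega> *\<^sub>R iexp (\<theta> * Y \<omega>) \<partial>M)) (at \<theta>)"
proof -
  define \<psi> where "\<psi> \<theta> = (\<integral>\<omega>. iexp (\<theta> * Y \<omega>) \<partial>M)" for \<theta>
  define d where "d = \<i> * (\<integral>\<omega>. Y \<omega> *\<^sub>R iexp (\<theta> * Y \<omega>) \<partial>M)"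
  have i1: "integrable M (\<lambda>\<omega>. iexp (\<theta> * Y \<omega>))" for \<theta>
    by (rule integrable_bounded_rv[where K=1]) auto
  have i2: "integrable M (\<lambda>\<omega>. Y \<omega> *\<^sub>R iexp (\<theta> * Y \<omega>))" for \<theta>
    by (rule integrable_bounded_rv[where K=K]) (auto simp: K)
  have le: "norm (\<psi> y - \<psi> \<theta> - (y - \<theta>) *\<^sub>R d) \<le> K\<^sup>2 / 2 * \<bar>y - \<theta>\<bar> ^ 2" for y
  proof -
    have eq: "iexp (y * Y \<omega>) - iexp (\<theta> * Y \<omega>) - ((y - \<theta>) *\<^sub>R (\<i> * (Y \<omega> *\<^sub>R iexp (\<theta> * Y \<omega>)))) =
       iexp (\<theta> * Y \<omega>) * (iexp ((y - \<theta>) * Y \<omega>) - (1 + \<i> * ((y - \<theta>) * Y \<omega>)))" for \<omega>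
    proof -
      have "iexp (y * Y \<omega>) = iexp (\<theta> * Y \<omega>) * iexp ((y - \<theta>) * Y \<omega>)"
        by (simp add: exp_add[symmetric] algebra_simps)
      then show ?thesis by (simp add: algebra_simps scaleR_conv_of_real)
    qed
    have "\<psi> y - \<psi> \<theta> - (y - \<theta>) *\<^sub>R d = (\<integral>\<omega>. iexp (y * Y \<omega>) - iexp (\<theta> * Y \<omega>) - ((y - \<theta>) *\<^sub>R (\<i> * (Y \<omega> *\<^sub>R iexp (\<theta> * Y \<omega>)))) \<partial>M)"
    proof -
      define D where "D \<omega> = \<i> * (Y \<omega> *\<^sub>R iexp (\<theta> * Y \<omega>))" for \<omega>
      have iD: "integrable M D" unfolding D_def using i2 by (rule integrable_mult_right)
      have "d = (\<integral>\<omega>. D \<omega> \<partial>M)" unfolding d_def D_def by (rule integral_mult_right_zero[symmetric])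
      then show ?thesis
        unfolding \<psi>_def D_def[symmetric] using i1[of y] i1[of \<theta>] iD by (simp del: of_real_mult)
    qed
    also have "norm \<dots> \<le> K\<^sup>2 / 2 * \<bar>y - \<theta>\<bar> ^ 2"
    proof (rule order_trans[OF integral_norm_bound integral_le_const])
      show "integrable M (\<lambda>\<omega>. norm (iexp (y * Y \<omega>) - iexp (\<theta> * Y \<omega>) - ((y - \<theta>) *\<^sub>R (\<i> * (Y \<omega> *\<^sub>R iexp (\<theta> * Y \<omega>))))))"
        using i1 i2[of \<theta>] by (intro integrable_norm Bochner_Integration.integrable_diff integrable_scaleR_right integrable_mult_right) auto
      show "AE \<omega> in M. norm (iexp (y * Y \<omega>) - iexp (\<theta> * Y \<omega>) - ((y - \<theta>) *\<^sub>R (\<i> * (Y \<omega> *\<^sub>R iexp (\<theta> * Y \<omega>))))) \<le> K\<^sup>2 / 2 * \<bar>y - \<theta>\<bar> ^ 2"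
      proof (rule AE_I2)
        fix \<omega>
        have "cmod (iexp ((y - \<theta>) * Y \<omega>) - (1 + \<i> * ((y - \<theta>) * Y \<omega>))) \<le> \<bar>(y - \<theta>) * Y \<omega>\<bar>\<^sup>2 / 2"
          using iexp_approx1[of "(y - \<theta>) * Y \<omega>" 1] by (simp add: numeral_2_eq_2)
        also have "\<dots> = \<bar>y - \<theta>\<bar> ^ 2 * \<bar>Y \<omega>\<bar> ^ 2 / 2" by (simp add: power_mult_distrib)
        also have "\<dots> \<le> \<bar>y - \<theta>\<bar> ^ 2 * K ^ 2 / 2"
          by (intro divide_right_mono mult_left_mono power_mono K) auto
        finally show "norm (iexp (y * Y \<omega>) - iexp (\<theta> * Y \<omega>) - ((y - \<theta>) *\<^sub>R (\<i> * (Y \<omega> *\<^sub>R iexp (\<theta> * Y \<omega>))))) \<le> K\<^sup>2 / 2 * \<bar>y - \<theta>\<bar> ^ 2"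
          unfolding eq by (simp add: norm_mult mult_ac)
      qed
    qed
    finally show ?thesis .
  qed
  have ev: "norm ((1 / norm (y - \<theta>)) *\<^sub>R (\<psi> y - (\<psi> \<theta> + (y - \<theta>) *\<^sub>R d))) \<le> K\<^sup>2 / 2 * \<bar>y - \<theta>\<bar>" if "y \<noteq> \<theta>" for y
  proof -
    define x where "x = \<bar>y - \<theta>\<bar>"
    have x: "0 < x" using that by (simp add: x_def)
    have "norm ((1 / norm (y - \<theta>)) *\<^sub>R (\<psi> y - (\<psi> \<theta> + (y - \<theta>) *\<^sub>R d))) = norm (\<psi> y - \<psi> \<theta> - (y - \<theta>) *\<^sub>R d) / x"
      by (simp add: x_def diff_diff_eq)
    also have "\<dots> \<le> (K\<^sup>2 / 2 * x ^ 2) / x" using le[of y] x unfolding x_def by (intro divide_right_mono) auto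
    also have "\<dots> = K\<^sup>2 / 2 * x" using x by (simp add: power2_eq_square)
    finally show ?thesis by (simp only: x_def)
  qed
  have "((\<lambda>y. (1 / norm (y - \<theta>)) *\<^sub>R (\<psi> y - (\<psi> \<theta> + (y - \<theta>) *\<^sub>R d))) \<longlongrightarrow> 0) (at \<theta>)"
  proof (rule Lim_null_comparison)
    show "\<forall>\<^sub>F y in at \<theta>. norm ((1 / norm (y - \<theta>)) *\<^sub>R (\<psi> y - (\<psi> \<theta> + (y - \<theta>) *\<^sub>R d))) \<le> K\<^sup>2 / 2 * \<bar>y - \<theta>\<bar>"
      unfolding eventually_at_filter by (intro always_eventually allI impI ev)
    have "((\<lambda>y. K\<^sup>2 / 2 * \<bar>y - \<theta>\<bar>) \<longlongrightarrow> K\<^sup>2 / 2 * \<bar>\<theta> - \<theta>\<bar>) (at \<theta>)" by (intro tendsto_intros)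
    then show "((\<lambda>y. K\<^sup>2 / 2 * \<bar>y - \<theta>\<bar>) \<longlongrightarrow> 0) (at \<theta>)" by simp
  qed
  then show ?thesis
    unfolding \<psi>_def[symmetric] d_def[symmetric] has_vector_derivative_def has_derivative_within
    by (auto intro!: bounded_linear_scaleR_left)
qed

text \<open>The part of \<open>S a\<close> farther than \<open>r\<close> from \<open>t\<close> is
  uncorrelated with \<open>Z t\<close> even after exponentiation. Expanding the near part N_t to
  first order turns E[Z_t exp(i\<theta>S)] into i\<theta> E[Z_t N_t exp(i\<theta>S)]; the quadratic
  remainder produces the first error term. Integrated against \<open>a\<close>, the products Z_t N_t
  form a variable \<open>QQ\<close> with mean \<open>v\<close>. Replacing it by \<open>v\<close>
  costs at most its standard deviation, the second error term. What remains is the differential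
  equation of the Gaussian characteristic function with a bounded defect.\<close>

lemma expectation_finite_range:
  assumes a: "integrable lborel a" and \<alpha>: "\<And>s. \<bar>a s\<bar> \<le> \<alpha>"
  defines "A \<equiv> (\<integral>s. \<bar>a s\<bar> \<partial>lborel)" and "n \<equiv> \<alpha> * B * measure lborel (cball (0::'a) r)"
    and "v \<equiv> (\<integral>\<omega>. (S a \<omega>)\<^sup>2 \<partial>M)"
  shows "cmod ((\<integral>\<omega>. iexp (S a \<omega>) \<partial>M) - exp (- v / 2)) \<le>
    A * B * n\<^sup>2 / 2 + sqrt (A * \<alpha> * measure lborel (cball (0::'a) (3 * r)) * (2 * B * n)\<^sup>2)"
proof -
  have \<alpha>0: "0 \<le> \<alpha>" using \<alpha>[of 0] by linarith
  have A0: "0 \<le> A" by (simp add: A_def)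
  have n0: "0 \<le> n" by (simp add: n_def \<alpha>0 B_nonneg)
  have [measurable]: "a \<in> borel_measurable borel" using a by auto
  note Sa[measurable] = S_measurable[OF a]
  \<comment> \<open>The weight is split at distance \<open>r\<close> from \<open>t\<close>. The near
    part of the integral is bounded by \<open>n\<close>, which is small when the supremum of
    \<open>a\<close> is small.\<close>
  define near where "near t s = (if dist t s \<le> r then a s else 0)" for t s
  define far where "far t s = (if dist t s \<le> r then 0 else a s)" for t s
  have near_i: "integrable lborel (near t)" for t
    unfolding near_def by (rule Bochner_Integration.integrable_bound[OF a]) (auto simp: indicator_def)
  have far_i: "integrable lborel (far t)" for t
    unfolding far_def by (rule Bochner_Integration.integrable_bound[OF a]) (auto simp: indicator_def)
  have content: "measure lborel (cball t x) = measure lborel (cball (0::'a) x)" for t :: 'a and x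
    by (cases "0 \<le> x") (auto simp: content_cball)
  have cball_int: "integrable lborel (indicat_real (cball (t::'a) x))" for t x
    using emeasure_bounded_finite[of "cball t x"] by (intro integrable_real_indicator) auto
  have near_l1: "(\<integral>s. \<bar>near t s\<bar> \<partial>lborel) \<le> \<alpha> * measure lborel (cball (0::'a) r)" for t
  proof -
    have "(\<integral>s. \<bar>near t s\<bar> \<partial>lborel) \<le> (\<integral>s. \<alpha> * indicator (cball t r) s \<partial>lborel)"
    proof (rule integral_mono)
      show "integrable lborel (\<lambda>s. \<bar>near t s\<bar>)" using near_i by (rule integrable_abs)
      show "integrable lborel (\<lambda>s. \<alpha> * indicat_real (cball t r) s)" using cball_int by (rule integrable_mult_right)
    qed (use \<alpha> in \<open>auto simp: near_def indicator_def\<close>)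
    then show ?thesis using content[of t r] by simp
  qed
  define N where "N t = S (near t)" for t
  have N_m[measurable]: "N t \<in> borel_measurable M" for t unfolding N_def by (rule S_measurable[OF near_i])
  have N_le: "\<bar>N t \<omega>\<bar> \<le> n" for t \<omega>
    unfolding N_def n_def
    using order_trans[OF S_le[OF near_i] mult_left_mono[OF near_l1 B_nonneg]] by (simp add: mult_ac)
  have split: "S a \<omega> = N t \<omega> + S (far t) \<omega>" if "\<omega> \<in> space M" for t \<omega>
  proof -
    have "S a \<omega> = (\<integral>s. near t s * Z s \<omega> + far t s * Z s \<omega> \<partial>lborel)"
      unfolding S_def by (intro Bochner_Integration.integral_cong refl) (auto simp: near_def far_def indicator_def)
    then show ?thesis
      unfolding N_def S_def using integrable_Z_path[OF near_i that] integrable_Z_path[OF far_i that] by simp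
  qed
  have far_d: "far t s \<noteq> 0 \<Longrightarrow> r < dist t s" for t s by (auto simp: far_def indicator_def split: if_splits)
  have near_d: "near t s \<noteq> 0 \<Longrightarrow> dist t s \<le> r" for t s by (auto simp: near_def indicator_def split: if_splits)
  have N_pair[measurable (raw)]: "(\<lambda>x. N (f x) (g x)) \<in> borel_measurable K"
    if [measurable]: "f \<in> borel_measurable K" "g \<in> K \<rightarrow>\<^sub>M M" for f g and K :: "'k measure"
    unfolding N_def S_def near_def by measurable
  \<comment> \<open>As the far part is uncorrelated with \<open>Z t\<close>, the mean of
    \<open>q t\<close> is that of \<open>Z t\<close> times \<open>S a\<close>; weighting by
    \<open>a\<close> gives the second moment \<open>v\<close>.\<close>
  define q where "q t \<omega> = Z t \<omega> * N t \<omega>" for t \<omega>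
  have q_le: "\<bar>q t \<omega>\<bar> \<le> B * n" for t \<omega>
    unfolding q_def abs_mult by (intro mult_mono Z_le N_le B_nonneg) auto
  have q_pair[measurable (raw)]: "(\<lambda>x. q (f x) (g x)) \<in> borel_measurable K"
    if [measurable]: "f \<in> borel_measurable K" "g \<in> K \<rightarrow>\<^sub>M M" for f g and K :: "'k measure"
    unfolding q_def by measurable
  define c where "c t = (\<integral>\<omega>. q t \<omega> \<partial>M)" for t
  have q_int: "integrable M (q t)" for t by (rule integrable_bounded_rv[where K="B*n"]) (auto simp: q_le)
  define QQ where "QQ \<omega> = (\<integral>t. a t * q t \<omega> \<partial>lborel)" for \<omega>

  have QQ_m[measurable]: "QQ \<in> borel_measurable M" unfolding QQ_def by measurable
  have QQ_le: "\<bar>QQ \<omega>\<bar> \<le> B * n * A" for \<omega>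
    unfolding QQ_def A_def using norm_integral_path_le[OF a, of q "B * n" \<omega>] q_le by simp
  have far0: "(\<integral>\<omega>. Z t \<omega> * S (far t) \<omega> \<partial>M) = 0" for t
    using expectation_far_power[where ss="[]" and k=1, OF far_i far_d, of t] by simp
  have c_eq: "c t = (\<integral>\<omega>. Z t \<omega> * S a \<omega> \<partial>M)" for t
  proof -
    have i: "integrable M (\<lambda>\<omega>. Z t \<omega> * S (far t) \<omega>)"
    proof (rule integrable_bounded_rv[where K="B * (B * (\<integral>s. \<bar>far t s\<bar> \<partial>lborel))"])
      show "norm (Z t \<omega> * S (far t) \<omega>) \<le> B * (B * (\<integral>s. \<bar>far t s\<bar> \<partial>lborel))" for \<omega>
        unfolding real_norm_def abs_mult by (intro mult_mono Z_le S_le far_i B_nonneg) auto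
    qed (use S_measurable[OF far_i] in measurable)
    have "(\<integral>\<omega>. Z t \<omega> * S a \<omega> \<partial>M) = (\<integral>\<omega>. q t \<omega> + Z t \<omega> * S (far t) \<omega> \<partial>M)"
      by (intro Bochner_Integration.integral_cong refl) (simp add: split[of _ t] q_def algebra_simps)
    also have "\<dots> = c t" using i q_int far0 by (simp add: c_def)
    finally show ?thesis by simp
  qed
  have v_eq: "v = (\<integral>t. a t * c t \<partial>lborel)"
    using expectation_mult_S[OF a Sa S_le[OF a, folded real_norm_def]]
    by (simp add: v_def power2_eq_square c_eq)
  have c_le: "\<bar>c t\<bar> \<le> B * n" for t
    unfolding c_def using norm_integral_le_integral[of M "\<lambda>_. B * n" "q t"] q_le by (simp add: prob_space)
  have c_m[measurable]: "c \<in> borel_measurable borel" unfolding c_def by measurable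
  have ac_int: "integrable lborel (\<lambda>t. a t * c t)"
    using integrable_expectation[OF a, of q "B * n"] q_le by (simp add: c_def)
  define R where "R \<omega> = QQ \<omega> - v" for \<omega>
  define q' where "q' t \<omega> = q t \<omega> - c t" for t \<omega>
  have q'_pair[measurable (raw)]: "(\<lambda>x. q' (f x) (g x)) \<in> borel_measurable K"
    if [measurable]: "f \<in> borel_measurable K" "g \<in> K \<rightarrow>\<^sub>M M" for f g and K :: "'k measure"
    unfolding q'_def by measurable
  have q'_le: "\<bar>q' t \<omega>\<bar> \<le> 2 * B * n" for t \<omega>
    using q_le[of t \<omega>] c_le[of t] unfolding q'_def by linarith
  have R_m[measurable]: "R \<in> borel_measurable M" unfolding R_def by measurable
  have R_eq: "R \<omega> = (\<integral>t. a t * q' t \<omega> \<partial>lborel)" if "\<omega> \<in> space M" for \<omega>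
  proof -
    have "integrable lborel (\<lambda>t. a t * q t \<omega>)" using integrable_path[OF a, of q "B * n"] q_le that by simp
    then show ?thesis unfolding R_def QQ_def v_eq q'_def using ac_int by (simp add: right_diff_distrib)
  qed
  define KR where "KR = B * n * A + \<bar>v\<bar>"
  have R_le: "\<bar>R \<omega>\<bar> \<le> KR" for \<omega> using QQ_le[of \<omega>] unfolding R_def KR_def by linarith
  have ZZc: "c t = (\<integral>s. near t s * (\<integral>\<omega>. Z s \<omega> * Z t \<omega> \<partial>M) \<partial>lborel)" for t
    using expectation_mult_S[OF near_i, of "Z t" B t] Z_le by (simp add: c_def q_def N_def mult.commute)
  \<comment> \<open>\<open>q t\<close> involves points up to distance \<open>r\<close> from
    \<open>t\<close>. Centres more than \<open>3 * r\<close> apart thus leave a gap larger than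
    \<open>r\<close> between the two groups of points, and the moments factor.\<close>
  have qq0: "(\<integral>\<omega>. q' t \<omega> * q' t' \<omega> \<partial>M) = 0" if far: "3 * r < dist t t'" for t t'
  proof -
    have 2: "(\<integral>\<omega>. Z s \<omega> * (Z t \<omega> * Z t' \<omega> * N t' \<omega>) \<partial>M) = (\<integral>\<omega>. Z s \<omega> * Z t \<omega> \<partial>M) * c t'" if s: "near t s \<noteq> 0" for s
    proof -
      have "(\<integral>\<omega>. Z s \<omega> * (Z t \<omega> * Z t' \<omega> * N t' \<omega>) \<partial>M) = (\<integral>\<omega>. S (near t') \<omega> *\<^sub>R (Z s \<omega> * Z t \<omega> * Z t' \<omega>) \<partial>M)"
        by (simp add: N_def mult_ac)
      also have "\<dots> = (\<integral>s'. near t' s' *\<^sub>R (\<integral>\<omega>. Z s' \<omega> *\<^sub>R (Z s \<omega> * Z t \<omega> * Z t' \<omega>) \<partial>M) \<partial>lborel)"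
      proof (rule expectation_mult_S[OF near_i])
        show "norm (Z s \<omega> * Z t \<omega> * Z t' \<omega>) \<le> B * B * B" for \<omega>
          unfolding real_norm_def abs_mult by (intro mult_mono Z_le B_nonneg mult_nonneg_nonneg) auto
      qed measurable
      also have "\<dots> = (\<integral>s'. (\<integral>\<omega>. Z s \<omega> * Z t \<omega> \<partial>M) * (near t' s' * (\<integral>\<omega>. Z s' \<omega> * Z t' \<omega> \<partial>M)) \<partial>lborel)"
      proof (rule Bochner_Integration.integral_cong[OF refl])
        fix s'
        show "near t' s' *\<^sub>R (\<integral>\<omega>. Z s' \<omega> *\<^sub>R (Z s \<omega> * Z t \<omega> * Z t' \<omega>) \<partial>M) =
          (\<integral>\<omega>. Z s \<omega> * Z t \<omega> \<partial>M) * (near t' s' * (\<integral>\<omega>. Z s' \<omega> * Z t' \<omega> \<partial>M))"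
        proof (cases "near t' s' = 0")
          case False
          have ds: "dist t s \<le> r" "dist t' s' \<le> r" using near_d s False by auto
          have dd: "r < dist x y" if "x \<in> set [s, t]" "y \<in> set [s', t']" for x y
          proof -
            have x: "dist t x \<le> r" and y: "dist t' y \<le> r" using that ds r_nonneg by auto
            have "dist t t' \<le> dist t x + dist x y + dist y t'" by (metis add_right_mono dist_triangle order_trans)
            then show ?thesis using x y far by (simp add: dist_commute)
          qed
          from Z_indep[of "[s, t]" "[s', t']", OF dd]
          have "(\<integral>\<omega>. Z s \<omega> * Z t \<omega> * (Z s' \<omega> * Z t' \<omega>) \<partial>M) = (\<integral>\<omega>. Z s \<omega> * Z t \<omega> \<partial>M) * (\<integral>\<omega>. Z s' \<omega> * Z t' \<omega> \<partial>M)"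
            by simp
          then show ?thesis by (simp add: mult_ac)
        qed simp
      qed
      also have "\<dots> = (\<integral>\<omega>. Z s \<omega> * Z t \<omega> \<partial>M) * c t'" unfolding ZZc[of t'] by simp
      finally show ?thesis .
    qed
    have "(\<integral>\<omega>. q t \<omega> * q t' \<omega> \<partial>M) = (\<integral>\<omega>. S (near t) \<omega> *\<^sub>R (Z t \<omega> * Z t' \<omega> * N t' \<omega>) \<partial>M)"
      by (simp add: q_def N_def mult_ac)
    also have "\<dots> = (\<integral>s. near t s *\<^sub>R (\<integral>\<omega>. Z s \<omega> *\<^sub>R (Z t \<omega> * Z t' \<omega> * N t' \<omega>) \<partial>M) \<partial>lborel)"
    proof (rule expectation_mult_S[OF near_i])
      show "norm (Z t \<omega> * Z t' \<omega> * N t' \<omega>) \<le> B * B * n" for \<omega>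
        unfolding real_norm_def abs_mult by (intro mult_mono Z_le N_le B_nonneg mult_nonneg_nonneg) auto
    qed measurable
    also have "\<dots> = (\<integral>s. (near t s * (\<integral>\<omega>. Z s \<omega> * Z t \<omega> \<partial>M)) * c t' \<partial>lborel)"
      using 2 by (intro Bochner_Integration.integral_cong refl) (auto simp: mult.assoc)
    also have "\<dots> = c t * c t'" unfolding ZZc[of t] by simp
    finally have qq: "(\<integral>\<omega>. q t \<omega> * q t' \<omega> \<partial>M) = c t * c t'" .
    have iqq: "integrable M (\<lambda>\<omega>. q t \<omega> * q t' \<omega>)"
    proof (rule integrable_bounded_rv[where K="(B * n) * (B * n)"])
      show "norm (q t \<omega> * q t' \<omega>) \<le> (B * n) * (B * n)" for \<omega>
        unfolding real_norm_def abs_mult using B_nonneg n0 by (intro mult_mono q_le) auto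
    qed measurable
    have "(\<integral>\<omega>. q' t \<omega> * q' t' \<omega> \<partial>M) = (\<integral>\<omega>. q t \<omega> * q t' \<omega> - c t' * q t \<omega> - c t * q t' \<omega> + c t * c t' \<partial>M)"
      unfolding q'_def by (intro Bochner_Integration.integral_cong refl) (simp add: algebra_simps)
    also have "\<dots> = c t * c t' - c t' * c t - c t * c t' + c t * c t'"
      using iqq q_int by (simp add: qq c_def[symmetric] prob_space)
    finally show ?thesis by simp
  qed
  define \<kappa> where "\<kappa> = measure lborel (cball (0::'a) (3 * r))"
  \<comment> \<open>Only centres within \<open>3 * r\<close> of \<open>t\<close> contribute, so the
    covariance with the whole of \<open>R\<close> is controlled by the supremum of \<open>a\<close>
    and the volume of one ball.\<close>
  have q'R: "\<bar>\<integral>\<omega>. q' t \<omega> * R \<omega> \<partial>M\<bar> \<le> \<alpha> * \<kappa> * (2 * B * n)\<^sup>2" for t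
  proof -
    have "(\<integral>\<omega>. q' t \<omega> * R \<omega> \<partial>M) = (\<integral>\<omega>. \<integral>t'. a t' *\<^sub>R (q' t \<omega> * q' t' \<omega>) \<partial>lborel \<partial>M)"
      by (intro Bochner_Integration.integral_cong refl) (simp add: R_eq integral_mult_right_zero[symmetric] mult_ac del: integral_mult_right_zero)
    also have "\<dots> = (\<integral>t'. a t' *\<^sub>R (\<integral>\<omega>. q' t \<omega> * q' t' \<omega> \<partial>M) \<partial>lborel)"
    proof (rule expectation_integral_swap[OF a])
      show "norm (q' t \<omega> * q' t' \<omega>) \<le> (2 * B * n) * (2 * B * n)" for t' \<omega>
        unfolding real_norm_def abs_mult using B_nonneg n0 by (intro mult_mono q'_le) auto
    qed measurable
    also have "\<bar>\<dots>\<bar> \<le> (\<integral>t'. \<alpha> * (2 * B * n)\<^sup>2 * indicator (cball t (3 * r)) t' \<partial>lborel)"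
      unfolding real_norm_def[symmetric]
    proof (rule norm_integral_le_integral)
      show "integrable lborel (\<lambda>t'. \<alpha> * (2 * B * n)\<^sup>2 * indicator (cball t (3 * r)) t')"
        using cball_int by (intro integrable_mult_right) auto
      fix t'
      have "\<bar>\<integral>\<omega>. q' t \<omega> * q' t' \<omega> \<partial>M\<bar> \<le> (\<integral>\<omega>. (2 * B * n)\<^sup>2 \<partial>M)"
        unfolding real_norm_def[symmetric]
      proof (rule norm_integral_le_integral)
        show "norm (q' t \<omega> * q' t' \<omega>) \<le> (2 * B * n)\<^sup>2" for \<omega>
          unfolding real_norm_def abs_mult power2_eq_square using B_nonneg n0 by (intro mult_mono q'_le) auto
      qed simp
      then have "\<bar>\<integral>\<omega>. q' t \<omega> * q' t' \<omega> \<partial>M\<bar> \<le> (2 * B * n)\<^sup>2 * indicator (cball t (3 * r)) t'"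
        using qq0[of t t'] by (cases "t' \<in> cball t (3 * r)") (auto simp: prob_space)
      then show "norm (a t' *\<^sub>R (\<integral>\<omega>. q' t \<omega> * q' t' \<omega> \<partial>M)) \<le> \<alpha> * (2 * B * n)\<^sup>2 * indicator (cball t (3 * r)) t'"
        unfolding real_scaleR_def real_norm_def abs_mult mult.assoc[of \<alpha>] using \<alpha> \<alpha>0 by (intro mult_mono) auto
    qed
    also have "\<dots> = \<alpha> * \<kappa> * (2 * B * n)\<^sup>2" using content[of t "3 * r"] by (simp add: \<kappa>_def)
    finally show ?thesis .
  qed
  have varR: "(\<integral>\<omega>. (R \<omega>)\<^sup>2 \<partial>M) \<le> A * \<alpha> * \<kappa> * (2 * B * n)\<^sup>2"
  proof -
    have "(\<integral>\<omega>. (R \<omega>)\<^sup>2 \<partial>M) = (\<integral>\<omega>. \<integral>t. a t *\<^sub>R (q' t \<omega> * R \<omega>) \<partial>lborel \<partial>M)"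
    proof (intro Bochner_Integration.integral_cong refl)
      fix \<omega> assume w: "\<omega> \<in> space M"
      have "(\<integral>t. a t *\<^sub>R (q' t \<omega> * R \<omega>) \<partial>lborel) = (\<integral>t. (a t * q' t \<omega>) * R \<omega> \<partial>lborel)" by (simp add: mult_ac)
      also have "\<dots> = (\<integral>t. a t * q' t \<omega> \<partial>lborel) * R \<omega>" by (rule integral_mult_left_zero)
      finally show "(R \<omega>)\<^sup>2 = (\<integral>t. a t *\<^sub>R (q' t \<omega> * R \<omega>) \<partial>lborel)" using R_eq[OF w] by (simp add: power2_eq_square)
    qed
    also have "\<dots> = (\<integral>t. a t *\<^sub>R (\<integral>\<omega>. q' t \<omega> * R \<omega> \<partial>M) \<partial>lborel)"
    proof (rule expectation_integral_swap[OF a])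
      show "norm (q' t \<omega> * R \<omega>) \<le> (2 * B * n) * KR" for t \<omega>
        unfolding real_norm_def abs_mult using B_nonneg n0 by (intro mult_mono q'_le R_le) auto
    qed measurable
    also have "\<dots> \<le> \<bar>\<dots>\<bar>" by simp
    also have "\<dots> \<le> (\<integral>t. \<bar>a t\<bar> * (\<alpha> * \<kappa> * (2 * B * n)\<^sup>2) \<partial>lborel)"
      unfolding real_norm_def[symmetric]
    proof (rule norm_integral_le_integral)
      show "norm (a t *\<^sub>R (\<integral>\<omega>. q' t \<omega> * R \<omega> \<partial>M)) \<le> norm (a t) * (\<alpha> * \<kappa> * (2 * B * n)\<^sup>2)" for t
        using mult_left_mono[OF q'R[of t], of "\<bar>a t\<bar>"] by (simp add: abs_mult)
      show "integrable lborel (\<lambda>x. norm (a x) * (\<alpha> * \<kappa> * (2 * B * n)\<^sup>2))" using a by (intro integrable_mult_left integrable_norm) auto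
    qed
    also have "\<dots> = A * \<alpha> * \<kappa> * (2 * B * n)\<^sup>2" by (simp add: A_def)
    finally show ?thesis .
  qed
  define K where "K = A * B * n\<^sup>2 / 2 + sqrt (A * \<alpha> * \<kappa> * (2 * B * n)\<^sup>2)"
  have ER: "(\<integral>\<omega>. \<bar>R \<omega>\<bar> \<partial>M) \<le> sqrt (A * \<alpha> * \<kappa> * (2 * B * n)\<^sup>2)"
    using expectation_abs_le_sqrt[OF R_m R_le] varR by (meson order_trans real_sqrt_le_mono)
  define E1 where "E1 \<theta> = (\<integral>\<omega>. S a \<omega> *\<^sub>R iexp (\<theta> * S a \<omega>) \<partial>M)" for \<theta>
  define E2 where "E2 \<theta> = (\<integral>\<omega>. QQ \<omega> *\<^sub>R iexp (\<theta> * S a \<omega>) \<partial>M)" for \<theta>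
  have ie: "integrable M (\<lambda>\<omega>. W \<omega> *\<^sub>R iexp (\<theta> * S a \<omega>))" if [measurable]: "W \<in> borel_measurable M" and "\<And>\<omega>. \<bar>W \<omega>\<bar> \<le> C" for W C \<theta>
    by (rule integrable_bounded_rv[where K=C]) (auto simp: that)
  \<comment> \<open>Subtracting the vanishing expectation with the far part only changes nothing,
    and makes the first-order expansion in \<open>N t\<close> visible.\<close>
  have local: "cmod ((\<integral>\<omega>. Z t \<omega> *\<^sub>R iexp (\<theta> * S a \<omega>) \<partial>M) - \<i> * \<theta> * (\<integral>\<omega>. q t \<omega> *\<^sub>R iexp (\<theta> * S a \<omega>) \<partial>M)) \<le> B * ((\<theta> * n)\<^sup>2 / 2)" for t \<theta>
  proof -
    have [measurable]: "S (far t) \<in> borel_measurable M" by (rule S_measurable[OF far_i])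
    have i3: "integrable M (\<lambda>\<omega>. Z t \<omega> *\<^sub>R iexp (\<theta> * S (far t) \<omega>))"
      by (rule integrable_bounded_rv[where K=B]) (auto simp: Z_le)
    have i1: "integrable M (\<lambda>\<omega>. Z t \<omega> *\<^sub>R iexp (\<theta> * S a \<omega>))" by (rule ie[of _ B]) (auto simp: Z_le)
    have i2: "integrable M (\<lambda>\<omega>. q t \<omega> *\<^sub>R iexp (\<theta> * S a \<omega>))" by (rule ie[of _ "B*n"]) (auto simp: q_le)
    have "(\<integral>\<omega>. Z t \<omega> *\<^sub>R iexp (\<theta> * S a \<omega>) \<partial>M) - \<i> * \<theta> * (\<integral>\<omega>. q t \<omega> *\<^sub>R iexp (\<theta> * S a \<omega>) \<partial>M) =
      (\<integral>\<omega>. Z t \<omega> *\<^sub>R iexp (\<theta> * S a \<omega>) - \<i> * \<theta> * (q t \<omega> *\<^sub>R iexp (\<theta> * S a \<omega>)) - Z t \<omega> *\<^sub>R iexp (\<theta> * S (far t) \<omega>) \<partial>M)"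
      by (rule integral_diff_mult_add_null[OF i1 i2 i3]) (rule expectation_far_iexp[OF far_i far_d])
    also have "\<dots> = (\<integral>\<omega>. - (Z t \<omega> *\<^sub>R (iexp (\<theta> * S a \<omega>) * (iexp (- (\<theta> * N t \<omega>)) - (1 + \<i> * (- (\<theta> * N t \<omega>)))))) \<partial>M)"
    proof (intro Bochner_Integration.integral_cong refl)
      fix \<omega> assume "\<omega> \<in> space M"
      then have "iexp (\<theta> * S (far t) \<omega>) = iexp (\<theta> * S a \<omega>) * iexp (- (\<theta> * N t \<omega>))"
        by (simp add: split[of \<omega> t] exp_add[symmetric] algebra_simps)
      then show "Z t \<omega> *\<^sub>R iexp (\<theta> * S a \<omega>) - \<i> * \<theta> * (q t \<omega> *\<^sub>R iexp (\<theta> * S a \<omega>)) - Z t \<omega> *\<^sub>R iexp (\<theta> * S (far t) \<omega>) =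
        - (Z t \<omega> *\<^sub>R (iexp (\<theta> * S a \<omega>) * (iexp (- (\<theta> * N t \<omega>)) - (1 + \<i> * (- (\<theta> * N t \<omega>))))))"
        by (simp only:) (simp add: q_def scaleR_conv_of_real algebra_simps)
    qed
    also have "norm \<dots> \<le> (\<integral>\<omega>. B * ((\<theta> * n)\<^sup>2 / 2) \<partial>M)"
    proof (rule norm_integral_le_integral)
      fix \<omega>
      have "cmod (iexp (- (\<theta> * N t \<omega>)) - (1 + \<i> * (- (\<theta> * N t \<omega>)))) \<le> \<bar>- (\<theta> * N t \<omega>)\<bar>\<^sup>2 / 2"
        using iexp_approx1[of "- (\<theta> * N t \<omega>)" 1] by (simp add: numeral_2_eq_2)
      also have "\<dots> = \<theta>\<^sup>2 * \<bar>N t \<omega>\<bar>\<^sup>2 / 2" by (simp add: power_mult_distrib)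
      also have "\<dots> \<le> \<theta>\<^sup>2 * n\<^sup>2 / 2" by (intro divide_right_mono mult_left_mono power_mono N_le) auto
      finally have "cmod (iexp (- (\<theta> * N t \<omega>)) - (1 + \<i> * (- (\<theta> * N t \<omega>)))) \<le> (\<theta> * n)\<^sup>2 / 2" by (simp add: power_mult_distrib)
      then show "norm (- (Z t \<omega> *\<^sub>R (iexp (\<theta> * S a \<omega>) * (iexp (- (\<theta> * N t \<omega>)) - (1 + \<i> * (- (\<theta> * N t \<omega>))))))) \<le> B * ((\<theta> * n)\<^sup>2 / 2)"
        unfolding norm_minus_cancel norm_scaleR norm_mult real_norm_def using Z_le B_nonneg
        by (intro mult_mono) auto
    qed simp
    finally show ?thesis by (simp add: prob_space)
  qed
  have E12: "cmod (E1 \<theta> - \<i> * \<theta> * E2 \<theta>) \<le> A * (B * ((\<theta> * n)\<^sup>2 / 2))" for \<theta>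
  proof -
    let ?e1 = "\<lambda>t. \<integral>\<omega>. Z t \<omega> *\<^sub>R iexp (\<theta> * S a \<omega>) \<partial>M" and ?e2 = "\<lambda>t. \<integral>\<omega>. q t \<omega> *\<^sub>R iexp (\<theta> * S a \<omega>) \<partial>M"
    have F1: "(\<lambda>p. Z (fst p) (snd p) *\<^sub>R iexp (\<theta> * S a (snd p))) \<in> borel_measurable (borel \<Otimes>\<^sub>M M)"
      "norm (Z t \<omega> *\<^sub>R iexp (\<theta> * S a \<omega>)) \<le> B" for t \<omega> by (measurable, simp add: Z_le)
    have F2: "(\<lambda>p. q (fst p) (snd p) *\<^sub>R iexp (\<theta> * S a (snd p))) \<in> borel_measurable (borel \<Otimes>\<^sub>M M)"
      "norm (q t \<omega> *\<^sub>R iexp (\<theta> * S a \<omega>)) \<le> B * n" for t \<omega> by (measurable, simp add: q_le)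
    have e1: "E1 \<theta> = (\<integral>t. a t *\<^sub>R ?e1 t \<partial>lborel)"
      unfolding E1_def by (rule expectation_mult_S[OF a, where K=1]) auto
    have e2: "E2 \<theta> = (\<integral>t. a t *\<^sub>R ?e2 t \<partial>lborel)"
    proof -
      have "E2 \<theta> = (\<integral>\<omega>. \<integral>t. a t *\<^sub>R (q t \<omega> *\<^sub>R iexp (\<theta> * S a \<omega>)) \<partial>lborel \<partial>M)"
        unfolding E2_def
      proof (intro Bochner_Integration.integral_cong refl)
        fix \<omega> assume "\<omega> \<in> space M"
        then have "integrable lborel (\<lambda>t. a t * q t \<omega>)" using integrable_path[OF a, of q "B * n"] q_le by simp
        from integral_scaleR_left[OF this, of "iexp (\<theta> * S a \<omega>)"]
        show "QQ \<omega> *\<^sub>R iexp (\<theta> * S a \<omega>) = (\<integral>t. a t *\<^sub>R (q t \<omega> *\<^sub>R iexp (\<theta> * S a \<omega>)) \<partial>lborel)" by (simp add: QQ_def)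
      qed
      also have "\<dots> = (\<integral>t. a t *\<^sub>R ?e2 t \<partial>lborel)" by (rule expectation_integral_swap[OF a F2])
      finally show ?thesis .
    qed
    have "E1 \<theta> - \<i> * \<theta> * E2 \<theta> = (\<integral>t. a t *\<^sub>R ?e1 t - \<i> * \<theta> * (a t *\<^sub>R ?e2 t) - 0 \<partial>lborel)"
      unfolding e1 e2
      by (rule integral_diff_mult_add_null[OF integrable_expectation[OF a F1] integrable_expectation[OF a F2]]) auto
    also have "\<dots> = (\<integral>t. a t *\<^sub>R (?e1 t - \<i> * \<theta> * ?e2 t) \<partial>lborel)"
      by (simp only: scaleR_diff_right mult_scaleR_right diff_0_right)
    also have "norm \<dots> \<le> (\<integral>t. \<bar>a t\<bar> * (B * ((\<theta> * n)\<^sup>2 / 2)) \<partial>lborel)"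
    proof (rule norm_integral_le_integral)
      show "integrable lborel (\<lambda>t. \<bar>a t\<bar> * (B * ((\<theta> * n)\<^sup>2 / 2)))" using a by (intro integrable_mult_left integrable_abs)
      show "norm (a t *\<^sub>R (?e1 t - \<i> * \<theta> * ?e2 t)) \<le> \<bar>a t\<bar> * (B * ((\<theta> * n)\<^sup>2 / 2))" for t
        unfolding norm_scaleR by (intro mult_left_mono local) auto
    qed
    finally show ?thesis by (simp add: A_def)
  qed
  define \<psi> where "\<psi> \<theta> = (\<integral>\<omega>. iexp (\<theta> * S a \<omega>) \<partial>M)" for \<theta>
  \<comment> \<open>The defect of \<psi> in the equation \<psi>' = - \<theta> v \<psi>, which the
    Gaussian characteristic function satisfies exactly.\<close>
  define e where "e \<theta> = \<i> * E1 \<theta> + \<theta> * v * \<psi> \<theta>" for \<theta> :: real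
  have d\<psi>: "(\<psi> has_vector_derivative \<i> * E1 \<theta>) (at \<theta>)" for \<theta>
    unfolding \<psi>_def E1_def by (rule vector_derivative_expectation_iexp[OF Sa S_le[OF a]])
  have e_le: "cmod (e \<theta>) \<le> K" if \<theta>: "0 \<le> \<theta>" "\<theta> \<le> 1" for \<theta>
  proof -
    have "E2 \<theta> - v * \<psi> \<theta> = (\<integral>\<omega>. R \<omega> *\<^sub>R iexp (\<theta> * S a \<omega>) \<partial>M)"
    proof -
      have "(\<integral>\<omega>. R \<omega> *\<^sub>R iexp (\<theta> * S a \<omega>) \<partial>M) = (\<integral>\<omega>. QQ \<omega> *\<^sub>R iexp (\<theta> * S a \<omega>) - v *\<^sub>R iexp (\<theta> * S a \<omega>) \<partial>M)"
        by (simp add: R_def scaleR_diff_left)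
      also have "\<dots> = E2 \<theta> - v *\<^sub>R \<psi> \<theta>"
        using ie[OF QQ_m QQ_le, of \<theta>] ie[of "\<lambda>_. 1" 1 \<theta>] by (simp add: E2_def \<psi>_def)
      finally show ?thesis by (simp add: scaleR_conv_of_real)
    qed
    moreover have "norm (\<integral>\<omega>. R \<omega> *\<^sub>R iexp (\<theta> * S a \<omega>) \<partial>M) \<le> (\<integral>\<omega>. \<bar>R \<omega>\<bar> \<partial>M)"
      by (rule norm_integral_le_integral) (auto intro!: integrable_bounded_rv[where K=KR] simp: R_le)
    ultimately have 1: "cmod (E2 \<theta> - v * \<psi> \<theta>) \<le> sqrt (A * \<alpha> * \<kappa> * (2 * B * n)\<^sup>2)" using ER by simp
    have "e \<theta> = \<i> * (E1 \<theta> - \<i> * \<theta> * E2 \<theta>) - \<theta> * (E2 \<theta> - v * \<psi> \<theta>)"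
      by (simp add: e_def algebra_simps)
    also have "cmod \<dots> \<le> cmod (E1 \<theta> - \<i> * \<theta> * E2 \<theta>) + \<theta> * cmod (E2 \<theta> - v * \<psi> \<theta>)"
      using norm_triangle_ineq4[of "\<i> * (E1 \<theta> - \<i> * \<theta> * E2 \<theta>)" "\<theta> * (E2 \<theta> - v * \<psi> \<theta>)"] \<theta> by (simp add: norm_mult)
    also have "\<dots> \<le> A * (B * ((\<theta> * n)\<^sup>2 / 2)) + 1 * sqrt (A * \<alpha> * \<kappa> * (2 * B * n)\<^sup>2)"
      using \<theta> by (intro add_mono E12 mult_mono 1) auto
    also have "A * (B * ((\<theta> * n)\<^sup>2 / 2)) \<le> A * (B * (n\<^sup>2 / 2))"
      using \<theta> n0 A0 B_nonneg power_mono[of "\<theta> * n" n 2] by (intro mult_left_mono divide_right_mono) (auto simp: mult_left_le_one_le)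
    finally show ?thesis by (simp add: K_def)
  qed
  have v0: "0 \<le> v" unfolding v_def by simp
  \<comment> \<open>The integrating factor: the derivative of \<eta> contains only the defect
    \<open>e\<close>.\<close>
  define \<eta> where "\<eta> \<theta> = exp (\<theta>\<^sup>2 * v / 2) *\<^sub>R \<psi> \<theta>" for \<theta>
  have d\<eta>: "(\<eta> has_vector_derivative exp (\<theta>\<^sup>2 * v / 2) *\<^sub>R e \<theta>) (at \<theta> within {0..1})" for \<theta>
  proof -
    have "((\<lambda>\<theta>. exp (\<theta>\<^sup>2 * v / 2)) has_real_derivative exp (\<theta>\<^sup>2 * v / 2) * (\<theta> * v)) (at \<theta>)"
      by (auto intro!: derivative_eq_intros)
    from has_vector_derivative_scaleR[OF this d\<psi>]
    have "(\<eta> has_vector_derivative exp (\<theta>\<^sup>2 * v / 2) *\<^sub>R e \<theta>) (at \<theta>)"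
      unfolding \<eta>_def e_def by (simp add: scaleR_conv_of_real algebra_simps)
    then show ?thesis by (rule has_vector_derivative_at_within)
  qed
  \<comment> \<open>The mean value inequality on [0, 1]. The factor exp(v/2) is cancelled when
    \<eta> is converted back to \<psi> at 1, so the final bound has no exponential in
    \<open>v\<close>.\<close>
  have "norm (\<eta> 1 - \<eta> 0) \<le> exp (v / 2) * K * norm (1 - 0 :: real)"
  proof (rule differentiable_bound[where S="{0..1}" and f'="\<lambda>\<theta> h. h *\<^sub>R (exp (\<theta>\<^sup>2 * v / 2) *\<^sub>R e \<theta>)"])
    show "onorm (\<lambda>h. h *\<^sub>R (exp (\<theta>\<^sup>2 * v / 2) *\<^sub>R e \<theta>)) \<le> exp (v / 2) * K" if "\<theta> \<in> {0..1}" for \<theta>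
    proof (rule onorm_le)
      have "\<theta>\<^sup>2 * v / 2 \<le> v / 2" using that v0 by (simp add: mult_left_le_one_le power_le_one)
      then have le: "exp (\<theta>\<^sup>2 * v / 2) * cmod (e \<theta>) \<le> exp (v / 2) * K"
        using that by (intro mult_mono e_le) auto
      then show "norm (h *\<^sub>R exp (\<theta>\<^sup>2 * v / 2) *\<^sub>R e \<theta>) \<le> exp (v / 2) * K * norm h" for h
        using mult_left_mono[OF le, of "\<bar>h\<bar>"] by (simp add: abs_mult mult_ac)
    qed
  qed (use d\<eta> in \<open>auto simp: has_vector_derivative_def\<close>)
  moreover have "\<eta> 0 = 1" by (simp add: \<eta>_def \<psi>_def prob_space)
  moreover have "\<psi> 1 - exp (- v / 2) = exp (- v / 2) *\<^sub>R (\<eta> 1 - 1)"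
  proof -
    have one: "exp (- v / 2) * exp (v / 2) = 1" by (simp add: exp_add[symmetric])
    have "exp (- v / 2) *\<^sub>R (\<eta> 1 - 1) = (exp (- v / 2) * exp (v / 2)) *\<^sub>R \<psi> 1 - exp (- v / 2) *\<^sub>R 1"
      by (simp add: \<eta>_def scaleR_diff_right)
    then show ?thesis unfolding one by (simp add: scaleR_conv_of_real del: of_real_exp)
  qed
  ultimately have "cmod (\<psi> 1 - exp (- v / 2)) \<le> exp (- v / 2) * (exp (v / 2) * K)"
    by (simp del: of_real_exp)
  also have "\<dots> = K" by (simp add: mult.assoc[symmetric] exp_add[symmetric])
  finally show ?thesis by (simp add: \<psi>_def K_def \<kappa>_def)
qed

end

section \<open>Convergence of random vectors from characteristic functions\<close>

text \<open>Real trigonometric polynomials in the coordinates from \<open>J\<close>. The phase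
  provides sines, and zero frequencies provide constants.\<close>

inductive_set trig :: "nat set \<Rightarrow> ((nat \<Rightarrow> real) \<Rightarrow> real) set" for J where
  cos: "(\<lambda>x. c * cos ((\<Sum>k\<in>J. a k * x k) + b)) \<in> trig J"
| add: "f \<in> trig J \<Longrightarrow> g \<in> trig J \<Longrightarrow> (\<lambda>x. f x + g x) \<in> trig J"

text \<open>The product-to-sum formula for cosines; closure under products is what Stone-Weierstrass
  demands.\<close>

lemma trig_mult:
  assumes f: "f \<in> trig J" and g: "g \<in> trig J"
  shows "(\<lambda>x. f x * g x) \<in> trig J"
  using f
proof induction
  case (cos c a b)
  show ?case using g
  proof induction
    case (cos c' a' b')
    have "(\<lambda>x. c * cos ((\<Sum>k\<in>J. a k * x k) + b) * (c' * cos ((\<Sum>k\<in>J. a' k * x k) + b'))) =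
      (\<lambda>x. c * c' / 2 * cos ((\<Sum>k\<in>J. (a k - a' k) * x k) + (b - b')) + c * c' / 2 * cos ((\<Sum>k\<in>J. (a k + a' k) * x k) + (b + b')))"
    proof
      fix x
      let ?A = "(\<Sum>k\<in>J. a k * x k) + b" and ?B = "(\<Sum>k\<in>J. a' k * x k) + b'"
      have "(\<Sum>k\<in>J. (a k - a' k) * x k) + (b - b') = ?A - ?B" "(\<Sum>k\<in>J. (a k + a' k) * x k) + (b + b') = ?A + ?B"
        by (simp_all add: algebra_simps sum.distrib sum_subtractf)
      then show "c * cos ?A * (c' * cos ?B) = c * c' / 2 * cos ((\<Sum>k\<in>J. (a k - a' k) * x k) + (b - b')) + c * c' / 2 * cos ((\<Sum>k\<in>J. (a k + a' k) * x k) + (b + b'))"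
        by (simp only: cos_add cos_diff) (simp add: field_simps)
    qed
    then show ?case by (simp only:) (intro trig.intros)
  next
    case (add f' g')
    then show ?case using trig.add[OF add.IH] by (simp add: distrib_left)
  qed
next
  case (add f' g')
  then show ?case using trig.add[OF add.IH] by (simp add: distrib_right)
qed

lemma trig_bounded: "h \<in> trig J \<Longrightarrow> \<exists>K. \<forall>x. \<bar>h x\<bar> \<le> K"
proof (induction rule: trig.induct)
  case (cos c a b)
  have "\<bar>c * cos ((\<Sum>k\<in>J. a k * x k) + b)\<bar> \<le> \<bar>c\<bar>" for x
    using abs_cos_le_one by (simp add: abs_mult mult_left_le)
  then show ?case by blast
next
  case (add f g)
  then obtain K K' where "\<And>x. \<bar>f x\<bar> \<le> K" "\<And>x. \<bar>g x\<bar> \<le> K'" by blast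
  then have "\<bar>f x + g x\<bar> \<le> K + K'" for x by (meson abs_triangle_ineq add_mono order_trans)
  then show ?case by blast
qed

lemma trig_measurable:
  assumes "h \<in> trig J" and "finite J" and X: "\<And>k. k \<in> J \<Longrightarrow> (\<lambda>\<omega>. X k \<omega>) \<in> borel_measurable M"
  shows "(\<lambda>\<omega>. h (\<lambda>k. X k \<omega>)) \<in> borel_measurable M"
  using assms(1)
proof induction
  case (cos c a b)
  have "(\<lambda>\<omega>. \<Sum>k\<in>J. a k * X k \<omega>) \<in> borel_measurable M"
    using X by (intro borel_measurable_sum borel_measurable_times) auto
  then show ?case by measurable
qed auto

text \<open>A cosine of a linear form with phase \<open>b\<close> is the real part of exp(i b) times
  the exponential of the form, so its expectation is read off from the characteristic
  function.\<close>

lemma expectation_trig_tendsto: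
  assumes h: "h \<in> trig J" and M: "prob_space M" and N: "prob_space N" and J: "finite J"
    and X: "\<forall>\<^sub>F i in F. \<forall>k\<in>J. X i k \<in> borel_measurable M" and W: "\<And>k. k \<in> J \<Longrightarrow> W k \<in> borel_measurable N"
    and char: "\<And>a. ((\<lambda>i. \<integral>\<omega>. iexp (\<Sum>k\<in>J. a k * X i k \<omega>) \<partial>M) \<longlongrightarrow> (\<integral>\<omega>. iexp (\<Sum>k\<in>J. a k * W k \<omega>) \<partial>N)) F"
  shows "((\<lambda>i. \<integral>\<omega>. h (\<lambda>k. X i k \<omega>) \<partial>M) \<longlongrightarrow> (\<integral>\<omega>. h (\<lambda>k. W k \<omega>) \<partial>N)) F"
  using h
proof induction
  case (cos c a b)
  have eq: "(\<integral>\<omega>. c * cos ((\<Sum>k\<in>J. a k * Y k \<omega>) + b) \<partial>K) = c * Re (iexp b * (\<integral>\<omega>. iexp (\<Sum>k\<in>J. a k * Y k \<omega>) \<partial>K))"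
    if K: "prob_space K" and Y: "\<And>k. k \<in> J \<Longrightarrow> Y k \<in> borel_measurable K" for K and Y :: "nat \<Rightarrow> 'z \<Rightarrow> real"
  proof -
    interpret K: prob_space K by fact
    have [measurable]: "(\<lambda>\<omega>. \<Sum>k\<in>J. a k * Y k \<omega>) \<in> borel_measurable K"
      using Y by (intro borel_measurable_sum borel_measurable_times) auto
    have i: "integrable K (\<lambda>\<omega>. iexp (\<Sum>k\<in>J. a k * Y k \<omega>))"
      by (rule K.integrable_const_bound[where B=1]) (auto simp del: of_real_sum)
    have "(\<integral>\<omega>. c * cos ((\<Sum>k\<in>J. a k * Y k \<omega>) + b) \<partial>K) = (\<integral>\<omega>. c * Re (iexp b * iexp (\<Sum>k\<in>J. a k * Y k \<omega>)) \<partial>K)"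
      by (intro Bochner_Integration.integral_cong refl)
         (simp add: exp_add[symmetric] Re_exp add.commute del: of_real_sum)
    also have "\<dots> = c * (\<integral>\<omega>. Re (iexp b * iexp (\<Sum>k\<in>J. a k * Y k \<omega>)) \<partial>K)" by (rule integral_mult_right_zero)
    also have "(\<integral>\<omega>. Re (iexp b * iexp (\<Sum>k\<in>J. a k * Y k \<omega>)) \<partial>K) = Re (\<integral>\<omega>. iexp b * iexp (\<Sum>k\<in>J. a k * Y k \<omega>) \<partial>K)"
      by (rule integral_Re) (rule integrable_mult_right[OF i])
    also have "(\<integral>\<omega>. iexp b * iexp (\<Sum>k\<in>J. a k * Y k \<omega>) \<partial>K) = iexp b * (\<integral>\<omega>. iexp (\<Sum>k\<in>J. a k * Y k \<omega>) \<partial>K)"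
      by (rule integral_mult_right_zero)
    finally show ?thesis .
  qed
  have "((\<lambda>i. c * Re (iexp b * (\<integral>\<omega>. iexp (\<Sum>k\<in>J. a k * X i k \<omega>) \<partial>M))) \<longlongrightarrow> c * Re (iexp b * (\<integral>\<omega>. iexp (\<Sum>k\<in>J. a k * W k \<omega>) \<partial>N))) F"
    by (intro tendsto_intros char)
  moreover have "\<forall>\<^sub>F i in F. c * Re (iexp b * (\<integral>\<omega>. iexp (\<Sum>k\<in>J. a k * X i k \<omega>) \<partial>M)) = (\<integral>\<omega>. c * cos ((\<Sum>k\<in>J. a k * X i k \<omega>) + b) \<partial>M)"
    using X by eventually_elim (rule eq[OF M, symmetric], blast)
  moreover have "c * Re (iexp b * (\<integral>\<omega>. iexp (\<Sum>k\<in>J. a k * W k \<omega>) \<partial>N)) = (\<integral>\<omega>. c * cos ((\<Sum>k\<in>J. a k * W k \<omega>) + b) \<partial>N)"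
    by (rule eq[OF N W, symmetric])
  ultimately show ?case
    by (simp only:) (rule Lim_transform_eventually)
next
  case (add f g)
  have eq: "(\<integral>\<omega>. f (\<lambda>k. Y k \<omega>) + g (\<lambda>k. Y k \<omega>) \<partial>K) = (\<integral>\<omega>. f (\<lambda>k. Y k \<omega>) \<partial>K) + (\<integral>\<omega>. g (\<lambda>k. Y k \<omega>) \<partial>K)"
    if K: "prob_space K" and Y: "\<And>k. k \<in> J \<Longrightarrow> Y k \<in> borel_measurable K" for K and Y :: "nat \<Rightarrow> 'z \<Rightarrow> real"
  proof -
    interpret K: prob_space K by fact
    have "integrable K (\<lambda>\<omega>. h (\<lambda>k. Y k \<omega>))" if hh: "h \<in> trig J" for h
    proof -
      obtain B where "\<And>x. \<bar>h x\<bar> \<le> B" using trig_bounded[OF hh] by blast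
      then show ?thesis
        by (intro K.integrable_const_bound[where B=B] trig_measurable[OF hh J Y]) auto
    qed
    then show ?thesis using add.hyps by simp
  qed
  from tendsto_add[OF add.IH]
  have "((\<lambda>i. (\<integral>\<omega>. f (\<lambda>k. X i k \<omega>) \<partial>M) + (\<integral>\<omega>. g (\<lambda>k. X i k \<omega>) \<partial>M)) \<longlongrightarrow> (\<integral>\<omega>. f (\<lambda>k. W k \<omega>) \<partial>N) + (\<integral>\<omega>. g (\<lambda>k. W k \<omega>) \<partial>N)) F" .
  moreover have "\<forall>\<^sub>F i in F. (\<integral>\<omega>. f (\<lambda>k. X i k \<omega>) \<partial>M) + (\<integral>\<omega>. g (\<lambda>k. X i k \<omega>) \<partial>M) = (\<integral>\<omega>. f (\<lambda>k. X i k \<omega>) + g (\<lambda>k. X i k \<omega>) \<partial>M)"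
    using X by eventually_elim (rule eq[OF M, symmetric], blast)
  moreover have "(\<integral>\<omega>. f (\<lambda>k. W k \<omega>) \<partial>N) + (\<integral>\<omega>. g (\<lambda>k. W k \<omega>) \<partial>N) = (\<integral>\<omega>. f (\<lambda>k. W k \<omega>) + g (\<lambda>k. W k \<omega>) \<partial>N)"
    by (rule eq[OF N W, symmetric])
  ultimately show ?case
    by (simp only:) (rule Lim_transform_eventually)
qed

section \<open>From trigonometric polynomials to bounded continuous functions\<close>

lemma one_minus_cos_le: "1 - cos (y::real) \<le> y\<^sup>2 / 2"
proof -
  have "1 - cos y = 2 * (sin (y / 2))\<^sup>2" using cos_double_sin[of "y / 2"] by simp
  also have "(sin (y / 2))\<^sup>2 \<le> (y / 2)\<^sup>2"
    using abs_sin_x_le_abs_x[of "y / 2"] by (rule abs_le_square_iff[THEN iffD1])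
  finally show ?thesis by (simp add: power_divide)
qed

text \<open>A bounded continuous function is replaced by the periodic function
  \<open>f (R arcsin (sin (x / R))) * (\<Prod>k. max 0 (cos (x k / R)))\<close>, which is a continuous function on a torus and
  hence a uniform limit of trigonometric polynomials.  The error is dominated by
  \<open>\<Sum>k. (x k / R)\<^sup>2\<close>, so that bounded second moments make it small.\<close>

lemma trig_approx:
  fixes f :: "(nat \<Rightarrow> real) \<Rightarrow> real"
  assumes J: "finite J" and f: "continuous_on UNIV f" and B: "\<And>x. \<bar>f x\<bar> \<le> B" and e: "0 < e" and R: "0 < R"
  obtains h where "h \<in> trig J"
    "\<And>x. \<bar>f (restrict x J) - h x\<bar> \<le> e + 2 * B * (\<Sum>k\<in>J. (x k / R)\<^sup>2)"
proof -
  have B0: "0 \<le> B" using B[of undefined] by linarith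
  \<comment> \<open>Coordinates outside \<open>J\<close> are sent to the constant 1, so the image
    lies in a compact torus inside the infinite product space.\<close>
  define T where "T x = (\<lambda>k. if k \<in> J then cis (x k / R) else 1)" for x :: "nat \<Rightarrow> real"
  define K where "K = PiE UNIV (\<lambda>k. if k \<in> J then sphere (0::complex) 1 else {1})"
  have TK: "T x \<in> K" for x by (auto simp: T_def K_def)
  have cK: "compact K"
  proof -
    have "compactin (product_topology (\<lambda>_::nat. euclidean :: complex topology) UNIV) K"
      unfolding K_def compactin_PiE by auto
    then show ?thesis unfolding euclidean_product_topology by simp
  qed
  have co: "continuous_on S (\<lambda>z::nat \<Rightarrow> complex. z k)" for S k
    by (rule continuous_on_subset[OF continuous_on_product_coordinates]) simp
  define P where "P H \<longleftrightarrow> continuous_on K H \<and> (\<lambda>x. H (T x)) \<in> trig J" for H :: "(nat \<Rightarrow> complex) \<Rightarrow> real"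
  \<comment> \<open>The value \<open>undefined\<close> off \<open>J\<close> is the one that
    \<open>restrict x J\<close> takes there.\<close>
  define F where "F z = f (\<lambda>k. if k \<in> J then R * arcsin (Im (z k)) else undefined) * (\<Prod>k\<in>J. max 0 (Re (z k)))" for z
  have zk: "cmod (z k) = 1" if "z \<in> K" "k \<in> J" for z k
    using that unfolding K_def by (auto simp: PiE_def Pi_def dest: spec[of _ k])
  have "continuous_on K F"
  proof -
    have "continuous_on K (\<lambda>z. (if k \<in> J then R * arcsin (Im (z k)) else undefined))" for k
    proof (cases "k \<in> J")
      case True
      have "- 1 \<le> Im (z k) \<and> Im (z k) \<le> 1" if "z \<in> K" for z
        using abs_Im_le_cmod[of "z k"] zk[OF that True] by auto
      then show ?thesis using True by (auto intro!: continuous_intros co)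
    qed simp
    then have "continuous_on K (\<lambda>z k. if k \<in> J then R * arcsin (Im (z k)) else undefined)"
      by (intro continuous_on_coordinatewise_then_product)
    then have "continuous_on K (\<lambda>z. f (\<lambda>k. if k \<in> J then R * arcsin (Im (z k)) else undefined))"
      by (rule continuous_on_compose2[OF f]) simp
    then show ?thesis unfolding F_def by (auto intro!: continuous_intros co)
  qed
  have "\<exists>g. P g \<and> (\<forall>x\<in>K. \<bar>F x - g x\<bar> < e)"
  proof (rule Stone_Weierstrass_HOL[OF cK])
    show "P (\<lambda>x. c)" for c using trig.cos[of c "\<lambda>_. 0" J 0] by (simp add: P_def)
    show "continuous_on K g" if "P g" for g using that by (simp add: P_def)
    show "P (\<lambda>x. g x + h x)" if "P g \<and> P h" for g h
      using that by (auto simp: P_def intro!: continuous_intros trig.add)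
    show "P (\<lambda>x. g x * h x)" if "P g \<and> P h" for g h
      using that by (auto simp: P_def intro!: continuous_intros trig_mult)
    have single: "(\<Sum>j\<in>J. (if j = k then 1 / R else 0) * x j) = x k / R" if "k \<in> J" for k and x :: "nat \<Rightarrow> real"
    proof -
      have "(\<Sum>j\<in>J. (if j = k then 1 / R else 0) * x j) = (\<Sum>j\<in>J. if j = k then x j / R else 0)"
        by (intro sum.cong) auto
      then show ?thesis using J that by simp
    qed
    have PRe: "P (\<lambda>z. Re (z k))" if "k \<in> J" for k
      using trig.cos[of 1 "\<lambda>j. if j = k then 1 / R else 0" J 0] that
      unfolding single[OF that] by (auto simp: P_def T_def intro!: continuous_intros co)
    have PIm: "P (\<lambda>z. Im (z k))" if "k \<in> J" for k
    proof -
      \<comment> \<open>A phase of \<open>- pi / 2\<close> turns the cosine into the sine, so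
        imaginary parts also belong to the algebra.\<close>
      have "(\<lambda>x. 1 * cos ((\<Sum>j\<in>J. (if j = k then 1 / R else 0) * x j) + (- pi / 2))) = (\<lambda>x. sin (x k / R))"
        unfolding single[OF that] by (simp add: sin_cos_eq cos_diff[symmetric]) (metis cos_minus minus_diff_eq)
      with trig.cos[of 1 "\<lambda>j. if j = k then 1 / R else 0" J "- pi / 2"] that
      show ?thesis by (auto simp: P_def T_def intro!: continuous_intros co)
    qed
    show "\<exists>g. P g \<and> g x \<noteq> g y" if "x \<in> K \<and> y \<in> K \<and> x \<noteq> y" for x y
    proof -
      have "\<exists>k. x k \<noteq> y k" using that by (auto simp: fun_eq_iff)
      then obtain k where k: "x k \<noteq> y k" by blast
      then have "k \<in> J" using that unfolding K_def by (auto simp: PiE_def Pi_def split: if_splits) metis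
      then show ?thesis using k PRe[of k] PIm[of k] by (metis complex_eqI)
    qed
  qed (use \<open>continuous_on K F\<close> e in auto)
  then obtain g where g: "P g" "\<And>x. x \<in> K \<Longrightarrow> \<bar>F x - g x\<bar> < e" by blast
  show ?thesis
  proof (rule that[of "\<lambda>x. g (T x)"])
    show "(\<lambda>x. g (T x)) \<in> trig J" using g(1) by (simp add: P_def)
    fix x :: "nat \<Rightarrow> real"
    have "\<bar>f (restrict x J) - F (T x)\<bar> \<le> 2 * B * (\<Sum>k\<in>J. (x k / R)\<^sup>2)"
    \<comment> \<open>Within the central cell the arcsine inverts the sine, and the error is that of
      the cosine product. Outside it some square exceeds 1, so the crude bound \<open>2 * B\<close>
      suffices.\<close>
    proof (cases "\<forall>k\<in>J. \<bar>x k / R\<bar> \<le> pi / 2")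
      case True
      then have ks: "- (pi / 2) \<le> x k / R \<and> x k / R \<le> pi / 2" if "k \<in> J" for k
        using True[rule_format, OF that] unfolding abs_le_iff by linarith
      have "(\<lambda>k. if k \<in> J then R * arcsin (Im (T x k)) else undefined) = restrict x J"
        using R ks by (auto simp: T_def restrict_def arcsin_sin)
      moreover have pc: "(\<Prod>k\<in>J. max 0 (Re (T x k))) = (\<Prod>k\<in>J. cos (x k / R))"
        using ks by (intro prod.cong refl) (auto simp: T_def max_def intro!: cos_ge_zero order_antisym)
      ultimately have "f (restrict x J) - F (T x) = f (restrict x J) * (1 - (\<Prod>k\<in>J. cos (x k / R)))"
        by (simp add: F_def algebra_simps)
      also have "\<bar>\<dots>\<bar> \<le> B * (\<Sum>k\<in>J. (x k / R)\<^sup>2)"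
        unfolding abs_mult
      proof (intro mult_mono B)
        have "norm ((\<Prod>k\<in>J. 1) - (\<Prod>k\<in>J. cos (x k / R))) \<le> (\<Sum>k\<in>J. norm (1 - cos (x k / R)))"
          by (rule norm_prod_diff) auto
        also have "\<dots> \<le> (\<Sum>k\<in>J. (x k / R)\<^sup>2)"
        proof (rule sum_mono)
          fix k
          show "norm (1 - cos (x k / R)) \<le> (x k / R)\<^sup>2"
            unfolding real_norm_def using one_minus_cos_le[of "x k / R"] cos_le_one[of "x k / R"] zero_le_power2[of "x k / R"]
            by linarith
        qed
        finally show "\<bar>1 - (\<Prod>k\<in>J. cos (x k / R))\<bar> \<le> (\<Sum>k\<in>J. (x k / R)\<^sup>2)" by simp
      qed (use B0 in auto)
      also have "\<dots> \<le> 2 * B * (\<Sum>k\<in>J. (x k / R)\<^sup>2)"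
        using B0 by (intro mult_right_mono) (auto intro!: sum_nonneg)
      finally show ?thesis .
    next
      case False
      then obtain k where k: "k \<in> J" "pi / 2 < \<bar>x k / R\<bar>" by auto
      have "1 \<le> \<bar>x k / R\<bar>" using k(2) pi_gt3 by linarith
      then have "1 \<le> (x k / R)\<^sup>2" by (metis one_le_power power2_abs)
      also have "\<dots> \<le> (\<Sum>k\<in>J. (x k / R)\<^sup>2)" using J k(1) by (intro member_le_sum) auto
      finally have 1: "1 \<le> (\<Sum>k\<in>J. (x k / R)\<^sup>2)" .
      have pb: "\<bar>\<Prod>k\<in>J. max 0 (Re (T x k))\<bar> \<le> 1"
        unfolding abs_prod by (intro prod_le_1) (auto simp: T_def max_def)
      have "\<bar>F (T x)\<bar> \<le> B * 1"
        unfolding F_def abs_mult using B0 pb B by (intro mult_mono) auto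
      then have "\<bar>f (restrict x J) - F (T x)\<bar> \<le> 2 * B * 1" using B[of "restrict x J"] by linarith
      also have "\<dots> \<le> 2 * B * (\<Sum>k\<in>J. (x k / R)\<^sup>2)" using B0 1 by (intro mult_left_mono) auto
      finally show ?thesis .
    qed
    then show "\<bar>f (restrict x J) - g (T x)\<bar> \<le> e + 2 * B * (\<Sum>k\<in>J. (x k / R)\<^sup>2)"
      using g(2)[OF TK[of x]] by linarith
  qed
qed

text \<open>Replacing a test function by a trigonometric polynomial costs at most a constant over
  R^2, the same for all indices and for the limit, because the second moments have a common bound.
  Thus tightness enters through \<open>V\<close> alone.\<close>

lemma conv_in_distribution_vector:
  fixes X :: "'i \<Rightarrow> nat \<Rightarrow> 'w \<Rightarrow> real" and W :: "nat \<Rightarrow> 'v \<Rightarrow> real"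
  assumes M: "prob_space M" and N: "prob_space N" and J: "finite J"
    and X: "\<forall>\<^sub>F i in F. \<forall>k\<in>J. X i k \<in> borel_measurable M \<and> integrable M (\<lambda>\<omega>. (X i k \<omega>)\<^sup>2) \<and> (\<integral>\<omega>. (X i k \<omega>)\<^sup>2 \<partial>M) \<le> V k"
    and W: "\<And>k. k \<in> J \<Longrightarrow> W k \<in> borel_measurable N \<and> integrable N (\<lambda>\<omega>. (W k \<omega>)\<^sup>2) \<and> (\<integral>\<omega>. (W k \<omega>)\<^sup>2 \<partial>N) \<le> V k"
    and char: "\<And>a. ((\<lambda>i. \<integral>\<omega>. iexp (\<Sum>k\<in>J. a k * X i k \<omega>) \<partial>M) \<longlongrightarrow> (\<integral>\<omega>. iexp (\<Sum>k\<in>J. a k * W k \<omega>) \<partial>N)) F"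
  shows "conv_in_distribution M (\<lambda>i \<omega>. \<lambda>k\<in>J. X i k \<omega>) N (\<lambda>\<omega>. \<lambda>k\<in>J. W k \<omega>) F"
proof -
  have meas: "(\<lambda>\<omega>. \<lambda>k\<in>J. Y k \<omega>) \<in> borel_measurable K" if "\<And>k. k \<in> J \<Longrightarrow> Y k \<in> borel_measurable K"
    for K and Y :: "nat \<Rightarrow> 'z \<Rightarrow> real"
  proof (rule measurable_coordinatewise_then_product)
    show "(\<lambda>\<omega>. (\<lambda>k\<in>J. Y k \<omega>) i) \<in> borel_measurable K" for i using that by (cases "i \<in> J") auto
  qed
  show ?thesis
    unfolding conv_in_distribution_def
  proof (intro conjI allI impI)
    show "\<forall>\<^sub>F i in F. (\<lambda>\<omega>. \<lambda>k\<in>J. X i k \<omega>) \<in> borel_measurable M"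
      using X by eventually_elim (rule meas, blast)
    show "(\<lambda>\<omega>. \<lambda>k\<in>J. W k \<omega>) \<in> borel_measurable N" using W by (intro meas) blast
    fix f :: "(nat \<Rightarrow> real) \<Rightarrow> real" assume f: "continuous_on UNIV f \<and> bounded (range f)"
    then obtain B where B: "\<And>x. \<bar>f x\<bar> \<le> B" unfolding bounded_iff by auto
    have B0: "0 \<le> B" using B[of undefined] by linarith
    have fm[measurable]: "f \<in> borel_measurable borel" using f by (intro borel_measurable_continuous_onI) auto
    show "((\<lambda>i. \<integral>\<omega>. f (\<lambda>k\<in>J. X i k \<omega>) \<partial>M) \<longlongrightarrow> (\<integral>\<omega>. f (\<lambda>k\<in>J. W k \<omega>) \<partial>N)) F"
    proof (rule tendstoI)
      fix e :: real assume e: "0 < e"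
      define C where "C = 2 * B * (\<Sum>k\<in>J. V k)"
      have V0: "0 \<le> V k" if "k \<in> J" for k
      proof -
        have "0 \<le> (\<integral>\<omega>. (W k \<omega>)\<^sup>2 \<partial>N)" by simp
        then show ?thesis using W[OF that] by linarith
      qed
      have C0: "0 \<le> C" unfolding C_def using B0 V0 by (intro mult_nonneg_nonneg sum_nonneg) auto
      \<comment> \<open>Chosen so that \<open>C / R\<^sup>2\<close> is at most \<open>e / 6\<close>;
        together with the uniform error \<open>e / 6\<close> this gives \<open>e / 3\<close> on each
        side. Adding 1 keeps \<open>R\<close> positive when \<open>C\<close> is 0.\<close>
      define R where "R = sqrt (6 * (C + 1) / e)"
      have R: "0 < R" and R2: "R\<^sup>2 = 6 * (C + 1) / e" using e C0 by (auto simp: R_def)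
      have CR: "C / R\<^sup>2 \<le> e / 6" unfolding R2 using e C0 by (simp add: field_simps)
      obtain h where h: "h \<in> trig J" and hf: "\<And>x. \<bar>f (restrict x J) - h x\<bar> \<le> e / 6 + 2 * B * (\<Sum>k\<in>J. (x k / R)\<^sup>2)"
        using trig_approx[OF J conjunct1[OF f] B _ R, of "e / 6"] e by auto
      obtain H where H: "\<And>x. \<bar>h x\<bar> \<le> H" using trig_bounded[OF h] by blast
      have approx: "\<bar>(\<integral>\<omega>. f (\<lambda>k\<in>J. Y k \<omega>) \<partial>K) - (\<integral>\<omega>. h (\<lambda>k. Y k \<omega>) \<partial>K)\<bar> \<le> e / 3"
        if K: "prob_space K" and Y: "\<And>k. k \<in> J \<Longrightarrow> Y k \<in> borel_measurable K \<and> integrable K (\<lambda>\<omega>. (Y k \<omega>)\<^sup>2) \<and> (\<integral>\<omega>. (Y k \<omega>)\<^sup>2 \<partial>K) \<le> V k"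
        for K and Y :: "nat \<Rightarrow> 'z \<Rightarrow> real"
      proof -
        interpret K: prob_space K by fact
        have [measurable]: "(\<lambda>\<omega>. \<lambda>k\<in>J. Y k \<omega>) \<in> borel_measurable K" using Y by (intro meas) auto
        have i1: "integrable K (\<lambda>\<omega>. f (\<lambda>k\<in>J. Y k \<omega>))"
          by (rule K.integrable_const_bound[where B=B]) (auto simp: B)
        have i2: "integrable K (\<lambda>\<omega>. h (\<lambda>k. Y k \<omega>))"
          by (rule K.integrable_const_bound[where B=H]) (use Y in \<open>auto simp: H intro!: trig_measurable[OF h J]\<close>)
        have i3: "integrable K (\<lambda>\<omega>. e / 6 + 2 * B * (\<Sum>k\<in>J. (Y k \<omega>)\<^sup>2 / R\<^sup>2))"
          using Y by (intro Bochner_Integration.integrable_add integrable_mult_right Bochner_Integration.integrable_sum integrable_divide) auto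
        have "\<bar>(\<integral>\<omega>. f (\<lambda>k\<in>J. Y k \<omega>) \<partial>K) - (\<integral>\<omega>. h (\<lambda>k. Y k \<omega>) \<partial>K)\<bar> = \<bar>\<integral>\<omega>. f (\<lambda>k\<in>J. Y k \<omega>) - h (\<lambda>k. Y k \<omega>) \<partial>K\<bar>"
          using i1 i2 by simp
        also have "\<dots> \<le> (\<integral>\<omega>. \<bar>f (\<lambda>k\<in>J. Y k \<omega>) - h (\<lambda>k. Y k \<omega>)\<bar> \<partial>K)" by (rule integral_abs_bound)
        also have "\<dots> \<le> (\<integral>\<omega>. e / 6 + 2 * B * (\<Sum>k\<in>J. (Y k \<omega>)\<^sup>2 / R\<^sup>2) \<partial>K)"
          using i1 i2 i3 hf by (intro integral_mono integrable_abs Bochner_Integration.integrable_diff) (auto simp: power_divide)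
        also have "\<dots> = e / 6 + 2 * B * (\<Sum>k\<in>J. (\<integral>\<omega>. (Y k \<omega>)\<^sup>2 \<partial>K) / R\<^sup>2)"
          using Y by (subst Bochner_Integration.integral_add) (auto simp: Bochner_Integration.integral_sum K.prob_space)
        also have "\<dots> \<le> e / 6 + 2 * B * (\<Sum>k\<in>J. V k / R\<^sup>2)"
          using Y B0 by (intro add_left_mono mult_left_mono sum_mono divide_right_mono) auto
        also have "\<dots> = e / 6 + C / R\<^sup>2" unfolding C_def by (simp add: sum_divide_distrib[symmetric])
        also have "\<dots> \<le> e / 6 + e / 6" using CR by (rule add_left_mono)
        also have "\<dots> = e / 3" by simp
        finally show ?thesis .
      qed
      have X': "\<forall>\<^sub>F i in F. \<forall>k\<in>J. X i k \<in> borel_measurable M" using X by eventually_elim blast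
      have "((\<lambda>i. \<integral>\<omega>. h (\<lambda>k. X i k \<omega>) \<partial>M) \<longlongrightarrow> (\<integral>\<omega>. h (\<lambda>k. W k \<omega>) \<partial>N)) F"
        using W by (intro expectation_trig_tendsto[OF h M N J X' _ char]) blast
      then have "\<forall>\<^sub>F i in F. dist (\<integral>\<omega>. h (\<lambda>k. X i k \<omega>) \<partial>M) (\<integral>\<omega>. h (\<lambda>k. W k \<omega>) \<partial>N) < e / 3"
        by (rule tendstoD) (use e in simp)
      then show "\<forall>\<^sub>F i in F. dist (\<integral>\<omega>. f (\<lambda>k\<in>J. X i k \<omega>) \<partial>M) (\<integral>\<omega>. f (\<lambda>k\<in>J. W k \<omega>) \<partial>N) < e"
        using X
      proof eventually_elim
        case (elim i)
        have "\<bar>(\<integral>\<omega>. f (\<lambda>k\<in>J. X i k \<omega>) \<partial>M) - (\<integral>\<omega>. h (\<lambda>k. X i k \<omega>) \<partial>M)\<bar> \<le> e / 3"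
          by (rule approx[OF M]) (use elim in blast)
        moreover have "\<bar>(\<integral>\<omega>. f (\<lambda>k\<in>J. W k \<omega>) \<partial>N) - (\<integral>\<omega>. h (\<lambda>k. W k \<omega>) \<partial>N)\<bar> \<le> e / 3"
          by (rule approx[OF N W])
        ultimately show ?case using elim(1) unfolding dist_real_def by linarith
      qed
    qed
  qed
qed

section \<open>Gaussian sequences with prescribed covariance\<close>

definition psd :: "(nat \<Rightarrow> nat \<Rightarrow> real) \<Rightarrow> bool" where
  "psd K \<longleftrightarrow> (\<forall>k l. K k l = K l k) \<and> (\<forall>J a. finite J \<longrightarrow> 0 \<le> (\<Sum>k\<in>J. \<Sum>l\<in>J. a k * a l * K k l))"

text \<open>One step of symmetric Gaussian elimination, the Schur complement of the entry at
  \<open>i\<close>. For a zero pivot the quotient is 0 and the kernel stays unchanged.\<close>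

definition schur :: "(nat \<Rightarrow> nat \<Rightarrow> real) \<Rightarrow> nat \<Rightarrow> nat \<Rightarrow> nat \<Rightarrow> real" where
  "schur K i k l = K k l - K k i * K i l / K i i"

lemma psd_sym: "psd K \<Longrightarrow> K k l = K l k"
  by (simp add: psd_def)

lemma psd_nonneg: "psd K \<Longrightarrow> finite J \<Longrightarrow> 0 \<le> (\<Sum>k\<in>J. \<Sum>l\<in>J. a k * a l * K k l)"
  by (simp add: psd_def)

lemma psd_diag: "psd K \<Longrightarrow> 0 \<le> K k k"
  using psd_nonneg[of K "{k}" "\<lambda>_. 1"] by simp

text \<open>With a zero diagonal entry the form on two indices is affine in the coefficient of
  \<open>k\<close>. An affine function that is nonnegative everywhere has slope 0.\<close>

lemma psd_null:
  assumes K: "psd K" and 0: "K k k = 0"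
  shows "K k l = 0"
proof (cases "k = l")
  case False
  have q: "0 \<le> 2 * t * K k l + K l l" for t
  proof -
    have "0 \<le> (\<Sum>i\<in>{k, l}. \<Sum>j\<in>{k, l}. (if i = k then t else 1) * (if j = k then t else 1) * K i j)"
      by (rule psd_nonneg[OF K]) simp
    then show ?thesis using False 0 psd_sym[OF K, of l k] by simp
  qed
  show ?thesis
  proof (rule ccontr)
    assume n: "K k l \<noteq> 0"
    have "2 * (- (K l l + 1) / (2 * K k l)) * K k l + K l l = - 1" using n by (simp add: field_simps)
    \<comment> \<open>At this coefficient the affine form takes the value -1.\<close>
    then show False using q[of "- (K l l + 1) / (2 * K k l)"] by linarith
  qed
qed (use 0 in simp)

text \<open>Completing the square: the form of the complement is the original form with the
  coefficient at \<open>i\<close> shifted by its minimiser.\<close>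

lemma schur_psd:
  assumes K: "psd K"
  shows "psd (schur K i)"
proof -
  define c where "c = K i i"
  have "schur K i k l = schur K i l k" for k l
    unfolding schur_def using psd_sym[OF K, of k l] psd_sym[OF K, of k i] psd_sym[OF K, of i l] by (simp add: mult.commute)
  moreover have "0 \<le> (\<Sum>k\<in>J. \<Sum>l\<in>J. a k * a l * schur K i k l)" if J: "finite J" for J a
  proof -
    define b where "b = (\<Sum>k\<in>J. a k * K k i)"
    \<comment> \<open>The minimiser of the quadratic in the shift; for \<open>c = 0\<close> the
      division yields 0, in agreement with the unchanged kernel.\<close>
    define t where "t = - b / c"
    define x where "x k = (if k \<in> J then a k else 0) + (if k = i then t else 0)" for k
    have ex: "(\<Sum>k\<in>insert i J. x k * f k) = (\<Sum>k\<in>J. a k * f k) + t * f i" for f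
    proof -
      have "(\<Sum>k\<in>insert i J. x k * f k) = (\<Sum>k\<in>insert i J. if k \<in> J then a k * f k else 0) + (\<Sum>k\<in>insert i J. if k = i then t * f i else 0)"
        unfolding x_def sum.distrib[symmetric] by (intro sum.cong) (auto simp: algebra_simps)
      also have "(\<Sum>k\<in>insert i J. if k \<in> J then a k * f k else 0) = (\<Sum>k\<in>J. a k * f k)"
        using J by (intro sum.mono_neutral_cong_right) auto
      also have "(\<Sum>k\<in>insert i J. if k = i then t * f i else 0) = t * f i" using J by simp
      finally show ?thesis .
    qed
    have sb: "(\<Sum>l\<in>J. a l * K i l) = b" unfolding b_def using psd_sym[OF K] by (intro sum.cong) auto
    have "0 \<le> (\<Sum>k\<in>insert i J. \<Sum>l\<in>insert i J. x k * x l * K k l)"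
      using J by (intro psd_nonneg[OF K]) simp
    also have "\<dots> = (\<Sum>k\<in>insert i J. x k * (\<Sum>l\<in>insert i J. x l * K k l))"
      by (simp only: sum_distrib_left mult.assoc)
    also have "\<dots> = (\<Sum>k\<in>J. a k * ((\<Sum>l\<in>J. a l * K k l) + t * K k i)) + t * (b + t * c)"
      unfolding ex sb c_def ..
    also have "(\<Sum>k\<in>J. a k * ((\<Sum>l\<in>J. a l * K k l) + t * K k i)) = (\<Sum>k\<in>J. \<Sum>l\<in>J. a k * a l * K k l) + t * b"
      by (simp add: distrib_left sum.distrib sum_distrib_left b_def mult_ac)
    finally have 1: "0 \<le> (\<Sum>k\<in>J. \<Sum>l\<in>J. a k * a l * K k l) + t * b + t * (b + t * c)" .
    have "(\<Sum>k\<in>J. \<Sum>l\<in>J. a k * a l * schur K i k l) = (\<Sum>k\<in>J. \<Sum>l\<in>J. a k * a l * K k l) - (\<Sum>k\<in>J. a k * K k i) * (\<Sum>l\<in>J. a l * K i l) / c"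
      by (simp add: schur_def c_def sum_product sum_divide_distrib sum_subtractf algebra_simps)
    also have "\<dots> = (\<Sum>k\<in>J. \<Sum>l\<in>J. a k * a l * K k l) - b * b / c" unfolding sb b_def[symmetric] ..
    also have "- b * b / c = t * b + t * (b + t * c)"
    proof (cases "c = 0")
      case False
      then show ?thesis by (simp add: t_def)
    qed (simp add: t_def)
    then have "(\<Sum>k\<in>J. \<Sum>l\<in>J. a k * a l * K k l) - b * b / c = (\<Sum>k\<in>J. \<Sum>l\<in>J. a k * a l * K k l) + t * b + t * (b + t * c)"
      by simp
    finally show ?thesis using 1 by simp
  qed
  ultimately show ?thesis unfolding psd_def by blast
qed

primrec schur_iter :: "(nat \<Rightarrow> nat \<Rightarrow> real) \<Rightarrow> nat \<Rightarrow> nat \<Rightarrow> nat \<Rightarrow> real" where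
  "schur_iter K 0 = K"
| "schur_iter K (Suc i) = schur (schur_iter K i) i"

lemma schur_iter_psd: "psd K \<Longrightarrow> psd (schur_iter K i)"
  by (induction i) (auto intro: schur_psd)

text \<open>Step \<open>i\<close> annihilates row \<open>i\<close> and preserves the rows that are
  already zero. For a zero pivot the row vanishes beforehand by \<open>psd_null\<close>.\<close>

lemma schur_iter_null:
  assumes K: "psd K"
  shows "k < i \<Longrightarrow> schur_iter K i k l = 0"
proof (induction i arbitrary: l)
  case (Suc i)
  note P = schur_iter_psd[OF K, of i]
  show ?case
  proof (cases "k = i")
    case True
    show ?thesis
    proof (cases "schur_iter K i i i = 0")
      case z: True
      then show ?thesis using psd_null[OF P z] True by (simp add: schur_def)
    next
      case False
      then show ?thesis using True by (simp add: schur_def)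
    qed
  next
    case False
    then have "k < i" using Suc.prems by simp
    then show ?thesis using Suc.IH by (simp add: schur_def)
  qed
qed simp

text \<open>Column \<open>i\<close> of the Cholesky factor. A zero pivot gives a zero column because
  division by 0 is 0, so singular covariances need no separate treatment.\<close>

definition chol :: "(nat \<Rightarrow> nat \<Rightarrow> real) \<Rightarrow> nat \<Rightarrow> nat \<Rightarrow> real" where
  "chol K k i = schur_iter K i k i / sqrt (schur_iter K i i i)"

lemma chol_upper: "psd K \<Longrightarrow> k < i \<Longrightarrow> chol K k i = 0"
  by (simp add: chol_def schur_iter_null)

text \<open>Each elimination step subtracts the rank-one kernel of one column, so the sum
  telescopes.\<close>

lemma chol_sum:
  assumes K: "psd K"
  shows "K k l = (\<Sum>i<n. chol K k i * chol K l i) + schur_iter K n k l"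
proof (induction n)
  case (Suc n)
  have "chol K k n * chol K l n = schur_iter K n k n * schur_iter K n n l / schur_iter K n n n"
    using psd_sym[OF schur_iter_psd[OF K], of n l n] psd_diag[OF schur_iter_psd[OF K], of n n]
    by (simp add: chol_def)
  then show ?case using Suc by (simp add: schur_def)
qed simp

lemma chol_factor:
  assumes K: "psd K" and n: "k < n"
  shows "(\<Sum>i<n. chol K k i * chol K l i) = K k l"
  using chol_sum[OF K, of k l n] schur_iter_null[OF K n, of l] by simp

section \<open>Independent standard normal variables and their linear combinations\<close>

locale std_normal_sequence =
  fixes N :: "(nat \<Rightarrow> real) measure"
  defines "N \<equiv> PiM UNIV (\<lambda>_. std_normal_distribution)"
begin

sublocale prob_space N
  unfolding N_def by (intro prob_space_PiM prob_space_normal_density) simp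

lemma coordinate_measurable[measurable]: "(\<lambda>\<omega>. \<omega> i) \<in> borel_measurable N"
  unfolding N_def by measurable

lemma distr_coordinate: "distr N borel (\<lambda>\<omega>. \<omega> i) = std_normal_distribution"
proof -
  have "distr (PiM UNIV (\<lambda>_. std_normal_distribution)) std_normal_distribution (\<lambda>\<omega>. \<omega> i) = std_normal_distribution"
    by (rule distr_PiM_component) (auto intro: prob_space_normal_density)
  moreover have "distr N borel (\<lambda>\<omega>. \<omega> i) = distr N std_normal_distribution (\<lambda>\<omega>. \<omega> i)"
    by (rule distr_cong) auto
  ultimately show ?thesis by (simp add: N_def)
qed

lemma indep_coordinates: "indep_vars (\<lambda>_. borel) (\<lambda>i \<omega>. \<omega> i) UNIV"
proof -
  have "distr N (PiM UNIV (\<lambda>_. borel)) (\<lambda>\<omega>. \<lambda>i\<in>UNIV. \<omega> i) = N"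
  proof -
    have "distr N (PiM UNIV (\<lambda>_. borel)) (\<lambda>\<omega>. \<omega>) = N"
      unfolding N_def by (rule distr_id2) (intro sets_PiM_cong, auto)
    then show ?thesis by (simp add: restrict_UNIV)
  qed
  moreover have "PiM UNIV (\<lambda>i. distr N borel (\<lambda>\<omega>. \<omega> i)) = N"
    unfolding distr_coordinate by (simp add: N_def)
  ultimately show ?thesis
    by (subst indep_vars_iff_distr_eq_PiM') auto
qed

lemma distributed_coordinate: "distributed N lborel (\<lambda>\<omega>. \<omega> i) std_normal_density"
  unfolding distributed_def
proof (intro conjI)
  have "distr N lborel (\<lambda>\<omega>. \<omega> i) = distr N borel (\<lambda>\<omega>. \<omega> i)" by (rule distr_cong) auto
  then show "distr N lborel (\<lambda>\<omega>. \<omega> i) = density lborel std_normal_density"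
    by (simp add: distr_coordinate)
qed auto

lemma coordinate_moments:
  "has_bochner_integral N (\<lambda>\<omega>. \<omega> i) 0" "has_bochner_integral N (\<lambda>\<omega>. (\<omega> i)\<^sup>2) 1"
proof -
  have b: "has_bochner_integral N (\<lambda>\<omega>. f (\<omega> i)) x" if f: "has_bochner_integral lborel (\<lambda>y. std_normal_density y * f y) x"
    and [measurable]: "f \<in> borel_measurable borel" for f :: "real \<Rightarrow> real" and x
  proof -
    have "has_bochner_integral std_normal_distribution f x"
      using f by (intro has_bochner_integral_density) (auto simp: std_normal_density_def)
    then have "has_bochner_integral (distr N borel (\<lambda>\<omega>. \<omega> i)) f x" by (simp add: distr_coordinate)
    then show ?thesis by (auto simp: has_bochner_integral_iff integrable_distr_eq integral_distr)
  qed
  show "has_bochner_integral N (\<lambda>\<omega>. \<omega> i) 0"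
    by (rule b) (use std_normal_moment_odd[of 0] in auto)
  show "has_bochner_integral N (\<lambda>\<omega>. (\<omega> i)\<^sup>2) 1"
    by (rule b) (use std_normal_moment_even[of 1] in auto)
qed

lemma coordinate_product:
  shows "has_bochner_integral N (\<lambda>\<omega>. \<omega> i * \<omega> j) (if i = j then 1 else 0)"
proof (cases "i = j")
  case True
  then show ?thesis using coordinate_moments(2)[of j] by (simp add: power2_eq_square)
next
  case False
  have ind: "indep_vars (\<lambda>_. borel) (\<lambda>i \<omega>. \<omega> i) {i, j}" by (rule indep_vars_subset[OF indep_coordinates]) auto
  have int: "integrable N (\<lambda>\<omega>. \<omega> k)" and "(\<integral>\<omega>. \<omega> k \<partial>N) = 0" for k
    using coordinate_moments(1)[of k] by (auto simp: has_bochner_integral_iff)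
  then show ?thesis
    using indep_vars_lebesgue_integral[OF _ ind] indep_vars_integrable[OF _ ind] False
    by (simp add: has_bochner_integral_iff)
qed

lemma linear_moments:
  "has_bochner_integral N (\<lambda>\<omega>. \<Sum>i<n. d i * \<omega> i) 0"
  "has_bochner_integral N (\<lambda>\<omega>. (\<Sum>i<n. d i * \<omega> i) * (\<Sum>i<n. e i * \<omega> i)) (\<Sum>i<n. d i * e i)"
proof -
  have "has_bochner_integral N (\<lambda>\<omega>. \<Sum>i<n. d i * \<omega> i) (\<Sum>i<n. d i * 0)"
    by (intro has_bochner_integral_sum has_bochner_integral_mult_right coordinate_moments)
  then show "has_bochner_integral N (\<lambda>\<omega>. \<Sum>i<n. d i * \<omega> i) 0" by simp
  have "has_bochner_integral N (\<lambda>\<omega>. \<Sum>i<n. \<Sum>j<n. (d i * e j) * (\<omega> i * \<omega> j)) (\<Sum>i<n. \<Sum>j<n. (d i * e j) * (if i = j then 1 else 0))"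
    by (intro has_bochner_integral_sum has_bochner_integral_mult_right coordinate_product)
  moreover have "(\<lambda>\<omega>. \<Sum>i<n. \<Sum>j<n. (d i * e j) * (\<omega> i * \<omega> j)) = (\<lambda>\<omega>. (\<Sum>i<n. d i * \<omega> i) * (\<Sum>i<n. e i * \<omega> i))"
    by (auto simp: sum_product mult_ac)
  moreover have "(\<Sum>i<n. \<Sum>j<n. (d i * e j) * (if i = j then 1 else 0)) = (\<Sum>i<n. d i * e i)"
  proof (intro sum.cong refl)
    fix i assume "i \<in> {..<n}"
    moreover have "(\<Sum>j<n. d i * e j * (if i = j then 1 else 0)) = (\<Sum>j<n. if j = i then d i * e i else 0)"
      by (intro sum.cong) auto
    ultimately show "(\<Sum>j<n. d i * e j * (if i = j then 1 else 0)) = d i * e i" by simp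
  qed
  ultimately show "has_bochner_integral N (\<lambda>\<omega>. (\<Sum>i<n. d i * \<omega> i) * (\<Sum>i<n. e i * \<omega> i)) (\<Sum>i<n. d i * e i)"
    by simp
qed

lemma linear_gaussian: "gaussian_rv N (\<lambda>\<omega>. \<Sum>i<n. d i * \<omega> i)"
proof -
  \<comment> \<open>The sum of independent normals is formed from positive standard deviations, so
    zero coefficients are dropped; an empty remainder is the degenerate Gaussian case.\<close>
  define I where "I = {i. i < n \<and> d i \<noteq> 0}"
  have eq: "(\<lambda>\<omega>. \<Sum>i<n. d i * \<omega> i) = (\<lambda>\<omega>. \<Sum>i\<in>I. d i * \<omega> i)"
    unfolding I_def by (intro ext sum.mono_neutral_cong_right) auto
  show ?thesis
  proof (cases "I = {}")
    case True
    then show ?thesis unfolding gaussian_rv_def eq by auto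
  next
    case False
    have fI: "finite I" by (simp add: I_def)
    have "indep_vars (\<lambda>_. borel) (\<lambda>i \<omega>. d i * \<omega> i) I"
      by (rule indep_vars_compose2[OF indep_vars_subset[OF indep_coordinates], of _ "\<lambda>i x. d i * x"]) auto
    moreover have "distributed N lborel (\<lambda>\<omega>. d i * \<omega> i) (normal_density 0 \<bar>d i\<bar>)" if "i \<in> I" for i
      using normal_density_affine[OF distributed_coordinate[of i], of "d i" 0] that by (simp add: I_def)
    ultimately have "distributed N lborel (\<lambda>\<omega>. \<Sum>i\<in>I. d i * \<omega> i) (normal_density (\<Sum>i\<in>I. 0) (sqrt (\<Sum>i\<in>I. \<bar>d i\<bar>\<^sup>2)))"
      using False fI by (intro sum_indep_normal) (auto simp: I_def)
    moreover have "0 < (\<Sum>i\<in>I. \<bar>d i\<bar>\<^sup>2)" using False fI by (intro sum_pos) (auto simp: I_def)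
    ultimately show ?thesis unfolding gaussian_rv_def eq
      by (intro conjI disjI1 exI[of _ "\<Sum>i\<in>I. 0 :: real"] exI[of _ "sqrt (\<Sum>i\<in>I. \<bar>d i\<bar>\<^sup>2)"]) auto
  qed
qed

lemma linear_char: "(\<integral>\<omega>. iexp (\<Sum>i<n. d i * \<omega> i) \<partial>N) = exp (- (\<Sum>i<n. (d i)\<^sup>2) / 2)"
proof -
  have "indep_vars (\<lambda>_. borel) (\<lambda>i \<omega>. iexp (d i * \<omega> i)) {..<n}"
    by (rule indep_vars_compose2[OF indep_vars_subset[OF indep_coordinates], of _ "\<lambda>i x. iexp (d i * x)"]) auto
  moreover have "integrable N (\<lambda>\<omega>. iexp (d i * \<omega> i))" for i
    by (rule integrable_const_bound[where B=1]) auto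
  ultimately have "(\<integral>\<omega>. (\<Prod>i<n. iexp (d i * \<omega> i)) \<partial>N) = (\<Prod>i<n. \<integral>\<omega>. iexp (d i * \<omega> i) \<partial>N)"
    by (intro indep_vars_lebesgue_integral) auto
  also have "\<dots> = (\<Prod>i<n. complex_of_real (exp (- (d i)\<^sup>2 / 2)))"
  proof (intro prod.cong refl)
    fix i
    have "(\<integral>\<omega>. iexp (d i * \<omega> i) \<partial>N) = (\<integral>x. iexp (d i * x) \<partial>distr N borel (\<lambda>\<omega>. \<omega> i))"
      by (subst integral_distr) auto
    also have "\<dots> = char std_normal_distribution (d i)" by (simp add: distr_coordinate char_def)
    finally show "(\<integral>\<omega>. iexp (d i * \<omega> i) \<partial>N) = complex_of_real (exp (- (d i)\<^sup>2 / 2))"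
      by (simp add: char_std_normal_distribution)
  qed
  also have "\<dots> = exp (- (\<Sum>i<n. (d i)\<^sup>2) / 2)"
    by (simp only: of_real_prod[symmetric] exp_sum[symmetric] finite_lessThan) (simp add: sum_negf sum_divide_distrib)
  also have "(\<lambda>\<omega>. (\<Prod>i<n. iexp (d i * \<omega> i))) = (\<lambda>\<omega>. iexp (\<Sum>i<n. d i * \<omega> i))"
    by (simp add: exp_sum sum_distrib_left)
  finally show ?thesis .
qed

end

text \<open>The Cholesky factor is lower triangular, so every \<open>W k\<close> is a finite
  combination of coordinates and the whole sequence lives on one product space. Finite combinations
  of the \<open>W k\<close> are again of this kind, which gives Gaussianity and the characteristic
  function.\<close>

lemma gaussian_sequence_exists:
  assumes K: "psd K"
  obtains N :: "(nat \<Rightarrow> real) measure" and W where "prob_space N" "\<And>k. W k \<in> borel_measurable N"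
    "\<And>k. has_bochner_integral N (W k) 0" "\<And>k l. has_bochner_integral N (\<lambda>\<omega>. W k \<omega> * W l \<omega>) (K k l)"
    "\<And>J c. finite J \<Longrightarrow> gaussian_rv N (\<lambda>\<omega>. \<Sum>k\<in>J. c k * W k \<omega>)"
    "\<And>J c. finite J \<Longrightarrow> (\<integral>\<omega>. iexp (\<Sum>k\<in>J. c k * W k \<omega>) \<partial>N) = exp (- (\<Sum>k\<in>J. \<Sum>l\<in>J. c k * c l * K k l) / 2)"
proof -
  define N where "N = PiM UNIV (\<lambda>_::nat. std_normal_distribution)"
  interpret std_normal_sequence N by unfold_locales (rule eq_reflection[OF N_def])
  define W where "W k \<omega> = (\<Sum>i\<le>k. chol K k i * \<omega> i)" for k and \<omega> :: "nat \<Rightarrow> real"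
  have W: "W k = (\<lambda>\<omega>. \<Sum>i<n. chol K k i * \<omega> i)" if "k < n" for k n
    unfolding W_def using that chol_upper[OF K] by (intro ext sum.mono_neutral_cong_left) auto
  have lin: "\<exists>n d. (\<lambda>\<omega>. \<Sum>k\<in>J. c k * W k \<omega>) = (\<lambda>\<omega>. \<Sum>i<n. d i * \<omega> i) \<and> (\<Sum>i<n. (d i)\<^sup>2) = (\<Sum>k\<in>J. \<Sum>l\<in>J. c k * c l * K k l)"
    if J: "finite J" for J c
  proof -
    obtain n where n: "J \<subseteq> {..<n}" using J finite_nat_iff_bounded by auto
    define d where "d i = (\<Sum>k\<in>J. c k * chol K k i)" for i
    have "(\<Sum>k\<in>J. c k * W k \<omega>) = (\<Sum>i<n. d i * \<omega> i)" for \<omega>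
    proof -
      have "(\<Sum>k\<in>J. c k * W k \<omega>) = (\<Sum>k\<in>J. \<Sum>i<n. c k * chol K k i * \<omega> i)"
      proof (rule sum.cong[OF refl])
        fix k assume "k \<in> J"
        then have "k < n" using n by auto
        from W[OF this] show "c k * W k \<omega> = (\<Sum>i<n. c k * chol K k i * \<omega> i)" by (simp add: sum_distrib_left mult.assoc)
      qed
      also have "\<dots> = (\<Sum>i<n. \<Sum>k\<in>J. c k * chol K k i * \<omega> i)" by (rule sum.swap)
      finally show ?thesis by (simp add: d_def sum_distrib_right)
    qed
    moreover have "(\<Sum>i<n. (d i)\<^sup>2) = (\<Sum>k\<in>J. \<Sum>l\<in>J. c k * c l * K k l)"
    proof -
      have "(\<Sum>i<n. (d i)\<^sup>2) = (\<Sum>i<n. \<Sum>k\<in>J. \<Sum>l\<in>J. c k * c l * (chol K k i * chol K l i))"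
        by (simp add: d_def power2_eq_square sum_product mult_ac)
      also have "\<dots> = (\<Sum>k\<in>J. \<Sum>i<n. \<Sum>l\<in>J. c k * c l * (chol K k i * chol K l i))" by (rule sum.swap)
      also have "\<dots> = (\<Sum>k\<in>J. \<Sum>l\<in>J. \<Sum>i<n. c k * c l * (chol K k i * chol K l i))"
        by (intro sum.cong refl sum.swap)
      also have "\<dots> = (\<Sum>k\<in>J. \<Sum>l\<in>J. c k * c l * K k l)"
        unfolding sum_distrib_left[symmetric] using n by (intro sum.cong refl) (auto simp: chol_factor[OF K])
      finally show ?thesis .
    qed
    ultimately show ?thesis by blast
  qed
  show ?thesis
  proof (rule that[of N W])
    show "prob_space N" by (rule prob_space_axioms)
    show "W k \<in> borel_measurable N" for k unfolding W_def by measurable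
    show "has_bochner_integral N (W k) 0" for k
      unfolding W[of k "Suc k", OF lessI] by (rule linear_moments)
    show "has_bochner_integral N (\<lambda>\<omega>. W k \<omega> * W l \<omega>) (K k l)" for k l
    proof -
      have kl: "k < Suc (max k l)" "l < Suc (max k l)" by auto
      show ?thesis
        unfolding W[OF kl(1)] W[OF kl(2)] chol_factor[OF K kl(1), of l, symmetric] by (rule linear_moments)
    qed
    fix J :: "nat set" and c :: "nat \<Rightarrow> real" assume J: "finite J"
    obtain n d where nd: "(\<lambda>\<omega>. \<Sum>k\<in>J. c k * W k \<omega>) = (\<lambda>\<omega>. \<Sum>i<n. d i * \<omega> i)"
      "(\<Sum>i<n. (d i)\<^sup>2) = (\<Sum>k\<in>J. \<Sum>l\<in>J. c k * c l * K k l)" using lin[OF J, of c] by blast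
    show "gaussian_rv N (\<lambda>\<omega>. \<Sum>k\<in>J. c k * W k \<omega>)" unfolding nd by (rule linear_gaussian)
    show "(\<integral>\<omega>. iexp (\<Sum>k\<in>J. c k * W k \<omega>) \<partial>N) = exp (- (\<Sum>k\<in>J. \<Sum>l\<in>J. c k * c l * K k l) / 2)"
      using linear_char[of d n] unfolding nd(2)[symmetric] fun_cong[OF nd(1)] .
  qed
qed

section \<open>Integrals of second-order fields\<close>

context prob_space begin

text \<open>The uniform bound \<open>V\<close> on second moments makes the integrands for one and
  for two space variables integrable on the product spaces. Fubini then applies, and the square of a
  path integral is a double integral.\<close>

lemma
  fixes Z :: "'b::euclidean_space \<Rightarrow> 'a \<Rightarrow> real"
  assumes Z: "(\<lambda>p. Z (fst p) (snd p)) \<in> borel_measurable (borel \<Otimes>\<^sub>M M)"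
    and Z2: "\<And>t. integrable M (\<lambda>\<omega>. (Z t \<omega>)\<^sup>2)" "\<And>t. (\<integral>\<omega>. (Z t \<omega>)\<^sup>2 \<partial>M) \<le> V"
    and a: "integrable lborel a"
  shows AE_integrable_field: "AE \<omega> in M. integrable lborel (\<lambda>t. a t * Z t \<omega>)"
    and integrable_field_integral: "integrable M (\<lambda>\<omega>. \<integral>t. a t * Z t \<omega> \<partial>lborel)"
    and expectation_field_integral: "(\<integral>\<omega>. \<integral>t. a t * Z t \<omega> \<partial>lborel \<partial>M) = (\<integral>t. a t * (\<integral>\<omega>. Z t \<omega> \<partial>M) \<partial>lborel)"
    and integrable_field_integral_square: "integrable M (\<lambda>\<omega>. (\<integral>t. a t * Z t \<omega> \<partial>lborel)\<^sup>2)"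
    and expectation_field_integral_square: "(\<integral>\<omega>. (\<integral>t. a t * Z t \<omega> \<partial>lborel)\<^sup>2 \<partial>M) =
      (\<integral>t. \<integral>t'. a t * a t' * (\<integral>\<omega>. Z t \<omega> * Z t' \<omega> \<partial>M) \<partial>lborel \<partial>lborel)"
proof -
  interpret lM: pair_sigma_finite "lborel :: 'b measure" M ..
  interpret ll: sigma_finite_measure "lborel \<Otimes>\<^sub>M lborel :: ('b \<times> 'b) measure"
    by (intro sigma_finite_pair_measure sigma_finite_lborel)
  interpret llM: pair_sigma_finite "lborel \<Otimes>\<^sub>M lborel :: ('b \<times> 'b) measure" M ..
  have [measurable]: "a \<in> borel_measurable borel" using a by auto
  have Zr[measurable (raw)]: "(\<lambda>x. Z (f x) (g x)) \<in> borel_measurable K"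
    if [measurable]: "f \<in> borel_measurable K" "g \<in> K \<rightarrow>\<^sub>M M" for f g and K :: "'k measure"
    using measurable_compose[OF measurable_Pair[OF that] Z] by simp
  have Z1: "integrable M (\<lambda>\<omega>. Z t \<omega>)" for t
    by (rule square_integrable_imp_integrable[OF _ Z2(1)]) measurable
  have ZZ: "integrable M (\<lambda>\<omega>. Z t \<omega> * Z t' \<omega>)" "(\<integral>\<omega>. \<bar>Z t \<omega> * Z t' \<omega>\<bar> \<partial>M) \<le> V" for t t'
  proof -
    have le: "\<bar>Z t \<omega> * Z t' \<omega>\<bar> \<le> ((Z t \<omega>)\<^sup>2 + (Z t' \<omega>)\<^sup>2) / 2" for \<omega>
      using zero_le_power2[of "\<bar>Z t \<omega>\<bar> - \<bar>Z t' \<omega>\<bar>"] by (simp add: power2_diff abs_mult)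
    have i: "integrable M (\<lambda>\<omega>. ((Z t \<omega>)\<^sup>2 + (Z t' \<omega>)\<^sup>2) / 2)" using Z2(1) by auto
    show ZZ: "integrable M (\<lambda>\<omega>. Z t \<omega> * Z t' \<omega>)"
      by (rule Bochner_Integration.integrable_bound[OF i]) (use le in \<open>auto intro: order_trans\<close>)
    have "(\<integral>\<omega>. \<bar>Z t \<omega> * Z t' \<omega>\<bar> \<partial>M) \<le> (\<integral>\<omega>. ((Z t \<omega>)\<^sup>2 + (Z t' \<omega>)\<^sup>2) / 2 \<partial>M)"
      using ZZ i le by (intro integral_mono) auto
    also have "\<dots> \<le> V" using Z2[of t] Z2[of t'] by simp
    finally show "(\<integral>\<omega>. \<bar>Z t \<omega> * Z t' \<omega>\<bar> \<partial>M) \<le> V" .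
  qed
  have EZ: "(\<integral>\<omega>. \<bar>Z t \<omega>\<bar> \<partial>M) \<le> 1 + V" for t
  proof -
    have "(\<integral>\<omega>. \<bar>Z t \<omega>\<bar> \<partial>M) \<le> (\<integral>\<omega>. 1 + (Z t \<omega>)\<^sup>2 \<partial>M)"
    proof (rule integral_mono)
      show "\<bar>Z t \<omega>\<bar> \<le> 1 + (Z t \<omega>)\<^sup>2" for \<omega>
        using zero_le_power2[of "\<bar>Z t \<omega>\<bar> - 1"] zero_le_power2[of "Z t \<omega>"] by (simp add: power2_diff)
    qed (use Z1[of t] Z2(1)[of t] in auto)
    also have "\<dots> \<le> 1 + V" using Z2[of t] by (simp add: prob_space)
    finally show ?thesis .
  qed
  have int1: "integrable (lborel \<Otimes>\<^sub>M M) (\<lambda>(t, \<omega>). a t * Z t \<omega>)"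
  proof (rule lM.Fubini_integrable)
    have "integrable lborel (\<lambda>t. \<bar>a t\<bar> * (\<integral>\<omega>. \<bar>Z t \<omega>\<bar> \<partial>M))"
    proof (rule integrable_bounded_mult[OF integrable_abs[OF a], of _ "1 + V"])
      show "\<bar>\<integral>\<omega>. \<bar>Z t \<omega>\<bar> \<partial>M\<bar> \<le> 1 + V" for t using EZ[of t] by simp
    qed measurable
    then show "integrable lborel (\<lambda>t. \<integral>\<omega>. norm (case (t, \<omega>) of (t, \<omega>) \<Rightarrow> a t * Z t \<omega>) \<partial>M)" by (simp add: abs_mult)
    show "AE t in lborel. integrable M (\<lambda>\<omega>. case (t, \<omega>) of (t, \<omega>) \<Rightarrow> a t * Z t \<omega>)" using Z1 by simp
  qed measurable
  show AE1: "AE \<omega> in M. integrable lborel (\<lambda>t. a t * Z t \<omega>)"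
    using lM.AE_integrable_snd[OF int1] by simp
  show "integrable M (\<lambda>\<omega>. \<integral>t. a t * Z t \<omega> \<partial>lborel)"
    using lM.integrable_snd[OF int1] by simp
  show "(\<integral>\<omega>. \<integral>t. a t * Z t \<omega> \<partial>lborel \<partial>M) = (\<integral>t. a t * (\<integral>\<omega>. Z t \<omega> \<partial>M) \<partial>lborel)"
    using lM.Fubini_integral[OF int1] by simp
  define F where "F p \<omega> = a (fst p) * a (snd p) * (Z (fst p) \<omega> * Z (snd p) \<omega>)" for p \<omega>
  have aa: "integrable (lborel \<Otimes>\<^sub>M lborel) (\<lambda>p. a (fst p) * a (snd p))"
    by (rule lborel_pair.integrable_mult_pair[OF a a])
  have int2: "integrable ((lborel \<Otimes>\<^sub>M lborel) \<Otimes>\<^sub>M M) (\<lambda>(p, \<omega>). F p \<omega>)"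
  proof (rule llM.Fubini_integrable)
    have "integrable (lborel \<Otimes>\<^sub>M lborel) (\<lambda>p. \<bar>a (fst p) * a (snd p)\<bar> * (\<integral>\<omega>. \<bar>Z (fst p) \<omega> * Z (snd p) \<omega>\<bar> \<partial>M))"
    proof (rule integrable_bounded_mult[OF integrable_abs[OF aa], of _ V])
      show "\<bar>\<integral>\<omega>. \<bar>Z (fst p) \<omega> * Z (snd p) \<omega>\<bar> \<partial>M\<bar> \<le> V" for p using ZZ(2)[of "fst p" "snd p"] by simp
    qed measurable
    then show "integrable (lborel \<Otimes>\<^sub>M lborel) (\<lambda>p. \<integral>\<omega>. norm (case (p, \<omega>) of (p, \<omega>) \<Rightarrow> F p \<omega>) \<partial>M)"
      by (simp add: F_def abs_mult)
    show "AE p in lborel \<Otimes>\<^sub>M lborel. integrable M (\<lambda>\<omega>. case (p, \<omega>) of (p, \<omega>) \<Rightarrow> F p \<omega>)" using ZZ(1) by (simp add: F_def)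
  qed (unfold F_def, measurable)
  have sq: "AE \<omega> in M. (\<integral>p. F p \<omega> \<partial>(lborel \<Otimes>\<^sub>M lborel)) = (\<integral>t. a t * Z t \<omega> \<partial>lborel)\<^sup>2"
    using AE1
  proof eventually_elim
    case (elim \<omega>)
    then show ?case using lborel_pair.integral_mult_pair[OF elim elim]
      by (simp add: F_def power2_eq_square mult_ac)
  qed
  have iF: "integrable M (\<lambda>\<omega>. \<integral>p. F p \<omega> \<partial>(lborel \<Otimes>\<^sub>M lborel))"
    using llM.integrable_snd[OF int2] by simp
  have m2: "(\<lambda>\<omega>. (\<integral>t. a t * Z t \<omega> \<partial>lborel)\<^sup>2) \<in> borel_measurable M" by measurable
  show "integrable M (\<lambda>\<omega>. (\<integral>t. a t * Z t \<omega> \<partial>lborel)\<^sup>2)"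
    using integrable_cong_AE[THEN iffD1, OF _ m2 sq iF] borel_measurable_integrable[OF iF] by blast
  have "(\<integral>\<omega>. (\<integral>t. a t * Z t \<omega> \<partial>lborel)\<^sup>2 \<partial>M) = (\<integral>\<omega>. \<integral>p. F p \<omega> \<partial>(lborel \<Otimes>\<^sub>M lborel) \<partial>M)"
    by (rule integral_cong_AE[symmetric, OF borel_measurable_integrable[OF iF] m2 sq])
  also have "\<dots> = (\<integral>p. \<integral>\<omega>. F p \<omega> \<partial>M \<partial>(lborel \<Otimes>\<^sub>M lborel))"
    by (rule llM.Fubini_integral[OF int2])
  also have "\<dots> = (\<integral>p. (\<lambda>(t, t'). a t * a t' * (\<integral>\<omega>. Z t \<omega> * Z t' \<omega> \<partial>M)) p \<partial>(lborel \<Otimes>\<^sub>M lborel))"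
    by (simp add: F_def case_prod_beta')
  also have "\<dots> = (\<integral>t. \<integral>t'. a t * a t' * (\<integral>\<omega>. Z t \<omega> * Z t' \<omega> \<partial>M) \<partial>lborel \<partial>lborel)"
  proof (rule lborel_pair.integral_fst'[symmetric, THEN trans])
    show "integrable (lborel \<Otimes>\<^sub>M lborel) (\<lambda>(t, t'). a t * a t' * (\<integral>\<omega>. Z t \<omega> * Z t' \<omega> \<partial>M))"
      using llM.integrable_fst[OF int2] by (simp add: F_def case_prod_beta')
  qed simp
  finally show "(\<integral>\<omega>. (\<integral>t. a t * Z t \<omega> \<partial>lborel)\<^sup>2 \<partial>M) =
      (\<integral>t. \<integral>t'. a t * a t' * (\<integral>\<omega>. Z t \<omega> * Z t' \<omega> \<partial>M) \<partial>lborel \<partial>lborel)" .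
qed

lemma cmod_expectation_iexp_diff_le:
  fixes S T :: "'a \<Rightarrow> real"
  assumes [measurable]: "S \<in> borel_measurable M" "T \<in> borel_measurable M"
    and i: "integrable M (\<lambda>\<omega>. (T \<omega> - S \<omega>)\<^sup>2)" and d: "(\<integral>\<omega>. (T \<omega> - S \<omega>)\<^sup>2 \<partial>M) \<le> d"
  shows "cmod ((\<integral>\<omega>. iexp (T \<omega>) \<partial>M) - (\<integral>\<omega>. iexp (S \<omega>) \<partial>M)) \<le> sqrt d"
proof -
  have ii: "integrable M (\<lambda>\<omega>. iexp (Y \<omega>))" if [measurable]: "Y \<in> borel_measurable M" for Y :: "'a \<Rightarrow> real"
    by (rule integrable_const_bound[where B=1]) auto
  have i1: "integrable M (\<lambda>\<omega>. \<bar>T \<omega> - S \<omega>\<bar>)"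
    by (intro integrable_abs square_integrable_imp_integrable[OF _ i]) measurable
  have le: "cmod (iexp x - iexp y) \<le> \<bar>x - y\<bar>" for x y :: real
  proof -
    have "iexp x = iexp y * iexp (x - y)" by (simp add: exp_add[symmetric] algebra_simps)
    then have "iexp x - iexp y = iexp y * (iexp (x - y) - 1)" by (simp only: right_diff_distrib mult_1_right)
    then show ?thesis using iexp_approx1[of "x - y" 0] by (simp add: norm_mult)
  qed
  have "cmod ((\<integral>\<omega>. iexp (T \<omega>) \<partial>M) - (\<integral>\<omega>. iexp (S \<omega>) \<partial>M)) = cmod (\<integral>\<omega>. iexp (T \<omega>) - iexp (S \<omega>) \<partial>M)"
    using ii by simp
  also have "\<dots> \<le> (\<integral>\<omega>. cmod (iexp (T \<omega>) - iexp (S \<omega>)) \<partial>M)" by (rule integral_norm_bound)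
  also have "\<dots> \<le> (\<integral>\<omega>. \<bar>T \<omega> - S \<omega>\<bar> \<partial>M)"
    using ii by (intro integral_mono i1 le integrable_norm Bochner_Integration.integrable_diff) auto
  also have "\<dots> \<le> sqrt d"
  proof (rule real_le_rsqrt)
    have i': "integrable M (\<lambda>\<omega>. \<bar>T \<omega> - S \<omega>\<bar>\<^sup>2)" using i by simp
    have "0 \<le> variance (\<lambda>\<omega>. \<bar>T \<omega> - S \<omega>\<bar>)" by simp
    then show "(\<integral>\<omega>. \<bar>T \<omega> - S \<omega>\<bar> \<partial>M)\<^sup>2 \<le> d"
      unfolding variance_eq[OF i1 i'] using d by simp
  qed
  finally show ?thesis .
qed

lemma abs_second_moment_diff_le:
  fixes S T :: "'a \<Rightarrow> real"
  assumes S: "integrable M (\<lambda>\<omega>. (S \<omega>)\<^sup>2)" and T: "integrable M (\<lambda>\<omega>. (T \<omega>)\<^sup>2)"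
    and i: "integrable M (\<lambda>\<omega>. (T \<omega> - S \<omega>)\<^sup>2)" and d: "(\<integral>\<omega>. (T \<omega> - S \<omega>)\<^sup>2 \<partial>M) \<le> d" "0 < d"
    and V: "(\<integral>\<omega>. (T \<omega>)\<^sup>2 \<partial>M) \<le> V"
  shows "\<bar>(\<integral>\<omega>. (T \<omega>)\<^sup>2 \<partial>M) - (\<integral>\<omega>. (S \<omega>)\<^sup>2 \<partial>M)\<bar> \<le> d + sqrt d * (V + 1)"
proof -
  \<comment> \<open>The weight in the inequality 2|x (x - y)| \<le> \<eta> x^2 + (x - y)^2/\<eta>;
    the choice of the square root of \<open>d\<close> makes both terms of order
    \<open>sqrt d\<close>.\<close>
  define \<eta> where "\<eta> = sqrt d"
  have \<eta>: "0 < \<eta>" and \<eta>2: "d = \<eta> * \<eta>" using d(2) by (auto simp: \<eta>_def)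
  have le: "\<bar>x\<^sup>2 - y\<^sup>2\<bar> \<le> (x - y)\<^sup>2 + (\<eta> * x\<^sup>2 + (x - y)\<^sup>2 / \<eta>)" for x y :: real
  proof -
    have "y\<^sup>2 - x\<^sup>2 = (x - y)\<^sup>2 - 2 * (x * (x - y))" by (simp add: power2_eq_square algebra_simps)
    moreover have "2 * \<bar>x * (x - y)\<bar> \<le> \<eta> * x\<^sup>2 + (x - y)\<^sup>2 / \<eta>"
    proof -
      have "0 \<le> (\<eta> * \<bar>x\<bar> - \<bar>x - y\<bar>)\<^sup>2 / \<eta>" using \<eta> by simp
      also have "(\<eta> * \<bar>x\<bar> - \<bar>x - y\<bar>)\<^sup>2 / \<eta> = \<eta> * x\<^sup>2 + (x - y)\<^sup>2 / \<eta> - 2 * (\<bar>x\<bar> * \<bar>x - y\<bar>)"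
        using \<eta> by (simp add: power2_diff power_mult_distrib field_simps) (simp add: power2_eq_square algebra_simps)
      finally show ?thesis by (simp add: abs_mult)
    qed
    ultimately show ?thesis using zero_le_power2[of "x - y"] by linarith
  qed
  have "\<bar>(\<integral>\<omega>. (T \<omega>)\<^sup>2 \<partial>M) - (\<integral>\<omega>. (S \<omega>)\<^sup>2 \<partial>M)\<bar> = \<bar>\<integral>\<omega>. (T \<omega>)\<^sup>2 - (S \<omega>)\<^sup>2 \<partial>M\<bar>" using S T by simp
  also have "\<dots> \<le> (\<integral>\<omega>. \<bar>(T \<omega>)\<^sup>2 - (S \<omega>)\<^sup>2\<bar> \<partial>M)" by (rule integral_abs_bound)
  also have "\<dots> \<le> (\<integral>\<omega>. (T \<omega> - S \<omega>)\<^sup>2 + (\<eta> * (T \<omega>)\<^sup>2 + (T \<omega> - S \<omega>)\<^sup>2 / \<eta>) \<partial>M)"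
    using S T i by (intro integral_mono le) auto
  also have "\<dots> = (\<integral>\<omega>. (T \<omega> - S \<omega>)\<^sup>2 \<partial>M) + (\<eta> * (\<integral>\<omega>. (T \<omega>)\<^sup>2 \<partial>M) + (\<integral>\<omega>. (T \<omega> - S \<omega>)\<^sup>2 \<partial>M) / \<eta>)"
    using S T i by simp
  also have "\<dots> \<le> d + (\<eta> * V + d / \<eta>)"
    using \<eta> d V by (intro add_mono mult_left_mono divide_right_mono) auto
  also have "d / \<eta> = \<eta>" using \<eta> by (simp add: \<eta>2)
  finally show ?thesis by (simp add: \<eta>_def algebra_simps)
qed

end

section \<open>Stationarity and covariance functions\<close>

text \<open>The function truncated at \<open>K\<close> is a continuous function of 2^(-n) on [0, 1],
  so Weierstrass applies. The error is at most 1 at every integer, hence increments grow by at most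
  2; the Lipschitz constant \<open>L + 2\<close> does not depend on \<open>K\<close>.\<close>

lemma lip_approx_polynomial:
  assumes f: "lip L f"
  shows "\<exists>b d. let g = (\<lambda>n. \<Sum>m\<le>d::nat. b m * ((1/2::real) ^ m) ^ n) in
    lip (L + 2) g \<and> (\<forall>n. \<bar>g n - f (min n K)\<bar> \<le> 1 / Suc K)"
proof -
  \<comment> \<open>A telescoping sum of the increments of \<open>f\<close>. At the points 2^(-n)
    the clipped ramp is 1 for \<open>n\<close> at least \<open>k\<close> and 0 otherwise.\<close>
  define h where "h y = f 0 + (\<Sum>k=1..K. (f k - f (k - 1)) * max 0 (min 1 (2 - 2 ^ k * y)))" for y :: real
  have step: "max 0 (min 1 (2 - 2 ^ k * (1/2::real) ^ n)) = of_bool (k \<le> n)" for k n :: nat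
  proof (cases "k \<le> n")
    case True
    have "2 ^ k * (1/2::real) ^ n \<le> 2 ^ k * (1/2) ^ k" using True by (intro mult_left_mono power_decreasing) auto
    then show ?thesis using True by (simp add: power_one_over)
  next
    case False
    then have "(1/2::real) ^ n \<ge> (1/2) ^ (k - 1)" by (intro power_decreasing) auto
    also have "(1/2::real) ^ (k - 1) = 2 * (1/2) ^ k" using False by (cases k) auto
    finally have "2 ^ k * (2 * (1/2) ^ k) \<le> 2 ^ k * (1/2::real) ^ n" by (intro mult_left_mono) auto
    then show ?thesis using False by (simp add: power_one_over)
  qed
  have hn: "h ((1/2) ^ n) = f (min n K)" for n
    unfolding h_def step
  proof (induction K)
    case (Suc K)
    then show ?case by (auto simp: min_def le_Suc_eq)
  qed simp
  have "continuous_on {0..1} h" unfolding h_def by (intro continuous_intros)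
  then obtain b d where bd: "\<And>y. 0 \<le> y \<Longrightarrow> y \<le> 1 \<Longrightarrow> \<bar>h y - (\<Sum>m\<le>d. b m * y ^ m)\<bar> < 1 / Suc K"
    by (rule polynomial_approx_unit_interval[where e="1 / Suc K"]) auto
  define g where "g n = (\<Sum>m\<le>d. b m * ((1/2::real) ^ m) ^ n)" for n
  have gn: "g n = (\<Sum>m\<le>d. b m * ((1/2) ^ n) ^ m)" for n by (simp add: g_def power_mult[symmetric] mult.commute)
  have approx: "\<bar>g n - f (min n K)\<bar> \<le> 1 / Suc K" for n
    using bd[of "(1/2) ^ n"] unfolding hn gn by (simp add: power_le_one abs_minus_commute)
  have L0: "0 \<le> L" using f by (simp add: lip_def)
  have "lip (L + 2) g"
  proof (rule lipI)
    fix n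
    have "\<bar>f (min (Suc n) K) - f (min n K)\<bar> \<le> L * \<bar>real (min (Suc n) K) - real (min n K)\<bar>"
      using f unfolding lip_def by blast
    also have "\<dots> \<le> L * 1" using L0 by (intro mult_left_mono) (auto simp: min_def)
    finally have "\<bar>f (min (Suc n) K) - f (min n K)\<bar> \<le> L" by simp
    moreover have "1 / real (Suc K) \<le> 1" by simp
    ultimately show "\<bar>g (Suc n) - g n\<bar> \<le> L + 2" using approx[of "Suc n"] approx[of n] by linarith
  qed (use L0 in simp)
  then show ?thesis using approx unfolding Let_def g_def by blast
qed

context grain_model begin

text \<open>The joint generating function involves only the measures of the two differences and of
  the intersection, so these determine the law of the pair.\<close>

lemma integral_num2_eq:
  fixes f g :: "nat \<Rightarrow> real"
  assumes C: "C \<in> sets Lam" "C' \<in> sets Lam" "emeasure Lam C < \<infinity>" "emeasure Lam C' < \<infinity>"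
    and E: "E \<in> sets Lam" "E' \<in> sets Lam" "emeasure Lam E < \<infinity>" "emeasure Lam E' < \<infinity>"
    and eq: "measure Lam C = measure Lam E" "measure Lam C' = measure Lam E'" "measure Lam (C \<inter> C') = measure Lam (E \<inter> E')"
  shows "(\<integral>\<omega>. f (num C \<omega>) * g (num C' \<omega>) \<partial>M) = (\<integral>\<omega>. f (num E \<omega>) * g (num E' \<omega>) \<partial>M)"
proof -
  have half: "0 \<le> (1/2::real) ^ k" "(1/2::real) ^ k \<le> 1" for k :: nat by (auto simp: power_le_one)
  have d: "measure Lam (C - C') = measure Lam (E - E')" "measure Lam (C' - C) = measure Lam (E' - E)"
    using measure_Lam_split[OF C(1,2,3)] measure_Lam_split[OF C(2,1,4)] measure_Lam_split[OF E(1,2,3)] measure_Lam_split[OF E(2,1,4)] eq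
    unfolding Int_commute[of C' C] Int_commute[of E' E] by linarith+
  show ?thesis
  proof (rule integral_eqI_pgf[OF prob_space_axioms _ _ prob_space_axioms])
    show "(\<integral>\<omega>. ((1/2) ^ k) ^ num C \<omega> * ((1/2::real) ^ l) ^ num C' \<omega> \<partial>M) = (\<integral>\<omega>. ((1/2) ^ k) ^ num E \<omega> * ((1/2::real) ^ l) ^ num E' \<omega> \<partial>M)" for k l
      unfolding expectation_power_num2[OF C half half] expectation_power_num2[OF E half half] d eq(3) ..
  qed (use C E in \<open>auto intro: measurable_num\<close>)
qed

lemma
  assumes D[measurable]: "D \<in> sets borel" "D' \<in> sets borel"
  shows integral_X2_stationary: "t - s = t' - s' \<Longrightarrow>
      (\<integral>\<omega>. f (X D t \<omega>) * g (X D' s \<omega>) \<partial>M) = (\<integral>\<omega>. f (X D t' \<omega>) * g (X D' s' \<omega>) \<partial>M)" (is "_ \<Longrightarrow> ?S")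
    and integral_X_stationary: "(\<integral>\<omega>. f (X D t \<omega>) \<partial>M) = (\<integral>\<omega>. f (X D t' \<omega>) \<partial>(M::'w measure) :: real)"
    and integral_X2_swap: "(\<integral>\<omega>. f (X D t \<omega>) * g (X D s \<omega>) \<partial>M) = (\<integral>\<omega>. f (X D s \<omega>) * g (X D t \<omega>) \<partial>M)"
proof -
  have num: "(\<integral>\<omega>. f (X A x \<omega>) * g (X A' y \<omega>) \<partial>M) = (\<integral>\<omega>. f (num (cover A x) \<omega>) * g (num (cover A' y) \<omega>) \<partial>M)"
    for A A' x y and f g :: "nat \<Rightarrow> real" by (intro Bochner_Integration.integral_cong refl) (simp add: X_eq_num)
  have single: "measure Lam (cover A x) = measure Lam (cover A y)" if "A \<in> sets borel" for A x y
    using emeasure_cover_Int[OF that that, of x x] emeasure_cover_Int[OF that that, of y y] by (simp add: measure_def)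
  have pair: "measure Lam (cover D t \<inter> cover D' s) = measure Lam (cover D t' \<inter> cover D' s')" if "t - s = t' - s'" for t s t' s'
  proof -
    have "s - t = s' - t'" using that by (simp add: algebra_simps)
    then show ?thesis by (simp add: measure_def emeasure_cover_Int)
  qed
  show ?S if "t - s = t' - s'"
    unfolding num
    by (rule integral_num2_eq[OF sets_cover[OF D(1)] sets_cover[OF D(2)] emeasure_cover_finite[OF D(1)] emeasure_cover_finite[OF D(2)]
          sets_cover[OF D(1)] sets_cover[OF D(2)] emeasure_cover_finite[OF D(1)] emeasure_cover_finite[OF D(2)]
          single[OF D(1)] single[OF D(2)] pair[OF that]])
  show "(\<integral>\<omega>. f (X D t \<omega>) \<partial>M) = (\<integral>\<omega>. f (X D t' \<omega>) \<partial>M)"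
  proof -
    have pp: "measure Lam (cover D t \<inter> cover D t) = measure Lam (cover D t' \<inter> cover D t')"
      by (simp add: single[OF D(1), of t t'])
    have "(\<integral>\<omega>. f (X D t \<omega>) * 1 \<partial>M) = (\<integral>\<omega>. f (X D t' \<omega>) * 1 \<partial>M)"
      unfolding num[of f D t "\<lambda>_. 1" D t] num[of f D t' "\<lambda>_. 1" D t']
      by (rule integral_num2_eq[OF sets_cover[OF D(1)] sets_cover[OF D(1)] emeasure_cover_finite[OF D(1)] emeasure_cover_finite[OF D(1)]
            sets_cover[OF D(1)] sets_cover[OF D(1)] emeasure_cover_finite[OF D(1)] emeasure_cover_finite[OF D(1)]
            single[OF D(1)] single[OF D(1)] pp])
    then show ?thesis by simp
  qed
  have comm: "measure Lam (cover D t \<inter> cover D s) = measure Lam (cover D s \<inter> cover D t)"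
    by (simp add: Int_commute)
  show "(\<integral>\<omega>. f (X D t \<omega>) * g (X D s \<omega>) \<partial>M) = (\<integral>\<omega>. f (X D s \<omega>) * g (X D t \<omega>) \<partial>M)"
    unfolding num
    by (rule integral_num2_eq[OF sets_cover[OF D(1)] sets_cover[OF D(1)] emeasure_cover_finite[OF D(1)] emeasure_cover_finite[OF D(1)]
          sets_cover[OF D(1)] sets_cover[OF D(1)] emeasure_cover_finite[OF D(1)] emeasure_cover_finite[OF D(1)]
          single[OF D(1)] single[OF D(1)] comm])
qed

definition mean :: "(nat \<Rightarrow> real) \<Rightarrow> 'a set \<Rightarrow> real" where
  "mean f D = (\<integral>\<omega>. f (X D 0 \<omega>) \<partial>M)"

text \<open>Two functions and two windows are allowed so that the field can be compared with its
  cut-off polynomial approximation.\<close>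

definition cov :: "(nat \<Rightarrow> real) \<Rightarrow> 'a set \<Rightarrow> (nat \<Rightarrow> real) \<Rightarrow> 'a set \<Rightarrow> 'a \<Rightarrow> real" where
  "cov f D g D' h = (\<integral>\<omega>. f (X D h \<omega>) * g (X D' 0 \<omega>) \<partial>M) - mean f D * mean g D'"

definition ctr :: "(nat \<Rightarrow> real) \<Rightarrow> 'a set \<Rightarrow> 'a \<Rightarrow> 'w \<Rightarrow> real" where
  "ctr f D t \<omega> = f (X D t \<omega>) - mean f D"

lemma ctr_measurable[measurable (raw)]:
  assumes [measurable]: "D \<in> sets borel" "h \<in> borel_measurable N" "k \<in> N \<rightarrow>\<^sub>M M"
  shows "(\<lambda>x. ctr f D (h x) (k x)) \<in> borel_measurable N"
  unfolding ctr_def by measurable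

lemma \<rho>_minus: "\<rho> (- h) = \<rho> h"
  using measure_cover_Int_UNIV[of 0 h] measure_cover_Int_UNIV[of h 0] by (simp add: Int_commute)

lemma lip_const: "lip 0 (\<lambda>_. c)" by (simp add: lip_def)

lemma
  assumes D[measurable]: "D \<in> sets borel" "D' \<in> sets borel" and f: "lip L f" and g: "lip L' g"
  shows integrable_X2: "integrable M (\<lambda>\<omega>. f (X D t \<omega>) * g (X D' s \<omega>))"
    and integrable_X: "integrable M (\<lambda>\<omega>. f (X D t \<omega>))"
    and integrable_ctr2: "integrable M (\<lambda>\<omega>. ctr f D t \<omega> * ctr g D' s \<omega>)"
    and integrable_ctr: "integrable M (ctr f D t)"
    and expectation_ctr: "(\<integral>\<omega>. ctr f D t \<omega> \<partial>M) = 0"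
    and expectation_ctr2: "(\<integral>\<omega>. ctr f D t \<omega> * ctr g D' s \<omega> \<partial>M) = cov f D g D' (t - s)"
    and abs_cov_le: "\<bar>cov f D g D' h\<bar> \<le> L * L' * \<rho> h"
    and borel_measurable_cov: "cov f D g D' \<in> borel_measurable borel"
proof -
  have i2: "integrable M (\<lambda>\<omega>. h (X A x \<omega>) * k (X A' y \<omega>))" if "lip H h" "lip H' k" and [measurable]: "A \<in> sets borel" "A' \<in> sets borel" for h H k H' A A' x y
    using integrable_num2[OF sets_cover[OF that(3), of x] sets_cover[OF that(4), of y] emeasure_cover_finite[OF that(3)] emeasure_cover_finite[OF that(4)] that(1,2)]
    by (simp add: X_eq_num cong: Bochner_Integration.integrable_cong)
  have i1: "integrable M (\<lambda>\<omega>. h (X A x \<omega>))" if "lip H h" "A \<in> sets borel" for h H A x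
  proof -
    have "integrable M (\<lambda>\<omega>. h (X A x \<omega>) * (\<lambda>_. 1) (X A x \<omega>))" by (rule i2[OF that(1) lip_const that(2) that(2)])
    then show ?thesis by simp
  qed
  show "integrable M (\<lambda>\<omega>. f (X D t \<omega>) * g (X D' s \<omega>))" by (rule i2[OF f g D])
  show "integrable M (\<lambda>\<omega>. f (X D t \<omega>))" by (rule i1[OF f D(1)])
  have eq: "ctr f D t \<omega> * ctr g D' s \<omega> = f (X D t \<omega>) * g (X D' s \<omega>) - mean g D' * f (X D t \<omega>) - mean f D * g (X D' s \<omega>) + mean f D * mean g D'" for \<omega>
    by (simp add: ctr_def algebra_simps)
  show "integrable M (\<lambda>\<omega>. ctr f D t \<omega> * ctr g D' s \<omega>)"
    unfolding eq using i2[OF f g D] i1[OF f D(1)] i1[OF g D(2)] by auto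
  show "integrable M (ctr f D t)" unfolding ctr_def[abs_def] using i1[OF f D(1)] by auto
  have mf: "(\<integral>\<omega>. f (X D t \<omega>) \<partial>M) = mean f D" for t unfolding mean_def by (rule integral_X_stationary[OF D])
  have mg: "(\<integral>\<omega>. g (X D' t \<omega>) \<partial>M) = mean g D'" for t unfolding mean_def by (rule integral_X_stationary[OF D(2,1)])
  show "(\<integral>\<omega>. ctr f D t \<omega> \<partial>M) = 0" unfolding ctr_def using i1[OF f D(1)] by (simp add: mf prob_space)
  have st: "(\<integral>\<omega>. f (X D t \<omega>) * g (X D' s \<omega>) \<partial>M) = (\<integral>\<omega>. f (X D (t - s) \<omega>) * g (X D' 0 \<omega>) \<partial>M)"
    by (rule integral_X2_stationary[OF D]) simp
  show "(\<integral>\<omega>. ctr f D t \<omega> * ctr g D' s \<omega> \<partial>M) = cov f D g D' (t - s)"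
    unfolding eq cov_def st[symmetric] using i2[OF f g D] i1[OF f D(1)] i1[OF g D(2)] by (simp add: mf mg prob_space)
  have LL: "0 \<le> L * L'" using f g by (simp add: lip_def)
  have "\<bar>cov f D g D' h\<bar> \<le> L * L' * measure Lam (cover D h \<inter> cover D' 0)"
    using covariance_num_le[OF sets_cover[OF D(1), of h] sets_cover[OF D(2), of 0] emeasure_cover_finite[OF D(1)] emeasure_cover_finite[OF D(2)] f g] mf[of h, symmetric] mg[of 0, symmetric]
    by (simp add: cov_def X_eq_num cong: Bochner_Integration.integral_cong)
  also have "\<dots> \<le> L * L' * \<rho> (0 - h)" by (intro mult_left_mono measure_cover_Int_le D LL)
  finally show "\<bar>cov f D g D' h\<bar> \<le> L * L' * \<rho> h" by (simp add: \<rho>_minus)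
  show "cov f D g D' \<in> borel_measurable borel" unfolding cov_def by measurable
qed

end

section \<open>The central limit theorem for Lipschitz functions of the counting field\<close>

context grain_model begin

section \<open>Factorisation of moments for the cut-off polynomial field\<close>

definition bounded_rv :: "('w \<Rightarrow> real) \<Rightarrow> bool" where
  "bounded_rv W \<longleftrightarrow> W \<in> borel_measurable M \<and> (\<exists>C. \<forall>\<omega>. \<bar>W \<omega>\<bar> \<le> C)"

lemma bounded_rv_integrable:
  assumes "bounded_rv W"
  shows "integrable M W"
proof -
  obtain C where "W \<in> borel_measurable M" "\<And>\<omega>. \<bar>W \<omega>\<bar> \<le> C" using assms unfolding bounded_rv_def by blast
  then show ?thesis by (intro integrable_const_bound[where B=C]) auto
qed

lemma bounded_rv_mult:
  assumes "bounded_rv W" "bounded_rv V"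
  shows "bounded_rv (\<lambda>\<omega>. W \<omega> * V \<omega>)"
proof -
  obtain C C' where C: "\<And>\<omega>. \<bar>W \<omega>\<bar> \<le> C" "\<And>\<omega>. \<bar>V \<omega>\<bar> \<le> C'" using assms unfolding bounded_rv_def by blast
  have "0 \<le> C" using C(1)[of undefined] by linarith
  then have "\<bar>W \<omega> * V \<omega>\<bar> \<le> C * C'" for \<omega> unfolding abs_mult using C by (intro mult_mono) auto
  then show ?thesis using assms unfolding bounded_rv_def by auto
qed

lemma bounded_rv_prod_list: "(\<And>x. x \<in> set xs \<Longrightarrow> bounded_rv (W x)) \<Longrightarrow> bounded_rv (\<lambda>\<omega>. \<Prod>x\<leftarrow>xs. W x \<omega>)"
proof (induction xs)
  case Nil
  then show ?case by (auto simp: bounded_rv_def)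
next
  case (Cons x xs)
  then show ?case using bounded_rv_mult[of "W x" "\<lambda>\<omega>. \<Prod>x\<leftarrow>xs. W x \<omega>"] by simp
qed

context
  fixes D :: "'a set" and r :: real
  assumes D: "D \<in> sets borel" and r: "\<And>x y. x \<in> D \<Longrightarrow> y \<in> D \<Longrightarrow> dist x y \<le> r"
begin

text \<open>A monomial in (1/2)^X at one site. Polynomial fields are combinations of these, and
  expectations of their products are explicit.\<close>

definition geo :: "nat \<times> 'a \<Rightarrow> 'w \<Rightarrow> real" where
  "geo p \<omega> = ((1/2) ^ fst p) ^ X D (snd p) \<omega>"

lemma bounded_rv_geo: "bounded_rv (geo p)"
proof -
  have "geo p \<in> borel_measurable M" unfolding geo_def[abs_def] using D by measurable
  moreover have "\<bar>geo p \<omega>\<bar> \<le> 1" for \<omega> by (simp add: geo_def power_le_one)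
  ultimately show ?thesis unfolding bounded_rv_def by blast
qed

text \<open>A marked point that covers two sites yields two points of \<open>D\<close> with the same
  difference as the sites. Sites more than \<open>r\<close> apart hence have disjoint covering sets,
  and the disjoint product formula applies.\<close>

lemma expectation_geo_far:
  assumes far: "\<And>p q. p \<in> set ps \<Longrightarrow> q \<in> set qs \<Longrightarrow> r < dist (snd p) (snd q)"
  shows "(\<integral>\<omega>. (\<Prod>p\<leftarrow>ps. geo p \<omega>) * (\<Prod>q\<leftarrow>qs. geo q \<omega>) \<partial>M) = (\<integral>\<omega>. (\<Prod>p\<leftarrow>ps. geo p \<omega>) \<partial>M) * (\<integral>\<omega>. (\<Prod>q\<leftarrow>qs. geo q \<omega>) \<partial>M)"
proof -
  \<comment> \<open>Positions in the lists, tagged by a sum type, serve as indices; repeated entries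
    and the two lists stay separate.\<close>
  define I where "I = (Inl ` {0..<length ps} :: (nat + nat) set)"
  define J where "J = (Inr ` {0..<length qs} :: (nat + nat) set)"
  define z where "z = case_sum (\<lambda>i. ps ! i) (\<lambda>i. qs ! i)"
  have num: "geo p \<omega> = ((1/2) ^ fst p) ^ num (cover D (snd p)) \<omega>" if "\<omega> \<in> space M" for p \<omega>
    using that by (simp add: geo_def X_eq_num)
  have pI: "(\<Prod>p\<leftarrow>ps. geo p \<omega>) = (\<Prod>i\<in>I. ((1/2) ^ fst (z i)) ^ num (cover D (snd (z i))) \<omega>)" if "\<omega> \<in> space M" for \<omega>
    using num[OF that] by (simp add: I_def z_def prod.reindex prod.list_conv_set_nth)
  have pJ: "(\<Prod>p\<leftarrow>qs. geo p \<omega>) = (\<Prod>i\<in>J. ((1/2) ^ fst (z i)) ^ num (cover D (snd (z i))) \<omega>)" if "\<omega> \<in> space M" for \<omega>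
    using num[OF that] by (simp add: J_def z_def prod.reindex prod.list_conv_set_nth)
  have disj: "cover D (snd (z i)) \<inter> cover D (snd (z j)) = {}" if "i \<in> I" "j \<in> J" for i j
  proof -
    have "z i \<in> set ps" "z j \<in> set qs" using that by (auto simp: I_def J_def z_def)
    from far[OF this] have d: "r < dist (snd (z i)) (snd (z j))" .
    show ?thesis
    proof (rule ccontr)
      assume "cover D (snd (z i)) \<inter> cover D (snd (z j)) \<noteq> {}"
      then obtain w where "snd (z i) - fst w \<in> D" "snd (z j) - fst w \<in> D" by (auto simp: cover_def)
      from r[OF this] d show False by (simp add: dist_norm)
    qed
  qed
  have "(\<integral>\<omega>. (\<Prod>i\<in>I. ((1/2::real) ^ fst (z i)) ^ num (cover D (snd (z i))) \<omega>) * (\<Prod>i\<in>J. ((1/2) ^ fst (z i)) ^ num (cover D (snd (z i))) \<omega>) \<partial>M) =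
    (\<integral>\<omega>. (\<Prod>i\<in>I. ((1/2) ^ fst (z i)) ^ num (cover D (snd (z i))) \<omega>) \<partial>M) * (\<integral>\<omega>. (\<Prod>i\<in>J. ((1/2) ^ fst (z i)) ^ num (cover D (snd (z i))) \<omega>) \<partial>M)"
  proof (rule expectation_prod_power_num_disjoint)
    show "finite I" "finite J" by (auto simp: I_def J_def)
    show "I \<inter> J = {}" by (auto simp: I_def J_def)
    show "cover D (snd (z i)) \<in> sets Lam" for i by (rule sets_cover[OF D])
    show "emeasure Lam (cover D (snd (z i))) < \<infinity>" for i by (rule emeasure_cover_finite[OF D])
    show "0 \<le> (1/2::real) ^ fst (z i) \<and> (1/2::real) ^ fst (z i) \<le> 1" for i by (simp add: power_le_one)
  qed (use disj in auto)
  then show ?thesis by (simp add: pI pJ cong: Bochner_Integration.integral_cong)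
qed

context
  fixes b :: "nat \<Rightarrow> real" and d :: nat
begin

definition pol :: "'a \<Rightarrow> 'w \<Rightarrow> real" where
  "pol t \<omega> = (\<Sum>m\<le>d. b m * geo (m, t) \<omega>)"

lemma bounded_rv_pol: "bounded_rv (pol t)"
proof -
  have "\<bar>pol t \<omega>\<bar> \<le> (\<Sum>m\<le>d. \<bar>b m\<bar>)" for \<omega>
    unfolding pol_def
    by (intro order_trans[OF sum_abs] sum_mono) (auto simp: abs_mult geo_def power_le_one mult_left_le)
  moreover have "pol t \<in> borel_measurable M"
    using bounded_rv_geo unfolding pol_def[abs_def] bounded_rv_def by (intro borel_measurable_sum borel_measurable_times) auto
  ultimately show ?thesis unfolding bounded_rv_def by blast
qed

text \<open>Polynomial factors are expanded one at a time into monomials, which are collected in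
  \<open>ps\<close>; the mixed statement is what the induction requires.\<close>

lemma expectation_pol_geo_far:
  assumes "\<And>t q. t \<in> set ts \<Longrightarrow> q \<in> set qs \<Longrightarrow> r < dist t (snd q)" "\<And>p q. p \<in> set ps \<Longrightarrow> q \<in> set qs \<Longrightarrow> r < dist (snd p) (snd q)"
  shows "(\<integral>\<omega>. ((\<Prod>t\<leftarrow>ts. pol t \<omega>) * (\<Prod>p\<leftarrow>ps. geo p \<omega>)) * (\<Prod>q\<leftarrow>qs. geo q \<omega>) \<partial>M) =
    (\<integral>\<omega>. (\<Prod>t\<leftarrow>ts. pol t \<omega>) * (\<Prod>p\<leftarrow>ps. geo p \<omega>) \<partial>M) * (\<integral>\<omega>. (\<Prod>q\<leftarrow>qs. geo q \<omega>) \<partial>M)"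
  using assms
proof (induction ts arbitrary: ps)
  case Nil
  then show ?case using expectation_geo_far[of ps qs] by simp
next
  case (Cons t ts)
  have i0: "integrable M (\<lambda>\<omega>. (\<Prod>t\<leftarrow>ts. pol t \<omega>) * (\<Prod>p\<leftarrow>(m, t) # ps. geo p \<omega>))"
    and i1: "integrable M (\<lambda>\<omega>. ((\<Prod>t\<leftarrow>ts. pol t \<omega>) * (\<Prod>p\<leftarrow>(m, t) # ps. geo p \<omega>)) * (\<Prod>q\<leftarrow>qs. geo q \<omega>))" for m
    by (intro bounded_rv_integrable bounded_rv_mult bounded_rv_prod_list bounded_rv_pol bounded_rv_geo)+
  have IH: "(\<integral>\<omega>. ((\<Prod>t\<leftarrow>ts. pol t \<omega>) * (\<Prod>p\<leftarrow>(m, t) # ps. geo p \<omega>)) * (\<Prod>q\<leftarrow>qs. geo q \<omega>) \<partial>M) =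
    (\<integral>\<omega>. (\<Prod>t\<leftarrow>ts. pol t \<omega>) * (\<Prod>p\<leftarrow>(m, t) # ps. geo p \<omega>) \<partial>M) * (\<integral>\<omega>. (\<Prod>q\<leftarrow>qs. geo q \<omega>) \<partial>M)" for m
    by (rule Cons.IH) (use Cons.prems in auto)
  have e1: "((\<Prod>t\<leftarrow>t # ts. pol t \<omega>) * (\<Prod>p\<leftarrow>ps. geo p \<omega>)) = (\<Sum>m\<le>d. b m * ((\<Prod>t\<leftarrow>ts. pol t \<omega>) * (\<Prod>p\<leftarrow>(m, t) # ps. geo p \<omega>)))" for \<omega>
    by (simp add: pol_def[of t] sum_distrib_left sum_distrib_right mult_ac)
  have "(\<integral>\<omega>. ((\<Prod>t\<leftarrow>t # ts. pol t \<omega>) * (\<Prod>p\<leftarrow>ps. geo p \<omega>)) * (\<Prod>q\<leftarrow>qs. geo q \<omega>) \<partial>M) =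
    (\<integral>\<omega>. (\<Sum>m\<le>d. b m * (((\<Prod>t\<leftarrow>ts. pol t \<omega>) * (\<Prod>p\<leftarrow>(m, t) # ps. geo p \<omega>)) * (\<Prod>q\<leftarrow>qs. geo q \<omega>))) \<partial>M)"
    unfolding e1 by (simp only: sum_distrib_right mult.assoc)
  also have "\<dots> = (\<Sum>m\<le>d. b m * ((\<integral>\<omega>. (\<Prod>t\<leftarrow>ts. pol t \<omega>) * (\<Prod>p\<leftarrow>(m, t) # ps. geo p \<omega>) \<partial>M) * (\<integral>\<omega>. (\<Prod>q\<leftarrow>qs. geo q \<omega>) \<partial>M)))"
    using i1 by (subst Bochner_Integration.integral_sum) (auto simp only: integrable_mult_right integral_mult_right_zero IH)
  also have "\<dots> = (\<integral>\<omega>. (\<Sum>m\<le>d. b m * ((\<Prod>t\<leftarrow>ts. pol t \<omega>) * (\<Prod>p\<leftarrow>(m, t) # ps. geo p \<omega>))) \<partial>M) * (\<integral>\<omega>. (\<Prod>q\<leftarrow>qs. geo q \<omega>) \<partial>M)"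
    using i0 by (subst Bochner_Integration.integral_sum) (auto simp only: integrable_mult_right integral_mult_right_zero sum_distrib_right mult.assoc)
  finally show ?case unfolding e1[symmetric] .
qed

lemma expectation_pol_far:
  assumes "\<And>t s. t \<in> set ts \<Longrightarrow> s \<in> set ss \<Longrightarrow> r < dist t s" "\<And>t q. t \<in> set ts \<Longrightarrow> q \<in> set qs \<Longrightarrow> r < dist t (snd q)"
  shows "(\<integral>\<omega>. (\<Prod>t\<leftarrow>ts. pol t \<omega>) * ((\<Prod>s\<leftarrow>ss. pol s \<omega>) * (\<Prod>q\<leftarrow>qs. geo q \<omega>)) \<partial>M) =
    (\<integral>\<omega>. (\<Prod>t\<leftarrow>ts. pol t \<omega>) \<partial>M) * (\<integral>\<omega>. (\<Prod>s\<leftarrow>ss. pol s \<omega>) * (\<Prod>q\<leftarrow>qs. geo q \<omega>) \<partial>M)"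
  using assms
proof (induction ss arbitrary: qs)
  case Nil
  then show ?case using expectation_pol_geo_far[of ts qs "[]"] by simp
next
  case (Cons s ss)
  have i0: "integrable M (\<lambda>\<omega>. (\<Prod>t\<leftarrow>ss. pol t \<omega>) * (\<Prod>p\<leftarrow>(m, s) # qs. geo p \<omega>))"
    and i1: "integrable M (\<lambda>\<omega>. (\<Prod>q\<leftarrow>ts. pol q \<omega>) * ((\<Prod>t\<leftarrow>ss. pol t \<omega>) * (\<Prod>p\<leftarrow>(m, s) # qs. geo p \<omega>)))" for m
    by (intro bounded_rv_integrable bounded_rv_mult bounded_rv_prod_list bounded_rv_pol bounded_rv_geo)+
  have IH: "(\<integral>\<omega>. (\<Prod>t\<leftarrow>ts. pol t \<omega>) * ((\<Prod>s\<leftarrow>ss. pol s \<omega>) * (\<Prod>q\<leftarrow>(m, s) # qs. geo q \<omega>)) \<partial>M) =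
    (\<integral>\<omega>. (\<Prod>t\<leftarrow>ts. pol t \<omega>) \<partial>M) * (\<integral>\<omega>. (\<Prod>s\<leftarrow>ss. pol s \<omega>) * (\<Prod>q\<leftarrow>(m, s) # qs. geo q \<omega>) \<partial>M)" for m
    by (rule Cons.IH) (use Cons.prems in auto)
  have e1: "((\<Prod>t\<leftarrow>s # ss. pol t \<omega>) * (\<Prod>p\<leftarrow>qs. geo p \<omega>)) = (\<Sum>m\<le>d. b m * ((\<Prod>t\<leftarrow>ss. pol t \<omega>) * (\<Prod>p\<leftarrow>(m, s) # qs. geo p \<omega>)))" for \<omega>
    by (simp add: pol_def[of s] sum_distrib_left sum_distrib_right mult_ac)
  have "(\<integral>\<omega>. (\<Prod>t\<leftarrow>ts. pol t \<omega>) * ((\<Prod>t\<leftarrow>s # ss. pol t \<omega>) * (\<Prod>p\<leftarrow>qs. geo p \<omega>)) \<partial>M) =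
    (\<integral>\<omega>. (\<Sum>m\<le>d. b m * ((\<Prod>t\<leftarrow>ts. pol t \<omega>) * ((\<Prod>t\<leftarrow>ss. pol t \<omega>) * (\<Prod>p\<leftarrow>(m, s) # qs. geo p \<omega>)))) \<partial>M)"
    unfolding e1 by (simp only: sum_distrib_left mult.left_commute)
  also have "\<dots> = (\<Sum>m\<le>d. b m * ((\<integral>\<omega>. (\<Prod>t\<leftarrow>ts. pol t \<omega>) \<partial>M) * (\<integral>\<omega>. (\<Prod>t\<leftarrow>ss. pol t \<omega>) * (\<Prod>p\<leftarrow>(m, s) # qs. geo p \<omega>) \<partial>M)))"
    using i1 by (subst Bochner_Integration.integral_sum) (auto simp only: integrable_mult_right integral_mult_right_zero IH)
  also have "\<dots> = (\<integral>\<omega>. (\<Prod>t\<leftarrow>ts. pol t \<omega>) \<partial>M) * (\<integral>\<omega>. (\<Sum>m\<le>d. b m * ((\<Prod>t\<leftarrow>ss. pol t \<omega>) * (\<Prod>p\<leftarrow>(m, s) # qs. geo p \<omega>))) \<partial>M)"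
    using i0 by (subst Bochner_Integration.integral_sum) (auto simp only: integrable_mult_right integral_mult_right_zero sum_distrib_left mult.left_commute)
  finally show ?case unfolding e1[symmetric] .
qed

end

lemma finite_range_field_ctr:
  fixes b :: "nat \<Rightarrow> real" and d :: nat
  assumes r0: "0 \<le> r"
  defines "g \<equiv> \<lambda>n. \<Sum>m\<le>d. b m * ((1/2::real) ^ m) ^ n"
  obtains B where "finite_range_field M (ctr g D) B r"
proof -
  \<comment> \<open>The mean is subtracted from the constant coefficient, so the centred field is
    itself a polynomial field.\<close>
  define b' where "b' = b(0 := b 0 - mean g D)"
  have ctr: "ctr g D t \<omega> = pol b' d t \<omega>" for t \<omega>
  proof -
    have "pol b' d t \<omega> = (\<Sum>m\<le>d. b m * geo (m, t) \<omega>) - (\<Sum>m\<le>d. if m = 0 then mean g D else 0)"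
      unfolding pol_def sum_subtractf[symmetric] by (intro sum.cong) (auto simp: b'_def geo_def algebra_simps)
    then show ?thesis by (simp add: ctr_def g_def geo_def)
  qed
  have bg: "\<bar>ctr g D t \<omega>\<bar> \<le> (\<Sum>m\<le>d. \<bar>b' m\<bar>)" for t \<omega>
    unfolding ctr pol_def
    by (intro order_trans[OF sum_abs] sum_mono) (auto simp: abs_mult geo_def power_le_one mult_left_le)
  have ip: "integrable M (\<lambda>\<omega>. g (X D t \<omega>))" for t
  proof -
    have "integrable M (pol b d t)" by (intro bounded_rv_integrable bounded_rv_pol)
    then show ?thesis by (simp add: pol_def[abs_def] g_def geo_def)
  qed
  have "finite_range_field M (ctr g D) (\<Sum>m\<le>d. \<bar>b' m\<bar>) r"
  proof unfold_locales
    show "(\<lambda>p. ctr g D (fst p) (snd p)) \<in> borel_measurable (borel \<Otimes>\<^sub>M M)" using D by measurable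
    show "\<bar>ctr g D t \<omega>\<bar> \<le> (\<Sum>m\<le>d. \<bar>b' m\<bar>)" for t \<omega> by (rule bg)
    show "(\<integral>\<omega>. ctr g D t \<omega> \<partial>M) = 0" for t
      unfolding ctr_def mean_def using ip[of t] integral_X_stationary[OF D D, of g t 0] by (simp add: prob_space)
    show "(\<integral>\<omega>. (\<Prod>t\<leftarrow>ts. ctr g D t \<omega>) * (\<Prod>s\<leftarrow>ss. ctr g D s \<omega>) \<partial>M) = (\<integral>\<omega>. (\<Prod>t\<leftarrow>ts. ctr g D t \<omega>) \<partial>M) * (\<integral>\<omega>. (\<Prod>s\<leftarrow>ss. ctr g D s \<omega>) \<partial>M)"
      if "\<And>t s. t \<in> set ts \<Longrightarrow> s \<in> set ss \<Longrightarrow> r < dist t s" for ts ss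
      using expectation_pol_far[of ts ss "[]" b' d] that by (simp add: ctr)
  qed (rule r0)
  then show ?thesis by (rule that)
qed

end

end

section \<open>Mean square approximation and the limit of characteristic functions\<close>

locale square_integrable_grain_model = grain_model M u \<Xi> G
  for M :: "'w measure" and u :: "nat \<Rightarrow> 'w \<Rightarrow> 'a::euclidean_space" and \<Xi> :: "'w \<Rightarrow> 'a set" and G :: "nat \<Rightarrow> 'w \<Rightarrow> 'a set" +
  assumes second_moment_finite: "grain_second_moment M \<Xi> < \<infinity>"
begin

lemma integrable_\<rho>: "integrable lborel \<rho>"
  using has_bochner_integral_\<rho>[OF second_moment_finite] by (rule integrable.intros)

lemma integrable_cov:
  assumes D: "D \<in> sets borel" "D' \<in> sets borel" and f: "lip L f" and g: "lip L' g"
  shows "integrable lborel (cov f D g D')"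
proof (rule Bochner_Integration.integrable_bound)
  show "integrable lborel (\<lambda>h. L * L' * \<rho> h)" using integrable_\<rho> by simp
  show "AE h in lborel. norm (cov f D g D' h) \<le> norm (L * L' * \<rho> h)"
    using order_trans[OF abs_cov_le[OF D f g] abs_ge_self] by (intro AE_I2) simp
  show "cov f D g D' \<in> borel_measurable lborel" using borel_measurable_cov[OF D f g] by simp
qed

definition T :: "(nat \<Rightarrow> real) \<Rightarrow> 'a set \<Rightarrow> ('a \<Rightarrow> real) \<Rightarrow> 'w \<Rightarrow> real" where
  "T f D a \<omega> = (\<integral>t. a t * ctr f D t \<omega> \<partial>lborel)"

lemma
  assumes D: "D \<in> sets borel" and f: "lip L f" and a: "integrable lborel a" and \<alpha>: "\<And>t. \<bar>a t\<bar> \<le> \<alpha>"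
  shows T_measurable: "T f D a \<in> borel_measurable M"
    and integrable_T: "integrable M (T f D a)"
    and expectation_T: "(\<integral>\<omega>. T f D a \<omega> \<partial>M) = 0"
    and integrable_T2: "integrable M (\<lambda>\<omega>. (T f D a \<omega>)\<^sup>2)"
    and expectation_T2: "(\<integral>\<omega>. (T f D a \<omega>)\<^sup>2 \<partial>M) = (\<integral>t. \<integral>t'. a t * a t' * cov f D f D (t - t') \<partial>lborel \<partial>lborel)"
    and expectation_T2_le: "(\<integral>\<omega>. (T f D a \<omega>)\<^sup>2 \<partial>M) \<le> (\<integral>t. (a t)\<^sup>2 \<partial>lborel) * (\<integral>h. \<bar>cov f D f D h\<bar> \<partial>lborel)"
    and AE_ctr_integrable: "AE \<omega> in M. integrable lborel (\<lambda>t. a t * ctr f D t \<omega>)"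
proof -
  have am[measurable]: "a \<in> borel_measurable borel" using a by auto
  have Z: "(\<lambda>p. ctr f D (fst p) (snd p)) \<in> borel_measurable (borel \<Otimes>\<^sub>M M)" using D by measurable
  have Z2: "integrable M (\<lambda>\<omega>. (ctr f D t \<omega>)\<^sup>2)" "(\<integral>\<omega>. (ctr f D t \<omega>)\<^sup>2 \<partial>M) \<le> cov f D f D 0" for t
    using integrable_ctr2[OF D D f f, of t t] expectation_ctr2[OF D D f f, of t t] by (simp_all add: power2_eq_square)
  note F = AE_integrable_field[OF Z Z2 a] integrable_field_integral[OF Z Z2 a] expectation_field_integral[OF Z Z2 a]
    integrable_field_integral_square[OF Z Z2 a] expectation_field_integral_square[OF Z Z2 a]
  show "AE \<omega> in M. integrable lborel (\<lambda>t. a t * ctr f D t \<omega>)" by (rule F)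
  show iT: "integrable M (T f D a)" unfolding T_def[abs_def] by (rule F)
  then show "T f D a \<in> borel_measurable M" by auto
  show "(\<integral>\<omega>. T f D a \<omega> \<partial>M) = 0" unfolding T_def F(3) using expectation_ctr[OF D D f f] by simp
  show "integrable M (\<lambda>\<omega>. (T f D a \<omega>)\<^sup>2)" unfolding T_def by (rule F)
  show eq: "(\<integral>\<omega>. (T f D a \<omega>)\<^sup>2 \<partial>M) = (\<integral>t. \<integral>t'. a t * a t' * cov f D f D (t - t') \<partial>lborel \<partial>lborel)"
    unfolding T_def F(5) using expectation_ctr2[OF D D f f] by simp
  show "(\<integral>\<omega>. (T f D a \<omega>)\<^sup>2 \<partial>M) \<le> (\<integral>t. (a t)\<^sup>2 \<partial>lborel) * (\<integral>h. \<bar>cov f D f D h\<bar> \<partial>lborel)"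
    unfolding eq using abs_quadratic_form_le[OF a \<alpha> integrable_cov[OF D D f f]] by linarith
qed

definition cov_diff :: "(nat \<Rightarrow> real) \<Rightarrow> 'a set \<Rightarrow> (nat \<Rightarrow> real) \<Rightarrow> 'a set \<Rightarrow> 'a \<Rightarrow> real" where
  "cov_diff f D g D' h = cov f D f D h - cov f D g D' h - cov g D' f D h + cov g D' g D' h"

text \<open>The covariance of the difference field is controlled in two ways: by a multiple of
  \<rho>, which dominates, and by its value at lag 0, which reduces pointwise convergence to the
  origin.\<close>

lemma
  assumes D: "D \<in> sets borel" "D' \<in> sets borel" and f: "lip L f" and g: "lip L' g"
  shows expectation_ctr_diff2: "(\<integral>\<omega>. (ctr f D t \<omega> - ctr g D' t \<omega>) * (ctr f D s \<omega> - ctr g D' s \<omega>) \<partial>M) = cov_diff f D g D' (t - s)"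
    and integrable_ctr_diff2: "integrable M (\<lambda>\<omega>. (ctr f D t \<omega> - ctr g D' t \<omega>) * (ctr f D s \<omega> - ctr g D' s \<omega>))"
    and integrable_cov_diff: "integrable lborel (cov_diff f D g D')"
    and abs_cov_diff_le: "\<bar>cov_diff f D g D' h\<bar> \<le> (L + L')\<^sup>2 * \<rho> h"
    and abs_cov_diff_le0: "\<bar>cov_diff f D g D' h\<bar> \<le> cov_diff f D g D' 0"
proof -
  have eq: "(ctr f D t \<omega> - ctr g D' t \<omega>) * (ctr f D s \<omega> - ctr g D' s \<omega>) =
    ctr f D t \<omega> * ctr f D s \<omega> - ctr f D t \<omega> * ctr g D' s \<omega> - ctr g D' t \<omega> * ctr f D s \<omega> + ctr g D' t \<omega> * ctr g D' s \<omega>" for t s \<omega>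
    by (simp add: algebra_simps)
  note i = integrable_ctr2[OF D(1) D(1) f f] integrable_ctr2[OF D f g] integrable_ctr2[OF D(2) D(1) g f] integrable_ctr2[OF D(2) D(2) g g]
  note e = expectation_ctr2[OF D(1) D(1) f f] expectation_ctr2[OF D f g] expectation_ctr2[OF D(2) D(1) g f] expectation_ctr2[OF D(2) D(2) g g]
  show E: "(\<integral>\<omega>. (ctr f D t \<omega> - ctr g D' t \<omega>) * (ctr f D s \<omega> - ctr g D' s \<omega>) \<partial>M) = cov_diff f D g D' (t - s)" for t s
    unfolding eq cov_diff_def using i[of t s] by (simp add: e)
  show I: "integrable M (\<lambda>\<omega>. (ctr f D t \<omega> - ctr g D' t \<omega>) * (ctr f D s \<omega> - ctr g D' s \<omega>))" for t s
    unfolding eq using i[of t s] by auto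
  show "integrable lborel (cov_diff f D g D')"
    unfolding cov_diff_def
    using integrable_cov[OF D(1) D(1) f f] integrable_cov[OF D f g] integrable_cov[OF D(2) D(1) g f] integrable_cov[OF D(2) D(2) g g] by auto
  have "(L + L')\<^sup>2 * \<rho> h = L * L * \<rho> h + L * L' * \<rho> h + L' * L * \<rho> h + L' * L' * \<rho> h" by (simp add: power2_eq_square algebra_simps)
  then show "\<bar>cov_diff f D g D' h\<bar> \<le> (L + L')\<^sup>2 * \<rho> h"
    unfolding cov_diff_def
    using abs_cov_le[OF D(1) D(1) f f, of h] abs_cov_le[OF D f g, of h] abs_cov_le[OF D(2) D(1) g f, of h] abs_cov_le[OF D(2) D(2) g g, of h]
    by linarith
  define W where "W t \<omega> = ctr f D t \<omega> - ctr g D' t \<omega>" for t \<omega>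
  have le: "\<bar>W h \<omega> * W 0 \<omega>\<bar> \<le> (W h \<omega> * W h \<omega> + W 0 \<omega> * W 0 \<omega>) / 2" for \<omega>
    unfolding power2_eq_square[symmetric]
    using zero_le_power2[of "\<bar>W h \<omega>\<bar> - \<bar>W 0 \<omega>\<bar>"] by (simp add: power2_diff abs_mult)
  have "cov_diff f D g D' h = (\<integral>\<omega>. W h \<omega> * W 0 \<omega> \<partial>M)" unfolding W_def E by simp
  also have "\<bar>\<dots>\<bar> \<le> (\<integral>\<omega>. \<bar>W h \<omega> * W 0 \<omega>\<bar> \<partial>M)" by (rule integral_abs_bound)
  also have "\<dots> \<le> (\<integral>\<omega>. (W h \<omega> * W h \<omega> + W 0 \<omega> * W 0 \<omega>) / 2 \<partial>M)"
    using I[of h 0] I[of h h] I[of 0 0] unfolding W_def[symmetric] by (intro integral_mono le) auto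
  also have "\<dots> = ((\<integral>\<omega>. W h \<omega> * W h \<omega> \<partial>M) + (\<integral>\<omega>. W 0 \<omega> * W 0 \<omega> \<partial>M)) / 2"
    using I[of h h] I[of 0 0] unfolding W_def[symmetric] by simp
  also have "\<dots> = cov_diff f D g D' 0" unfolding W_def E by simp
  finally show "\<bar>cov_diff f D g D' h\<bar> \<le> cov_diff f D g D' 0" .
qed

lemma T_diff2:
  assumes D: "D \<in> sets borel" "D' \<in> sets borel" and f: "lip L f" and g: "lip L' g"
    and a: "integrable lborel a" and \<alpha>: "\<And>t. \<bar>a t\<bar> \<le> \<alpha>"
  shows "integrable M (\<lambda>\<omega>. (T f D a \<omega> - T g D' a \<omega>)\<^sup>2)"
    and "(\<integral>\<omega>. (T f D a \<omega> - T g D' a \<omega>)\<^sup>2 \<partial>M) \<le> (\<integral>t. (a t)\<^sup>2 \<partial>lborel) * (\<integral>h. \<bar>cov_diff f D g D' h\<bar> \<partial>lborel)"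
proof -
  define W where "W t \<omega> = ctr f D t \<omega> - ctr g D' t \<omega>" for t \<omega>
  have am[measurable]: "a \<in> borel_measurable borel" using a by auto
  have Z: "(\<lambda>p. W (fst p) (snd p)) \<in> borel_measurable (borel \<Otimes>\<^sub>M M)" unfolding W_def using D by measurable
  have Z2: "integrable M (\<lambda>\<omega>. (W t \<omega>)\<^sup>2)" "(\<integral>\<omega>. (W t \<omega>)\<^sup>2 \<partial>M) \<le> cov_diff f D g D' 0" for t
    using integrable_ctr_diff2[OF D f g, of t t] expectation_ctr_diff2[OF D f g, of t t] by (simp_all add: power2_eq_square W_def)
  note F = integrable_field_integral_square[OF Z Z2 a] expectation_field_integral_square[OF Z Z2 a]
  have AE: "AE \<omega> in M. (\<integral>t. a t * W t \<omega> \<partial>lborel)\<^sup>2 = (T f D a \<omega> - T g D' a \<omega>)\<^sup>2"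
    using AE_ctr_integrable[OF D(1) f a \<alpha>] AE_ctr_integrable[OF D(2) g a \<alpha>]
    by eventually_elim (simp add: W_def T_def right_diff_distrib)
  have m: "(\<lambda>\<omega>. (T f D a \<omega> - T g D' a \<omega>)\<^sup>2) \<in> borel_measurable M"
    using T_measurable[OF D(1) f a \<alpha>] T_measurable[OF D(2) g a \<alpha>] by measurable
  show "integrable M (\<lambda>\<omega>. (T f D a \<omega> - T g D' a \<omega>)\<^sup>2)"
    using integrable_cong_AE[OF borel_measurable_integrable[OF F(1)] m AE] F(1) by simp
  have "(\<integral>\<omega>. (T f D a \<omega> - T g D' a \<omega>)\<^sup>2 \<partial>M) = (\<integral>\<omega>. (\<integral>t. a t * W t \<omega> \<partial>lborel)\<^sup>2 \<partial>M)"
    by (rule integral_cong_AE[symmetric, OF borel_measurable_integrable[OF F(1)] m AE])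
  also have "\<dots> = (\<integral>t. \<integral>t'. a t * a t' * cov_diff f D g D' (t - t') \<partial>lborel \<partial>lborel)"
    unfolding F(2) unfolding W_def by (simp add: expectation_ctr_diff2[OF D f g])
  also have "\<dots> \<le> (\<integral>t. (a t)\<^sup>2 \<partial>lborel) * (\<integral>h. \<bar>cov_diff f D g D' h\<bar> \<partial>lborel)"
    using abs_quadratic_form_le[OF a \<alpha> integrable_cov_diff[OF D f g]] by linarith
  finally show "(\<integral>\<omega>. (T f D a \<omega> - T g D' a \<omega>)\<^sup>2 \<partial>M) \<le> (\<integral>t. (a t)\<^sup>2 \<partial>lborel) * (\<integral>h. \<bar>cov_diff f D g D' h\<bar> \<partial>lborel)" .
qed

text \<open>Almost surely only finitely many grains cover the origin, and a large ball contains the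
  grain points through which they do so.\<close>

lemma AE_window_tendsto: "AE \<omega> in M. \<exists>K0. \<forall>K\<ge>K0. X (cball 0 (real K)) 0 \<omega> = X UNIV 0 \<omega>"
proof -
  have "AE \<omega> in M. finite {j. (u j \<omega>, G j \<omega>) \<in> cover UNIV 0}"
    by (rule AE_finite_num[OF sets_cover emeasure_cover_finite]) auto
  then show ?thesis
  proof (rule AE_mp, intro AE_I2 impI)
    fix \<omega> assume w: "\<omega> \<in> space M" and "finite {j. (u j \<omega>, G j \<omega>) \<in> cover UNIV 0}"
    moreover have "{j. (u j \<omega>, G j \<omega>) \<in> cover UNIV 0} = {j. 0 - u j \<omega> \<in> G j \<omega> \<and> 0 - u j \<omega> \<in> UNIV}"
      using measurable_space[OF measurable_G w] by (auto simp: cover_def space_pair_measure)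
    ultimately have fin: "finite {j. 0 - u j \<omega> \<in> G j \<omega>}" by simp
    \<comment> \<open>The sum of the norms bounds each of them and also makes sense for an empty
      set.\<close>
    obtain K0 :: nat where K0: "(\<Sum>j\<in>{j. 0 - u j \<omega> \<in> G j \<omega>}. norm (u j \<omega>)) \<le> real K0"
      using real_arch_simple by blast
    show "\<exists>K0. \<forall>K\<ge>K0. X (cball 0 (real K)) 0 \<omega> = X UNIV 0 \<omega>"
    proof (intro exI[of _ K0] allI impI)
      fix K assume K: "K0 \<le> K"
      have "norm (u j \<omega>) \<le> real K" if "0 - u j \<omega> \<in> G j \<omega>" for j
      proof -
        have "norm (u j \<omega>) \<le> (\<Sum>j\<in>{j. 0 - u j \<omega> \<in> G j \<omega>}. norm (u j \<omega>))"
          using that fin by (intro member_le_sum) auto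
        then show ?thesis using K0 K by linarith
      qed
      then show "X (cball 0 (real K)) 0 \<omega> = X UNIV 0 \<omega>"
        unfolding X_def by (intro arg_cong[where f=card]) auto
    qed
  qed
qed

text \<open>Inclusion of index sets gives an inequality of cardinalities only where the larger set
  is finite, hence almost everywhere.\<close>

lemma AE_X_mono: "D \<in> sets borel \<Longrightarrow> AE \<omega> in M. X D 0 \<omega> \<le> X UNIV 0 \<omega>"
proof -
  assume D: "D \<in> sets borel"
  have "AE \<omega> in M. finite {j. (u j \<omega>, G j \<omega>) \<in> cover UNIV 0}"
    by (rule AE_finite_num[OF sets_cover emeasure_cover_finite]) auto
  then show ?thesis
  proof (rule AE_mp, intro AE_I2 impI)
    fix \<omega> assume w: "\<omega> \<in> space M" and "finite {j. (u j \<omega>, G j \<omega>) \<in> cover UNIV 0}"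
    moreover have "{j. (u j \<omega>, G j \<omega>) \<in> cover UNIV 0} = {j. 0 - u j \<omega> \<in> G j \<omega> \<and> 0 - u j \<omega> \<in> UNIV}"
      using measurable_space[OF measurable_G w] by (auto simp: cover_def space_pair_measure)
    ultimately show "X D 0 \<omega> \<le> X UNIV 0 \<omega>" unfolding X_def by (intro card_mono) auto
  qed
qed

text \<open>At the origin the approximation error tends to 0 in mean square. The lag-0 bound extends
  this to all lags, and the uniform Lipschitz constants give a dominating multiple of
  \<rho>.\<close>

lemma cov_diff_tendsto_0:
  assumes f: "lip L f" and g: "\<And>K. lip (L + 2) (g K)" and fg: "\<And>K n. \<bar>g K n - f (min n K)\<bar> \<le> 1 / Suc K"
  shows "(\<lambda>K. \<integral>h. \<bar>cov_diff f UNIV (g K) (cball 0 (real K)) h\<bar> \<partial>lborel) \<longlonglongrightarrow> 0"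
proof -
  define c where "c K = cov_diff f UNIV (g K) (cball 0 (real K))" for K
  have U: "UNIV \<in> sets (borel :: 'a measure)" "cball 0 (real K) \<in> sets (borel :: 'a measure)" for K by auto
  define E where "E K \<omega> = f (X UNIV 0 \<omega>) - g K (X (cball 0 (real K)) 0 \<omega>)" for K \<omega>
  have L0: "0 \<le> L" using f by (simp add: lip_def)
  have step: "1 / real (Suc K) \<le> 1" for K by simp
  have [measurable]: "E K \<in> borel_measurable M" for K unfolding E_def by measurable
  \<comment> \<open>The dominating function for the error: truncation and window cost at most
    \<open>L\<close> times the full count, the polynomial at most 1. It is Lipschitz in the count,
    so its square is integrable.\<close>
  have lipid: "lip L (\<lambda>n. L * real n + 1)" using L0 by (auto simp: lip_def abs_mult right_diff_distrib[symmetric])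
  have dom: "integrable M (\<lambda>\<omega>. (L * real (X UNIV 0 \<omega>) + 1)\<^sup>2)"
    using integrable_X2[OF U(1) U(1) lipid lipid, of 0 0] by (simp add: power2_eq_square)
  have Eb: "AE \<omega> in M. \<bar>E K \<omega>\<bar> \<le> L * real (X UNIV 0 \<omega>) + 1" for K
    using AE_X_mono[OF U(2)[of K]]
  proof eventually_elim
    case (elim \<omega>)
    let ?x = "X UNIV 0 \<omega>" and ?y = "X (cball 0 (real K)) 0 \<omega>"
    have "\<bar>f ?x - f (min ?y K)\<bar> \<le> L * \<bar>real ?x - real (min ?y K)\<bar>" using f unfolding lip_def by blast
    also have "\<dots> \<le> L * real ?x" using elim L0 by (intro mult_left_mono) auto
    finally show ?case using fg[of K ?y] step[of K] unfolding E_def by linarith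
  qed
  have E0: "AE \<omega> in M. (\<lambda>K. (E K \<omega>)\<^sup>2) \<longlonglongrightarrow> 0"
    using AE_window_tendsto
  proof eventually_elim
    case (elim \<omega>)
    then obtain K0 where K0: "\<And>K. K \<ge> K0 \<Longrightarrow> X (cball 0 (real K)) 0 \<omega> = X UNIV 0 \<omega>" by blast
    have "(\<lambda>K. E K \<omega>) \<longlonglongrightarrow> 0"
    proof (rule Lim_null_comparison)
      show "(\<lambda>K. 1 / real (Suc K)) \<longlonglongrightarrow> 0" by (rule LIMSEQ_Suc[OF lim_1_over_n])
      show "\<forall>\<^sub>F K in sequentially. norm (E K \<omega>) \<le> 1 / real (Suc K)"
      proof (rule eventually_sequentiallyI[of "max K0 (X UNIV 0 \<omega>)"])
        fix K assume "max K0 (X UNIV 0 \<omega>) \<le> K"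
        then have "X (cball 0 (real K)) 0 \<omega> = X UNIV 0 \<omega>" "min (X UNIV 0 \<omega>) K = X UNIV 0 \<omega>" using K0 by auto
        then show "norm (E K \<omega>) \<le> 1 / real (Suc K)" using fg[of K "X UNIV 0 \<omega>"] by (simp add: E_def abs_minus_commute)
      qed
    qed
    from tendsto_power[OF this, of 2] show ?case by simp
  qed
  have "(\<lambda>K. \<integral>\<omega>. (E K \<omega>)\<^sup>2 \<partial>M) \<longlonglongrightarrow> (\<integral>\<omega>. 0 \<partial>M)"
  proof (rule integral_dominated_convergence[where w="\<lambda>\<omega>. (L * real (X UNIV 0 \<omega>) + 1)\<^sup>2"])
    show "AE \<omega> in M. norm ((E K \<omega>)\<^sup>2) \<le> (L * real (X UNIV 0 \<omega>) + 1)\<^sup>2" for K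
      using Eb[of K]
    proof eventually_elim
      case (elim \<omega>)
      then show ?case using power_mono[OF elim, of 2] by simp
    qed
  qed (use dom E0 in auto)
  then have EE: "(\<lambda>K. \<integral>\<omega>. (E K \<omega>)\<^sup>2 \<partial>M) \<longlonglongrightarrow> 0" by simp
  \<comment> \<open>At lag 0 the covariance is the variance of the error, which is at most its
    second moment.\<close>
  have c0: "c K 0 \<le> (\<integral>\<omega>. (E K \<omega>)\<^sup>2 \<partial>M)" for K
  proof -
    have i: "integrable M (\<lambda>\<omega>. (E K \<omega>)\<^sup>2)"
    proof (rule Bochner_Integration.integrable_bound[OF dom])
      show "AE \<omega> in M. norm ((E K \<omega>)\<^sup>2) \<le> norm ((L * real (X UNIV 0 \<omega>) + 1)\<^sup>2)"
        using Eb[of K]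
      proof eventually_elim
        case (elim \<omega>)
        then show ?case using power_mono[OF elim, of 2] by simp
      qed
    qed simp
    have i1: "integrable M (E K)" by (rule square_integrable_imp_integrable[OF _ i]) simp
    have m: "(\<integral>\<omega>. E K \<omega> \<partial>M) = mean f UNIV - mean (g K) (cball 0 (real K))"
      unfolding E_def mean_def
      using integrable_X[OF U(1) U(1) f f] integrable_X[OF U(2) U(2) g g] by simp
    have "c K 0 = (\<integral>\<omega>. (E K \<omega> - (\<integral>\<omega>. E K \<omega> \<partial>M))\<^sup>2 \<partial>M)"
    proof -
      have "E K \<omega> - (\<integral>\<omega>. E K \<omega> \<partial>M) = ctr f UNIV 0 \<omega> - ctr (g K) (cball 0 (real K)) 0 \<omega>" for \<omega>
        unfolding m by (simp add: E_def ctr_def)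
      then show ?thesis
        unfolding c_def power2_eq_square by (simp add: expectation_ctr_diff2[OF U(1) U(2) f g])
    qed
    also have "\<dots> = (\<integral>\<omega>. (E K \<omega>)\<^sup>2 \<partial>M) - (\<integral>\<omega>. E K \<omega> \<partial>M)\<^sup>2" by (rule variance_eq[OF i1 i])
    finally show ?thesis by simp
  qed
  have lim: "(\<lambda>K. \<bar>c K h\<bar>) \<longlonglongrightarrow> 0" for h
  proof (rule Lim_null_comparison[OF always_eventually EE], rule allI)
    fix K
    show "norm \<bar>c K h\<bar> \<le> (\<integral>\<omega>. (E K \<omega>)\<^sup>2 \<partial>M)"
      using abs_cov_diff_le0[OF U(1) U(2)[of K] f g[of K], of h] c0[of K] by (simp add: c_def)
  qed
  have "(\<lambda>K. \<integral>h. \<bar>c K h\<bar> \<partial>lborel) \<longlonglongrightarrow> (\<integral>h. 0 \<partial>(lborel :: 'a measure))"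
  proof (rule integral_dominated_convergence[where w="\<lambda>h. (L + (L + 2))\<^sup>2 * \<rho> h"])
    show "(\<lambda>h. \<bar>c K h\<bar>) \<in> borel_measurable lborel" for K
      using borel_measurable_integrable[OF integrable_cov_diff[OF U(1) U(2)[of K] f g[of K]]] by (simp add: c_def)
    show "AE h in lborel. norm \<bar>c K h\<bar> \<le> (L + (L + 2))\<^sup>2 * \<rho> h" for K
      using abs_cov_diff_le[OF U(1) U(2)[of K] f g[of K]] by (simp add: c_def)
  qed (use integrable_\<rho> lim in auto)
  then show ?thesis by (simp add: c_def)
qed

text \<open>For the rescaled weight the supremum is of order s^(-nu/2) and the L1 norm of order
  s^(nu/2). The near bound is then of order s^(-nu/2), and both error terms of the finite-range
  estimate are of this order.\<close>

lemma char_T_polynomial_tendsto: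
  fixes b :: "nat \<Rightarrow> real" and d K :: nat
  defines "g \<equiv> \<lambda>n. \<Sum>m\<le>d. b m * ((1/2::real) ^ m) ^ n"
  assumes \<phi>: "integrable lborel \<phi>" and C: "\<And>x. \<bar>\<phi> x\<bar> \<le> C"
  shows "((\<lambda>s. cmod ((\<integral>\<omega>. iexp (T g (cball 0 (real K)) (rescale \<phi> s) \<omega>) \<partial>M) -
    exp (- (\<integral>\<omega>. (T g (cball 0 (real K)) (rescale \<phi> s) \<omega>)\<^sup>2 \<partial>M) / 2))) \<longlongrightarrow> 0) at_top"
proof -
  let ?D = "cball (0::'a) (real K)" and ?\<nu> = "real DIM('a)"
  have D: "?D \<in> sets borel" by simp
  \<comment> \<open>Two points of a ball of radius \<open>K\<close> are at most \<open>2 * K\<close>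
    apart; this is the dependence range.\<close>
  have r: "dist x y \<le> 2 * real K" if "x \<in> ?D" "y \<in> ?D" for x y
    using that dist_triangle[of x y 0] by (simp add: dist_commute)
  obtain B where B: "finite_range_field M (ctr g ?D) B (2 * real K)"
    using finite_range_field_ctr[where b=b and d=d, OF D r] unfolding g_def by auto
  interpret F: finite_range_field M "ctr g ?D" B "2 * real K" by (rule B)
  have TS: "T g ?D a = F.S a" for a by (simp add: T_def[abs_def] F.S_def[abs_def])
  define A where "A = (\<integral>x. \<bar>\<phi> x\<bar> \<partial>lborel)"
  define k1 where "k1 = measure lborel (cball (0::'a) (2 * real K))"
  define k3 where "k3 = measure lborel (cball (0::'a) (3 * (2 * real K)))"
  define p where "p s = s powr (- (?\<nu> / 2))" for s :: real
  define bound where "bound s = A * B * (C * B * k1)\<^sup>2 / 2 * p s + sqrt (A * C * k3 * (2 * B * (C * B * k1))\<^sup>2) * p s" for s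
  have p0: "(p \<longlongrightarrow> 0) at_top" unfolding p_def by (rule tendsto_neg_powr[OF _ filterlim_ident]) simp
  have b0: "(bound \<longlongrightarrow> 0) at_top"
    unfolding bound_def[abs_def] by (rule tendsto_eq_intros p0 refl | simp)+
  show ?thesis
  proof (rule Lim_null_comparison[OF _ b0])
    show "\<forall>\<^sub>F s in at_top. norm (cmod ((\<integral>\<omega>. iexp (T g ?D (rescale \<phi> s) \<omega>) \<partial>M) - exp (- (\<integral>\<omega>. (T g ?D (rescale \<phi> s) \<omega>)\<^sup>2 \<partial>M) / 2))) \<le> bound s"
      using eventually_gt_at_top[of 0]
    proof eventually_elim
      case (elim s)
      define q where "q = s powr (?\<nu> / 2)"
      have ps: "0 < p s" and pq: "q * p s = 1" using elim by (auto simp: p_def q_def powr_add[symmetric])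
      have a: "integrable lborel (rescale \<phi> s)" "\<And>t. \<bar>rescale \<phi> s t\<bar> \<le> p s * C" "(\<integral>t. \<bar>rescale \<phi> s t\<bar> \<partial>lborel) = q * A"
        using integrable_rescale[OF \<phi> C elim] rescale_le[OF \<phi> C elim] rescale_L1[OF \<phi> C elim] by (auto simp: p_def q_def A_def)
      have 1: "q * A * B * (p s * C * B * k1)\<^sup>2 / 2 = A * B * (C * B * k1)\<^sup>2 / 2 * p s"
      proof -
        have "q * A * B * (p s * C * B * k1)\<^sup>2 / 2 = (q * p s) * (A * B * (C * B * k1)\<^sup>2 / 2 * p s)"
          by (simp add: power2_eq_square)
        then show ?thesis by (simp only: pq mult_1_left)
      qed
      have 2: "sqrt (q * A * (p s * C) * k3 * (2 * B * (p s * C * B * k1))\<^sup>2) = sqrt (A * C * k3 * (2 * B * (C * B * k1))\<^sup>2) * p s"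
      proof -
        have "q * A * (p s * C) * k3 * (2 * B * (p s * C * B * k1))\<^sup>2 = (q * p s) * (A * C * k3 * (2 * B * (C * B * k1))\<^sup>2 * (p s)\<^sup>2)"
          by (simp add: power2_eq_square)
        then show ?thesis using ps by (simp only: pq mult_1_left real_sqrt_mult) (simp add: real_sqrt_mult[symmetric])
      qed
      show ?case
        using F.expectation_finite_range[OF a(1,2)] unfolding a(3) k1_def[symmetric] k3_def[symmetric] 1 2 TS bound_def by simp
    qed
  qed
qed

text \<open>The error of passing to the approximant \<open>K\<close> does not depend on
  \<open>s\<close>. First \<open>K\<close> is fixed to make it small, then the finite-range limit is
  applied to that one approximant; the variance converges separately by the quadratic form.\<close>

theorem char_T_tendsto:
  assumes f: "lip L f" and \<phi>: "integrable lborel \<phi>" and C: "\<And>x. \<bar>\<phi> x\<bar> \<le> C"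
  shows "((\<lambda>s. \<integral>\<omega>. iexp (T f UNIV (rescale \<phi> s) \<omega>) \<partial>M) \<longlongrightarrow>
     exp (- ((\<integral>x. (\<phi> x)\<^sup>2 \<partial>lborel) * (\<integral>h. cov f UNIV f UNIV h \<partial>lborel)) / 2)) at_top"
proof -
  have U: "UNIV \<in> sets (borel :: 'a measure)" "cball 0 (real K) \<in> sets (borel :: 'a measure)" for K by auto
  define A where "A = (\<integral>x. (\<phi> x)\<^sup>2 \<partial>lborel)"
  have A0: "0 \<le> A" by (simp add: A_def)
  define v where "v s = (\<integral>\<omega>. (T f UNIV (rescale \<phi> s) \<omega>)\<^sup>2 \<partial>M)" for s
  define V where "V = A * (\<integral>h. \<bar>cov f UNIV f UNIV h\<bar> \<partial>lborel)"
  note rs = integrable_rescale[OF \<phi> C] rescale_le[OF \<phi> C] rescale_L2[OF \<phi> C]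
  have vV: "v s \<le> V" if "0 < s" for s
    using expectation_T2_le[OF U(1) f rs(1,2)[OF that]] unfolding rs(3)[OF that] v_def V_def A_def .
  have v0: "0 \<le> v s" for s by (simp add: v_def)
  have vlim: "(v \<longlongrightarrow> A * (\<integral>h. cov f UNIV f UNIV h \<partial>lborel)) at_top"
  proof -
    note Q = quadratic_form_rescale_tendsto[OF \<phi> C integrable_cov[OF U(1) U(1) f f]]
    have "\<forall>\<^sub>F s in at_top. (\<integral>t. \<integral>t'. rescale \<phi> s t * rescale \<phi> s t' * cov f UNIV f UNIV (t - t') \<partial>lborel \<partial>lborel) = v s"
      using eventually_gt_at_top[of 0]
    proof eventually_elim
      case (elim s)
      show ?case unfolding v_def by (rule expectation_T2[OF U(1) f rs(1,2)[OF elim], symmetric])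
    qed
    then show ?thesis unfolding A_def by (rule Lim_transform_eventually[OF Q])
  qed
  have "\<exists>g. \<forall>K. (\<exists>b d. g K = (\<lambda>n. \<Sum>m\<le>d::nat. b m * ((1/2::real) ^ m) ^ n)) \<and> lip (L + 2) (g K) \<and> (\<forall>n. \<bar>g K n - f (min n K)\<bar> \<le> 1 / Suc K)"
    using lip_approx_polynomial[OF f] unfolding Let_def by (intro choice allI) blast
  then obtain g where gp: "\<And>K. \<exists>b d. g K = (\<lambda>n. \<Sum>m\<le>d::nat. b m * ((1/2::real) ^ m) ^ n)"
    and g: "\<And>K. lip (L + 2) (g K)" and gf: "\<And>K n. \<bar>g K n - f (min n K)\<bar> \<le> 1 / Suc K" by blast
  \<comment> \<open>The summand \<open>1 / real (Suc K)\<close> keeps \<delta> positive, as required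
    where its square root is divided by.\<close>
  define \<delta> where "\<delta> K = A * (\<integral>h. \<bar>cov_diff f UNIV (g K) (cball 0 (real K)) h\<bar> \<partial>lborel) + 1 / real (Suc K)" for K
  define err where "err K = sqrt (\<delta> K) + (\<delta> K + sqrt (\<delta> K) * (V + 1)) / 2" for K
  have "(\<lambda>K. A * (\<integral>h. \<bar>cov_diff f UNIV (g K) (cball 0 (real K)) h\<bar> \<partial>lborel) + 1 / real (Suc K)) \<longlonglongrightarrow> A * 0 + 0"
    by (intro tendsto_intros cov_diff_tendsto_0[OF f g gf] LIMSEQ_Suc[OF lim_1_over_n])
  then have \<delta>lim: "\<delta> \<longlonglongrightarrow> 0" by (simp add: \<delta>_def[abs_def])
  have \<delta>0: "0 < \<delta> K" for K unfolding \<delta>_def using A0 by (intro add_nonneg_pos mult_nonneg_nonneg) auto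
  have errlim: "err \<longlonglongrightarrow> 0"
  proof -
    have "err \<longlonglongrightarrow> sqrt 0 + (0 + sqrt 0 * (V + 1)) / 2"
      unfolding err_def[abs_def] by (intro tendsto_intros \<delta>lim) simp
    then show ?thesis by simp
  qed
  have exp_le: "\<bar>exp (- x) - exp (- y)\<bar> \<le> \<bar>x - y\<bar>" if "0 \<le> x" "0 \<le> y" for x y :: real
  proof -
    have *: "exp (- x) - exp (- y) \<le> y - x" if "x \<le> y" "0 \<le> x" for x y :: real
    proof -
      have "exp (- x) - exp (- y) = exp (- x) * (1 - exp (x - y))" by (simp add: right_diff_distrib exp_add[symmetric])
      also have "\<dots> \<le> 1 * (y - x)"
      proof (rule mult_mono)
        show "1 - exp (x - y) \<le> y - x" using exp_ge_add_one_self[of "x - y"] by linarith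
      qed (use that in auto)
      finally show ?thesis by simp
    qed
    show ?thesis using *[of x y] *[of y x] that by (cases "x \<le> y") (auto simp: abs_if)
  qed
  have main: "cmod ((\<integral>\<omega>. iexp (T f UNIV (rescale \<phi> s) \<omega>) \<partial>M) - exp (- v s / 2)) \<le>
     err K + cmod ((\<integral>\<omega>. iexp (T (g K) (cball 0 (real K)) (rescale \<phi> s) \<omega>) \<partial>M) - exp (- (\<integral>\<omega>. (T (g K) (cball 0 (real K)) (rescale \<phi> s) \<omega>)\<^sup>2 \<partial>M) / 2))"
    if s: "0 < s" for s K
  proof -
    let ?a = "rescale \<phi> s" and ?D = "cball 0 (real K)"
    note m1 = T_measurable[OF U(1) f rs(1,2)[OF s]] and m2 = T_measurable[OF U(2) g rs(1,2)[OF s], of K K]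
    note i1 = integrable_T2[OF U(1) f rs(1,2)[OF s]] and i2 = integrable_T2[OF U(2) g rs(1,2)[OF s], of K K]
    note d = T_diff2[OF U(1) U(2) f g rs(1,2)[OF s], of K K]
    have d\<delta>: "(\<integral>\<omega>. (T f UNIV ?a \<omega> - T (g K) ?D ?a \<omega>)\<^sup>2 \<partial>M) \<le> \<delta> K"
      using d(2) unfolding rs(3)[OF s] A_def[symmetric] \<delta>_def by (rule order_trans) simp
    define v' where "v' = (\<integral>\<omega>. (T (g K) ?D ?a \<omega>)\<^sup>2 \<partial>M)"
    have v'0: "0 \<le> v'" by (simp add: v'_def)
    have 1: "cmod ((\<integral>\<omega>. iexp (T f UNIV ?a \<omega>) \<partial>M) - (\<integral>\<omega>. iexp (T (g K) ?D ?a \<omega>) \<partial>M)) \<le> sqrt (\<delta> K)"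
      by (rule cmod_expectation_iexp_diff_le[OF m2 m1 d(1) d\<delta>])
    have 2: "\<bar>v s - v'\<bar> \<le> \<delta> K + sqrt (\<delta> K) * (V + 1)"
      unfolding v_def v'_def by (rule abs_second_moment_diff_le[OF i2 i1 d(1) d\<delta> \<delta>0 vV[OF s, unfolded v_def]])
    have "cmod (of_real (exp (- v s / 2)) - of_real (exp (- v' / 2))) = \<bar>exp (- v s / 2) - exp (- v' / 2)\<bar>"
      unfolding of_real_diff[symmetric] norm_of_real ..
    also have "\<dots> \<le> \<bar>v s / 2 - v' / 2\<bar>" using exp_le[of "v s / 2" "v' / 2"] v0[of s] v'0 by simp
    also have "\<dots> \<le> (\<delta> K + sqrt (\<delta> K) * (V + 1)) / 2"
      using divide_right_mono[OF 2, of 2] by (simp add: diff_divide_distrib[symmetric])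
    finally have 3: "cmod (of_real (exp (- v s / 2)) - of_real (exp (- v' / 2))) \<le> (\<delta> K + sqrt (\<delta> K) * (V + 1)) / 2" .
    have tri: "cmod (x - y) \<le> cmod (x - z) + cmod (y - w) + cmod (z - w)" for x y z w :: complex
    proof -
      have "cmod (x - y) = cmod ((x - z) + (z - w) - (y - w))" by simp
      then show ?thesis using norm_triangle_ineq4[of "(x - z) + (z - w)" "y - w"] norm_triangle_ineq[of "x - z" "z - w"] by linarith
    qed
    show ?thesis
      unfolding err_def v'_def[symmetric] using tri[of "\<integral>\<omega>. iexp (T f UNIV ?a \<omega>) \<partial>M" "of_real (exp (- v s / 2))" "\<integral>\<omega>. iexp (T (g K) ?D ?a \<omega>) \<partial>M" "of_real (exp (- v' / 2))"] 1 3
      by linarith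
  qed
  have "((\<lambda>s. (\<integral>\<omega>. iexp (T f UNIV (rescale \<phi> s) \<omega>) \<partial>M) - exp (- v s / 2)) \<longlongrightarrow> 0) at_top"
  proof (rule tendstoI)
    fix e :: real assume e: "0 < e"
    have "\<forall>\<^sub>F K in sequentially. err K < e / 2" using order_tendstoD(2)[OF errlim, of "e/2"] e by simp
    then obtain K where K: "err K < e / 2" by (auto dest: eventually_happens)
    obtain b d where bd: "g K = (\<lambda>n. \<Sum>m\<le>d::nat. b m * ((1/2::real) ^ m) ^ n)" using gp by blast
    have "\<forall>\<^sub>F s in at_top. cmod ((\<integral>\<omega>. iexp (T (g K) (cball 0 (real K)) (rescale \<phi> s) \<omega>) \<partial>M) - exp (- (\<integral>\<omega>. (T (g K) (cball 0 (real K)) (rescale \<phi> s) \<omega>)\<^sup>2 \<partial>M) / 2)) < e / 2"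
      using order_tendstoD(2)[OF char_T_polynomial_tendsto[where K=K and b=b and d=d, OF \<phi> C], of "e / 2"] e unfolding bd by simp
    then show "\<forall>\<^sub>F s in at_top. dist ((\<integral>\<omega>. iexp (T f UNIV (rescale \<phi> s) \<omega>) \<partial>M) - exp (- v s / 2)) 0 < e"
      using eventually_gt_at_top[of 0]
    proof eventually_elim
      case (elim s)
      then show ?case using main[OF elim(2), of K] K by simp
    qed
  qed
  moreover have "((\<lambda>s. complex_of_real (exp (- v s / 2))) \<longlongrightarrow> of_real (exp (- (A * (\<integral>h. cov f UNIV f UNIV h \<partial>lborel)) / 2))) at_top"
    by (intro tendsto_intros vlim) simp
  ultimately have "((\<lambda>s. ((\<integral>\<omega>. iexp (T f UNIV (rescale \<phi> s) \<omega>) \<partial>M) - exp (- v s / 2)) + exp (- v s / 2)) \<longlongrightarrow> 0 + of_real (exp (- (A * (\<integral>h. cov f UNIV f UNIV h \<partial>lborel)) / 2))) at_top"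
    by (rule tendsto_add)
  then show ?thesis by (simp add: A_def)
qed

end

section \<open>Test functions and rescaled integrals\<close>

text \<open>A Borel version, clipped at the essential bound, is bounded at every point and can be
  used with product measures over \<open>lborel\<close>.\<close>

lemma L1_Linf_borel_version:
  fixes \<phi> :: "'a::euclidean_space \<Rightarrow> real"
  assumes "\<phi> \<in> L1_Linf"
  obtains \<psi> C where "integrable lborel \<psi>" "\<And>x. \<bar>\<psi> x\<bar> \<le> C" "AE x in lborel. \<phi> x = \<psi> x"
proof -
  from assms obtain C where i: "integrable lebesgue \<phi>" and C: "AE t in lborel. \<bar>\<phi> t\<bar> \<le> C"
    unfolding L1_Linf_def by (auto simp: AE_completion_iff)
  obtain g where g[measurable]: "g \<in> borel_measurable borel" and ae: "AE x in lborel. \<phi> x = g x"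
    using completion_ex_borel_measurable_real[OF borel_measurable_integrable[OF i]] by auto
  define \<psi> where "\<psi> x = max (- \<bar>C\<bar>) (min \<bar>C\<bar> (g x))" for x
  have ae': "AE x in lborel. \<phi> x = \<psi> x"
    using ae C by eventually_elim (auto simp: \<psi>_def abs_le_iff max_def min_def abs_if split: if_splits)
  show ?thesis
  proof (rule that[OF _ _ ae'])
    have m: "\<psi> \<in> borel_measurable borel" unfolding \<psi>_def by measurable
    have "integrable lebesgue \<psi>"
      using integrable_cong_AE_imp[OF i, of \<psi>] m ae' by (auto simp: AE_completion_iff measurable_completion)
    then show "integrable lborel \<psi>" using m by (subst (asm) integrable_completion) auto
    show "\<bar>\<psi> x\<bar> \<le> \<bar>C\<bar>" for x by (auto simp: \<psi>_def)
  qed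
qed

lemma AE_lborel_scale:
  fixes P :: "'a::euclidean_space \<Rightarrow> bool"
  assumes P: "AE x in lborel. P x" and s: "0 < s"
  shows "AE t in lborel. P (t /\<^sub>R s)"
proof -
  obtain N where N: "N \<in> null_sets lborel" "{x. \<not> P x} \<subseteq> N"
    using P by (auto simp: eventually_ae_filter)
  have i: "integrable lborel (indicat_real N)" using N(1) by (intro integrable_real_indicator) (auto simp: null_sets_def)
  have "(\<integral>t. indicat_real N (t /\<^sub>R s) \<partial>lborel) = 0"
    using integral_lborel_scale[OF s i] N(1) by (simp add: measure_eq_0_null_sets)
  then have "AE t in lborel. indicat_real N (t /\<^sub>R s) = 0"
    using integral_nonneg_eq_0_iff_AE[OF integrable_lborel_scale[OF s i]] by simp
  then show ?thesis by eventually_elim (use N(2) in \<open>auto simp: indicator_def split: if_splits\<close>)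
qed

lemma scaled_integral_borel_version:
  fixes \<phi> \<psi> :: "'a::euclidean_space \<Rightarrow> real"
  assumes \<phi>: "\<phi> \<in> borel_measurable lebesgue" and \<psi>: "\<psi> \<in> borel_measurable borel" and ae: "AE x in lborel. \<phi> x = \<psi> x"
    and s: "0 < s" and Y: "(\<lambda>t. Y t \<omega>) \<in> borel_measurable borel"
  shows "scaled_integral Y \<phi> s \<omega> = (\<integral>t. \<psi> (t /\<^sub>R s) * Y t \<omega> \<partial>lborel)"
proof -
  note [measurable] = \<psi> Y
  have Yl[measurable]: "(\<lambda>t. Y t \<omega>) \<in> borel_measurable lebesgue" using Y by (simp add: measurable_completion)
  have \<phi>l: "(\<lambda>t. \<phi> (t /\<^sub>R s)) \<in> borel_measurable lebesgue"
    using measurable_compose[OF lebesgue_measurable_scaling[of "inverse s"] \<phi>] by simp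
  have m: "(\<lambda>t. \<psi> (t /\<^sub>R s) * Y t \<omega>) \<in> borel_measurable borel" by measurable
  have "scaled_integral Y \<phi> s \<omega> = (\<integral>t. \<psi> (t /\<^sub>R s) * Y t \<omega> \<partial>lebesgue)"
    unfolding scaled_integral_def
  proof (rule integral_cong_AE)
    show "(\<lambda>t. \<phi> (t /\<^sub>R s) * Y t \<omega>) \<in> borel_measurable lebesgue" using \<phi>l by measurable
    show "(\<lambda>t. \<psi> (t /\<^sub>R s) * Y t \<omega>) \<in> borel_measurable lebesgue" using m by (simp add: measurable_completion)
    show "AE t in lebesgue. \<phi> (t /\<^sub>R s) * Y t \<omega> = \<psi> (t /\<^sub>R s) * Y t \<omega>"
      unfolding AE_completion_iff using AE_lborel_scale[OF ae s] by eventually_elim simp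
  qed
  also have "\<dots> = (\<integral>t. \<psi> (t /\<^sub>R s) * Y t \<omega> \<partial>lborel)" using m by (intro integral_completion) simp
  finally show ?thesis .
qed

context square_integrable_grain_model begin

text \<open>The normalising factor and the mean are moved inside: up to a null event the normalised
  integral is the integral of the centred field against the rescaled weight. Afterwards only
  \<open>T\<close> has to be studied.\<close>

lemma
  fixes Y :: "'a \<Rightarrow> 'w \<Rightarrow> real"
  assumes Y: "(\<lambda>p. Y (fst p) (snd p)) \<in> borel_measurable (borel \<Otimes>\<^sub>M M)"
    and YX: "\<And>t. AE \<omega> in M. Y t \<omega> = f (X UNIV t \<omega>)" and f: "lip L f"
    and \<phi>: "\<phi> \<in> borel_measurable lebesgue" and \<psi>: "integrable lborel \<psi>" and C: "\<And>x. \<bar>\<psi> x\<bar> \<le> C"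
    and ae: "AE x in lborel. \<phi> x = \<psi> x" and s: "0 < s"
  shows integrable_scaled_integral: "integrable M (scaled_integral Y \<phi> s)"
    and AE_normalized_integral: "AE \<omega> in M. normalized_integral M Y \<phi> s \<omega> = T f UNIV (rescale \<psi> s) \<omega>"
    and measurable_normalized_integral: "normalized_integral M Y \<phi> s \<in> borel_measurable M"
proof -
  interpret lM: pair_sigma_finite "lborel :: 'a measure" M ..
  have [measurable]: "\<psi> \<in> borel_measurable borel" using \<psi> by auto
  have Yr[measurable (raw)]: "(\<lambda>x. Y (h x) (k x)) \<in> borel_measurable K"
    if [measurable]: "h \<in> borel_measurable K" "k \<in> K \<rightarrow>\<^sub>M M" for h k and K :: "'k measure"
    using measurable_compose[OF measurable_Pair[OF that] Y] by simp
  have U: "UNIV \<in> sets (borel :: 'a measure)" by simp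
  define b where "b t = \<psi> (t /\<^sub>R s)" for t
  have b: "integrable lborel b" unfolding b_def by (rule integrable_lborel_scale[OF s \<psi>])
  have [measurable]: "b \<in> borel_measurable borel" using b by auto
  have bC: "\<bar>b t\<bar> \<le> C" for t using C by (simp add: b_def)
  define I where "I \<omega> = (\<integral>t. b t * Y t \<omega> \<partial>lborel)" for \<omega>
  have SI: "scaled_integral Y \<phi> s \<omega> = I \<omega>" if "\<omega> \<in> space M" for \<omega>
    unfolding I_def b_def
  proof (rule scaled_integral_borel_version[OF \<phi> _ ae s])
    show "(\<lambda>t. Y t \<omega>) \<in> borel_measurable borel" using that by measurable
  qed measurable
  have [measurable]: "I \<in> borel_measurable M" unfolding I_def by measurable
  define c where "c = mean f UNIV * (\<integral>t. b t \<partial>lborel)"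
  \<comment> \<open>The exceptional null event depends on the site; Fubini exchanges this for a null
    set of sites depending on the outcome, which the integral ignores.\<close>
  have AE1: "AE \<omega> in M. AE t in lborel. Y t \<omega> = f (X UNIV t \<omega>)"
  proof (rule lM.AE_commute[THEN iffD1])
    show "{x \<in> space (lborel \<Otimes>\<^sub>M M). Y (fst x) (snd x) = f (X UNIV (fst x) (snd x))} \<in> sets (lborel \<Otimes>\<^sub>M M)" by measurable
    show "AE t in lborel. AE \<omega> in M. Y t \<omega> = f (X UNIV t \<omega>)" by (intro AE_I2 YX)
  qed
  have AEI: "AE \<omega> in M. I \<omega> = T f UNIV b \<omega> + c"
    using AE1 AE_ctr_integrable[OF U f b bC] AE_space
  proof eventually_elim
    case (elim \<omega>)
    have "I \<omega> = (\<integral>t. b t * ctr f UNIV t \<omega> + mean f UNIV * b t \<partial>lborel)"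
      unfolding I_def
    proof (rule integral_cong_AE)
      show "(\<lambda>t. b t * Y t \<omega>) \<in> borel_measurable lborel" "(\<lambda>t. b t * ctr f UNIV t \<omega> + mean f UNIV * b t) \<in> borel_measurable lborel"
        using elim(3) by measurable
      show "AE t in lborel. b t * Y t \<omega> = b t * ctr f UNIV t \<omega> + mean f UNIV * b t"
        using elim(1) by eventually_elim (simp add: ctr_def algebra_simps)
    qed
    then show ?case using elim(2) b by (simp add: T_def c_def)
  qed
  have iI: "integrable M I"
  proof (rule integrable_cong_AE_imp)
    show "integrable M (\<lambda>\<omega>. T f UNIV b \<omega> + c)" using integrable_T[OF U f b bC] by simp
    show "AE \<omega> in M. T f UNIV b \<omega> + c = I \<omega>" using AEI by eventually_elim simp
  qed simp
  show iS: "integrable M (scaled_integral Y \<phi> s)"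
    using iI SI by (simp cong: Bochner_Integration.integrable_cong)
  have "(\<integral>\<omega>. scaled_integral Y \<phi> s \<omega> \<partial>M) = (\<integral>\<omega>. I \<omega> \<partial>M)"
    using SI by (intro Bochner_Integration.integral_cong) auto
  also have "\<dots> = (\<integral>\<omega>. T f UNIV b \<omega> + c \<partial>M)"
    using AEI T_measurable[OF U f b bC] by (intro integral_cong_AE) auto
  also have "\<dots> = c" using integrable_T[OF U f b bC] expectation_T[OF U f b bC] by (simp add: prob_space)
  finally have E: "(\<integral>\<omega>. scaled_integral Y \<phi> s \<omega> \<partial>M) = c" .
  show "AE \<omega> in M. normalized_integral M Y \<phi> s \<omega> = T f UNIV (rescale \<psi> s) \<omega>"
    using AEI AE_space
    by eventually_elim (simp add: normalized_integral_def E SI T_def rescale_def b_def mult.assoc)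
  show "normalized_integral M Y \<phi> s \<in> borel_measurable M"
    unfolding normalized_integral_def[abs_def] using borel_measurable_integrable[OF iS] by measurable
qed

section \<open>The grain field and its excursion sets\<close>

definition exc :: "nat \<Rightarrow> nat \<Rightarrow> real" where "exc k n = of_bool (k \<le> n)"

lemma lip_exc: "lip 1 (exc k)" by (rule lipI) (auto simp: exc_def)

lemma lip_real: "lip 1 real" by (simp add: lip_def)

lemma grain_count_eq: "grain_count u G t \<omega> =
  (if finite {j. t - u j \<omega> \<in> G j \<omega>} then of_nat (X UNIV t \<omega>) else \<infinity>)"
proof -
  have "t \<in> (+) (u j \<omega>) ` G j \<omega> \<longleftrightarrow> t - u j \<omega> \<in> G j \<omega>" for j
    by (metis (no_types, lifting) add_diff_cancel_left' diff_add_cancel add.commute image_iff)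
  then have "grain_count u G t \<omega> = (\<Sum>j. indicator {j. t - u j \<omega> \<in> G j \<omega>} j)"
    unfolding grain_count_def by (intro suminf_cong) (auto simp: indicator_def)
  then show ?thesis
    unfolding suminf_indicator_eq_card[of "{j. t - u j \<omega> \<in> G j \<omega>}" "\<lambda>j. j"] by (simp add: X_def)
qed

text \<open>Valid for every outcome: both sides are 0 where infinitely many grains cover
  \<open>t\<close>.\<close>

lemma grain_field_eq: "grain_field u G t \<omega> = real (X UNIV t \<omega>)"
  unfolding grain_field_def grain_count_eq by (simp add: X_def)

text \<open>Here an infinite count matters: the excursion field is 1 there, while \<open>X\<close>
  records 0. The equality thus rests on the almost sure finiteness of the count.\<close>

lemma AE_excursion_field_eq: "AE \<omega> in M. excursion_field u G k t \<omega> = exc k (X UNIV t \<omega>)"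
proof -
  have "AE \<omega> in M. finite {j. (u j \<omega>, G j \<omega>) \<in> cover UNIV t}"
    by (rule AE_finite_num[OF sets_cover emeasure_cover_finite]) auto
  then show ?thesis
  proof (rule AE_mp, intro AE_I2 impI)
    fix \<omega> assume w: "\<omega> \<in> space M" and "finite {j. (u j \<omega>, G j \<omega>) \<in> cover UNIV t}"
    moreover have "{j. (u j \<omega>, G j \<omega>) \<in> cover UNIV t} = {j. t - u j \<omega> \<in> G j \<omega>}"
      using measurable_space[OF measurable_G w] by (auto simp: cover_def space_pair_measure)
    ultimately have "finite {j. t - u j \<omega> \<in> G j \<omega>}" by simp
    then show "excursion_field u G k t \<omega> = exc k (X UNIV t \<omega>)"
      by (simp add: excursion_field_def grain_count_eq exc_def)
  qed
qed

lemma measurable_grain_count: "(\<lambda>p. grain_count u G (fst p) (snd p)) \<in> borel_measurable (borel \<Otimes>\<^sub>M M)"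
proof -
  have "grain_count u G t \<omega> = (\<Sum>j. if t - u j \<omega> \<in> G j \<omega> then 1 else 0)" for t \<omega>
  proof -
    have "t \<in> (+) (u j \<omega>) ` G j \<omega> \<longleftrightarrow> t - u j \<omega> \<in> G j \<omega>" for j
      by (metis (no_types, lifting) add_diff_cancel_left' diff_add_cancel add.commute image_iff)
    then show ?thesis unfolding grain_count_def by (intro suminf_cong) (auto simp: indicator_def)
  qed
  then show ?thesis by simp
qed

lemma measurable_grain_field: "(\<lambda>p. grain_field u G (fst p) (snd p)) \<in> borel_measurable (borel \<Otimes>\<^sub>M M)"
  unfolding grain_field_def using measurable_grain_count by measurable

lemma measurable_excursion_field: "(\<lambda>p. excursion_field u G k (fst p) (snd p)) \<in> borel_measurable (borel \<Otimes>\<^sub>M M)"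
  unfolding excursion_field_def using measurable_grain_count by measurable

lemma covariance_eq_cov:
  assumes Y: "(\<lambda>p. Y (fst p) (snd p)) \<in> borel_measurable (borel \<Otimes>\<^sub>M M)" "\<And>t. AE \<omega> in M. Y t \<omega> = f (X UNIV t \<omega>)" "lip L f"
    and Y': "(\<lambda>p. Y' (fst p) (snd p)) \<in> borel_measurable (borel \<Otimes>\<^sub>M M)" "\<And>t. AE \<omega> in M. Y' t \<omega> = f' (X UNIV t \<omega>)" "lip L' f'"
  shows "covariance M (Y t) (Y' s) = cov f UNIV f' UNIV (t - s)"
proof -
  have U: "UNIV \<in> sets (borel :: 'a measure)" by simp
  have [measurable]: "Y t \<in> borel_measurable M" "Y' t \<in> borel_measurable M" for t
    using measurable_compose[OF measurable_Pair1'[of t borel M] Y(1)] measurable_compose[OF measurable_Pair1'[of t borel M] Y'(1)] by simp_all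
  have m: "(\<integral>\<omega>. Y t \<omega> \<partial>M) = mean f UNIV"
  proof -
    have "(\<integral>\<omega>. Y t \<omega> \<partial>M) = (\<integral>\<omega>. f (X UNIV t \<omega>) \<partial>M)" using Y(2) by (intro integral_cong_AE) auto
    then show ?thesis unfolding mean_def using integral_X_stationary[OF U U, of f t 0] by simp
  qed
  have m': "(\<integral>\<omega>. Y' s \<omega> \<partial>M) = mean f' UNIV"
  proof -
    have "(\<integral>\<omega>. Y' s \<omega> \<partial>M) = (\<integral>\<omega>. f' (X UNIV s \<omega>) \<partial>M)" using Y'(2) by (intro integral_cong_AE) auto
    then show ?thesis unfolding mean_def using integral_X_stationary[OF U U, of f' s 0] by simp
  qed
  have "covariance M (Y t) (Y' s) = (\<integral>\<omega>. ctr f UNIV t \<omega> * ctr f' UNIV s \<omega> \<partial>M)"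
    unfolding covariance_def m m'
  proof (rule integral_cong_AE)
    show "AE \<omega> in M. (Y t \<omega> - mean f UNIV) * (Y' s \<omega> - mean f' UNIV) = ctr f UNIV t \<omega> * ctr f' UNIV s \<omega>"
      using Y(2)[of t] Y'(2)[of s] by eventually_elim (simp add: ctr_def)
  qed measurable
  then show ?thesis using expectation_ctr2[OF U U Y(3) Y'(3)] by simp
qed

lemma covariance_excursion_eq: "covariance M (excursion_field u G k t) (excursion_field u G l 0) = cov (exc k) UNIV (exc l) UNIV t"
  using covariance_eq_cov[OF measurable_excursion_field AE_excursion_field_eq lip_exc measurable_excursion_field AE_excursion_field_eq lip_exc, of k t l 0] by simp

lemma cov_real: "cov real UNIV real UNIV h = \<rho> h"
proof -
  have U: "UNIV \<in> sets (borel :: 'a measure)" by simp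
  have "mean real UNIV = (\<integral>\<omega>. real (X UNIV h \<omega>) \<partial>M)"
    unfolding mean_def by (rule integral_X_stationary[OF U U])
  then have "cov real UNIV real UNIV h = (\<integral>\<omega>. real (X UNIV h \<omega>) * real (X UNIV 0 \<omega>) \<partial>M) - (\<integral>\<omega>. real (X UNIV h \<omega>) \<partial>M) * (\<integral>\<omega>. real (X UNIV 0 \<omega>) \<partial>M)"
    by (simp add: cov_def mean_def)
  also have "\<dots> = measure Lam (cover UNIV h \<inter> cover UNIV 0)"
    using covariance_num[OF sets_cover[OF U, of h] sets_cover[OF U, of 0] emeasure_cover_finite[OF U] emeasure_cover_finite[OF U] lip_real lip_real]
    by (simp add: X_eq_num cong: Bochner_Integration.integral_cong)
  also have "\<dots> = \<rho> h" unfolding measure_cover_Int_UNIV using \<rho>_minus[of h] by simp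
  finally show ?thesis .
qed

lemma grain_covariance_eq: "grain_covariance M u G = \<rho>"
proof
  fix t
  have "covariance M (grain_field u G 0) (grain_field u G t) = cov real UNIV real UNIV (0 - t)"
    by (rule covariance_eq_cov[OF measurable_grain_field _ lip_real measurable_grain_field _ lip_real]) (simp_all add: grain_field_eq)
  then show "grain_covariance M u G t = \<rho> t" unfolding grain_covariance_def cov_real by (simp add: \<rho>_minus)
qed

end

context square_integrable_grain_model begin

section \<open>Limit covariances and linear combinations\<close>

context
  fixes \<phi> \<psi> :: "'a \<Rightarrow> real" and C :: real
  assumes \<phi>: "\<phi> \<in> borel_measurable lebesgue" and \<psi>: "integrable lborel \<psi>" and C: "\<And>x. \<bar>\<psi> x\<bar> \<le> C"
    and \<phi>\<psi>: "AE x in lborel. \<phi> x = \<psi> x"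
begin

lemma U: "UNIV \<in> sets (borel :: 'a measure)" by simp

definition lcov :: "(nat \<Rightarrow> real) \<Rightarrow> (nat \<Rightarrow> real) \<Rightarrow> real" where
  "lcov f g = (\<integral>x. (\<psi> x)\<^sup>2 \<partial>lborel) * (\<integral>h. cov f UNIV g UNIV h \<partial>lborel)"

lemma lcov_sym: "lcov f g = lcov g f"
proof -
  have "cov f UNIV g UNIV h = cov g UNIV f UNIV h" for h
    unfolding cov_def using integral_X2_swap[OF U U, of f h g 0] by (simp add: mult.commute)
  then show ?thesis by (simp add: lcov_def)
qed

lemma normalized_integral_second_moment:
  assumes Y: "(\<lambda>p. Y (fst p) (snd p)) \<in> borel_measurable (borel \<Otimes>\<^sub>M M)" "\<And>t. AE \<omega> in M. Y t \<omega> = f (X UNIV t \<omega>)" "lip L f"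
    and s: "0 < s"
  shows "integrable M (\<lambda>\<omega>. (normalized_integral M Y \<phi> s \<omega>)\<^sup>2)"
    "(\<integral>\<omega>. (normalized_integral M Y \<phi> s \<omega>)\<^sup>2 \<partial>M) \<le> (\<integral>x. (\<psi> x)\<^sup>2 \<partial>lborel) * (\<integral>h. \<bar>cov f UNIV f UNIV h\<bar> \<partial>lborel)"
proof -
  note rs = integrable_rescale[OF \<psi> C s] rescale_le[OF \<psi> C s]
  note m[measurable] = measurable_normalized_integral[OF Y \<phi> \<psi> C \<phi>\<psi> s]
  have AE: "AE \<omega> in M. (T f UNIV (rescale \<psi> s) \<omega>)\<^sup>2 = (normalized_integral M Y \<phi> s \<omega>)\<^sup>2"
    using AE_normalized_integral[OF Y \<phi> \<psi> C \<phi>\<psi> s] by eventually_elim simp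
  note i = integrable_T2[OF U Y(3) rs]
  show "integrable M (\<lambda>\<omega>. (normalized_integral M Y \<phi> s \<omega>)\<^sup>2)"
    by (rule integrable_cong_AE_imp[OF i _ AE]) measurable
  have "(\<integral>\<omega>. (normalized_integral M Y \<phi> s \<omega>)\<^sup>2 \<partial>M) = (\<integral>\<omega>. (T f UNIV (rescale \<psi> s) \<omega>)\<^sup>2 \<partial>M)"
    by (rule integral_cong_AE[symmetric, OF borel_measurable_integrable[OF i] _ AE]) measurable
  also have "\<dots> \<le> (\<integral>x. (\<psi> x)\<^sup>2 \<partial>lborel) * (\<integral>h. \<bar>cov f UNIV f UNIV h\<bar> \<partial>lborel)"
    using expectation_T2_le[OF U Y(3) rs] unfolding rescale_L2[OF \<psi> C s] .
  finally show "(\<integral>\<omega>. (normalized_integral M Y \<phi> s \<omega>)\<^sup>2 \<partial>M) \<le> (\<integral>x. (\<psi> x)\<^sup>2 \<partial>lborel) * (\<integral>h. \<bar>cov f UNIV f UNIV h\<bar> \<partial>lborel)" .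
qed

context
  fixes f :: "nat \<Rightarrow> nat \<Rightarrow> real" and L :: "nat \<Rightarrow> real" and J :: "nat set" and a :: "nat \<Rightarrow> real"
  assumes f: "\<And>k. lip (L k) (f k)" and J: "finite J"
begin

text \<open>A linear combination of Lipschitz functions of the count is again one. The limit theorem
  for a single function therefore already contains the joint one, by the Cramer-Wold device.\<close>

definition comb :: "nat \<Rightarrow> real" where "comb n = (\<Sum>k\<in>J. a k * f k n)"

lemma lip_comb: "lip (\<Sum>k\<in>J. \<bar>a k\<bar> * L k) comb"
  unfolding lip_def
proof (intro conjI allI)
  have L0: "0 \<le> L k" for k using f[of k] by (simp add: lip_def)
  then show "0 \<le> (\<Sum>k\<in>J. \<bar>a k\<bar> * L k)" by (intro sum_nonneg mult_nonneg_nonneg) auto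
  fix m n
  have "\<bar>comb m - comb n\<bar> = \<bar>\<Sum>k\<in>J. a k * (f k m - f k n)\<bar>"
    by (simp add: comb_def sum_subtractf right_diff_distrib)
  also have "\<dots> \<le> (\<Sum>k\<in>J. \<bar>a k * (f k m - f k n)\<bar>)" by (rule sum_abs)
  also have "\<dots> \<le> (\<Sum>k\<in>J. \<bar>a k\<bar> * (L k * \<bar>real m - real n\<bar>))"
    unfolding abs_mult using f by (intro sum_mono mult_left_mono) (auto simp: lip_def)
  also have "\<dots> = (\<Sum>k\<in>J. \<bar>a k\<bar> * L k) * \<bar>real m - real n\<bar>" by (simp add: sum_distrib_right mult.assoc)
  finally show "\<bar>comb m - comb n\<bar> \<le> (\<Sum>k\<in>J. \<bar>a k\<bar> * L k) * \<bar>real m - real n\<bar>" .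
qed

lemma mean_comb: "mean comb UNIV = (\<Sum>k\<in>J. a k * mean (f k) UNIV)"
  unfolding mean_def comb_def using integrable_X[OF U U f f] by simp

lemma ctr_comb: "ctr comb UNIV t \<omega> = (\<Sum>k\<in>J. a k * ctr (f k) UNIV t \<omega>)"
  unfolding ctr_def mean_comb by (simp add: comb_def right_diff_distrib sum_subtractf)

lemma lcov_comb: "lcov comb comb = (\<Sum>k\<in>J. \<Sum>l\<in>J. a k * a l * lcov (f k) (f l))"
proof -
  have "cov comb UNIV comb UNIV h = (\<Sum>k\<in>J. \<Sum>l\<in>J. a k * a l * cov (f k) UNIV (f l) UNIV h)" for h
  proof -
    have i: "integrable M (\<lambda>\<omega>. ctr (f k) UNIV h \<omega> * ctr (f l) UNIV 0 \<omega>)" for k l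
      by (rule integrable_ctr2[OF U U f f])
    have "cov comb UNIV comb UNIV h = (\<integral>\<omega>. ctr comb UNIV h \<omega> * ctr comb UNIV 0 \<omega> \<partial>M)"
      using expectation_ctr2[OF U U lip_comb lip_comb, of h 0] by simp
    also have "\<dots> = (\<integral>\<omega>. (\<Sum>k\<in>J. \<Sum>l\<in>J. a k * a l * (ctr (f k) UNIV h \<omega> * ctr (f l) UNIV 0 \<omega>)) \<partial>M)"
      unfolding ctr_comb sum_product by (simp add: mult_ac)
    also have "\<dots> = (\<Sum>k\<in>J. \<Sum>l\<in>J. a k * a l * (\<integral>\<omega>. ctr (f k) UNIV h \<omega> * ctr (f l) UNIV 0 \<omega> \<partial>M))"
      using i by simp
    finally show ?thesis using expectation_ctr2[OF U U f f] by simp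
  qed
  then have "(\<integral>h. cov comb UNIV comb UNIV h \<partial>lborel) = (\<Sum>k\<in>J. \<Sum>l\<in>J. a k * a l * (\<integral>h. cov (f k) UNIV (f l) UNIV h \<partial>lborel))"
    using integrable_cov[OF U U f f] by simp
  then show ?thesis by (simp add: lcov_def sum_distrib_left mult_ac)
qed

text \<open>It is a limit of variances of integrals of the field, and these are nonnegative.\<close>

lemma lcov_comb_nonneg: "0 \<le> lcov comb comb"
proof -
  have "((\<lambda>s. \<integral>t. \<integral>t'. rescale \<psi> s t * rescale \<psi> s t' * cov comb UNIV comb UNIV (t - t') \<partial>lborel \<partial>lborel) \<longlongrightarrow> lcov comb comb) at_top"
    unfolding lcov_def by (rule quadratic_form_rescale_tendsto[OF \<psi> C integrable_cov[OF U U lip_comb lip_comb]])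
  moreover have "\<forall>\<^sub>F s in at_top. 0 \<le> (\<integral>t. \<integral>t'. rescale \<psi> s t * rescale \<psi> s t' * cov comb UNIV comb UNIV (t - t') \<partial>lborel \<partial>lborel)"
    using eventually_gt_at_top[of 0]
  proof eventually_elim
    case (elim s)
    show ?case
      unfolding expectation_T2[OF U lip_comb integrable_rescale[OF \<psi> C elim] rescale_le[OF \<psi> C elim], symmetric] by simp
  qed
  ultimately show ?thesis by (rule tendsto_lowerbound) simp
qed

lemma char_normalized_integrals_tendsto:
  assumes Y: "\<And>k. (\<lambda>p. Y k (fst p) (snd p)) \<in> borel_measurable (borel \<Otimes>\<^sub>M M)" "\<And>k t. AE \<omega> in M. Y k t \<omega> = f k (X UNIV t \<omega>)"
  shows "((\<lambda>s. \<integral>\<omega>. iexp (\<Sum>k\<in>J. a k * normalized_integral M (Y k) \<phi> s \<omega>) \<partial>M) \<longlongrightarrow>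
    exp (- (\<Sum>k\<in>J. \<Sum>l\<in>J. a k * a l * lcov (f k) (f l)) / 2)) at_top"
proof -
  have "((\<lambda>s. \<integral>\<omega>. iexp (T comb UNIV (rescale \<psi> s) \<omega>) \<partial>M) \<longlongrightarrow> exp (- lcov comb comb / 2)) at_top"
    unfolding lcov_def by (rule char_T_tendsto[OF lip_comb \<psi> C])
  moreover have "\<forall>\<^sub>F s in at_top. (\<integral>\<omega>. iexp (T comb UNIV (rescale \<psi> s) \<omega>) \<partial>M) = (\<integral>\<omega>. iexp (\<Sum>k\<in>J. a k * normalized_integral M (Y k) \<phi> s \<omega>) \<partial>M)"
    using eventually_gt_at_top[of 0]
  proof eventually_elim
    case (elim s)
    note rs = integrable_rescale[OF \<psi> C elim] rescale_le[OF \<psi> C elim]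
    have [measurable]: "normalized_integral M (Y k) \<phi> s \<in> borel_measurable M" for k
      by (rule measurable_normalized_integral[OF Y f \<phi> \<psi> C \<phi>\<psi> elim])
    have [measurable]: "T comb UNIV (rescale \<psi> s) \<in> borel_measurable M" by (rule T_measurable[OF U lip_comb rs])
    have "AE \<omega> in M. \<forall>k\<in>J. normalized_integral M (Y k) \<phi> s \<omega> = T (f k) UNIV (rescale \<psi> s) \<omega> \<and> integrable lborel (\<lambda>t. rescale \<psi> s t * ctr (f k) UNIV t \<omega>)"
      using J by (intro AE_finite_allI AE_conjI AE_normalized_integral[OF Y f \<phi> \<psi> C \<phi>\<psi> elim] AE_ctr_integrable[OF U f rs])
    then have AE: "AE \<omega> in M. T comb UNIV (rescale \<psi> s) \<omega> = (\<Sum>k\<in>J. a k * normalized_integral M (Y k) \<phi> s \<omega>)"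
    proof eventually_elim
      case (elim \<omega>)
      have "T comb UNIV (rescale \<psi> s) \<omega> = (\<integral>t. (\<Sum>k\<in>J. a k * (rescale \<psi> s t * ctr (f k) UNIV t \<omega>)) \<partial>lborel)"
        unfolding T_def ctr_comb by (simp add: sum_distrib_left mult_ac)
      also have "\<dots> = (\<Sum>k\<in>J. a k * T (f k) UNIV (rescale \<psi> s) \<omega>)"
        using elim by (subst Bochner_Integration.integral_sum) (auto simp: T_def)
      also have "\<dots> = (\<Sum>k\<in>J. a k * normalized_integral M (Y k) \<phi> s \<omega>)"
        using elim by (intro sum.cong) auto
      finally show ?case .
    qed
    show ?case
    proof (rule integral_cong_AE)
      show "AE \<omega> in M. iexp (T comb UNIV (rescale \<psi> s) \<omega>) = iexp (\<Sum>k\<in>J. a k * normalized_integral M (Y k) \<phi> s \<omega>)"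
        using AE by eventually_elim (simp only:)
    qed measurable
  qed
  ultimately show ?thesis unfolding lcov_comb by (rule Lim_transform_eventually)
qed

end

lemma psd_lcov:
  fixes f :: "nat \<Rightarrow> nat \<Rightarrow> real"
  assumes f: "\<And>k. lip (L k) (f k)"
  shows "psd (\<lambda>k l. lcov (f k) (f l))"
  unfolding psd_def
proof (intro conjI allI impI)
  show "lcov (f k) (f l) = lcov (f l) (f k)" for k l by (rule lcov_sym)
  show "0 \<le> (\<Sum>k\<in>J. \<Sum>l\<in>J. a k * a l * lcov (f k) (f l))" if "finite J" for J a
    using lcov_comb_nonneg[where f=f and L=L and J=J and a=a, OF f that] unfolding lcov_comb[where f=f and L=L and J=J and a=a, OF f that] .
qed

lemma conv_normalized_integrals:
  fixes f :: "nat \<Rightarrow> nat \<Rightarrow> real"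
  assumes f: "\<And>k. lip (L k) (f k)" and J: "finite J"
    and Y: "\<And>k. (\<lambda>p. Y k (fst p) (snd p)) \<in> borel_measurable (borel \<Otimes>\<^sub>M M)" "\<And>k t. AE \<omega> in M. Y k t \<omega> = f k (X UNIV t \<omega>)"
    and N: "prob_space N" and W: "\<And>k. k \<in> J \<Longrightarrow> W k \<in> borel_measurable N"
    and W2: "\<And>k. k \<in> J \<Longrightarrow> has_bochner_integral N (\<lambda>\<omega>. W k \<omega> * W k \<omega>) (lcov (f k) (f k))"
    and char: "\<And>a. (\<integral>\<omega>. iexp (\<Sum>k\<in>J. a k * W k \<omega>) \<partial>N) = exp (- (\<Sum>k\<in>J. \<Sum>l\<in>J. a k * a l * lcov (f k) (f l)) / 2)"
  shows "conv_in_distribution M (\<lambda>s \<omega>. \<lambda>k\<in>J. normalized_integral M (Y k) \<phi> s \<omega>) N (\<lambda>\<omega>. \<lambda>k\<in>J. W k \<omega>) at_top"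
proof (rule conv_in_distribution_vector[OF prob_space_axioms N J])
  \<comment> \<open>With the absolute value of the covariance the same constant bounds the second
    moments at all scales and that of the limit.\<close>
  let ?V = "\<lambda>k. (\<integral>x. (\<psi> x)\<^sup>2 \<partial>lborel) * (\<integral>h. \<bar>cov (f k) UNIV (f k) UNIV h\<bar> \<partial>lborel)"
  show "\<forall>\<^sub>F s in at_top. \<forall>k\<in>J. normalized_integral M (Y k) \<phi> s \<in> borel_measurable M \<and>
      integrable M (\<lambda>\<omega>. (normalized_integral M (Y k) \<phi> s \<omega>)\<^sup>2) \<and> (\<integral>\<omega>. (normalized_integral M (Y k) \<phi> s \<omega>)\<^sup>2 \<partial>M) \<le> ?V k"
    using eventually_gt_at_top[of 0]
  proof eventually_elim
    case (elim s)
    show ?case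
      using measurable_normalized_integral[OF Y f \<phi> \<psi> C \<phi>\<psi> elim] normalized_integral_second_moment[OF Y f elim] by blast
  qed
  show "W k \<in> borel_measurable N \<and> integrable N (\<lambda>\<omega>. (W k \<omega>)\<^sup>2) \<and> (\<integral>\<omega>. (W k \<omega>)\<^sup>2 \<partial>N) \<le> ?V k" if "k \<in> J" for k
  proof -
    have "(\<integral>h. cov (f k) UNIV (f k) UNIV h \<partial>lborel) \<le> (\<integral>h. \<bar>cov (f k) UNIV (f k) UNIV h\<bar> \<partial>lborel)"
      using integrable_cov[OF U U f f] by (intro integral_mono) auto
    then have "lcov (f k) (f k) \<le> ?V k" unfolding lcov_def by (intro mult_left_mono) auto
    then show ?thesis using W[OF that] W2[OF that] by (simp add: has_bochner_integral_iff power2_eq_square)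
  qed
  show "((\<lambda>s. \<integral>\<omega>. iexp (\<Sum>k\<in>J. a k * normalized_integral M (Y k) \<phi> s \<omega>) \<partial>M) \<longlongrightarrow> (\<integral>\<omega>. iexp (\<Sum>k\<in>J. a k * W k \<omega>) \<partial>N)) at_top" for a
    unfolding char using char_normalized_integrals_tendsto[OF f J Y, where a=a] by simp
qed

end

end

section \<open>The scalar limit variable and the final assembly\<close>

lemma scaled_std_normal:
  fixes \<sigma> :: real
  assumes \<sigma>: "0 \<le> \<sigma>"
  shows "gaussian_rv std_normal_distribution (\<lambda>x. \<sigma> * x)"
    and "has_bochner_integral std_normal_distribution (\<lambda>x. \<sigma> * x) 0"
    and "has_bochner_integral std_normal_distribution (\<lambda>x. (\<sigma> * x) * (\<sigma> * x)) (\<sigma>\<^sup>2)"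
    and "(\<integral>x. iexp (a * (\<sigma> * x)) \<partial>std_normal_distribution) = exp (- (a * a * \<sigma>\<^sup>2) / 2)"
proof -
  interpret S: prob_space std_normal_distribution by (rule prob_space_normal_density) simp
  have d: "distributed std_normal_distribution lborel (\<lambda>x. x) std_normal_density"
    unfolding distributed_def by (auto simp: distr_id2)
  show "gaussian_rv std_normal_distribution (\<lambda>x. \<sigma> * x)"
  proof (cases "\<sigma> = 0")
    case True
    then show ?thesis unfolding gaussian_rv_def by auto
  next
    case False
    with \<sigma> have "0 < \<sigma>" by simp
    then show ?thesis
      using S.normal_density_affine[OF d, of \<sigma> 0] unfolding gaussian_rv_def
      by (intro conjI disjI1 exI[of _ 0] exI[of _ \<sigma>]) auto
  qed
  have b: "has_bochner_integral std_normal_distribution f x" if f: "has_bochner_integral lborel (\<lambda>y. std_normal_density y * f y) x"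
    and [measurable]: "f \<in> borel_measurable borel" for f :: "real \<Rightarrow> real" and x
    using f by (intro has_bochner_integral_density) (auto simp: std_normal_density_def)
  have 1: "has_bochner_integral std_normal_distribution (\<lambda>x. x) 0"
    by (rule b) (use std_normal_moment_odd[of 0] in auto)
  have 2: "has_bochner_integral std_normal_distribution (\<lambda>x. x\<^sup>2) 1"
    by (rule b) (use std_normal_moment_even[of 1] in auto)
  show "has_bochner_integral std_normal_distribution (\<lambda>x. \<sigma> * x) 0"
    using has_bochner_integral_mult_right[OF 1, of \<sigma>] by simp
  show "has_bochner_integral std_normal_distribution (\<lambda>x. (\<sigma> * x) * (\<sigma> * x)) (\<sigma>\<^sup>2)"
    using has_bochner_integral_mult_right[OF 2, of "\<sigma>\<^sup>2"] by (simp add: power2_eq_square mult_ac)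
  have "(\<integral>x. iexp (a * (\<sigma> * x)) \<partial>std_normal_distribution) = char std_normal_distribution (a * \<sigma>)"
    by (simp add: char_def mult.assoc)
  then show "(\<integral>x. iexp (a * (\<sigma> * x)) \<partial>std_normal_distribution) = exp (- (a * a * \<sigma>\<^sup>2) / 2)"
    by (simp add: char_std_normal_distribution power2_eq_square mult_ac)
qed

text \<open>Continuous mapping along one coordinate; it extracts the scalar statement from
  convergence of a one-element family.\<close>

lemma conv_in_distribution_coordinate:
  assumes "conv_in_distribution M (\<lambda>i \<omega>. \<lambda>k\<in>J. X i k \<omega>) N (\<lambda>\<omega>. \<lambda>k\<in>J. W k \<omega>) F" and k: "k \<in> (J :: nat set)"
  shows "conv_in_distribution M (\<lambda>i. X i k :: _ \<Rightarrow> real) N (W k) F"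
proof -
  have cont: "continuous_on UNIV (\<lambda>x::nat \<Rightarrow> real. x k)" by (rule continuous_on_product_coordinates)
  have meas: "Z k \<in> borel_measurable K" if "(\<lambda>\<omega>. \<lambda>k\<in>J. Z k \<omega>) \<in> borel_measurable K" for Z :: "nat \<Rightarrow> 'z \<Rightarrow> real" and K
    using measurable_compose[OF that borel_measurable_continuous_onI[OF cont]] k by simp
  show ?thesis
    using assms(1) unfolding conv_in_distribution_def
  proof (elim conjE, intro conjI allI impI)
    assume "\<forall>\<^sub>F i in F. (\<lambda>\<omega>. \<lambda>k\<in>J. X i k \<omega>) \<in> borel_measurable M"
    then show "\<forall>\<^sub>F i in F. X i k \<in> borel_measurable M" by eventually_elim (rule meas)
  next
    assume "(\<lambda>\<omega>. \<lambda>k\<in>J. W k \<omega>) \<in> borel_measurable N"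
    then show "W k \<in> borel_measurable N" by (rule meas)
  next
    fix f :: "real \<Rightarrow> real"
    assume A: "\<forall>f::(nat \<Rightarrow> real) \<Rightarrow> real. continuous_on UNIV f \<and> bounded (range f) \<longrightarrow>
        ((\<lambda>i. \<integral>\<omega>. f (\<lambda>k\<in>J. X i k \<omega>) \<partial>M) \<longlongrightarrow> (\<integral>\<omega>. f (\<lambda>k\<in>J. W k \<omega>) \<partial>N)) F"
      and f: "continuous_on UNIV f \<and> bounded (range f)"
    have "continuous_on UNIV (\<lambda>x::nat \<Rightarrow> real. f (x k))"
      by (rule continuous_on_compose2[OF conjunct1[OF f] cont]) simp
    moreover have "bounded (range (\<lambda>x::nat \<Rightarrow> real. f (x k)))"
      using conjunct2[OF f] by (rule bounded_subset) auto
    ultimately show "((\<lambda>i. \<integral>\<omega>. f (X i k \<omega>) \<partial>M) \<longlongrightarrow> (\<integral>\<omega>. f (W k \<omega>) \<partial>N)) F"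
      using A[rule_format, of "\<lambda>x. f (x k)"] k by simp
  qed
qed

theorem theorem2:
  fixes M :: "'w measure"
    and u :: "nat \<Rightarrow> 'w \<Rightarrow> 'a::euclidean_space"
    and \<Xi> :: "'w \<Rightarrow> 'a set"
    and G :: "nat \<Rightarrow> 'w \<Rightarrow> 'a set"
    and \<phi> :: "'a \<Rightarrow> real"
  assumes model: "random_grain_model M u \<Xi> G"
    and moment_pos: "0 < grain_second_moment M \<Xi>"
    and moment_fin: "grain_second_moment M \<Xi> < \<infinity>"
    and phi: "\<phi> \<in> L1_Linf"
  shows "(\<forall>s>0. integrable M (scaled_integral (grain_field u G) \<phi> s))
    \<and> integrable lebesgue (\<lambda>t. \<bar>\<phi> t\<bar>\<^sup>2)
    \<and> integrable lebesgue (grain_covariance M u G)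
    \<and> (\<exists>(N::real measure) W. prob_space N
        \<and> gaussian_rv N W \<and> prob_space.expectation N W = 0
        \<and> prob_space.variance N W = L2_norm_sq \<phi> * (\<integral>t. grain_covariance M u G t \<partial>lebesgue)
        \<and> prob_space.variance N W = L2_norm_sq \<phi> * enn2real (grain_second_moment M \<Xi>)
        \<and> (\<not> (AE t in lebesgue. \<phi> t = 0) \<longrightarrow> 0 < prob_space.variance N W)
        \<and> conv_in_distribution M (normalized_integral M (grain_field u G) \<phi>) N W at_top)
    \<and> (\<forall>s>0. \<forall>k\<ge>1. integrable M (scaled_integral (excursion_field u G k) \<phi> s))
    \<and> (\<forall>k\<ge>1. \<forall>l\<ge>1. integrable lebesgue
          (\<lambda>t. covariance M (excursion_field u G k t) (excursion_field u G l 0)))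
    \<and> (\<exists>(N::(nat \<Rightarrow> real) measure) W. prob_space N
        \<and> gaussian_family N {1..} W
        \<and> (\<forall>k\<ge>1. prob_space.expectation N (W k) = 0)
        \<and> (\<forall>k\<ge>1. \<forall>l\<ge>1. covariance N (W k) (W l) =
              L2_norm_sq \<phi> *
              (\<integral>t. covariance M (excursion_field u G k t) (excursion_field u G l 0) \<partial>lebesgue))
        \<and> conv_fdd M (\<lambda>s k. normalized_integral M (excursion_field u G k) \<phi> s) N W {1..} at_top)"
proof -
  interpret square_integrable_grain_model M u \<Xi> G
  proof -
    interpret prob_space M using model by (simp add: random_grain_model_def)
    show "square_integrable_grain_model M u \<Xi> G" by unfold_locales (fact model moment_fin)+
  qed
  obtain \<psi> C where \<psi>: "integrable lborel \<psi>" and C: "\<And>x. \<bar>\<psi> x\<bar> \<le> C" and ae: "AE x in lborel. \<phi> x = \<psi> x"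
    using L1_Linf_borel_version[OF phi] by blast
  have \<phi>: "\<phi> \<in> borel_measurable lebesgue" using phi by (auto simp: L1_Linf_def)
  have [measurable]: "\<psi> \<in> borel_measurable borel" using \<psi> by auto
  have U: "UNIV \<in> sets (borel :: 'a measure)" by simp
  note pc = \<phi> \<psi> C ae
  define A where "A = (\<integral>x. (\<psi> x)\<^sup>2 \<partial>lborel)"
  have \<psi>2: "integrable lborel (\<lambda>x. (\<psi> x)\<^sup>2)"
    unfolding power2_eq_square using C by (intro integrable_bounded_mult[OF \<psi>]) auto
  have \<psi>2l: "integrable lebesgue (\<lambda>x. (\<psi> x)\<^sup>2)"
    using \<psi>2 by (subst integrable_completion) auto
  have ae2: "AE x in lebesgue. (\<psi> x)\<^sup>2 = \<bar>\<phi> x\<bar>\<^sup>2"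
    unfolding AE_completion_iff using ae by eventually_elim simp
  have \<phi>2m: "(\<lambda>t. \<bar>\<phi> t\<bar>\<^sup>2) \<in> borel_measurable lebesgue" using \<phi> by measurable
  have \<phi>2: "integrable lebesgue (\<lambda>t. \<bar>\<phi> t\<bar>\<^sup>2)"
    by (rule integrable_cong_AE_imp[OF \<psi>2l \<phi>2m ae2])
  have norm: "L2_norm_sq \<phi> = A"
  proof -
    have "L2_norm_sq \<phi> = (\<integral>x. (\<psi> x)\<^sup>2 \<partial>lebesgue)"
      unfolding L2_norm_sq_def by (rule integral_cong_AE[symmetric, OF borel_measurable_integrable[OF \<psi>2l] \<phi>2m ae2])
    then show ?thesis unfolding A_def by (subst (asm) integral_completion) auto
  qed
  define m where "m = enn2real (grain_second_moment M \<Xi>)"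
  have m0: "0 < m" using moment_pos moment_fin by (simp add: m_def enn2real_positive_iff)
  have \<rho>m: "(\<integral>h. \<rho> h \<partial>lborel) = m"
    using has_bochner_integral_\<rho>[OF moment_fin] by (simp add: m_def has_bochner_integral_iff)
  have gc_int: "integrable lebesgue (grain_covariance M u G)"
    unfolding grain_covariance_eq using integrable_\<rho> by (subst integrable_completion) auto
  have gc: "(\<integral>t. grain_covariance M u G t \<partial>lebesgue) = m"
    unfolding grain_covariance_eq \<rho>m[symmetric] by (intro integral_completion) simp
  have ec_int: "integrable lebesgue (\<lambda>t. covariance M (excursion_field u G k t) (excursion_field u G l 0))"
    and ec: "(\<integral>t. covariance M (excursion_field u G k t) (excursion_field u G l 0) \<partial>lebesgue) = (\<integral>h. cov (exc k) UNIV (exc l) UNIV h \<partial>lborel)" for k l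
  proof -
    note i = integrable_cov[OF U U lip_exc lip_exc, of k l]
    have b: "cov (exc k) UNIV (exc l) UNIV \<in> borel_measurable lborel" using i by (rule borel_measurable_integrable)
    show "integrable lebesgue (\<lambda>t. covariance M (excursion_field u G k t) (excursion_field u G l 0))"
      unfolding covariance_excursion_eq using i b by (subst integrable_completion) auto
    show "(\<integral>t. covariance M (excursion_field u G k t) (excursion_field u G l 0) \<partial>lebesgue) = (\<integral>h. cov (exc k) UNIV (exc l) UNIV h \<partial>lborel)"
      unfolding covariance_excursion_eq by (rule integral_completion[OF b])
  qed
  have A0: "0 \<le> A" by (simp add: A_def)
  have part1: "\<exists>(N::real measure) W. prob_space N
        \<and> gaussian_rv N W \<and> prob_space.expectation N W = 0
        \<and> prob_space.variance N W = L2_norm_sq \<phi> * (\<integral>t. grain_covariance M u G t \<partial>lebesgue)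
        \<and> prob_space.variance N W = L2_norm_sq \<phi> * enn2real (grain_second_moment M \<Xi>)
        \<and> (\<not> (AE t in lebesgue. \<phi> t = 0) \<longrightarrow> 0 < prob_space.variance N W)
        \<and> conv_in_distribution M (normalized_integral M (grain_field u G) \<phi>) N W at_top"
  proof -
    define \<sigma> where "\<sigma> = sqrt (A * m)"
    have \<sigma>0: "0 \<le> \<sigma>" and \<sigma>2: "\<sigma>\<^sup>2 = A * m" using A0 m0 by (auto simp: \<sigma>_def)
    let ?N = "std_normal_distribution" and ?W = "\<lambda>x::real. \<sigma> * x"
    interpret S: prob_space std_normal_distribution by (rule prob_space_normal_density) simp
    note S = scaled_std_normal[OF \<sigma>0]
    have EW: "S.expectation ?W = 0" using S(2) by (rule has_bochner_integral_integral_eq)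
    have VW: "S.variance ?W = A * m"
      unfolding EW \<sigma>2[symmetric] using has_bochner_integral_integral_eq[OF S(3)] by (simp add: power2_eq_square)
    have lc: "lcov \<psi> real real = \<sigma>\<^sup>2" unfolding lcov_def[OF pc] \<sigma>2 A_def cov_real \<rho>m ..
    \<comment> \<open>The field is treated as a family with the single index 0, so that the vector
      theorem applies.\<close>
    have "conv_in_distribution M (\<lambda>s \<omega>. \<lambda>k\<in>{0}. normalized_integral M (grain_field u G) \<phi> s \<omega>) ?N (\<lambda>\<omega>. \<lambda>k\<in>{0::nat}. ?W \<omega>) at_top"
      by (rule conv_normalized_integrals[OF pc, where f="\<lambda>_. real" and L="\<lambda>_. 1"])
         (use S in \<open>auto simp: lip_real measurable_grain_field grain_field_eq S.prob_space_axioms lc power2_eq_square\<close>)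
    from conv_in_distribution_coordinate[OF this, of 0]
    have conv: "conv_in_distribution M (normalized_integral M (grain_field u G) \<phi>) ?N ?W at_top" by simp
    \<comment> \<open>A vanishing L2 norm forces the test function to be zero almost everywhere, and
      the second moment of the grain volume is positive.\<close>
    have pos: "0 < A * m" if n: "\<not> (AE t in lebesgue. \<phi> t = 0)"
    proof -
      have "A \<noteq> 0"
      proof
        assume "A = 0"
        then have "AE x in lborel. (\<psi> x)\<^sup>2 = 0"
          unfolding A_def using integral_nonneg_eq_0_iff_AE[OF \<psi>2] by simp
        then have "AE x in lborel. \<phi> x = 0" using ae by eventually_elim simp
        then show False using n by (simp add: AE_completion_iff)
      qed
      then show ?thesis using A0 m0 by simp
    qed
    show ?thesis
      by (intro exI[of _ ?N] exI[of _ ?W] conjI impI)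
         (use S(1) EW VW conv pos S.prob_space_axioms in \<open>auto simp: norm gc m_def[symmetric]\<close>)
  qed
  have part2: "\<exists>(N::(nat \<Rightarrow> real) measure) W. prob_space N
        \<and> gaussian_family N {1..} W
        \<and> (\<forall>k\<ge>1. prob_space.expectation N (W k) = 0)
        \<and> (\<forall>k\<ge>1. \<forall>l\<ge>1. covariance N (W k) (W l) =
              L2_norm_sq \<phi> *
              (\<integral>t. covariance M (excursion_field u G k t) (excursion_field u G l 0) \<partial>lebesgue))
        \<and> conv_fdd M (\<lambda>s k. normalized_integral M (excursion_field u G k) \<phi> s) N W {1..} at_top"
  proof -
    obtain N :: "(nat \<Rightarrow> real) measure" and W where N: "prob_space N" and W: "\<And>k. W k \<in> borel_measurable N"
      and W1: "\<And>k. has_bochner_integral N (W k) 0"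
      and W2: "\<And>k l. has_bochner_integral N (\<lambda>\<omega>. W k \<omega> * W l \<omega>) (lcov \<psi> (exc k) (exc l))"
      and Wg: "\<And>J c. finite J \<Longrightarrow> gaussian_rv N (\<lambda>\<omega>. \<Sum>k\<in>J. c k * W k \<omega>)"
      and Wc: "\<And>J c. finite J \<Longrightarrow> (\<integral>\<omega>. iexp (\<Sum>k\<in>J. c k * W k \<omega>) \<partial>N) = exp (- (\<Sum>k\<in>J. \<Sum>l\<in>J. c k * c l * lcov \<psi> (exc k) (exc l)) / 2)"
      using gaussian_sequence_exists[OF psd_lcov[OF pc, where f=exc and L="\<lambda>_. 1", OF lip_exc]] by blast
    have E: "prob_space.expectation N (W k) = 0" for k using W1 by (rule has_bochner_integral_integral_eq)
    have "covariance N (W k) (W l) = L2_norm_sq \<phi> * (\<integral>t. covariance M (excursion_field u G k t) (excursion_field u G l 0) \<partial>lebesgue)" for k l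
      unfolding ec norm A_def lcov_def[OF pc, symmetric] covariance_def[of N] E
      using has_bochner_integral_integral_eq[OF W2[of k l]] by simp
    moreover have "conv_fdd M (\<lambda>s k. normalized_integral M (excursion_field u G k) \<phi> s) N W {1..} at_top"
      unfolding conv_fdd_def
    proof (intro allI impI)
      fix J :: "nat set" assume "finite J \<and> J \<subseteq> {1..}"
      then have J: "finite J" by simp
      show "conv_in_distribution M (\<lambda>s \<omega>. \<lambda>k\<in>J. normalized_integral M (excursion_field u G k) \<phi> s \<omega>) N (\<lambda>\<omega>. \<lambda>k\<in>J. W k \<omega>) at_top"
        by (rule conv_normalized_integrals[OF pc, where f=exc and L="\<lambda>_. 1" and Y="excursion_field u G"])
           (rule lip_exc J measurable_excursion_field AE_excursion_field_eq N W W2 Wc[OF J])+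
    qed
    moreover have "gaussian_family N {1..} W" unfolding gaussian_family_def using Wg by blast
    ultimately show ?thesis using N E by (intro exI[of _ N] exI[of _ W]) blast
  qed
  have "\<forall>s>0. integrable M (scaled_integral (grain_field u G) \<phi> s)"
    by (intro allI impI integrable_scaled_integral[OF measurable_grain_field _ lip_real pc]) (simp_all add: grain_field_eq)
  moreover have "\<forall>s>0. \<forall>k\<ge>1. integrable M (scaled_integral (excursion_field u G k) \<phi> s)"
    using integrable_scaled_integral[OF measurable_excursion_field AE_excursion_field_eq lip_exc pc] by blast
  ultimately show ?thesis using \<phi>2 gc_int ec_int part1 part2 by blast
qed

end
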